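(* Let $0<\alpha<1/2$. There is a positive real number $\varepsilon_0$ such that: if $\theta^0\in H^{2-2\alpha}(\mathbb R^2)$ satisfies $\|\theta^0\|_{H^{2-2\alpha}}<\varepsilon_0$, then there exists a global solution $\theta$ of $$\partial_t\theta+|D|^{2\alpha}\theta+u_\theta\cdot\nabla\theta=0,\qquad \theta(0,x)=\theta^0(x),$$ with $u_\theta=(-\partial_2|D|^{-1}\theta,\ \partial_1|D|^{-1}\theta)$, such that $$\theta\in C([0,\infty),H^{2-2\alpha}(\mathbb R^2))\cap L^2(\mathbb R^+,\dot H^{2-\alpha}(\mathbb R^2)),$$ and for all $t\ge 0$, $$\|\theta(t)\|_{H^{2-2\alpha}}^2+\int_0^t\big\||D|^\alpha\theta(\tau)\big\|_{H^{2-2\alpha}}^2\,d\tau\le\|\theta^0\|_{H^{2-2\alpha}}^2.$$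
   Context: $|D|^s$ is the Fourier multiplier $\widehat{|D|^s f}(\xi)=|\xi|^s\widehat f(\xi)$. $H^s(\mathbb R^2)$ is the inhomogeneous Sobolev space and $\dot H^s(\mathbb R^2)$ the homogeneous one; for $s>0$ the $H^s$ norm is taken to be $\|f\|_{H^s}^2=\|f\|_{L^2}^2+\||D|^sf\|_{L^2}^2$. *)

theory Defs
  imports "HOL-Analysis.Analysis"
begin

text \<open>Points of the plane are vectors in real^2; functions on the plane are complex valued
  (real functions are embedded via complex_of_real).  Fourier transform convention:
  fourier phi xi = integral of phi x * exp(-i x.xi) dx (unnormalised).\<close>

type_synonym pt = "real ^ 2"

definition L2c :: "(pt \<Rightarrow> complex) \<Rightarrow> bool" where
  "L2c f \<longleftrightarrow> f \<in> borel_measurable lborel \<and> integrable lborel (\<lambda>x. (cmod (f x))\<^sup>2)"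

definition L2norm_sq :: "(pt \<Rightarrow> complex) \<Rightarrow> real" where
  "L2norm_sq f = (LINT x|lborel. (cmod (f x))\<^sup>2)"

definition testc :: "(pt \<Rightarrow> complex) \<Rightarrow> bool" where
  "testc \<phi> \<longleftrightarrow> continuous_on UNIV \<phi> \<and> bounded {x. \<phi> x \<noteq> 0}"

definition fourier :: "(pt \<Rightarrow> complex) \<Rightarrow> pt \<Rightarrow> complex" where
  "fourier \<phi> \<xi> = (LINT x|lborel. \<phi> x * cis (- (x \<bullet> \<xi>)))"

text \<open>g is the (L^2, Plancherel) Fourier transform of f, characterised by duality
  against test functions; this determines g up to null sets.\<close>
definition is_FT :: "(pt \<Rightarrow> complex) \<Rightarrow> (pt \<Rightarrow> complex) \<Rightarrow> bool" where
  "is_FT f g \<longleftrightarrow> L2c f \<and> L2c g \<and>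
     (\<forall>\<phi>. testc \<phi> \<longrightarrow> (LINT x|lborel. f x * fourier \<phi> x) = (LINT \<xi>|lborel. g \<xi> * \<phi> \<xi>))"

definition FTL2 :: "(pt \<Rightarrow> complex) \<Rightarrow> pt \<Rightarrow> complex" where
  "FTL2 f = (SOME g. is_FT f g)"

definition fmult :: "(pt \<Rightarrow> complex) \<Rightarrow> (pt \<Rightarrow> complex) \<Rightarrow> pt \<Rightarrow> complex" where
  "fmult m f = (SOME h. is_FT h (\<lambda>\<xi>. m \<xi> * FTL2 f \<xi>))"

definition Dpow :: "real \<Rightarrow> (pt \<Rightarrow> complex) \<Rightarrow> pt \<Rightarrow> complex" where
  "Dpow s f = fmult (\<lambda>\<xi>. complex_of_real (norm \<xi> powr s)) f"

definition pderiv2 :: "2 \<Rightarrow> (pt \<Rightarrow> complex) \<Rightarrow> pt \<Rightarrow> complex" where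
  "pderiv2 j f = fmult (\<lambda>\<xi>. \<i> * complex_of_real (\<xi> $ j)) f"

text \<open>u_theta = (-d_2 |D|^{-1} theta, d_1 |D|^{-1} theta); symbols -i xi_2/|xi| and i xi_1/|xi|.\<close>
definition sqg_u1 :: "(pt \<Rightarrow> complex) \<Rightarrow> pt \<Rightarrow> complex" where
  "sqg_u1 f = fmult (\<lambda>\<xi>. - \<i> * complex_of_real (\<xi> $ 2 / norm \<xi>)) f"

definition sqg_u2 :: "(pt \<Rightarrow> complex) \<Rightarrow> pt \<Rightarrow> complex" where
  "sqg_u2 f = fmult (\<lambda>\<xi>. \<i> * complex_of_real (\<xi> $ 1 / norm \<xi>)) f"

text \<open>Homogeneous seminorm squared, normalised by Plancherel: ||D|^s f|_{L^2}^2.\<close>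
definition hdot_norm_sq :: "real \<Rightarrow> (pt \<Rightarrow> complex) \<Rightarrow> real" where
  "hdot_norm_sq s f = (1 / (2*pi)\<^sup>2) * (LINT \<xi>|lborel. ((norm \<xi> powr (2 * s)) * (cmod (FTL2 f \<xi>))\<^sup>2))"

definition sob_norm_sq :: "real \<Rightarrow> (pt \<Rightarrow> complex) \<Rightarrow> real" where
  "sob_norm_sq s f = L2norm_sq f + hdot_norm_sq s f"

definition sob_norm :: "real \<Rightarrow> (pt \<Rightarrow> complex) \<Rightarrow> real" where
  "sob_norm s f = sqrt (sob_norm_sq s f)"

definition in_H :: "real \<Rightarrow> (pt \<Rightarrow> complex) \<Rightarrow> bool" where
  "in_H s f \<longleftrightarrow> (\<exists>g. is_FT f g) \<and>
     integrable lborel (\<lambda>\<xi>. (1 + (norm \<xi>)\<^sup>2) powr s * (cmod (FTL2 f \<xi>))\<^sup>2)"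

text \<open>Homogeneous space, for functions already in L^2.\<close>
definition in_Hdot :: "real \<Rightarrow> (pt \<Rightarrow> complex) \<Rightarrow> bool" where
  "in_Hdot s f \<longleftrightarrow> (\<exists>g. is_FT f g) \<and>
     integrable lborel (\<lambda>\<xi>. (norm \<xi> powr (2 * s)) * (cmod (FTL2 f \<xi>))\<^sup>2)"

abbreviation cR :: "(pt \<Rightarrow> real) \<Rightarrow> pt \<Rightarrow> complex" where
  "cR f \<equiv> (\<lambda>x. complex_of_real (f x))"

definition cont_H :: "real \<Rightarrow> (real \<Rightarrow> pt \<Rightarrow> real) \<Rightarrow> bool" where
  "cont_H s \<theta> \<longleftrightarrow> (\<forall>t\<ge>0. in_H s (cR (\<theta> t))) \<and>
     (\<forall>t\<ge>0. ((\<lambda>\<tau>. sob_norm s (\<lambda>x. cR (\<theta> \<tau>) x - cR (\<theta> t) x)) \<longlongrightarrow> 0) (at t within {0..}))"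

definition L2_Hdot :: "real \<Rightarrow> (real \<Rightarrow> pt \<Rightarrow> real) \<Rightarrow> bool" where
  "L2_Hdot s \<theta> \<longleftrightarrow> (AE \<tau> in lborel. \<tau> \<ge> 0 \<longrightarrow> in_Hdot s (cR (\<theta> \<tau>))) \<and>
     set_integrable lborel {0..} (\<lambda>\<tau>. hdot_norm_sq s (cR (\<theta> \<tau>)))"

text \<open>Weak (in space, integrated in time) formulation of
  d_t theta + |D|^{2 alpha} theta + u_theta . grad theta = 0, theta(0) = theta0.\<close>
definition sqg_solution :: "real \<Rightarrow> (pt \<Rightarrow> real) \<Rightarrow> (real \<Rightarrow> pt \<Rightarrow> real) \<Rightarrow> bool" where
  "sqg_solution \<alpha> \<theta>0 \<theta> \<longleftrightarrow>
    (\<forall>t\<ge>0. \<forall>\<phi>. testc \<phi> \<longrightarrow>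
      (let F = (\<lambda>s. LINT x|lborel.
                   (Dpow (2*\<alpha>) (cR (\<theta> s)) x
                    + sqg_u1 (cR (\<theta> s)) x * pderiv2 1 (cR (\<theta> s)) x
                    + sqg_u2 (cR (\<theta> s)) x * pderiv2 2 (cR (\<theta> s)) x) * \<phi> x)
       in set_integrable lborel {0..t} F \<and>
          (LINT x|lborel. cR (\<theta> t) x * \<phi> x) - (LINT x|lborel. cR \<theta>0 x * \<phi> x)
          + (LINT s:{0..t}|lborel. F s) = 0))"

end

(*
  On the Fourier side the equation reads w' = -|xi|^(2 alpha) w - NL(w,w), where NL is a convolution
  with the antisymmetric kernel kap(xi,eta) = (xi_2 eta_1 - xi_1 eta_2) / |xi - eta|, bounded by
  |xi| and by |eta|.  The system truncated to a ball is a bounded ODE in L2.  Antisymmetry of kap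
  makes the L2 energy exact, and in the H^s energy (s = 2 - 2 alpha) it replaces the weight by the
  difference of its values at xi and eta.  This commutator is bounded by
  C |w|_(H^s) |w|_(H^(s+alpha))^2, so it is absorbed by the dissipation for small data.  The truncated
  solutions are Cauchy in L2, Fatou's lemma passes the energy inequality to the limit, and the
  commutator bound with weights cut off at R, R -> infinity, shows that the H^s norm of the limit
  varies continuously in time, which together with pointwise convergence gives strong continuity.
*)

theory Submission
  imports Defs "HOL-Probability.Probability"
begin

section \<open>L2 functions on the plane\<close>

text \<open>The exponent s = 2 - 2 \<alpha> is invariant under the scaling of the equation, so a
  short time gives no small factor: what the nonlinearity costs has to be paid by the dissipation,
  and small data make it affordable. The energy identity contains twice the dissipation; one half
  absorbs the commutator, the other half is the coefficient 1 in the final inequality. In frequency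
  variables criticality shows in kernels of degree -1, half the dimension, whose square integrals
  over the smaller variable are scale invariant. Functions of frequency are treated as genuine
  functions, not as classes. Since |\<open>kap\<close>| is at most |xi|, the quadratic term of L2
  functions is defined at every xi, the Duhamel formula holds at every xi, and all time integrals
  are scalar. This is why limits are taken pointwise as well as in L2, and why the transform of the
  data, determined only up to null sets, is first replaced by a representative that is Hermitian
  everywhere. Two truncations at n and m, n \<le> m, differ in squared L2 norm by O(n^(-s)), which
  comes from the frequencies beyond n; the whole sequence converges and no compactness is
  used.\<close>

abbreviation lborel2 :: "('a::euclidean_space \<times> 'b::euclidean_space) measure" where
  "lborel2 \<equiv> lborel \<Otimes>\<^sub>M lborel"

text \<open>By the default value of the Bochner integral this is 0 when the square is not
  integrable, so a bound on \<open>n2 f\<close> carries information only together with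
  \<open>L2c f\<close>.\<close>

definition n2 :: "(pt \<Rightarrow> complex) \<Rightarrow> real" where
  "n2 f = sqrt (L2norm_sq f)"

lemma L2norm_sq_nonneg [simp]: "0 \<le> L2norm_sq f"
  unfolding L2norm_sq_def by simp

lemma n2_nonneg [simp]: "0 \<le> n2 f"
  by (simp add: n2_def)

lemma n2_squared: "(n2 f)\<^sup>2 = L2norm_sq f"
  by (simp add: n2_def)

lemma L2c_measurable [measurable_dest]: "L2c f \<Longrightarrow> f \<in> borel_measurable lborel"
  by (simp add: L2c_def)

lemma L2c_integrable: "L2c f \<Longrightarrow> integrable lborel (\<lambda>x. (cmod (f x))\<^sup>2)"
  by (simp add: L2c_def)

lemma L2c_nn_integral: "L2c f \<Longrightarrow> (\<integral>\<^sup>+x. ennreal ((cmod (f x))\<^sup>2) \<partial>lborel) = ennreal ((n2 f)\<^sup>2)"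
  unfolding n2_squared L2norm_sq_def by (rule nn_integral_eq_integral) (auto simp: L2c_def)

text \<open>Membership in L2 and the norm bound come from one bound on the nonnegative integral,
  which has no default value to guard against.\<close>

lemma L2c_nn_leI:
  assumes [measurable]: "f \<in> borel_measurable lborel"
    and le: "(\<integral>\<^sup>+x. ennreal ((cmod (f x))\<^sup>2) \<partial>lborel) \<le> ennreal (B\<^sup>2)" and "0 \<le> B"
  shows "L2c f" "n2 f \<le> B"
proof -
  show f: "L2c f"
    unfolding L2c_def integrable_iff_bounded using le by (auto intro: le_less_trans)
  have "ennreal ((n2 f)\<^sup>2) \<le> ennreal (B\<^sup>2)"
    using le L2c_nn_integral[OF f] by simp
  then show "n2 f \<le> B"
    using \<open>0 \<le> B\<close> power2_le_imp_le[of "n2 f" B] by (simp add: ennreal_le_iff)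
qed

lemma L2c_mono:
  assumes "L2c f" and [measurable]: "g \<in> borel_measurable lborel"
    and le: "AE x in lborel. cmod (g x) \<le> B * cmod (f x)" and "0 \<le> B"
  shows "L2c g" "n2 g \<le> B * n2 f"
proof -
  note [measurable] = L2c_measurable[OF assms(1)]
  have "(\<integral>\<^sup>+x. ennreal ((cmod (g x))\<^sup>2) \<partial>lborel) \<le> (\<integral>\<^sup>+x. ennreal (B\<^sup>2) * ennreal ((cmod (f x))\<^sup>2) \<partial>lborel)"
    using le
    by (intro nn_integral_mono_AE)
       (auto simp: ennreal_mult[symmetric] power_mult_distrib[symmetric] intro!: ennreal_leI power_mono)
  also have "\<dots> = ennreal (B\<^sup>2) * ennreal ((n2 f)\<^sup>2)"
    by (simp add: nn_integral_cmult L2c_nn_integral[OF assms(1)])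
  also have "\<dots> = ennreal ((B * n2 f)\<^sup>2)"
    by (simp add: ennreal_mult[symmetric] power_mult_distrib)
  finally have *: "(\<integral>\<^sup>+x. ennreal ((cmod (g x))\<^sup>2) \<partial>lborel) \<le> ennreal ((B * n2 f)\<^sup>2)" .
  show "L2c g" "n2 g \<le> B * n2 f"
    using L2c_nn_leI[OF assms(2) *] \<open>0 \<le> B\<close> by auto
qed

lemma n2_cong_AE:
  assumes [measurable]: "f \<in> borel_measurable lborel" "g \<in> borel_measurable lborel"
    and "AE x in lborel. f x = g x"
  shows "n2 f = n2 g"
  unfolding n2_def L2norm_sq_def using assms(3)
  by (intro arg_cong[where f=sqrt] integral_cong_AE) (auto elim!: AE_mp)

lemma L2c_cong_AE:
  assumes "L2c f" and [measurable]: "g \<in> borel_measurable lborel"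
    and "AE x in lborel. f x = g x"
  shows "L2c g"
  by (rule L2c_mono(1)[where B=1, OF assms(1,2)]) (use assms(3) in auto)

lemma L2c_cmult [intro]: "L2c f \<Longrightarrow> L2c (\<lambda>x. c * f x)"
  by (rule L2c_mono(1)[where B="cmod c" and f=f]) (auto simp: norm_mult dest!: L2c_measurable)

lemma n2_cmult: "n2 (\<lambda>x. c * f x) = cmod c * n2 f"
  unfolding n2_def L2norm_sq_def by (simp add: norm_mult power_mult_distrib real_sqrt_mult)

lemma L2c_add [intro]:
  assumes "L2c f" "L2c g" shows "L2c (\<lambda>x. f x + g x)"
proof -
  note [measurable] = L2c_measurable[OF assms(1)] L2c_measurable[OF assms(2)]
  have le: "(cmod (f x + g x))\<^sup>2 \<le> 2 * (cmod (f x))\<^sup>2 + 2 * (cmod (g x))\<^sup>2" for x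
  proof -
    have "(cmod (f x + g x))\<^sup>2 \<le> (cmod (f x) + cmod (g x))\<^sup>2"
      by (intro power_mono norm_triangle_ineq) auto
    also have "\<dots> \<le> 2 * (cmod (f x))\<^sup>2 + 2 * (cmod (g x))\<^sup>2"
      using sum_squares_bound[of "cmod (f x)" "cmod (g x)"] by (simp add: power2_sum)
    finally show ?thesis .
  qed
  have "integrable lborel (\<lambda>x. 2 * (cmod (f x))\<^sup>2 + 2 * (cmod (g x))\<^sup>2)"
    using assms by (intro Bochner_Integration.integrable_add integrable_mult_right L2c_integrable)
  then have "integrable lborel (\<lambda>x. (cmod (f x + g x))\<^sup>2)"
    by (rule Bochner_Integration.integrable_bound) (auto intro!: AE_I2 order_trans[OF le])
  then show ?thesis by (simp add: L2c_def)
qed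

lemma L2c_uminus [intro]: "L2c f \<Longrightarrow> L2c (\<lambda>x. - f x)"
  using L2c_cmult[of f "-1"] by simp

lemma L2c_diff [intro]: "L2c f \<Longrightarrow> L2c g \<Longrightarrow> L2c (\<lambda>x. f x - g x)"
  using L2c_add[OF _ L2c_uminus, of f g] by simp

lemma borel_measurable_cnj [measurable (raw)]:
  "f \<in> borel_measurable M \<Longrightarrow> (\<lambda>x. cnj (f x)) \<in> borel_measurable M"
  by (rule borel_measurable_continuous_on[where f=cnj]) (auto intro: continuous_intros)

lemma L2c_cnj [intro]: "L2c f \<Longrightarrow> L2c (\<lambda>x. cnj (f x))"
  by (rule L2c_mono(1)[where B=1 and f=f]) (auto dest!: L2c_measurable intro: borel_measurable_cnj)

lemma L2c_zero [simp]: "L2c (\<lambda>x. 0)"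
  by (simp add: L2c_def)

lemma n2_zero [simp]: "n2 (\<lambda>x. 0) = 0"
  by (simp add: n2_def L2norm_sq_def)

text \<open>Cauchy--Schwarz for nonnegative integrals comes in squared form; this takes the root,
  with infinity on either side treated apart.\<close>

lemma ennreal_power2_le_D:
  assumes "(a::ennreal)\<^sup>2 \<le> b\<^sup>2" shows "a \<le> b"
proof (cases "b = \<top>")
  case False
  then obtain y where y: "b = ennreal y" "0 \<le> y" by (cases b) auto
  have bt: "b * b < \<top>" using y by (simp add: ennreal_mult[symmetric])
  have "a \<noteq> \<top>"
  proof
    assume "a = \<top>"
    then have "a * a = \<top>" by (simp add: ennreal_top_mult)
    then show False using assms bt unfolding power2_eq_square by (metis not_le)
  qed
  then obtain x where x: "a = ennreal x" "0 \<le> x" by (cases a) auto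
  have "x\<^sup>2 \<le> y\<^sup>2" using assms x y by (simp add: ennreal_power)
  then have "x \<le> y" using y(2) by (rule power2_le_imp_le)
  then show ?thesis using x y by (simp add: ennreal_leI)
qed simp

lemma L2_CS_nn:
  assumes "L2c f" "L2c g"
  shows "(\<integral>\<^sup>+x. ennreal (cmod (f x) * cmod (g x)) \<partial>lborel) \<le> ennreal (n2 f * n2 g)"
proof -
  note [measurable] = L2c_measurable[OF assms(1)] L2c_measurable[OF assms(2)]
  have "(\<integral>\<^sup>+x. ennreal (cmod (f x)) * ennreal (cmod (g x)) \<partial>lborel)\<^sup>2
      \<le> (\<integral>\<^sup>+x. ennreal (cmod (f x)) ^ 2 \<partial>lborel) * (\<integral>\<^sup>+x. ennreal (cmod (g x)) ^ 2 \<partial>lborel)"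
    by (rule Cauchy_Schwarz_nn_integral) auto
  also have "\<dots> = ennreal ((n2 f * n2 g)\<^sup>2)"
    by (simp add: ennreal_power L2c_nn_integral[OF assms(1)] L2c_nn_integral[OF assms(2)] ennreal_mult power_mult_distrib)
  finally have le: "(\<integral>\<^sup>+x. ennreal (cmod (f x) * cmod (g x)) \<partial>lborel)\<^sup>2 \<le> (ennreal (n2 f * n2 g))\<^sup>2"
    by (simp add: ennreal_mult[symmetric] ennreal_power)
  then show ?thesis by (rule ennreal_power2_le_D)
qed

lemma L2c_mult_integrable_norm:
  assumes "L2c f" "L2c g"
  shows "integrable lborel (\<lambda>x. cmod (f x) * cmod (g x))"
proof -
  note [measurable] = L2c_measurable[OF assms(1)] L2c_measurable[OF assms(2)]
  show ?thesis
    unfolding integrable_iff_bounded using L2_CS_nn[OF assms] by (auto simp: abs_mult intro: le_less_trans)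
qed

lemma L2c_mult_integrable:
  assumes "L2c f" "L2c g"
  shows "integrable lborel (\<lambda>x. f x * g x)"
proof -
  note [measurable] = L2c_measurable[OF assms(1)] L2c_measurable[OF assms(2)]
  show ?thesis
    by (rule Bochner_Integration.integrable_bound[OF L2c_mult_integrable_norm[OF assms]]) (auto simp: norm_mult)
qed

lemma L2_CS:
  assumes "L2c f" "L2c g"
  shows "(LINT x|lborel. cmod (f x) * cmod (g x)) \<le> n2 f * n2 g"
proof -
  have "ennreal (LINT x|lborel. cmod (f x) * cmod (g x)) = (\<integral>\<^sup>+x. ennreal (cmod (f x) * cmod (g x)) \<partial>lborel)"
    by (rule nn_integral_eq_integral[symmetric]) (auto intro: L2c_mult_integrable_norm[OF assms])
  also note L2_CS_nn[OF assms]
  finally show ?thesis by (simp add: ennreal_le_iff)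
qed

lemma L2_CS_norm:
  assumes "L2c f" "L2c g"
  shows "cmod (LINT x|lborel. f x * g x) \<le> n2 f * n2 g"
proof -
  have "cmod (LINT x|lborel. f x * g x) \<le> (LINT x|lborel. cmod (f x * g x))"
    by (rule integral_norm_bound)
  also have "\<dots> \<le> n2 f * n2 g" using L2_CS[OF assms] by (simp add: norm_mult)
  finally show ?thesis .
qed

lemma n2_triangle:
  assumes "L2c f" "L2c g"
  shows "n2 (\<lambda>x. f x + g x) \<le> n2 f + n2 g"
proof -
  have fg: "L2c (\<lambda>x. f x + g x)" using assms by auto
  have "(n2 (\<lambda>x. f x + g x))\<^sup>2 = (LINT x|lborel. (cmod (f x + g x))\<^sup>2)"
    by (simp add: n2_squared L2norm_sq_def)
  also have "\<dots> \<le> (LINT x|lborel. (cmod (f x))\<^sup>2 + (cmod (g x))\<^sup>2 + 2 * (cmod (f x) * cmod (g x)))"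
  proof (rule integral_mono)
    show "integrable lborel (\<lambda>x. (cmod (f x + g x))\<^sup>2)" using fg by (rule L2c_integrable)
    show "integrable lborel (\<lambda>x. (cmod (f x))\<^sup>2 + (cmod (g x))\<^sup>2 + 2 * (cmod (f x) * cmod (g x)))"
      using assms by (intro Bochner_Integration.integrable_add integrable_mult_right L2c_integrable L2c_mult_integrable_norm)
    fix x
    have "(cmod (f x + g x))\<^sup>2 \<le> (cmod (f x) + cmod (g x))\<^sup>2"
      by (intro power_mono norm_triangle_ineq) auto
    then show "(cmod (f x + g x))\<^sup>2 \<le> (cmod (f x))\<^sup>2 + (cmod (g x))\<^sup>2 + 2 * (cmod (f x) * cmod (g x))"
      by (simp add: power2_sum)
  qed
  also have "\<dots> = (n2 f)\<^sup>2 + (n2 g)\<^sup>2 + 2 * (LINT x|lborel. cmod (f x) * cmod (g x))"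
    using assms by (simp add: L2c_integrable L2c_mult_integrable_norm n2_squared L2norm_sq_def)
  also have "\<dots> \<le> (n2 f + n2 g)\<^sup>2"
    using L2_CS[OF assms] by (simp add: power2_sum)
  finally show ?thesis by (rule power2_le_imp_le) simp
qed

lemma n2_minus_commute: "n2 (\<lambda>x. f x - g x) = n2 (\<lambda>x. g x - f x)"
  by (simp add: n2_def L2norm_sq_def norm_minus_commute)

lemma n2_triangle_diff:
  assumes "L2c f" "L2c g" "L2c h"
  shows "n2 (\<lambda>x. f x - h x) \<le> n2 (\<lambda>x. f x - g x) + n2 (\<lambda>x. g x - h x)"
  using n2_triangle[of "\<lambda>x. f x - g x" "\<lambda>x. g x - h x"] assms by auto

lemma n2_diff_le:
  assumes "L2c f" "L2c g"
  shows "\<bar>n2 f - n2 g\<bar> \<le> n2 (\<lambda>x. f x - g x)"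
  using n2_triangle[OF L2c_diff[OF assms] assms(2)] n2_triangle[OF L2c_diff[OF assms(2,1)] assms(1)]
  by (simp add: n2_minus_commute[of f g] abs_le_iff)

text \<open>The bound is required only for large k: in one later use the sequence is the difference
  of a fixed truncated solution and the k-th one, and the bound holds once k has passed the fixed
  index.\<close>

lemma L2_fatou:
  assumes "\<And>k::nat. L2c (f k)" and [measurable]: "g \<in> borel_measurable lborel"
    and lim: "AE x in lborel. (\<lambda>k. f k x) \<longlonglongrightarrow> g x"
    and B: "eventually (\<lambda>k. n2 (f k) \<le> B) sequentially"
  shows "L2c g" "n2 g \<le> B"
proof -
  note [measurable] = L2c_measurable[OF assms(1)]
  have B0: "0 \<le> B" using B by (auto dest!: eventually_happens intro: order_trans[OF n2_nonneg])
  have "(\<integral>\<^sup>+x. ennreal ((cmod (g x))\<^sup>2) \<partial>lborel) = (\<integral>\<^sup>+x. liminf (\<lambda>k. ennreal ((cmod (f k x))\<^sup>2)) \<partial>lborel)"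
  proof (rule nn_integral_cong_AE)
    show "AE x in lborel. ennreal ((cmod (g x))\<^sup>2) = liminf (\<lambda>k. ennreal ((cmod (f k x))\<^sup>2))"
      using lim
    proof eventually_elim
      case (elim x)
      then have "(\<lambda>k. ennreal ((cmod (f k x))\<^sup>2)) \<longlonglongrightarrow> ennreal ((cmod (g x))\<^sup>2)"
        by (intro tendsto_intros tendsto_ennrealI)
      then show ?case by (rule lim_imp_Liminf[OF sequentially_bot, symmetric])
    qed
  qed
  also have "\<dots> \<le> liminf (\<lambda>k. \<integral>\<^sup>+x. ennreal ((cmod (f k x))\<^sup>2) \<partial>lborel)"
    by (rule nn_integral_liminf) simp
  also have "\<dots> = liminf (\<lambda>k. ennreal ((n2 (f k))\<^sup>2))"
    by (simp add: L2c_nn_integral[OF assms(1)])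
  also have "\<dots> \<le> liminf (\<lambda>k. ennreal (B\<^sup>2))"
    by (intro Liminf_mono eventually_mono[OF B]) (auto intro!: ennreal_leI power_mono)
  also have "\<dots> = ennreal (B\<^sup>2)" by (simp add: Liminf_const)
  finally have *: "(\<integral>\<^sup>+x. ennreal ((cmod (g x))\<^sup>2) \<partial>lborel) \<le> ennreal (B\<^sup>2)" .
  show "L2c g" "n2 g \<le> B"
    using L2c_nn_leI[OF assms(2) * B0] by auto
qed

text \<open>Riesz--Fischer for rapidly converging sequences: the limit is obtained pointwise almost
  everywhere, and \<open>L2_fatou\<close> applied to the tails f (k + j) - f k turns it into a limit
  in norm.\<close>

lemma L2_complete:
  assumes f: "\<And>k::nat. L2c (f k)"
    and d: "\<And>k. n2 (\<lambda>x. f (Suc k) x - f k x) \<le> (1/2)^k"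
  shows "\<exists>g. L2c g \<and> (\<lambda>k. n2 (\<lambda>x. f k x - g x)) \<longlonglongrightarrow> 0"
proof -
  note [measurable] = L2c_measurable[OF f]
  have dL: "L2c (\<lambda>x. f (Suc k) x - f k x)" for k using f by auto
  have "(\<integral>\<^sup>+x. (\<Sum>k. ennreal (2^k) * ennreal ((cmod (f (Suc k) x - f k x))\<^sup>2)) \<partial>lborel)
     = (\<Sum>k. ennreal (2^k) * ennreal ((n2 (\<lambda>x. f (Suc k) x - f k x))\<^sup>2))"
    by (subst nn_integral_suminf) (auto simp: nn_integral_cmult L2c_nn_integral[OF dL])
  also have "\<dots> \<le> (\<Sum>k. ennreal ((1/2)^k))"
  proof (rule suminf_le)
    fix k
    have "(n2 (\<lambda>x. f (Suc k) x - f k x))\<^sup>2 \<le> ((1/2)^k)\<^sup>2" by (intro power_mono d) simp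
    then have "2^k * (n2 (\<lambda>x. f (Suc k) x - f k x))\<^sup>2 \<le> 2^k * ((1/2)^k)\<^sup>2" by simp
    also have "\<dots> = (1/2)^k" by (simp add: power2_eq_square power_divide)
    finally show "ennreal (2^k) * ennreal ((n2 (\<lambda>x. f (Suc k) x - f k x))\<^sup>2) \<le> ennreal ((1/2)^k)"
      by (simp add: ennreal_mult[symmetric] ennreal_leI)
  qed auto
  also have "\<dots> = ennreal (\<Sum>k. (1/2)^k)" by (intro suminf_ennreal2) (auto intro: summable_geometric)
  also have "\<dots> < \<infinity>" by simp
  finally have "AE x in lborel. (\<Sum>k. ennreal (2^k) * ennreal ((cmod (f (Suc k) x - f k x))\<^sup>2)) \<noteq> \<infinity>"
    by (intro nn_integral_PInf_AE) auto
  then have conv: "AE x in lborel. convergent (\<lambda>k. f k x)"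
  proof eventually_elim
    case (elim x)
    define S where "S = (\<Sum>k. ennreal (2^k) * ennreal ((cmod (f (Suc k) x - f k x))\<^sup>2))"
    \<comment> \<open>A finite sum with weights 2^k bounds each step by a constant times 2^(-k/2),
      which is summable. The weights are affordable because the squared norms decay like
      4^(-k).\<close>
    have "cmod (f (Suc k) x - f k x) \<le> sqrt (enn2real S) * (sqrt (1/2))^k" for k
    proof -
      have "ennreal (2^k * (cmod (f (Suc k) x - f k x))\<^sup>2) \<le> S"
        unfolding S_def
        using sum_le_suminf[OF summableI, of "{k}" "\<lambda>k. ennreal (2^k) * ennreal ((cmod (f (Suc k) x - f k x))\<^sup>2)"]
        by (simp add: ennreal_mult)
      then have "2^k * (cmod (f (Suc k) x - f k x))\<^sup>2 \<le> enn2real S"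
        using elim unfolding S_def[symmetric] by (cases S) (auto simp: ennreal_le_iff)
      then have "(cmod (f (Suc k) x - f k x))\<^sup>2 \<le> enn2real S * (1/2)^k"
        by (simp add: power_divide mult.commute pos_le_divide_eq)
      also have "\<dots> = (sqrt (enn2real S))\<^sup>2 * ((sqrt (1/2))\<^sup>2)^k"
        by (subst (1 2) real_sqrt_pow2) auto
      also have "\<dots> = (sqrt (enn2real S) * (sqrt (1/2))^k)\<^sup>2"
        by (simp only: power_mult_distrib power_mult[symmetric] mult.commute)
      finally show ?thesis by (rule power2_le_imp_le) (intro mult_nonneg_nonneg zero_le_power real_sqrt_ge_zero, auto)
    qed
    then have "summable (\<lambda>k. f (Suc k) x - f k x)"
      by (intro summable_comparison_test[OF _ summable_mult[OF summable_geometric]]) (auto simp: real_sqrt_divide)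
    then have "convergent (\<lambda>n. \<Sum>k<n. f (Suc k) x - f k x)" by (simp add: summable_iff_convergent)
    then have "convergent (\<lambda>n. f n x - f 0 x)" by (simp only: sum_lessThan_telescope[of "\<lambda>k. f k x"])
    from convergent_add[OF this convergent_const[of "f 0 x"]] show ?case by simp
  qed
  define g where "g = (\<lambda>x. lim (\<lambda>k. f k x))"
  have [measurable]: "g \<in> borel_measurable lborel" unfolding g_def by measurable
  have lim: "AE x in lborel. (\<lambda>k. f k x) \<longlonglongrightarrow> g x"
    using conv by eventually_elim (simp add: g_def convergent_LIMSEQ_iff)
  \<comment> \<open>The factor 1 - (1/2)^j is the closed form of the partial geometric sum; with the
    plain bound 2 (1/2)^k the induction would not close.\<close>
  have tail: "n2 (\<lambda>x. f (k + j) x - f k x) \<le> 2 * (1/2)^k * (1 - (1/2)^j)" for k j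
  proof (induction j)
    case (Suc j)
    have "n2 (\<lambda>x. f (k + Suc j) x - f k x) \<le> n2 (\<lambda>x. f (Suc (k + j)) x - f (k+j) x) + n2 (\<lambda>x. f (k + j) x - f k x)"
      using n2_triangle_diff[OF f f f, of "Suc (k+j)" k "k+j"] by simp
    also have "\<dots> \<le> (1/2)^(k+j) + 2 * (1/2)^k * (1 - (1/2)^j)" using Suc d by (intro add_mono) auto
    also have "\<dots> = 2 * (1/2)^k * (1 - (1/2)^(Suc j))" by (simp add: field_simps power_add)
    finally show ?case .
  qed simp
  have est: "L2c (\<lambda>x. g x - f k x)" "n2 (\<lambda>x. g x - f k x) \<le> 2 * (1/2)^k" for k
  proof -
    have e: "eventually (\<lambda>j. n2 (\<lambda>x. f (k + j) x - f k x) \<le> 2 * (1/2)^k) sequentially"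
      by (intro always_eventually allI order_trans[OF tail]) (simp add: mult_left_le)
    have l: "AE x in lborel. (\<lambda>j. f (k + j) x - f k x) \<longlonglongrightarrow> g x - f k x"
      using lim
    proof eventually_elim
      case (elim x)
      then show ?case using LIMSEQ_ignore_initial_segment[OF elim, of k] by (intro tendsto_intros) (simp add: add.commute)
    qed
    show "L2c (\<lambda>x. g x - f k x)" "n2 (\<lambda>x. g x - f k x) \<le> 2 * (1/2)^k"
      using L2_fatou[OF _ _ l e] f by auto
  qed
  have "L2c g" using L2c_add[OF est(1)[of 0] f[of 0]] by simp
  moreover have "(\<lambda>k. n2 (\<lambda>x. f k x - g x)) \<longlonglongrightarrow> 0"
  proof (rule tendsto_sandwich[of "\<lambda>_. 0"])
    show "(\<lambda>k. 2 * (1/2)^k) \<longlonglongrightarrow> (0::real)"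
      using tendsto_mult_right_zero[OF LIMSEQ_power_zero[of "1/2::real"]] by simp
  qed (use est(2) n2_minus_commute in auto)
  ultimately show ?thesis by blast
qed

section \<open>Continuous functions of compact support and their density in L2\<close>

lemma testc_bound:
  assumes "testc \<phi>"
  obtains R B where "0 < R" "0 < B" "\<And>x. norm x > R \<Longrightarrow> \<phi> x = 0" "\<And>x. cmod (\<phi> x) \<le> B"
proof -
  obtain R where R: "\<And>x. \<phi> x \<noteq> 0 \<Longrightarrow> norm x \<le> R" "0 < R"
    using assms unfolding testc_def bounded_pos by auto
  have "compact (\<phi> ` cball 0 R)"
    using assms by (intro compact_continuous_image) (auto simp: testc_def intro: continuous_on_subset)
  then obtain B where B: "0 < B" "\<And>x. x \<in> cball 0 R \<Longrightarrow> cmod (\<phi> x) \<le> B"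
    by (auto dest!: compact_imp_bounded simp: bounded_pos)
  show ?thesis
  proof (rule that[OF R(2) B(1)])
    fix x show "norm x > R \<Longrightarrow> \<phi> x = 0" using R(1)[of x] by force
    show "cmod (\<phi> x) \<le> B" using B R(1)[of x] by (cases "\<phi> x = 0") (auto simp: less_imp_le)
  qed
qed

lemma testc_measurable [measurable_dest]: "testc \<phi> \<Longrightarrow> \<phi> \<in> borel_measurable lborel"
  by (simp add: testc_def borel_measurable_continuous_onI)

lemma integrable_bounded_support:
  fixes f :: "pt \<Rightarrow> 'b::{banach, second_countable_topology}"
  assumes [measurable]: "f \<in> borel_measurable lborel"
    and "\<And>x. norm x > R \<Longrightarrow> f x = 0" "\<And>x. norm (f x) \<le> B"
  shows "integrable lborel f"
proof -
  have "integrable lborel (\<lambda>x. B * indicator (cball (0::pt) R) x)"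
    by (intro integrable_mult_right integrable_real_indicator) (auto simp: emeasure_bounded_finite[unfolded infinity_ennreal_def])
  then show ?thesis
    by (rule Bochner_Integration.integrable_bound)
       (use assms(2,3) order_trans[OF norm_ge_zero assms(3)] in \<open>auto simp: indicator_def not_le\<close>)
qed

lemma testc_integrable: "testc \<phi> \<Longrightarrow> integrable lborel \<phi>"
  using testc_measurable by (metis integrable_bounded_support testc_bound)

lemma testc_L2c: assumes "testc \<phi>" shows "L2c \<phi>"
proof -
  note [measurable] = testc_measurable[OF assms]
  obtain R B where "0 < R" "0 < B" "\<And>x. norm x > R \<Longrightarrow> \<phi> x = 0" "\<And>x. cmod (\<phi> x) \<le> B"
    using testc_bound[OF assms] by metis
  then have "integrable lborel (\<lambda>x. (cmod (\<phi> x))\<^sup>2)"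
    by (intro integrable_bounded_support[where R=R and B="B\<^sup>2"]) (auto intro: power_mono)
  then show ?thesis by (simp add: L2c_def)
qed

lemma L2_dominated:
  assumes "\<And>k::nat. f k \<in> borel_measurable lborel" and "L2c h"
    and lim: "AE x in lborel. (\<lambda>k. f k x) \<longlonglongrightarrow> 0"
    and le: "\<And>k. AE x in lborel. cmod (f k x) \<le> cmod (h x)"
  shows "(\<lambda>k. n2 (f k)) \<longlonglongrightarrow> 0"
proof -
  note [measurable] = assms(1) L2c_measurable[OF assms(2)]
  have "(\<lambda>k. LINT x|lborel. (cmod (f k x))\<^sup>2) \<longlonglongrightarrow> (LINT x|(lborel::pt measure). (0::real))"
  proof (rule integral_dominated_convergence[where f="\<lambda>x. 0" and s="\<lambda>k x. (cmod (f k x))\<^sup>2" and w="\<lambda>x. (cmod (h x))\<^sup>2"])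
    show "AE x in lborel. (\<lambda>k. (cmod (f k x))\<^sup>2) \<longlonglongrightarrow> 0"
      using lim by eventually_elim (auto intro!: tendsto_eq_intros)
    show "AE x in lborel. norm ((cmod (f k x))\<^sup>2) \<le> (cmod (h x))\<^sup>2" for k
      using le[of k] by eventually_elim (auto intro!: power_mono)
  qed (use assms(2) in \<open>auto simp: L2c_def\<close>)
  then have "(\<lambda>k. sqrt (LINT x|lborel. (cmod (f k x))\<^sup>2)) \<longlonglongrightarrow> sqrt 0"
    by (intro tendsto_real_sqrt) simp
  then show ?thesis by (simp add: n2_def L2norm_sq_def)
qed

text \<open>Measurability yields continuous functions converging almost everywhere. A continuous
  cutoff in space makes their supports compact, the projection of the values onto the closed disc of
  radius R keeps them bounded and continuous, and neither operation disturbs the limit f; dominated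
  convergence finishes. R bounds both the support and the values, which leaves one parameter for the
  truncation of a general f.\<close>

lemma testc_dense_bounded:
  assumes [measurable]: "f \<in> borel_measurable lborel"
    and sup: "\<And>x. norm x > R \<Longrightarrow> f x = 0" and bd: "\<And>x. cmod (f x) \<le> R" and R: "0 < R"
  shows "\<exists>\<phi>. (\<forall>k::nat. testc (\<phi> k)) \<and> (\<lambda>k. n2 (\<lambda>x. \<phi> k x - f x)) \<longlonglongrightarrow> 0"
proof -
  have "f measurable_on UNIV"
    by (rule lebesgue_measurable_imp_measurable_on) (auto simp: measurable_completion)
  then obtain N g where N: "negligible N" and g: "\<And>n. continuous_on UNIV (g n)"
    and lim: "\<And>x. x \<notin> N \<Longrightarrow> (\<lambda>n. g n x) \<longlonglongrightarrow> f x"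
    unfolding measurable_on_def by auto
  define cut :: "pt \<Rightarrow> real" where "cut x = max 0 (min 1 (R + 1 - norm x))" for x
  define \<phi> where "\<phi> n x = complex_of_real (cut x) * closest_point (cball 0 R) (g n x)" for n x
  have cp: "closest_point (cball 0 R) z \<in> cball 0 R" for z :: complex
    using R by (intro closest_point_in_set) auto
  have cont: "continuous_on UNIV (closest_point (cball (0::complex) R))"
    using R by (intro continuous_on_closest_point) auto
  have cphi: "continuous_on UNIV (\<phi> n)" for n
    unfolding \<phi>_def cut_def
    by (intro continuous_intros continuous_on_compose2[OF cont g]) auto
  have z: "norm x > R + 1 \<Longrightarrow> \<phi> n x = 0" for n x by (simp add: \<phi>_def cut_def)
  have t: "testc (\<phi> n)" for n
    unfolding testc_def using cphi z by (auto intro!: boundedI[of _ "R+1"] simp: not_less[symmetric])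
  note [measurable] = testc_measurable[OF t]
  have b: "cmod (\<phi> n x) \<le> R" for n x
  proof -
    have "cmod (\<phi> n x) = cut x * cmod (closest_point (cball 0 R) (g n x))"
      by (simp add: \<phi>_def norm_mult cut_def)
    also have "\<dots> \<le> 1 * R" using cp[of "g n x"] R by (intro mult_mono) (auto simp: cut_def)
    finally show ?thesis by simp
  qed
  have "(\<lambda>k. n2 (\<lambda>x. \<phi> k x - f x)) \<longlonglongrightarrow> 0"
  proof (rule L2_dominated[where h="\<lambda>x. complex_of_real (2 * R * indicator (cball 0 (R+1)) x)"])
    show "L2c (\<lambda>x. complex_of_real (2 * R * indicator (cball 0 (R+1)) x))"
      unfolding L2c_def using R
      by (auto intro!: integrable_bounded_support[where R="R+1" and B="(2*R)\<^sup>2"] power_mono simp: indicator_def)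
    show "AE x in lborel. (\<lambda>k. \<phi> k x - f x) \<longlonglongrightarrow> 0"
    proof -
      have "AE x in lebesgue. x \<notin> N" using N by (auto simp: negligible_iff_null_sets intro: AE_not_in)
      then have "AE x in lborel. x \<notin> N" by (simp add: AE_completion_iff)
      then show ?thesis
      proof eventually_elim
        case (elim x)
        have fx: "f x \<in> cball 0 R" using bd by simp
        have "(\<lambda>k. closest_point (cball 0 R) (g k x)) \<longlonglongrightarrow> closest_point (cball 0 R) (f x)"
          using continuous_on_tendsto_compose[OF cont lim[OF elim]] by simp
        then have "(\<lambda>k. \<phi> k x) \<longlonglongrightarrow> complex_of_real (cut x) * f x"
          unfolding \<phi>_def using fx by (auto intro!: tendsto_intros simp: closest_point_self)
        moreover have "complex_of_real (cut x) * f x = f x"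
          using sup[of x] by (cases "norm x > R") (auto simp: cut_def)
        ultimately show ?case by (simp add: LIM_zero)
      qed
    qed
    show "AE x in lborel. cmod (\<phi> k x - f x) \<le> cmod (complex_of_real (2 * R * indicator (cball 0 (R+1)) x))" for k
    proof (intro AE_I2)
      fix x
      have "cmod (\<phi> k x - f x) \<le> R + R"
        by (rule order_trans[OF norm_triangle_ineq4]) (intro add_mono b bd)
      then show "cmod (\<phi> k x - f x) \<le> cmod (complex_of_real (2 * R * indicator (cball 0 (R+1)) x))"
        using R z[of x k] sup[of x] by (cases "norm x \<le> R + 1") auto
    qed
  qed measurable
  with t show ?thesis by blast
qed

lemma L2_truncate_tendsto:
  assumes "L2c f"
  shows "(\<lambda>k. n2 (\<lambda>x. (if norm x \<le> real k \<and> cmod (f x) \<le> real k then f x else 0) - f x)) \<longlonglongrightarrow> 0"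
proof (rule L2_dominated[OF _ assms])
  note [measurable] = L2c_measurable[OF assms]
  show "(\<lambda>x. (if norm x \<le> real k \<and> cmod (f x) \<le> real k then f x else 0) - f x) \<in> borel_measurable lborel" for k
    by measurable
  show "AE x in lborel. (\<lambda>k. (if norm x \<le> real k \<and> cmod (f x) \<le> real k then f x else 0) - f x) \<longlonglongrightarrow> 0"
  proof (intro AE_I2 tendsto_eventually)
    fix x
    show "eventually (\<lambda>k. (if norm x \<le> real k \<and> cmod (f x) \<le> real k then f x else 0) - f x = 0) sequentially"
    proof -
      obtain m :: nat where "max (norm x) (cmod (f x)) \<le> real m" using real_arch_simple by blast
      then have "(if norm x \<le> real k \<and> cmod (f x) \<le> real k then f x else 0) - f x = 0" if "k \<ge> m" for k
        using that by auto
      then show ?thesis using eventually_ge_at_top[of m] by (rule eventually_mono[rotated])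
    qed
  qed
qed auto

lemma testc_dense:
  assumes f: "L2c f" and e: "0 < e"
  shows "\<exists>\<phi>. testc \<phi> \<and> n2 (\<lambda>x. \<phi> x - f x) < e"
proof -
  note [measurable] = L2c_measurable[OF f]
  define F where "F k x = (if norm x \<le> real k \<and> cmod (f x) \<le> real k then f x else 0)" for k x
  have "eventually (\<lambda>k. n2 (\<lambda>x. F k x - f x) < e/2) sequentially"
    using L2_truncate_tendsto[OF f] e unfolding F_def
    by (intro order_tendstoD) auto
  from eventually_happens[OF eventually_conj[OF this eventually_gt_at_top[of "0::nat"]]]
  obtain k where k: "n2 (\<lambda>x. F k x - f x) < e/2" "k > 0" by auto
  have [measurable]: "F k \<in> borel_measurable lborel" unfolding F_def by measurable
  have FL: "L2c (F k)" by (rule L2c_mono(1)[OF f, where B=1]) (auto simp: F_def)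
  obtain \<phi> where \<phi>: "\<And>j::nat. testc (\<phi> j)" "(\<lambda>j. n2 (\<lambda>x. \<phi> j x - F k x)) \<longlonglongrightarrow> 0"
  proof -
    have "norm x > real k \<Longrightarrow> F k x = 0" "cmod (F k x) \<le> real k" for x by (auto simp: F_def)
    then have "\<exists>\<phi>. (\<forall>j::nat. testc (\<phi> j)) \<and> (\<lambda>j. n2 (\<lambda>x. \<phi> j x - F k x)) \<longlonglongrightarrow> 0"
      using k(2) by (intro testc_dense_bounded[where R="real k"]) auto
    then show thesis using that by blast
  qed
  have "eventually (\<lambda>j. n2 (\<lambda>x. \<phi> j x - F k x) < e/2) sequentially"
    using \<phi>(2) e by (intro order_tendstoD) auto
  then obtain j where j: "n2 (\<lambda>x. \<phi> j x - F k x) < e/2" by (auto dest: eventually_happens)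
  have "n2 (\<lambda>x. \<phi> j x - f x) < e"
    using n2_triangle_diff[OF testc_L2c[OF \<phi>(1)] FL f, of j] j k(1) by simp
  with \<phi>(1) show ?thesis by blast
qed

section \<open>The Fourier transform of integrable functions\<close>

lemma nn_integral_affine:
  fixes f :: "pt \<Rightarrow> ennreal"
  assumes [measurable]: "f \<in> borel_measurable borel" and c: "c \<noteq> 0"
  shows "(\<integral>\<^sup>+x. f x \<partial>lborel) = ennreal (c\<^sup>2) * (\<integral>\<^sup>+x. f (t + c *\<^sub>R x) \<partial>lborel)"
  by (subst lborel_affine[OF c, of t])
     (simp add: nn_integral_density nn_integral_distr nn_integral_cmult ennreal_power)

lemma nn_integral_shift:
  fixes f :: "pt \<Rightarrow> ennreal"
  assumes "f \<in> borel_measurable borel"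
  shows "(\<integral>\<^sup>+x. f (x - t) \<partial>lborel) = (\<integral>\<^sup>+x. f x \<partial>lborel)"
  using nn_integral_affine[OF assms, of 1 "-t"] by simp

lemma nn_integral_reflect:
  fixes f :: "pt \<Rightarrow> ennreal"
  assumes "f \<in> borel_measurable borel"
  shows "(\<integral>\<^sup>+x. f (t - x) \<partial>lborel) = (\<integral>\<^sup>+x. f x \<partial>lborel)"
  using nn_integral_affine[OF assms, of "-1" t] by simp

lemma integrable_affine:
  fixes f :: "pt \<Rightarrow> 'b::{banach, second_countable_topology}"
  assumes f: "integrable lborel f" and c: "c \<noteq> 0"
  shows "integrable lborel (\<lambda>x. f (t + c *\<^sub>R x))"
  using f f[THEN borel_measurable_integrable] c unfolding integrable_iff_bounded
  by (subst (asm) nn_integral_affine[where c=c and t=t]) (auto simp: ennreal_mult_less_top)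

lemma integrable_affine_iff:
  fixes f :: "pt \<Rightarrow> 'b::{banach, second_countable_topology}"
  assumes c: "c \<noteq> 0"
  shows "integrable lborel (\<lambda>x. f (t + c *\<^sub>R x)) \<longleftrightarrow> integrable lborel f"
  using integrable_affine[of f c t] integrable_affine[of "\<lambda>x. f (t + c *\<^sub>R x)" "1/c" "-(1/c) *\<^sub>R t"] c
  by (auto simp: scaleR_diff_right)

text \<open>No integrability is assumed: if f is not integrable, neither is its affine image, and
  both sides are 0 by default. The shift and reflection rules can therefore be used without side
  conditions.\<close>

lemma integral_affine:
  fixes f :: "pt \<Rightarrow> 'b::{banach, second_countable_topology}"
  assumes c: "c \<noteq> 0"
  shows "(LINT x|lborel. f x) = c\<^sup>2 *\<^sub>R (LINT x|lborel. f (t + c *\<^sub>R x))"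
proof cases
  assume f[measurable]: "integrable lborel f"
  have [measurable]: "f \<in> borel_measurable borel" using f[THEN borel_measurable_integrable] by simp
  show ?thesis
    using c integrable_affine[OF f c, of t]
    by (subst lborel_affine[OF c, of t])
       (simp add: integral_density integral_distr ennreal_power)
next
  assume "\<not> integrable lborel f" with c show ?thesis
    by (simp add: integrable_affine_iff not_integrable_integral_eq)
qed

lemma integral_shift:
  fixes f :: "pt \<Rightarrow> 'b::{banach, second_countable_topology}"
  shows "(LINT x|lborel. f (x - t)) = (LINT x|lborel. f x)"
  using integral_affine[of 1 f "-t"] by simp

lemma integral_reflect:
  fixes f :: "pt \<Rightarrow> 'b::{banach, second_countable_topology}"
  shows "(LINT x|lborel. f (t - x)) = (LINT x|lborel. f x)"
  using integral_affine[of "-1" f "t"] by simp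

lemma integral_uminus:
  fixes f :: "pt \<Rightarrow> 'b::{banach, second_countable_topology}"
  shows "(LINT x|lborel. f (- x)) = (LINT x|lborel. f x)"
  using integral_reflect[of f 0] by simp

lemma integrable_reflect:
  fixes f :: "pt \<Rightarrow> 'b::{banach, second_countable_topology}"
  shows "integrable lborel f \<Longrightarrow> integrable lborel (\<lambda>x. f (t - x))"
  using integrable_affine[of f "-1" t] by simp

lemma L2c_uminus_arg [intro]: assumes "L2c f" shows "L2c (\<lambda>x. f (- x))"
proof -
  note [measurable] = L2c_measurable[OF assms]
  have "integrable lborel (\<lambda>x. (cmod (f (0 - x)))\<^sup>2)"
    using assms by (intro integrable_reflect[of "\<lambda>x. (cmod (f x))\<^sup>2"] L2c_integrable)
  then show ?thesis by (simp add: L2c_def)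
qed

text \<open>Points are vectors while Fubini speaks of pairs; this map carries Lebesgue measure
  across so that the Gaussian integral factors.\<close>

definition vec2 :: "real \<times> real \<Rightarrow> pt" where
  "vec2 p = fst p *\<^sub>R axis 1 1 + snd p *\<^sub>R axis 2 1"

lemma vec2_nth [simp]: "vec2 p $ 1 = fst p" "vec2 p $ 2 = snd p"
  by (simp_all add: vec2_def axis_def)

lemma vec2_measurable [measurable]: "vec2 \<in> borel_measurable lborel2"
  unfolding vec2_def by measurable

lemma Basis_pt: "(Basis :: pt set) = {axis 1 1, axis 2 1}"
  by (auto simp: Basis_vec_def UNIV_2)

lemma axis_12: "axis (1::2) (1::real) \<noteq> axis 2 1"
  by (simp add: axis_eq_axis)

lemma inner_pt: "(x::pt) \<bullet> y = x $ 1 * y $ 1 + x $ 2 * y $ 2"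
  by (simp add: inner_vec_def UNIV_2)

lemma norm_pt_sq: "(norm (x::pt))\<^sup>2 = (x $ 1)\<^sup>2 + (x $ 2)\<^sup>2"
  by (subst power2_norm_eq_inner) (simp add: inner_pt power2_eq_square)

lemma lborel_vec2: "(lborel :: pt measure) = distr lborel2 borel vec2"
proof (rule lborel_eqI)
  fix l u :: pt
  assume le: "\<And>b. b \<in> Basis \<Longrightarrow> l \<bullet> b \<le> u \<bullet> b"
  have le12: "l $ 1 \<le> u $ 1" "l $ 2 \<le> u $ 2"
    using le[of "axis 1 1"] le[of "axis 2 1"] by (auto simp: Basis_pt inner_axis)
  have "vec2 -` box l u \<inter> space lborel2 = {l$1<..<u$1} \<times> {l$2<..<u$2}"
    by (auto simp: box_def Basis_pt inner_axis space_pair_measure)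
  then have "emeasure (distr lborel2 borel vec2) (box l u) = ennreal (u$1 - l$1) * ennreal (u$2 - l$2)"
    using le12 by (simp add: emeasure_distr lborel.emeasure_pair_measure_Times)
  also have "\<dots> = ennreal (\<Prod>b\<in>Basis. (u - l) \<bullet> b)"
    using axis_12 le12 by (simp add: Basis_pt inner_axis ennreal_mult)
  finally show "emeasure (distr lborel2 borel vec2) (box l u) = (\<Prod>b\<in>Basis. (u - l) \<bullet> b)" by simp
qed simp

lemma integrable_prod_mult:
  fixes f :: "'a::euclidean_space \<Rightarrow> complex" and h :: "'b::euclidean_space \<Rightarrow> complex"
  assumes f: "integrable lborel f" and h: "integrable lborel h"
  shows "integrable lborel2 (\<lambda>(x, y). f x * h y)"
proof -
  have [measurable]: "f \<in> borel_measurable borel" "h \<in> borel_measurable borel"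
    using borel_measurable_integrable[OF f] borel_measurable_integrable[OF h] by auto
  show ?thesis
  proof (rule lborel_pair.Fubini_integrable)
    show "integrable lborel (\<lambda>x. LINT y|lborel. norm (case (x, y) of (x, y) \<Rightarrow> f x * h y))"
      using f by (simp add: norm_mult)
  qed (use h in auto)
qed

section \<open>The Gaussian and its Fourier transform\<close>

lemma borel_measurable_cis [measurable (raw)]:
  "f \<in> borel_measurable M \<Longrightarrow> (\<lambda>x. cis (f x)) \<in> borel_measurable M"
  by (rule borel_measurable_continuous_on[where f=cis]) (auto intro: continuous_on_cis continuous_on_id)

text \<open>Read off from the characteristic function of the standard normal law; the factor sqrt (2
  pi) undoes the normalisation of its density.\<close>

lemma gauss_1d:
  shows "integrable lborel (\<lambda>a. cis (- (t * a)) * complex_of_real (exp (- a\<^sup>2 / 2)))"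
    and "(LINT a|lborel. cis (- (t * a)) * complex_of_real (exp (- a\<^sup>2 / 2))) = complex_of_real (sqrt (2*pi) * exp (- t\<^sup>2 / 2))"
proof -
  let ?g = "\<lambda>a. cis (- (t * a)) * complex_of_real (exp (- a\<^sup>2 / 2))"
  have eq: "?g a = complex_of_real (sqrt (2*pi)) * (std_normal_density a *\<^sub>R iexp (- t * a))" for a
    by (simp add: std_normal_density_def cis_conv_exp scaleR_conv_of_real)
  have "integrable lborel (\<lambda>a. std_normal_density a *\<^sub>R iexp (- t * a))"
    by (rule Bochner_Integration.integrable_bound[OF integrable_std_normal_moment[of 0]]) auto
  then show "integrable lborel ?g" unfolding eq by (rule integrable_mult_right)
  have "(LINT a|lborel. std_normal_density a *\<^sub>R iexp (- t * a)) = char std_normal_distribution (-t)"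
    unfolding char_def by (subst integral_density) auto
  also have "\<dots> = complex_of_real (exp (- t\<^sup>2 / 2))" by (simp add: char_std_normal_distribution)
  finally show "(LINT a|lborel. ?g a) = complex_of_real (sqrt (2*pi) * exp (- t\<^sup>2 / 2))"
    by (simp only: eq integral_mult_right_zero of_real_mult)
qed

definition gauss :: "pt \<Rightarrow> real" where "gauss \<xi> = exp (- (norm \<xi>)\<^sup>2 / 2)"

lemma gauss_measurable [measurable]: "gauss \<in> borel_measurable borel"
  unfolding gauss_def by measurable

lemma gauss_2d:
  shows "integrable lborel (\<lambda>\<xi>. cis (- (z \<bullet> \<xi>)) * complex_of_real (gauss \<xi>))"
    and "(LINT \<xi>|lborel. cis (- (z \<bullet> \<xi>)) * complex_of_real (gauss \<xi>)) = complex_of_real (2 * pi * gauss z)"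
proof -
  let ?F = "\<lambda>\<xi>. cis (- (z \<bullet> \<xi>)) * complex_of_real (gauss \<xi>)"
  let ?g = "\<lambda>t a. cis (- (t * a)) * complex_of_real (exp (- a\<^sup>2 / 2))"
  have eq: "?F (vec2 p) = (case p of (a, b) \<Rightarrow> ?g (z$1) a * ?g (z$2) b)" for p
  proof (cases p)
    case (Pair a b)
    have 1: "cis (- (z \<bullet> vec2 p)) = cis (- (z$1 * a)) * cis (- (z$2 * b))" by (simp add: inner_pt Pair cis_mult)
    have 2: "gauss (vec2 p) = exp (- a\<^sup>2 / 2) * exp (- b\<^sup>2 / 2)"
      unfolding gauss_def norm_pt_sq exp_add[symmetric] by (simp add: Pair field_simps)
    show ?thesis by (simp only: 1 2 of_real_mult, simp add: Pair mult_ac)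
  qed
  have int: "integrable lborel2 (\<lambda>p. ?F (vec2 p))"
    unfolding eq by (rule integrable_prod_mult[OF gauss_1d(1) gauss_1d(1)])
  show "integrable lborel ?F"
    by (subst lborel_vec2, subst integrable_distr_eq) (use int in auto)
  have "(LINT \<xi>|lborel. ?F \<xi>) = (LINT p|lborel2. ?F (vec2 p))"
    by (subst lborel_vec2, subst integral_distr) auto
  also have "\<dots> = (LINT a|lborel. LINT b|lborel. ?g (z$1) a * ?g (z$2) b)"
    unfolding eq by (subst lborel_pair.integral_fst[symmetric]) (use int eq in auto)
  also have "\<dots> = complex_of_real (sqrt (2*pi) * exp (- (z$1)\<^sup>2 / 2)) * complex_of_real (sqrt (2*pi) * exp (- (z$2)\<^sup>2 / 2))"
    by (simp only: integral_mult_right_zero integral_mult_left_zero gauss_1d(2))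
  also have "\<dots> = complex_of_real ((sqrt (2*pi) * sqrt (2*pi)) * (exp (- (z$1)\<^sup>2 / 2) * exp (- (z$2)\<^sup>2 / 2)))"
    by (simp only: of_real_mult mult_ac)
  also have "\<dots> = complex_of_real (2 * pi * gauss z)"
    by (simp add: gauss_def norm_pt_sq exp_add[symmetric] add_divide_distrib)
  finally show "(LINT \<xi>|lborel. ?F \<xi>) = complex_of_real (2 * pi * gauss z)" .
qed

lemma gauss_integrable: "integrable lborel gauss"
  using integrable_norm[OF gauss_2d(1)[of 0]] by (simp add: gauss_def[abs_def])

lemma gauss_integral: "(LINT \<xi>|lborel. gauss \<xi>) = 2 * pi"
proof -
  have "complex_of_real (LINT \<xi>|lborel. gauss \<xi>) = complex_of_real (2 * pi)"
    using gauss_2d(2)[of 0] by (simp add: gauss_def)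
  then show ?thesis by (simp only: of_real_eq_iff)
qed

section \<open>The Fourier integral, up to Plancherel's identity for test functions\<close>

lemma fourier_measurable [measurable (raw)]:
  assumes [measurable]: "f \<in> borel_measurable borel"
  shows "fourier f \<in> borel_measurable borel"
  unfolding fourier_def by measurable

lemma fourier_integrable:
  assumes "integrable lborel f"
  shows "integrable lborel (\<lambda>x. f x * cis (- (x \<bullet> \<xi>)))"
  by (rule Bochner_Integration.integrable_bound[OF assms]) 
     (use assms[THEN borel_measurable_integrable] in \<open>auto simp: norm_mult\<close>)

lemma fourier_bound:
  assumes "integrable lborel f"
  shows "cmod (fourier f \<xi>) \<le> (LINT x|lborel. cmod (f x))"
  unfolding fourier_def using integral_norm_bound[of lborel "\<lambda>x. f x * cis (- (x \<bullet> \<xi>))"]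
  by (simp add: norm_mult)

lemma fourier_diff:
  assumes "integrable lborel f" "integrable lborel g"
  shows "fourier (\<lambda>x. f x - g x) \<xi> = fourier f \<xi> - fourier g \<xi>"
  unfolding fourier_def
  using fourier_integrable[OF assms(1)] fourier_integrable[OF assms(2)] by (simp add: left_diff_distrib)

lemma cnj_lint: "cnj (LINT x|M. f x) = (LINT x|M. cnj (f x))"
  by (rule Bochner_Integration.integral_cnj[symmetric])

lemma fourier_cnj: "fourier (\<lambda>x. cnj (f x)) \<xi> = cnj (fourier f (- \<xi>))"
  unfolding fourier_def cnj_lint
  by (rule Bochner_Integration.integral_cong) (simp_all add: cis_cnj)

lemma fourier_multiplication:
  assumes f: "integrable lborel f" and h: "integrable lborel h"
  shows "(LINT \<xi>|lborel. fourier f \<xi> * h \<xi>) = (LINT x|lborel. f x * fourier h x)"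
proof -
  have [measurable]: "f \<in> borel_measurable borel" "h \<in> borel_measurable borel"
    using borel_measurable_integrable[OF f] borel_measurable_integrable[OF h] by auto
  have int: "integrable lborel2 (\<lambda>(x, \<xi>). f x * h \<xi> * cis (- (x \<bullet> \<xi>)))"
    by (rule Bochner_Integration.integrable_bound[OF integrable_prod_mult[OF f h]]) (auto simp: norm_mult)
  have "(LINT \<xi>|lborel. fourier f \<xi> * h \<xi>) = (LINT \<xi>|lborel. LINT x|lborel. f x * h \<xi> * cis (- (x \<bullet> \<xi>)))"
    unfolding fourier_def by (subst integral_mult_left_zero[symmetric]) (simp add: mult_ac)
  also have "\<dots> = (LINT x|lborel. LINT \<xi>|lborel. f x * h \<xi> * cis (- (x \<bullet> \<xi>)))"
    by (rule lborel_pair.Fubini_integral[OF int])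
  also have "\<dots> = (LINT x|lborel. f x * fourier h x)"
    unfolding fourier_def by (subst integral_mult_right_zero[symmetric]) (simp add: mult_ac inner_commute)
  finally show ?thesis .
qed

text \<open>Dilation by e spreads the Gaussian and modulation by
  \<open>cis (x \<bullet> \<xi>)\<close> moves its transform to x: the result is (2 pi)^2 times an
  approximate identity at x as e tends to 0.\<close>

lemma gauss_scaled_fourier:
  assumes e: "0 < (e::real)"
  shows "integrable lborel (\<lambda>\<xi>. complex_of_real (gauss (e *\<^sub>R \<xi>)) * cis (x \<bullet> \<xi>))"
    and "fourier (\<lambda>\<xi>. complex_of_real (gauss (e *\<^sub>R \<xi>)) * cis (x \<bullet> \<xi>)) y =
        complex_of_real (2 * pi / e\<^sup>2 * gauss ((1/e) *\<^sub>R (y - x)))"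
proof -
  let ?z = "(1/e) *\<^sub>R (y - x)"
  have *: "cis (- (?z \<bullet> (0 + e *\<^sub>R \<xi>))) * complex_of_real (gauss (0 + e *\<^sub>R \<xi>)) =
    complex_of_real (gauss (e *\<^sub>R \<xi>)) * cis (x \<bullet> \<xi>) * cis (- (\<xi> \<bullet> y))" for \<xi>
    using e by (simp add: cis_mult inner_diff_left inner_commute[of \<xi> y])
  have "complex_of_real (2 * pi * gauss ?z) = e\<^sup>2 *\<^sub>R fourier (\<lambda>\<xi>. complex_of_real (gauss (e *\<^sub>R \<xi>)) * cis (x \<bullet> \<xi>)) y"
    unfolding gauss_2d(2)[symmetric] fourier_def
    by (subst integral_affine[of e _ 0]) (use e in simp, simp only: *)
  then show "fourier (\<lambda>\<xi>. complex_of_real (gauss (e *\<^sub>R \<xi>)) * cis (x \<bullet> \<xi>)) y =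
        complex_of_real (2 * pi / e\<^sup>2 * gauss ((1/e) *\<^sub>R (y - x)))"
    using e by (simp add: scaleR_conv_of_real field_simps)
  have "integrable lborel (\<lambda>\<xi>. gauss (0 + e *\<^sub>R \<xi>))"
    using e by (intro integrable_affine gauss_integrable) auto
  then show "integrable lborel (\<lambda>\<xi>. complex_of_real (gauss (e *\<^sub>R \<xi>)) * cis (x \<bullet> \<xi>))"
    by (rule Bochner_Integration.integrable_bound) (auto simp: norm_mult)
qed

text \<open>Plancherel's identity damped by a Gaussian so that every integral converges absolutely.
  The multiplication formula is used twice: once to move the transform from \<open>\<phi>\<close> to
  the damped conjugate h, once to see that the transform of h is, up to conjugation and 2 pi, the
  Gaussian average of \<open>\<phi>\<close> at scale e around x.\<close>

lemma fourier_energy_gauss: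
  assumes \<phi>: "integrable lborel \<phi>" and e: "0 < (e::real)"
  shows "(LINT \<xi>|lborel. complex_of_real ((cmod (fourier \<phi> \<xi>))\<^sup>2 * gauss (e *\<^sub>R \<xi>))) =
    (LINT x|lborel. \<phi> x * cnj (2 * pi * (LINT z|lborel. \<phi> (x + e *\<^sub>R z) * complex_of_real (gauss z))))"
proof -
  have [measurable]: "\<phi> \<in> borel_measurable borel" using borel_measurable_integrable[OF \<phi>] by auto
  define h where "h \<xi> = cnj (fourier \<phi> \<xi>) * complex_of_real (gauss (e *\<^sub>R \<xi>))" for \<xi>
  have hm [measurable]: "h \<in> borel_measurable borel" unfolding h_def by measurable
  have hint: "integrable lborel h"
  proof (rule Bochner_Integration.integrable_bound)
    show "integrable lborel (\<lambda>\<xi>. (LINT x|lborel. cmod (\<phi> x)) * gauss (e *\<^sub>R \<xi>))"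
      using integrable_affine[OF gauss_integrable, of e 0] e by (intro integrable_mult_right) auto
    show "AE \<xi> in lborel. norm (h \<xi>) \<le> norm ((LINT x|lborel. cmod (\<phi> x)) * gauss (e *\<^sub>R \<xi>))"
      using fourier_bound[OF \<phi>] by (auto simp: h_def norm_mult gauss_def intro!: mult_right_mono)
  qed simp
  have "(LINT \<xi>|lborel. complex_of_real ((cmod (fourier \<phi> \<xi>))\<^sup>2 * gauss (e *\<^sub>R \<xi>))) = (LINT \<xi>|lborel. fourier \<phi> \<xi> * h \<xi>)"
    by (simp add: h_def complex_norm_square mult_ac del: of_real_power)
  also have "\<dots> = (LINT x|lborel. \<phi> x * fourier h x)" by (rule fourier_multiplication[OF \<phi> hint])
  finally have 1: "(LINT \<xi>|lborel. complex_of_real ((cmod (fourier \<phi> \<xi>))\<^sup>2 * gauss (e *\<^sub>R \<xi>))) = (LINT x|lborel. \<phi> x * fourier h x)" .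
  have fh: "fourier h x = cnj (2 * pi * (LINT z|lborel. \<phi> (x + e *\<^sub>R z) * complex_of_real (gauss z)))" for x
  proof -
    let ?g = "\<lambda>\<xi>. complex_of_real (gauss (e *\<^sub>R \<xi>)) * cis (x \<bullet> \<xi>)"
    have "fourier h x = cnj (LINT \<xi>|lborel. fourier \<phi> \<xi> * ?g \<xi>)"
      unfolding fourier_def[of h] h_def cnj_lint
      by (rule Bochner_Integration.integral_cong) (simp_all add: cis_cnj inner_commute mult_ac)
    also have "(LINT \<xi>|lborel. fourier \<phi> \<xi> * ?g \<xi>) = (LINT y|lborel. \<phi> y * fourier ?g y)"
      by (rule fourier_multiplication[OF \<phi> gauss_scaled_fourier(1)[OF e]])
    also have "\<dots> = (LINT y|lborel. \<phi> y * complex_of_real (2 * pi / e\<^sup>2 * gauss ((1/e) *\<^sub>R (y - x))))"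
      by (simp only: gauss_scaled_fourier(2)[OF e])
    also have "\<dots> = e\<^sup>2 *\<^sub>R (LINT z|lborel. \<phi> (x + e *\<^sub>R z) * complex_of_real (2 * pi / e\<^sup>2 * gauss z))"
      using e by (subst integral_affine[of e _ x]) auto
    also have "\<dots> = e\<^sup>2 *\<^sub>R (LINT z|lborel. complex_of_real (2 * pi / e\<^sup>2) * (\<phi> (x + e *\<^sub>R z) * complex_of_real (gauss z)))"
      by (simp only: of_real_mult mult_ac)
    also have "\<dots> = 2 * pi * (LINT z|lborel. \<phi> (x + e *\<^sub>R z) * complex_of_real (gauss z))"
      using e by (simp only: integral_mult_right_zero) (simp add: scaleR_conv_of_real)
    finally show ?thesis .
  qed
  have "(LINT x|lborel. \<phi> x * fourier h x) = (LINT x|lborel. \<phi> x * cnj (2 * pi * (LINT z|lborel. \<phi> (x + e *\<^sub>R z) * complex_of_real (gauss z))))"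
    by (simp only: fh)
  with 1 show ?thesis by (rule trans)
qed

text \<open>The damping is removed by letting e tend to 0 in \<open>fourier_energy_gauss\<close>. On
  the physical side the Gaussian averages converge to 2 pi \<open>\<phi>\<close> by continuity,
  boundedly, and \<open>\<phi>\<close> is integrable; on the frequency side the convergence is
  monotone.\<close>

lemma plancherel_testc:
  assumes \<phi>: "testc \<phi>"
  shows "L2c (fourier \<phi>)" "n2 (fourier \<phi>) = 2 * pi * n2 \<phi>"
proof -
  note [measurable] = testc_measurable[OF \<phi>]
  have [measurable]: "\<phi> \<in> borel_measurable borel" by simp
  have int: "integrable lborel \<phi>" by (rule testc_integrable[OF \<phi>])
  obtain R B where RB: "0 < R" "0 < B" "\<And>x. norm x > R \<Longrightarrow> \<phi> x = 0" "\<And>x. cmod (\<phi> x) \<le> B"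
    using testc_bound[OF \<phi>] by metis
  define e where "e k = 1 / real (Suc k)" for k
  have e0: "0 < e k" for k by (simp add: e_def)
  have elim: "e \<longlonglongrightarrow> 0" unfolding e_def by (rule LIMSEQ_Suc[OF lim_1_over_n])
  define \<Phi> where "\<Phi> k x = (LINT z|lborel. \<phi> (x + e k *\<^sub>R z) * complex_of_real (gauss z))" for k x
  have gb: "integrable lborel (\<lambda>z. B * gauss z)" by (intro integrable_mult_right gauss_integrable)
  have [measurable]: "\<Phi> k \<in> borel_measurable borel" for k unfolding \<Phi>_def by measurable
  have \<Phi>lim: "(\<lambda>k. \<Phi> k x) \<longlonglongrightarrow> \<phi> x * (2 * pi)" for x
  proof -
    have "(\<lambda>k. LINT z|lborel. \<phi> (x + e k *\<^sub>R z) * complex_of_real (gauss z)) \<longlonglongrightarrow> (LINT z|lborel. \<phi> x * complex_of_real (gauss z))"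
    proof (rule integral_dominated_convergence[OF _ _ gb])
      show "AE z in lborel. (\<lambda>k. \<phi> (x + e k *\<^sub>R z) * complex_of_real (gauss z)) \<longlonglongrightarrow> \<phi> x * complex_of_real (gauss z)"
      proof (rule AE_I2)
        fix z :: pt
        have "(\<lambda>k. x + e k *\<^sub>R z) \<longlonglongrightarrow> x + 0 *\<^sub>R z" by (intro tendsto_intros elim)
        then have "(\<lambda>k. \<phi> (x + e k *\<^sub>R z)) \<longlonglongrightarrow> \<phi> x"
          using \<phi> unfolding testc_def by (intro continuous_on_tendsto_compose[of UNIV \<phi>]) auto
        then show "(\<lambda>k. \<phi> (x + e k *\<^sub>R z) * complex_of_real (gauss z)) \<longlonglongrightarrow> \<phi> x * complex_of_real (gauss z)"
          by (intro tendsto_intros)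
      qed
      show "AE z in lborel. norm (\<phi> (x + e k *\<^sub>R z) * complex_of_real (gauss z)) \<le> B * gauss z" for k
        using RB(4) by (intro AE_I2) (auto simp: norm_mult gauss_def)
    qed auto
    then show ?thesis unfolding \<Phi>_def by (simp add: gauss_integral)
  qed
  have \<Phi>b: "cmod (\<Phi> k x) \<le> B * (2 * pi)" for k x
  proof -
    have "cmod (\<Phi> k x) \<le> (LINT z|lborel. cmod (\<phi> (x + e k *\<^sub>R z) * complex_of_real (gauss z)))"
      unfolding \<Phi>_def by (rule integral_norm_bound)
    also have "\<dots> \<le> (LINT z|lborel. B * gauss z)"
      using RB(4) RB(2) by (intro integral_mono' gb) (auto simp: norm_mult gauss_def)
    finally show ?thesis by (simp add: gauss_integral)
  qed
  have lim1: "(\<lambda>k. LINT x|lborel. \<phi> x * cnj (2 * pi * \<Phi> k x)) \<longlonglongrightarrow> (LINT x|lborel. \<phi> x * cnj (2 * pi * (\<phi> x * (2 * pi))))"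
  proof (rule integral_dominated_convergence[where w="\<lambda>x. cmod (\<phi> x) * (2 * pi * (B * (2 * pi)))"])
    show "integrable lborel (\<lambda>x. cmod (\<phi> x) * (2 * pi * (B * (2 * pi))))"
      using int by auto
    show "AE x in lborel. norm (\<phi> x * cnj (2 * pi * \<Phi> k x)) \<le> cmod (\<phi> x) * (2 * pi * (B * (2 * pi)))" for k
    proof (rule AE_I2)
      fix x
      have "cmod (\<phi> x) * (2 * pi * cmod (\<Phi> k x)) \<le> cmod (\<phi> x) * (2 * pi * (B * (2 * pi)))"
        by (intro mult_left_mono \<Phi>b) auto
      then show "norm (\<phi> x * cnj (2 * pi * \<Phi> k x)) \<le> cmod (\<phi> x) * (2 * pi * (B * (2 * pi)))"
        by (simp only: norm_mult complex_mod_cnj norm_of_real norm_numeral) simp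
    qed
    show "AE x in lborel. (\<lambda>k. \<phi> x * cnj (2 * pi * \<Phi> k x)) \<longlonglongrightarrow> \<phi> x * cnj (2 * pi * (\<phi> x * (2 * pi)))"
      by (intro AE_I2 tendsto_intros \<Phi>lim)
  qed auto
  have "(LINT x|lborel. \<phi> x * cnj (2 * pi * (\<phi> x * (2 * pi)))) = (LINT x|lborel. complex_of_real ((2*pi)\<^sup>2) * complex_of_real ((cmod (\<phi> x))\<^sup>2))"
    by (intro Bochner_Integration.integral_cong refl) (simp only: complex_norm_square, simp add: power2_eq_square mult_ac)
  also have "\<dots> = complex_of_real ((2*pi)\<^sup>2 * (n2 \<phi>)\<^sup>2)"
    unfolding n2_squared L2norm_sq_def of_real_mult integral_complex_of_real[symmetric] by (rule integral_mult_right_zero)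
  finally have lim2: "(\<lambda>k. LINT x|lborel. \<phi> x * cnj (2 * pi * \<Phi> k x)) \<longlonglongrightarrow> complex_of_real ((2*pi*n2 \<phi>)\<^sup>2)"
    using lim1 by (simp add: power_mult_distrib)
  define I where "I k = (LINT \<xi>|lborel. (cmod (fourier \<phi> \<xi>))\<^sup>2 * gauss (e k *\<^sub>R \<xi>))" for k
  have "complex_of_real (I k) = (LINT x|lborel. \<phi> x * cnj (2 * pi * \<Phi> k x))" for k
    unfolding I_def \<Phi>_def integral_complex_of_real[symmetric] by (rule fourier_energy_gauss[OF int e0])
  then have "(\<lambda>k. complex_of_real (I k)) \<longlonglongrightarrow> complex_of_real ((2*pi*n2 \<phi>)\<^sup>2)" using lim2 by simp
  then have Ilim: "I \<longlonglongrightarrow> (2*pi*n2 \<phi>)\<^sup>2" by (simp only: tendsto_of_real_iff)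
  have fb: "cmod (fourier \<phi> \<xi>) \<le> (LINT x|lborel. cmod (\<phi> x))" for \<xi> by (rule fourier_bound[OF int])
  have nnI: "(\<integral>\<^sup>+\<xi>. ennreal ((cmod (fourier \<phi> \<xi>))\<^sup>2 * gauss (e k *\<^sub>R \<xi>)) \<partial>lborel) = ennreal (I k)" for k
    unfolding I_def
  proof (rule nn_integral_eq_integral)
    show "integrable lborel (\<lambda>\<xi>. (cmod (fourier \<phi> \<xi>))\<^sup>2 * gauss (e k *\<^sub>R \<xi>))"
    proof (rule Bochner_Integration.integrable_bound)
      show "integrable lborel (\<lambda>\<xi>. (LINT x|lborel. cmod (\<phi> x))\<^sup>2 * gauss (e k *\<^sub>R \<xi>))"
        using integrable_affine[OF gauss_integrable, of "e k" 0] e0[of k] by (intro integrable_mult_right) auto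
    qed (auto simp: gauss_def intro!: mult_right_mono power_mono fb AE_I2)
  qed (auto simp: gauss_def)
  \<comment> \<open>The Gaussian factor increases to 1 as e decreases. Monotone convergence does not
    presuppose that the transform is square integrable, and so delivers this as well.\<close>
  have inc: "incseq (\<lambda>k \<xi>. ennreal ((cmod (fourier \<phi> \<xi>))\<^sup>2 * gauss (e k *\<^sub>R \<xi>)))"
  proof (rule incseq_SucI, rule le_funI)
    fix k and \<xi> :: pt
    have 1: "e (Suc k) * norm \<xi> \<le> e k * norm \<xi>"
      by (intro mult_right_mono) (auto simp: e_def frac_le)
    have "(norm (e (Suc k) *\<^sub>R \<xi>))\<^sup>2 \<le> (norm (e k *\<^sub>R \<xi>))\<^sup>2"
      using 1 by (intro power_mono) (auto simp: abs_of_pos[OF e0] less_imp_le[OF e0])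
    then show "ennreal ((cmod (fourier \<phi> \<xi>))\<^sup>2 * gauss (e k *\<^sub>R \<xi>)) \<le> ennreal ((cmod (fourier \<phi> \<xi>))\<^sup>2 * gauss (e (Suc k) *\<^sub>R \<xi>))"
      unfolding gauss_def by (intro ennreal_leI mult_left_mono) auto
  qed
  have "(\<lambda>k. \<integral>\<^sup>+\<xi>. ennreal ((cmod (fourier \<phi> \<xi>))\<^sup>2 * gauss (e k *\<^sub>R \<xi>)) \<partial>lborel)
     \<longlonglongrightarrow> (\<integral>\<^sup>+\<xi>. ennreal ((cmod (fourier \<phi> \<xi>))\<^sup>2) \<partial>lborel)"
  proof (rule nn_integral_LIMSEQ[OF inc])
    fix \<xi> :: pt
    have "(\<lambda>k. (cmod (fourier \<phi> \<xi>))\<^sup>2 * gauss (e k *\<^sub>R \<xi>)) \<longlonglongrightarrow> (cmod (fourier \<phi> \<xi>))\<^sup>2 * exp (- (norm (0 *\<^sub>R \<xi>))\<^sup>2 / 2)"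
      unfolding gauss_def by (intro tendsto_intros elim) auto
    then show "(\<lambda>k. ennreal ((cmod (fourier \<phi> \<xi>))\<^sup>2 * gauss (e k *\<^sub>R \<xi>))) \<longlonglongrightarrow> ennreal ((cmod (fourier \<phi> \<xi>))\<^sup>2)"
      by (intro tendsto_ennrealI) simp
  qed auto
  then have "(\<lambda>k. ennreal (I k)) \<longlonglongrightarrow> (\<integral>\<^sup>+\<xi>. ennreal ((cmod (fourier \<phi> \<xi>))\<^sup>2) \<partial>lborel)"
    by (simp only: nnI)
  moreover have "(\<lambda>k. ennreal (I k)) \<longlonglongrightarrow> ennreal ((2*pi*n2 \<phi>)\<^sup>2)" by (intro tendsto_ennrealI Ilim)
  ultimately have eq: "(\<integral>\<^sup>+\<xi>. ennreal ((cmod (fourier \<phi> \<xi>))\<^sup>2) \<partial>lborel) = ennreal ((2*pi*n2 \<phi>)\<^sup>2)"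
    by (rule LIMSEQ_unique)
  show L: "L2c (fourier \<phi>)" by (rule L2c_nn_leI(1)[where B="2*pi*n2 \<phi>"]) (auto simp: eq)
  have "(n2 (fourier \<phi>))\<^sup>2 = (2*pi*n2 \<phi>)\<^sup>2"
    using eq L2c_nn_integral[OF L] by simp
  then show "n2 (fourier \<phi>) = 2 * pi * n2 \<phi>"
    by (rule power2_eq_imp_eq) auto
qed

section \<open>The Plancherel transform\<close>

lemma L2_pair_tendsto:
  assumes f: "\<And>k::nat. L2c (f k)" and g: "L2c g" and h: "L2c h"
    and lim: "(\<lambda>k. n2 (\<lambda>x. f k x - g x)) \<longlonglongrightarrow> 0"
  shows "(\<lambda>k. LINT x|lborel. f k x * h x) \<longlonglongrightarrow> (LINT x|lborel. g x * h x)"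
proof (rule LIM_zero_cancel, rule tendsto_norm_zero_cancel, rule tendsto_sandwich[of "\<lambda>_. 0"])
  show "(\<lambda>k. n2 (\<lambda>x. f k x - g x) * n2 h) \<longlonglongrightarrow> 0" using tendsto_mult_left_zero[OF lim] .
  have "cmod ((LINT x|lborel. f k x * h x) - (LINT x|lborel. g x * h x)) \<le> n2 (\<lambda>x. f k x - g x) * n2 h" for k
  proof -
    have "(LINT x|lborel. f k x * h x) - (LINT x|lborel. g x * h x) = (LINT x|lborel. (f k x - g x) * h x)"
      using L2c_mult_integrable[OF f h, of k] L2c_mult_integrable[OF g h] by (simp add: left_diff_distrib)
    then show ?thesis using L2_CS_norm[OF L2c_diff[OF f g] h, of k] by simp
  qed
  then show "eventually (\<lambda>k. norm ((LINT x|lborel. f k x * h x) - (LINT x|lborel. g x * h x)) \<le> n2 (\<lambda>x. f k x - g x) * n2 h) sequentially"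
    by simp
qed auto

lemma n2_tendsto:
  assumes f: "\<And>k::nat. L2c (f k)" and g: "L2c g"
    and lim: "(\<lambda>k. n2 (\<lambda>x. f k x - g x)) \<longlonglongrightarrow> 0"
  shows "(\<lambda>k. n2 (f k)) \<longlonglongrightarrow> n2 g"
proof (rule LIM_zero_cancel, rule tendsto_norm_zero_cancel, rule tendsto_sandwich[OF _ _ tendsto_const lim])
  show "eventually (\<lambda>k. norm (n2 (f k) - n2 g) \<le> n2 (\<lambda>x. f k x - g x)) sequentially"
    using n2_diff_le[OF f g] by auto
qed auto

lemma n2_eq_0_AE:
  assumes "L2c f" "n2 f = 0" shows "AE x in lborel. f x = 0"
proof -
  have "(LINT x|lborel. (cmod (f x))\<^sup>2) = 0" using assms(2) by (simp add: n2_def L2norm_sq_def)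
  then show ?thesis
    by (subst (asm) integral_nonneg_eq_0_iff_AE[OF L2c_integrable[OF assms(1)]]) auto
qed

lemma testc_seq:
  assumes f: "L2c f" and e: "\<And>k::nat. 0 < (e k::real)"
  obtains \<phi> where "\<And>k. testc (\<phi> k)" "\<And>k. n2 (\<lambda>x. \<phi> k x - f x) < e k"
  using testc_dense[OF f e] by metis

text \<open>Test functions approximating the conjugate of q turn the hypothesis into the vanishing
  of the squared norm of q.\<close>

lemma testc_orthogonal_AE:
  assumes q: "L2c q" and z: "\<And>\<psi>. testc \<psi> \<Longrightarrow> (LINT x|lborel. q x * \<psi> x) = 0"
  shows "AE x in lborel. q x = 0"
proof -
  obtain \<phi> where \<phi>: "\<And>k. testc (\<phi> k)" "\<And>k. n2 (\<lambda>x. \<phi> k x - cnj (q x)) < inverse (real (Suc k))"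
    using testc_seq[OF L2c_cnj[OF q], of "\<lambda>k. inverse (real (Suc k))"] by auto
  have "(\<lambda>k. n2 (\<lambda>x. \<phi> k x - cnj (q x))) \<longlonglongrightarrow> 0"
    by (rule tendsto_sandwich[OF _ _ tendsto_const LIMSEQ_inverse_real_of_nat])
       (simp, intro always_eventually allI less_imp_le \<phi>(2))
  from L2_pair_tendsto[OF testc_L2c[OF \<phi>(1)] L2c_cnj[OF q] q this]
  have "(\<lambda>k. LINT x|lborel. q x * \<phi> k x) \<longlonglongrightarrow> (LINT x|lborel. q x * cnj (q x))"
    by (simp only: mult.commute)
  then have "(LINT x|lborel. q x * cnj (q x)) = 0"
    using z[OF \<phi>(1)] by (simp add: LIMSEQ_const_iff)
  moreover have "(LINT x|lborel. q x * cnj (q x)) = complex_of_real ((n2 q)\<^sup>2)"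
    unfolding n2_squared L2norm_sq_def integral_complex_of_real[symmetric] complex_norm_square ..
  ultimately have "n2 q = 0" by simp
  then show ?thesis by (rule n2_eq_0_AE[OF q])
qed

section \<open>The L2 transform defined by duality: uniqueness, existence, Parseval,
  inversion\<close>

lemma is_FT_testc: assumes "testc \<phi>" shows "is_FT \<phi> (fourier \<phi>)"
  unfolding is_FT_def
  using testc_L2c[OF assms] plancherel_testc(1)[OF assms]
    fourier_multiplication[OF testc_integrable[OF assms] testc_integrable] by auto

lemma is_FT_L2c: "is_FT f g \<Longrightarrow> L2c f" "is_FT f g \<Longrightarrow> L2c g"
  by (auto simp: is_FT_def)

lemma is_FT_add:
  assumes "is_FT f g" "is_FT f' g'" shows "is_FT (\<lambda>x. f x + f' x) (\<lambda>x. g x + g' x)"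
  unfolding is_FT_def
proof (intro conjI allI impI)
  fix \<phi> assume t: "testc \<phi>"
  note L = is_FT_L2c[OF assms(1)] is_FT_L2c[OF assms(2)]
  note p = plancherel_testc(1)[OF t] and tl = testc_L2c[OF t]
  show "(LINT x|lborel. (f x + f' x) * fourier \<phi> x) = (LINT \<xi>|lborel. (g \<xi> + g' \<xi>) * \<phi> \<xi>)"
    using assms t L2c_mult_integrable[OF L(1) p] L2c_mult_integrable[OF L(3) p]
      L2c_mult_integrable[OF L(2) tl] L2c_mult_integrable[OF L(4) tl]
    unfolding is_FT_def by (simp add: distrib_right)
qed (use assms in \<open>auto simp: is_FT_def\<close>)

lemma is_FT_cmult:
  assumes "is_FT f g" shows "is_FT (\<lambda>x. c * f x) (\<lambda>x. c * g x)"
  using assms unfolding is_FT_def by (auto simp: mult.assoc)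

lemma is_FT_diff:
  assumes "is_FT f g" "is_FT f' g'" shows "is_FT (\<lambda>x. f x - f' x) (\<lambda>x. g x - g' x)"
  using is_FT_add[OF assms(1) is_FT_cmult[OF assms(2), of "-1"]] by simp

lemma is_FT_cong_AE:
  assumes "is_FT f g" and [measurable]: "f' \<in> borel_measurable lborel" "g' \<in> borel_measurable lborel"
    and "AE x in lborel. f x = f' x" "AE x in lborel. g x = g' x"
  shows "is_FT f' g'"
  unfolding is_FT_def
proof (intro conjI allI impI)
  note [measurable] = L2c_measurable[OF is_FT_L2c(1)[OF assms(1)]] L2c_measurable[OF is_FT_L2c(2)[OF assms(1)]]
  show "L2c f'" "L2c g'"
    using L2c_cong_AE[OF is_FT_L2c(1)[OF assms(1)] assms(2,4)] L2c_cong_AE[OF is_FT_L2c(2)[OF assms(1)] assms(3,5)] by auto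
  fix \<phi> assume t: "testc \<phi>"
  note [measurable] = testc_measurable[OF t] L2c_measurable[OF plancherel_testc(1)[OF t]]
  have "(LINT x|lborel. f x * fourier \<phi> x) = (LINT x|lborel. f' x * fourier \<phi> x)"
    using assms(4) by (intro integral_cong_AE) auto
  moreover have "(LINT x|lborel. g x * \<phi> x) = (LINT x|lborel. g' x * \<phi> x)"
    using assms(5) by (intro integral_cong_AE) auto
  ultimately show "(LINT x|lborel. f' x * fourier \<phi> x) = (LINT x|lborel. g' x * \<phi> x)"
    using assms(1) t unfolding is_FT_def by auto
qed

lemma is_FT_unique:
  assumes "is_FT f g" "is_FT f g'" shows "AE x in lborel. g x = g' x"
proof -
  have d: "is_FT (\<lambda>x. f x - f x) (\<lambda>x. g x - g' x)" by (rule is_FT_diff[OF assms])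
  have "AE x in lborel. g x - g' x = 0"
    by (rule testc_orthogonal_AE) (use d in \<open>auto simp: is_FT_def\<close>)
  then show ?thesis by simp
qed

text \<open>Extension by density: by Plancherel for test functions the transforms of an
  approximating sequence are again rapidly Cauchy, and both the duality relation and the norm
  identity pass to the limit.\<close>

lemma is_FT_exists_n2:
  assumes f: "L2c f"
  shows "\<exists>g. is_FT f g \<and> n2 g = 2 * pi * n2 f"
proof -
  \<comment> \<open>The rate is chosen so that 2 pi (e (k+1) + e k), which is 3/4 of (1/2)^k, meets
    the requirement of \<open>L2_complete\<close>.\<close>
  define e :: "nat \<Rightarrow> real" where "e k = (1/2)^k / (4 * pi)" for k
  have e0: "0 < e k" for k by (simp add: e_def)
  obtain \<phi> where \<phi>: "\<And>k. testc (\<phi> k)" "\<And>k. n2 (\<lambda>x. \<phi> k x - f x) < e k"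
    using testc_seq[OF f, of e] e0 by auto
  have L: "L2c (\<phi> k)" for k by (rule testc_L2c[OF \<phi>(1)])
  have elim: "e \<longlonglongrightarrow> 0" unfolding e_def
    using tendsto_divide[OF LIMSEQ_power_zero[of "1/2::real"] tendsto_const[of "4*pi"]] by simp
  have lim: "(\<lambda>k. n2 (\<lambda>x. \<phi> k x - f x)) \<longlonglongrightarrow> 0"
    by (rule tendsto_sandwich[OF _ _ tendsto_const elim])
       (simp, intro always_eventually allI less_imp_le \<phi>(2))
  have tdiff: "testc (\<lambda>x. \<phi> (Suc k) x - \<phi> k x)" for k
  proof -
    have "{x. \<phi> (Suc k) x - \<phi> k x \<noteq> 0} \<subseteq> {x. \<phi> (Suc k) x \<noteq> 0} \<union> {x. \<phi> k x \<noteq> 0}" by auto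
    then show ?thesis using \<phi>(1)[of k] \<phi>(1)[of "Suc k"] unfolding testc_def
      by (auto intro: bounded_subset[OF bounded_Un[THEN iffD2]] continuous_on_diff)
  qed
  have d: "n2 (\<lambda>\<xi>. fourier (\<phi> (Suc k)) \<xi> - fourier (\<phi> k) \<xi>) \<le> (1/2)^k" for k
  proof -
    have "(\<lambda>\<xi>. fourier (\<phi> (Suc k)) \<xi> - fourier (\<phi> k) \<xi>) = fourier (\<lambda>x. \<phi> (Suc k) x - \<phi> k x)"
      using fourier_diff[OF testc_integrable[OF \<phi>(1)] testc_integrable[OF \<phi>(1)]] by auto
    then have "n2 (\<lambda>\<xi>. fourier (\<phi> (Suc k)) \<xi> - fourier (\<phi> k) \<xi>) = 2 * pi * n2 (\<lambda>x. \<phi> (Suc k) x - \<phi> k x)"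
      using plancherel_testc(2)[OF tdiff] by simp
    also have "n2 (\<lambda>x. \<phi> (Suc k) x - \<phi> k x) \<le> e (Suc k) + e k"
      using n2_triangle_diff[OF L f L, of "Suc k" k] \<phi>(2)[of "Suc k"] \<phi>(2)[of k]
      by (simp add: n2_minus_commute[of f])
    also have "2 * pi * (e (Suc k) + e k) \<le> (1/2)^k" by (simp add: e_def field_simps)
    finally show ?thesis by simp
  qed
  obtain g where g: "L2c g" "(\<lambda>k. n2 (\<lambda>x. fourier (\<phi> k) x - g x)) \<longlonglongrightarrow> 0"
    using L2_complete[of "\<lambda>k. fourier (\<phi> k)", OF plancherel_testc(1)[OF \<phi>(1)] d] by auto
  have "is_FT f g"
    unfolding is_FT_def
  proof (intro conjI allI impI f g(1))
    fix \<psi> assume t: "testc \<psi>"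
    have 1: "(\<lambda>k. LINT x|lborel. \<phi> k x * fourier \<psi> x) \<longlonglongrightarrow> (LINT x|lborel. f x * fourier \<psi> x)"
      by (rule L2_pair_tendsto[OF L f plancherel_testc(1)[OF t] lim])
    have 2: "(\<lambda>k. LINT x|lborel. fourier (\<phi> k) x * \<psi> x) \<longlonglongrightarrow> (LINT x|lborel. g x * \<psi> x)"
      by (rule L2_pair_tendsto[OF plancherel_testc(1)[OF \<phi>(1)] g(1) testc_L2c[OF t] g(2)])
    show "(LINT x|lborel. f x * fourier \<psi> x) = (LINT x|lborel. g x * \<psi> x)"
      using 1 2 fourier_multiplication[OF testc_integrable[OF \<phi>(1)] testc_integrable[OF t]]
      by (auto intro: LIMSEQ_unique)
  qed
  moreover have "n2 g = 2 * pi * n2 f"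
  proof (rule LIMSEQ_unique[OF n2_tendsto[OF plancherel_testc(1)[OF \<phi>(1)] g]])
    show "(\<lambda>k. n2 (fourier (\<phi> k))) \<longlonglongrightarrow> 2 * pi * n2 f"
      unfolding plancherel_testc(2)[OF \<phi>(1)] by (intro tendsto_intros n2_tendsto[OF L f lim])
  qed
  ultimately show ?thesis by blast
qed

lemma is_FT_n2:
  assumes "is_FT f g" shows "n2 g = 2 * pi * n2 f"
proof -
  obtain g' where g': "is_FT f g'" "n2 g' = 2 * pi * n2 f"
    using is_FT_exists_n2[OF is_FT_L2c(1)[OF assms]] by auto
  have "n2 g = n2 g'"
    using is_FT_L2c[OF assms] is_FT_L2c[OF g'(1)]
    by (intro n2_cong_AE is_FT_unique[OF assms g'(1)]) (auto simp: L2c_def)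
  with g' show ?thesis by simp
qed

lemma FTL2_is_FT: "L2c f \<Longrightarrow> is_FT f (FTL2 f)"
  unfolding FTL2_def using is_FT_exists_n2 by (metis someI)

text \<open>\<open>FTL2\<close> is a choice, known only up to null sets. Later arguments work with
  an arbitrary transform g of f, and this lemma carries their results over to the definitions that
  mention \<open>FTL2\<close>.\<close>

lemma is_FT_FTL2: "is_FT f g \<Longrightarrow> AE x in lborel. FTL2 f x = g x"
  by (rule is_FT_unique[OF FTL2_is_FT]) (auto dest: is_FT_L2c)

lemma is_FT_inj:
  assumes "is_FT f g" "is_FT f' g'" "AE x in lborel. g x = g' x"
  shows "AE x in lborel. f x = f' x"
proof -
  have d: "is_FT (\<lambda>x. f x - f' x) (\<lambda>x. g x - g' x)" by (rule is_FT_diff[OF assms(1,2)])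
  have "n2 (\<lambda>x. g x - g' x) = n2 (\<lambda>x. 0)"
    using assms(3) is_FT_L2c(2)[OF d] by (intro n2_cong_AE) (auto simp: L2c_def)
  then have "n2 (\<lambda>x. f x - f' x) = 0" using is_FT_n2[OF d] by simp
  from n2_eq_0_AE[OF is_FT_L2c(1)[OF d] this] show ?thesis by simp
qed

lemma L2norm_sq_add:
  assumes "L2c f" "L2c g"
  shows "L2norm_sq (\<lambda>x. f x + g x) = L2norm_sq f + L2norm_sq g + 2 * Re (LINT x|lborel. f x * cnj (g x))"
proof -
  have i: "integrable lborel (\<lambda>x. f x * cnj (g x))"
    by (rule L2c_mult_integrable[OF assms(1) L2c_cnj[OF assms(2)]])
  have "L2norm_sq (\<lambda>x. f x + g x) = (LINT x|lborel. (cmod (f x))\<^sup>2 + (cmod (g x))\<^sup>2 + 2 * Re (f x * cnj (g x)))"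
    unfolding L2norm_sq_def
    by (intro Bochner_Integration.integral_cong refl) (simp add: cmod_add_squared cmod_power2 power2_sum algebra_simps)
  also have "\<dots> = L2norm_sq f + L2norm_sq g + 2 * (LINT x|lborel. Re (f x * cnj (g x)))"
    using integrable_Re[OF i] L2c_integrable[OF assms(1)] L2c_integrable[OF assms(2)]
    unfolding L2norm_sq_def by (simp del: times_complex.sel)
  also have "(LINT x|lborel. Re (f x * cnj (g x))) = Re (LINT x|lborel. f x * cnj (g x))"
    by (rule integral_Re[OF i])
  finally show ?thesis .
qed

text \<open>Polarisation: the norms of f, f' and f + f' determine the real part of the pairing, and
  the same for i f', whose transform is i g', gives the imaginary part.\<close>

lemma parseval:
  assumes "is_FT f g" "is_FT f' g'"
  shows "(LINT \<xi>|lborel. g \<xi> * cnj (g' \<xi>)) = (2*pi)\<^sup>2 * (LINT x|lborel. f x * cnj (f' x))"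
proof -
  have N: "L2norm_sq b = (2*pi)\<^sup>2 * L2norm_sq a" if "is_FT a b" for a b
    using is_FT_n2[OF that] unfolding n2_squared[symmetric] by (simp add: power_mult_distrib)
  have Re: "Re (LINT \<xi>|lborel. g \<xi> * cnj (b \<xi>)) = (2*pi)\<^sup>2 * Re (LINT x|lborel. f x * cnj (a x))" if "is_FT a b" for a b
    using N[OF is_FT_add[OF assms(1) that]] N[OF assms(1)] N[OF that]
      L2norm_sq_add[OF is_FT_L2c(1)[OF assms(1)] is_FT_L2c(1)[OF that]]
      L2norm_sq_add[OF is_FT_L2c(2)[OF assms(1)] is_FT_L2c(2)[OF that]]
    by (simp add: algebra_simps)
  have I: "(LINT x|lborel. u x * cnj (\<i> * v x)) = - \<i> * (LINT x|lborel. u x * cnj (v x))" for u v :: "pt \<Rightarrow> complex"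
  proof -
    have "(LINT x|lborel. u x * cnj (\<i> * v x)) = (LINT x|lborel. - \<i> * (u x * cnj (v x)))"
      by (intro Bochner_Integration.integral_cong refl) simp
    also have "\<dots> = - \<i> * (LINT x|lborel. u x * cnj (v x))" by (rule integral_mult_right_zero)
    finally show ?thesis .
  qed
  have Im: "Im (LINT \<xi>|lborel. g \<xi> * cnj (g' \<xi>)) = (2*pi)\<^sup>2 * Im (LINT x|lborel. f x * cnj (f' x))"
    using Re[OF is_FT_cmult[OF assms(2), of \<i>]] unfolding I by simp
  have c: "z = (2*pi)\<^sup>2 * w" if "Re z = (2*pi)\<^sup>2 * Re w" "Im z = (2*pi)\<^sup>2 * Im w" for z w :: complex
  proof -
    have "z = ((2*pi)\<^sup>2) *\<^sub>R w" using that by (intro complex_eqI) simp_all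
    then show ?thesis by (simp add: scaleR_conv_of_real)
  qed
  show ?thesis by (rule c[OF Re[OF assms(2)] Im])
qed

text \<open>The preimage of g is the reflected transform of g divided by (2 pi)^2. Duality is
  checked by Parseval against the conjugate of the test function, since reflecting
  \<open>fourier \<phi>\<close> and conjugating the test function amount to conjugating the
  transform.\<close>

lemma is_FT_inverse_exists:
  assumes g: "L2c g" shows "\<exists>h. is_FT h g"
proof -
  define G where "G = FTL2 g"
  have G: "is_FT g G" unfolding G_def by (rule FTL2_is_FT[OF g])
  define h where "h x = complex_of_real (1 / (2*pi)\<^sup>2) * G (- x)" for x
  have hL: "L2c h" unfolding h_def by (intro L2c_cmult L2c_uminus_arg is_FT_L2c(2)[OF G])
  have "is_FT h g"
    unfolding is_FT_def
  proof (intro conjI allI impI hL g)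
    fix \<phi> assume t: "testc \<phi>"
    have tc: "testc (\<lambda>x. cnj (\<phi> x))" using t unfolding testc_def by (auto intro: continuous_on_cnj)
    have "(LINT x|lborel. h x * fourier \<phi> x) = (LINT x|lborel. h (-x) * fourier \<phi> (- x))"
      using integral_uminus[of "\<lambda>x. h x * fourier \<phi> x"] by simp
    also have "\<dots> = (LINT x|lborel. complex_of_real (1 / (2*pi)\<^sup>2) * (G x * cnj (fourier (\<lambda>x. cnj (\<phi> x)) x)))"
      by (simp add: h_def fourier_cnj mult.assoc)
    also have "\<dots> = complex_of_real (1 / (2*pi)\<^sup>2) * (LINT x|lborel. G x * cnj (fourier (\<lambda>x. cnj (\<phi> x)) x))"
      by (rule integral_mult_right_zero)
    also have "\<dots> = complex_of_real (1 / (2*pi)\<^sup>2) * ((2*pi)\<^sup>2 * (LINT x|lborel. g x * cnj (cnj (\<phi> x))))"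
      by (simp only: parseval[OF G is_FT_testc[OF tc]])
    also have "\<dots> = (LINT x|lborel. g x * \<phi> x)" by simp
    finally show "(LINT x|lborel. h x * fourier \<phi> x) = (LINT x|lborel. g x * \<phi> x)" .
  qed
  then show ?thesis by blast
qed

text \<open>Duality is transferred by the test function x -> cnj (\<phi> (-x)), whose transform is
  the conjugate of that of \<phi>. This is the source of the correspondence between real functions
  and Hermitian transforms.\<close>

lemma is_FT_cnj:
  assumes "is_FT f g" shows "is_FT (\<lambda>x. cnj (f x)) (\<lambda>\<xi>. cnj (g (- \<xi>)))"
  unfolding is_FT_def
proof (intro conjI allI impI)
  show "L2c (\<lambda>x. cnj (f x))" "L2c (\<lambda>\<xi>. cnj (g (- \<xi>)))" using is_FT_L2c[OF assms] by auto
  fix \<phi> assume t: "testc \<phi>"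
  define \<psi> where "\<psi> x = cnj (\<phi> (- x))" for x
  have "{x. \<psi> x \<noteq> 0} \<subseteq> uminus ` {x. \<phi> x \<noteq> 0}" by (force simp: \<psi>_def image_iff intro!: exI[of _ "- x" for x])
  then have tp: "testc \<psi>" using t unfolding testc_def \<psi>_def
    by (auto intro!: continuous_intros continuous_on_compose2[of UNIV \<phi>] intro: bounded_subset[OF bounded_uminus[THEN iffD2]])
  have fp: "fourier \<psi> x = cnj (fourier \<phi> x)" for x
    unfolding fourier_def cnj_lint \<psi>_def
    by (subst integral_uminus[symmetric]) (simp add: cis_cnj)
  have "(LINT x|lborel. cnj (f x) * fourier \<phi> x) = cnj (LINT x|lborel. f x * fourier \<psi> x)"
    unfolding cnj_lint fp by simp
  also have "(LINT x|lborel. f x * fourier \<psi> x) = (LINT x|lborel. g x * \<psi> x)"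
    using assms tp by (simp add: is_FT_def)
  also have "cnj \<dots> = (LINT x|lborel. cnj (g (- x)) * \<phi> x)"
    unfolding cnj_lint by (subst integral_uminus[symmetric]) (simp add: \<psi>_def)
  finally show "(LINT x|lborel. cnj (f x) * fourier \<phi> x) = (LINT x|lborel. cnj (g (- x)) * \<phi> x)" .
qed

text \<open>Both candidates give the same pairings with test functions, but the orthogonality
  argument needs an L2 difference and \<open>fourier h\<close> is so far only bounded. Multiplying
  by continuous cutoffs that are 1 on large balls gives equality on each ball, and countably many
  balls cover the plane.\<close>

lemma is_FT_fourier:
  assumes h: "L2c h" and int: "integrable lborel h"
  shows "AE \<xi> in lborel. FTL2 h \<xi> = fourier h \<xi>" "is_FT h (fourier h)"
proof -
  define g where "g = FTL2 h"
  have g: "is_FT h g" unfolding g_def by (rule FTL2_is_FT[OF h])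
  have gL: "L2c g" using is_FT_L2c(2)[OF g] .
  note [measurable] = L2c_measurable[OF gL] L2c_measurable[OF h]
  have [measurable]: "h \<in> borel_measurable borel" by simp
  define cut :: "nat \<Rightarrow> pt \<Rightarrow> complex" where "cut k x = complex_of_real (max 0 (min 1 (real k + 1 - norm x)))" for k x
  have cutc: "continuous_on UNIV (cut k)" for k unfolding cut_def by (intro continuous_intros)
  have cutz: "norm x > real k + 1 \<Longrightarrow> cut k x = 0" for k x by (simp add: cut_def)
  have tcut: "testc (cut k)" for k
    unfolding testc_def using cutc cutz by (auto intro!: boundedI[of _ "real k+1"] simp: not_less[symmetric])
  note [measurable] = testc_measurable[OF tcut]
  have cut1: "cmod (cut k x) \<le> 1" for k x by (simp add: cut_def)
  have AEk: "AE \<xi> in lborel. (g \<xi> - fourier h \<xi>) * cut k \<xi> = 0" for k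
  proof (rule testc_orthogonal_AE)
    have 1: "L2c (\<lambda>\<xi>. g \<xi> * cut k \<xi>)"
      by (rule L2c_mono(1)[OF gL, where B=1]) (use cut1 in \<open>auto simp: norm_mult mult_left_le\<close>)
    have 2: "L2c (\<lambda>\<xi>. fourier h \<xi> * cut k \<xi>)"
      by (rule L2c_mono(1)[OF testc_L2c[OF tcut[of k]], where B="LINT x|lborel. cmod (h x)"])
         (use fourier_bound[OF int] in \<open>auto simp: norm_mult intro!: mult_right_mono\<close>)
    show "L2c (\<lambda>\<xi>. (g \<xi> - fourier h \<xi>) * cut k \<xi>)"
      using L2c_diff[OF 1 2] by (simp add: left_diff_distrib)
    fix \<psi> assume t: "testc \<psi>"
    have tp: "testc (\<lambda>x. cut k x * \<psi> x)"
    proof -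
      have "{x. cut k x * \<psi> x \<noteq> 0} \<subseteq> {x. \<psi> x \<noteq> 0}" by auto
      then show ?thesis using t tcut[of k] unfolding testc_def
        by (auto intro: bounded_subset continuous_on_mult)
    qed
    note tl = testc_L2c[OF t]
    have "(LINT \<xi>|lborel. (g \<xi> - fourier h \<xi>) * cut k \<xi> * \<psi> \<xi>)
       = (LINT \<xi>|lborel. g \<xi> * cut k \<xi> * \<psi> \<xi>) - (LINT \<xi>|lborel. fourier h \<xi> * cut k \<xi> * \<psi> \<xi>)"
      using L2c_mult_integrable[OF 1 tl] L2c_mult_integrable[OF 2 tl] by (simp add: left_diff_distrib)
    also have "\<dots> = (LINT \<xi>|lborel. g \<xi> * (cut k \<xi> * \<psi> \<xi>)) - (LINT \<xi>|lborel. fourier h \<xi> * (cut k \<xi> * \<psi> \<xi>))"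
      by (simp only: mult.assoc)
    also have "\<dots> = 0"
      using g tp fourier_multiplication[OF int testc_integrable[OF tp]] unfolding is_FT_def by simp
    finally show "(LINT \<xi>|lborel. (g \<xi> - fourier h \<xi>) * cut k \<xi> * \<psi> \<xi>) = 0" .
  qed
  then have "AE \<xi> in lborel. \<forall>k. (g \<xi> - fourier h \<xi>) * cut k \<xi> = 0" unfolding AE_all_countable by (intro allI)
  then show AE: "AE \<xi> in lborel. FTL2 h \<xi> = fourier h \<xi>"
  proof eventually_elim
    case (elim \<xi>)
    obtain k :: nat where "norm \<xi> \<le> real k" using real_arch_simple by blast
    then have "cut k \<xi> = 1" by (simp add: cut_def)
    with elim[rule_format, of k] show ?case by (simp add: g_def)
  qed
  show "is_FT h (fourier h)"
    by (rule is_FT_cong_AE[OF g]) (use AE in \<open>auto simp: g_def\<close>)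
qed

lemma parseval_mult:
  assumes f: "is_FT f g" and h: "L2c h" and int: "integrable lborel h"
  shows "(LINT x|lborel. f x * h x) = complex_of_real (1 / (2*pi)\<^sup>2) * (LINT \<xi>|lborel. g \<xi> * fourier h (- \<xi>))"
proof -
  have "is_FT (\<lambda>x. cnj (h x)) (fourier (\<lambda>x. cnj (h x)))"
    by (rule is_FT_fourier(2)) (use h int in auto)
  from parseval[OF f this] show ?thesis by (simp add: fourier_cnj)
qed

text \<open>The transform of a product is the convolution divided by (2 pi)^2, in weak form. The
  product u v need not be in L2, so it is tested against \<phi>: bilinear Parseval is applied first
  to u and the integrable L2 function v \<phi>, then to v. Absolute integrability over both
  frequencies is a hypothesis because it comes from regularity that is not visible here.\<close>

lemma product_fourier:
  assumes u: "is_FT u U" and v: "is_FT v V" and t: "testc \<phi>"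
    and int: "integrable lborel2 (\<lambda>(\<xi>, \<eta>). U (\<xi> - \<eta>) * V \<eta> * fourier \<phi> (- \<xi>))"
  shows "(LINT x|lborel. u x * v x * \<phi> x) = complex_of_real (1 / (2*pi)\<^sup>2) * (complex_of_real (1 / (2*pi)\<^sup>2) *
           (LINT \<xi>|lborel. (LINT \<eta>|lborel. U (\<xi> - \<eta>) * V \<eta>) * fourier \<phi> (- \<xi>)))"
proof -
  let ?c = "complex_of_real (1 / (2*pi)\<^sup>2)"
  have uL: "L2c u" "L2c U" and vL: "L2c v" "L2c V" using is_FT_L2c[OF u] is_FT_L2c[OF v] by auto
  note [measurable] = L2c_measurable[OF uL(1)] L2c_measurable[OF uL(2)] L2c_measurable[OF vL(1)] L2c_measurable[OF vL(2)] testc_measurable[OF t]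
  have [measurable]: "\<phi> \<in> borel_measurable borel" "U \<in> borel_measurable borel" "V \<in> borel_measurable borel" by simp_all
  have [measurable]: "fourier \<phi> \<in> borel_measurable borel" by (rule fourier_measurable) simp
  obtain R B where RB: "0 < R" "0 < B" "\<And>x. norm x > R \<Longrightarrow> \<phi> x = 0" "\<And>x. cmod (\<phi> x) \<le> B"
    using testc_bound[OF t] by metis
  have vp: "L2c (\<lambda>x. v x * \<phi> x)"
  proof (rule L2c_mono(1)[OF vL(1), where B=B])
    have "cmod (v x * \<phi> x) \<le> B * cmod (v x)" for x
      using mult_right_mono[OF RB(4)[of x], of "cmod (v x)"] by (simp add: norm_mult mult.commute)
    then show "AE x in lborel. cmod (v x * \<phi> x) \<le> B * cmod (v x)" by simp
  qed (use RB in auto)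
  have vpi: "integrable lborel (\<lambda>x. v x * \<phi> x)" by (rule L2c_mult_integrable[OF vL(1) testc_L2c[OF t]])
  have fvp: "fourier (\<lambda>x. v x * \<phi> x) (- \<zeta>) = ?c * (LINT \<eta>|lborel. V \<eta> * fourier \<phi> (- (\<zeta> + \<eta>)))" for \<zeta>
  proof -
    \<comment> \<open>Evaluating the transform of v \<phi> at a point is pairing v with a modulated
      test function; modulation translates the transform, which produces the convolution
      variable.\<close>
    define \<psi> where "\<psi> x = \<phi> x * cis (x \<bullet> \<zeta>)" for x
    have tp: "testc \<psi>"
    proof -
      have "{x. \<psi> x \<noteq> 0} \<subseteq> {x. \<phi> x \<noteq> 0}" by (auto simp: \<psi>_def)
      moreover have "continuous_on UNIV \<psi>" unfolding \<psi>_def using t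
        by (auto simp: testc_def intro!: continuous_intros)
      ultimately show ?thesis using t unfolding testc_def by (auto intro: bounded_subset)
    qed
    have fs: "fourier \<psi> (- \<eta>) = fourier \<phi> (- (\<zeta> + \<eta>))" for \<eta>
      unfolding fourier_def \<psi>_def by (simp add: mult.assoc cis_mult inner_add_right inner_diff_right add.commute)
    have "fourier (\<lambda>x. v x * \<phi> x) (- \<zeta>) = (LINT x|lborel. v x * \<psi> x)"
      by (simp add: fourier_def \<psi>_def mult.assoc)
    also have "\<dots> = ?c * (LINT \<eta>|lborel. V \<eta> * fourier \<psi> (- \<eta>))"
      by (rule parseval_mult[OF v testc_L2c[OF tp] testc_integrable[OF tp]])
    also have "(LINT \<eta>|lborel. V \<eta> * fourier \<psi> (- \<eta>)) = (LINT \<eta>|lborel. V \<eta> * fourier \<phi> (- (\<zeta> + \<eta>)))"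
      by (simp only: fs)
    finally show ?thesis .
  qed
  have "(LINT x|lborel. u x * v x * \<phi> x) = (LINT x|lborel. u x * (v x * \<phi> x))" by (simp add: mult.assoc)
  also have "\<dots> = ?c * (LINT \<zeta>|lborel. U \<zeta> * fourier (\<lambda>x. v x * \<phi> x) (- \<zeta>))"
    by (rule parseval_mult[OF u vp vpi])
  also have "(LINT \<zeta>|lborel. U \<zeta> * fourier (\<lambda>x. v x * \<phi> x) (- \<zeta>)) = (LINT \<zeta>|lborel. ?c * (LINT \<eta>|lborel. U \<zeta> * (V \<eta> * fourier \<phi> (- (\<zeta> + \<eta>)))))"
    unfolding fvp by (subst integral_mult_right_zero) (simp add: mult_ac)
  also have "\<dots> = ?c * (LINT \<zeta>|lborel. LINT \<eta>|lborel. U \<zeta> * (V \<eta> * fourier \<phi> (- (\<zeta> + \<eta>))))"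
    by (rule integral_mult_right_zero)
  also have "(LINT \<zeta>|lborel. LINT \<eta>|lborel. U \<zeta> * (V \<eta> * fourier \<phi> (- (\<zeta> + \<eta>))))
     = (LINT \<eta>|lborel. LINT \<zeta>|lborel. U \<zeta> * (V \<eta> * fourier \<phi> (- (\<zeta> + \<eta>))))"
  proof (rule lborel_pair.Fubini_integral[symmetric])
    have "(\<integral>\<^sup>+p. norm (case p of (\<zeta>, \<eta>) \<Rightarrow> U \<zeta> * (V \<eta> * fourier \<phi> (- (\<zeta> + \<eta>)))) \<partial>lborel2)
       = (\<integral>\<^sup>+\<eta>. \<integral>\<^sup>+\<zeta>. ennreal (cmod (U \<zeta> * (V \<eta> * fourier \<phi> (- (\<zeta> + \<eta>))))) \<partial>lborel \<partial>lborel)"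
      by (subst lborel_pair.nn_integral_snd[symmetric]) auto
    also have "\<dots> = (\<integral>\<^sup>+\<eta>. \<integral>\<^sup>+\<xi>. ennreal (cmod (U (\<xi> - \<eta>) * V \<eta> * fourier \<phi> (- \<xi>))) \<partial>lborel \<partial>lborel)"
    proof (rule nn_integral_cong)
      fix \<eta>
      show "(\<integral>\<^sup>+\<zeta>. ennreal (cmod (U \<zeta> * (V \<eta> * fourier \<phi> (- (\<zeta> + \<eta>))))) \<partial>lborel) =
         (\<integral>\<^sup>+\<xi>. ennreal (cmod (U (\<xi> - \<eta>) * V \<eta> * fourier \<phi> (- \<xi>))) \<partial>lborel)"
        by (subst nn_integral_shift[of _ \<eta>, symmetric]) (simp_all add: mult.assoc)
    qed
    also have "\<dots> = (\<integral>\<^sup>+p. norm (case p of (\<xi>, \<eta>) \<Rightarrow> U (\<xi> - \<eta>) * V \<eta> * fourier \<phi> (- \<xi>)) \<partial>lborel2)"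
      by (subst lborel_pair.nn_integral_snd[symmetric]) auto
    also have "\<dots> < \<infinity>" using int by (simp add: integrable_iff_bounded)
    finally show "integrable lborel2 (\<lambda>(\<zeta>, \<eta>). U \<zeta> * (V \<eta> * fourier \<phi> (- (\<zeta> + \<eta>))))"
      by (intro integrableI_bounded) auto
  qed
  also have "\<dots> = (LINT \<eta>|lborel. LINT \<xi>|lborel. U (\<xi> - \<eta>) * V \<eta> * fourier \<phi> (- \<xi>))"
  proof (rule Bochner_Integration.integral_cong[OF refl])
    fix \<eta>
    show "(LINT \<zeta>|lborel. U \<zeta> * (V \<eta> * fourier \<phi> (- (\<zeta> + \<eta>)))) = (LINT \<xi>|lborel. U (\<xi> - \<eta>) * V \<eta> * fourier \<phi> (- \<xi>))"
      by (subst integral_shift[of _ \<eta>, symmetric]) (simp add: mult.assoc)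
  qed
  also have "\<dots> = (LINT \<xi>|lborel. LINT \<eta>|lborel. U (\<xi> - \<eta>) * V \<eta> * fourier \<phi> (- \<xi>))"
    by (rule lborel_pair.Fubini_integral[OF int])
  also have "\<dots> = (LINT \<xi>|lborel. (LINT \<eta>|lborel. U (\<xi> - \<eta>) * V \<eta>) * fourier \<phi> (- \<xi>))"
    by simp
  finally show ?thesis .
qed

section \<open>Trilinear convolution estimates\<close>

text \<open>Dyadic shells: on the k-th shell the power is comparable to that of the radius R 2^(-k),
  and the area of the surrounding ball is enough. The series is geometric with ratio q = 2^(-(2 -
  2p)), which is below 1 because p < 1.\<close>

lemma nn_integral_power_ball:
  assumes p: "0 \<le> p" "p < (1::real)"
  shows "\<exists>C\<ge>0. \<forall>R>0. (\<integral>\<^sup>+\<zeta>. ennreal (norm (\<zeta>::pt) powr (- 2 * p)) * indicator (cball 0 R) \<zeta> \<partial>lborel)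
       \<le> ennreal (C * R powr (2 - 2 * p))"
proof -
  define V where "V = unit_ball_vol (2::real)"
  define q where "q = (1/2::real) powr (2 - 2 * p)"
  have V: "0 \<le> V" by (simp add: V_def)
  have q: "0 < q" "q < 1" using p by (auto simp: q_def powr_def ln_div mult_less_0_iff)
  define C where "C = V * 2 powr (2 * p) * (1 / (1 - q))"
  have "(\<integral>\<^sup>+\<zeta>. ennreal (norm (\<zeta>::pt) powr (- 2 * p)) * indicator (cball 0 R) \<zeta> \<partial>lborel) \<le> ennreal (C * R powr (2 - 2 * p))"
    if R: "0 < R" for R
  proof -
    define r where "r k = R * (1/2)^k" for k :: nat
    have r0: "0 < r k" for k using R by (simp add: r_def)
    have "(\<integral>\<^sup>+\<zeta>. ennreal (norm (\<zeta>::pt) powr (- 2 * p)) * indicator (cball 0 R) \<zeta> \<partial>lborel)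
        \<le> (\<integral>\<^sup>+\<zeta>. (\<Sum>k. ennreal ((r k / 2) powr (- 2 * p)) * indicator (cball (0::pt) (r k)) \<zeta>) \<partial>lborel)"
    proof (rule nn_integral_mono)
      fix \<zeta> :: pt
      show "ennreal (norm \<zeta> powr (- 2 * p)) * indicator (cball 0 R) \<zeta> \<le> (\<Sum>k. ennreal ((r k / 2) powr (- 2 * p)) * indicator (cball (0::pt) (r k)) \<zeta>)"
      proof (cases "\<zeta> = 0 \<or> norm \<zeta> > R")
        case True then show ?thesis by (auto simp: indicator_def)
      next
        case False
        then have z: "0 < norm \<zeta>" "norm \<zeta> \<le> R" by auto
        have "(\<lambda>k. r k) \<longlonglongrightarrow> R * 0" unfolding r_def by (intro tendsto_mult tendsto_const LIMSEQ_power_zero) auto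
        then have "eventually (\<lambda>k. r k < norm \<zeta>) sequentially" using z(1) by (intro order_tendstoD(2)[of _ 0]) auto
        then obtain n where "r n < norm \<zeta>" by (auto dest: eventually_happens)
        \<comment> \<open>The first radius below |zeta|. It is not the zeroth, and the radius before
          it encloses zeta while half of that radius does not.\<close>
        define k where "k = (LEAST n. r n < norm \<zeta>)"
        have k: "r k < norm \<zeta>" unfolding k_def by (rule LeastI) fact
        have "k \<noteq> 0"
        proof
          assume "k = 0"
          then have "r k = R" by (simp add: r_def)
          with k z(2) show False by simp
        qed
        then obtain j where j: "k = Suc j" by (cases k) auto
        have "\<not> r j < norm \<zeta>" unfolding k_def[symmetric] using not_less_Least[of j "\<lambda>n. r n < norm \<zeta>"] j k_def by auto
        then have rj: "norm \<zeta> \<le> r j" "r j / 2 < norm \<zeta>" using k j by (auto simp: r_def)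
        have "norm \<zeta> powr (- 2 * p) \<le> (r j / 2) powr (- 2 * p)"
          using rj r0[of j] p by (intro powr_mono2') auto
        then have "ennreal (norm \<zeta> powr (- 2 * p)) * indicator (cball 0 R) \<zeta> \<le> ennreal ((r j / 2) powr (- 2 * p)) * indicator (cball (0::pt) (r j)) \<zeta>"
          using rj z by (simp add: ennreal_leI)
        also have "\<dots> \<le> (\<Sum>k. ennreal ((r k / 2) powr (- 2 * p)) * indicator (cball (0::pt) (r k)) \<zeta>)"
        proof -
          define g :: "nat \<Rightarrow> ennreal" where "g k = ennreal ((r k / 2) powr (- 2 * p)) * indicator (cball (0::pt) (r k)) \<zeta>" for k
          have "sum g {j} \<le> suminf g" by (rule sum_le_suminf[OF summableI]) auto
          then have "g j \<le> suminf g" by simp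
          then show ?thesis unfolding g_def .
        qed
        finally show ?thesis .
      qed
    qed
    also have "\<dots> = (\<Sum>k. ennreal ((r k / 2) powr (- 2 * p)) * emeasure lborel (cball (0::pt) (r k)))"
    proof -
      have "(\<integral>\<^sup>+\<zeta>. (\<Sum>k. ennreal ((r k / 2) powr (- 2 * p)) * indicator (cball (0::pt) (r k)) \<zeta>) \<partial>lborel)
        = (\<Sum>k. \<integral>\<^sup>+\<zeta>. ennreal ((r k / 2) powr (- 2 * p)) * indicator (cball (0::pt) (r k)) \<zeta> \<partial>lborel)"
        by (rule nn_integral_suminf) (intro borel_measurable_times_ennreal borel_measurable_const borel_measurable_indicator, simp)
      also have "\<dots> = (\<Sum>k. ennreal ((r k / 2) powr (- 2 * p)) * emeasure lborel (cball (0::pt) (r k)))"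
        by (rule suminf_cong, rule nn_integral_cmult_indicator, simp)
      finally show ?thesis .
    qed
    also have "\<dots> = (\<Sum>k. ennreal (V * 2 powr (2 * p) * R powr (2 - 2 * p) * q ^ k))"
    proof (rule suminf_cong)
      fix k
      have 1: "(r k / 2) powr (- 2 * p) = 2 powr (2 * p) * r k powr (- 2 * p)"
        using r0[of k] by (simp add: powr_divide powr_minus divide_simps)
      have 2: "(r k)\<^sup>2 = r k powr 2" using r0[of k] by (simp add: powr_numeral)
      have 3: "r k powr (- 2 * p) * r k powr 2 = r k powr (2 - 2 * p)" by (simp add: powr_add[symmetric])
      have 4: "((1/2::real)^k) powr (2 - 2 * p) = q ^ k"
      proof -
        have "((1/2::real)^k) powr (2 - 2 * p) = ((1/2) powr real k) powr (2 - 2 * p)" by (subst powr_realpow) auto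
        also have "\<dots> = ((1/2) powr (2 - 2 * p)) powr real k" by (simp only: powr_powr mult.commute)
        also have "\<dots> = q ^ k" unfolding q_def by (subst powr_realpow) auto
        finally show ?thesis .
      qed
      have 5: "r k powr (2 - 2 * p) = R powr (2 - 2 * p) * q ^ k"
        unfolding r_def using R by (subst powr_mult) (auto simp: 4)
      have "(r k / 2) powr (- 2 * p) * (V * (r k)\<^sup>2) = V * 2 powr (2 * p) * (r k powr (- 2 * p) * r k powr 2)"
        unfolding 1 2 by (simp only: mult_ac)
      also have "\<dots> = V * 2 powr (2 * p) * R powr (2 - 2 * p) * q ^ k"
        unfolding 3 5 by (simp only: mult_ac)
      finally have *: "(r k / 2) powr (- 2 * p) * (V * (r k)\<^sup>2) = V * 2 powr (2 * p) * R powr (2 - 2 * p) * q ^ k" .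
      have "emeasure lborel (cball (0::pt) (r k)) = ennreal (V * (r k)\<^sup>2)"
        using r0[of k] by (subst emeasure_cball) (auto simp: V_def)
      then show "ennreal ((r k / 2) powr (- 2 * p)) * emeasure lborel (cball (0::pt) (r k)) = ennreal (V * 2 powr (2 * p) * R powr (2 - 2 * p) * q ^ k)"
        using V by (simp only: ennreal_mult[symmetric] * powr_ge_zero mult_nonneg_nonneg zero_le_power2)
    qed
    also have "\<dots> = ennreal (\<Sum>k. V * 2 powr (2 * p) * R powr (2 - 2 * p) * q ^ k)"
      using V q by (intro suminf_ennreal2 summable_mult summable_geometric) auto
    also have "(\<Sum>k. V * 2 powr (2 * p) * R powr (2 - 2 * p) * q ^ k) = V * 2 powr (2 * p) * R powr (2 - 2 * p) * (1 / (1 - q))"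
      using q by (subst suminf_mult) (auto simp: suminf_geometric intro: summable_geometric)
    also have "\<dots> = C * R powr (2 - 2 * p)" unfolding C_def by (simp only: mult_ac)
    finally show ?thesis .
  qed
  moreover have "0 \<le> C" using V q by (auto simp: C_def)
  ultimately show ?thesis by blast
qed

text \<open>The model kernel: sigma is the smallest frequency and mu one of the two large ones. Its
  degree of homogeneity is -1 for every p, so the integral of its square in sigma over the plane
  does not depend on the size of mu.\<close>

definition Hk :: "real \<Rightarrow> pt \<Rightarrow> pt \<Rightarrow> real" where
  "Hk p \<sigma> \<mu> = (if norm \<sigma> \<le> norm \<mu> then norm \<sigma> powr (- p) * norm \<mu> powr (p - 1) else 0)"

lemma Hk_nonneg [simp]: "0 \<le> Hk p \<sigma> \<mu>"
  by (simp add: Hk_def)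

lemma Hk_measurable [measurable (raw)]:
  assumes [measurable]: "f \<in> borel_measurable M" "g \<in> borel_measurable M"
  shows "(\<lambda>x. Hk p (f x) (g x)) \<in> borel_measurable M"
  unfolding Hk_def by measurable

lemma Hk_square_bound:
  assumes p: "0 \<le> p" "p < (1::real)"
  shows "\<exists>C\<ge>0. \<forall>\<mu>. (\<integral>\<^sup>+\<sigma>. ennreal ((Hk p \<sigma> \<mu>)\<^sup>2) \<partial>lborel) \<le> ennreal C"
proof -
  obtain C where C: "0 \<le> C" "\<And>R. 0 < R \<Longrightarrow> (\<integral>\<^sup>+\<zeta>. ennreal (norm (\<zeta>::pt) powr (- 2 * p)) * indicator (cball 0 R) \<zeta> \<partial>lborel) \<le> ennreal (C * R powr (2 - 2 * p))"
    using nn_integral_power_ball[OF p] by auto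
  have "(\<integral>\<^sup>+\<sigma>. ennreal ((Hk p \<sigma> \<mu>)\<^sup>2) \<partial>lborel) \<le> ennreal C" for \<mu>
  proof (cases "\<mu> = 0")
    case True then have "Hk p \<sigma> \<mu> = 0" for \<sigma> by (auto simp: Hk_def)
    then show ?thesis by simp
  next
    case False
    then have l: "0 < norm \<mu>" by simp
    have sq: "(x powr a)\<^sup>2 = x powr (2 * a)" for x a :: real
      by (simp add: power2_eq_square powr_add[symmetric])
    have eq: "ennreal ((Hk p \<sigma> \<mu>)\<^sup>2) = ennreal (norm \<mu> powr (2 * p - 2)) * (ennreal (norm \<sigma> powr (- 2 * p)) * indicator (cball 0 (norm \<mu>)) \<sigma>)" for \<sigma>
      by (auto simp: Hk_def indicator_def power_mult_distrib sq ennreal_mult[symmetric] algebra_simps)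
    have "(\<integral>\<^sup>+\<sigma>. ennreal ((Hk p \<sigma> \<mu>)\<^sup>2) \<partial>lborel) =
      ennreal (norm \<mu> powr (2 * p - 2)) * (\<integral>\<^sup>+\<sigma>. ennreal (norm (\<sigma>::pt) powr (- 2 * p)) * indicator (cball 0 (norm \<mu>)) \<sigma> \<partial>lborel)"
    proof -
      have "(\<lambda>\<sigma>::pt. ennreal (norm \<sigma> powr (- 2 * p))) \<in> borel_measurable lborel" by measurable
      then show ?thesis unfolding eq
        by (intro nn_integral_cmult borel_measurable_times_ennreal borel_measurable_indicator) (simp_all add: borel_closed)
    qed
    also have "\<dots> \<le> ennreal (norm \<mu> powr (2 * p - 2)) * ennreal (C * norm \<mu> powr (2 - 2 * p))"
      by (intro mult_left_mono C(2) l) simp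
    also have "\<dots> = ennreal (C * (norm \<mu> powr (2 * p - 2) * norm \<mu> powr (2 - 2 * p)))"
      using C(1) by (simp add: ennreal_mult[symmetric] mult_ac)
    also have "norm \<mu> powr (2 * p - 2) * norm \<mu> powr (2 - 2 * p) = 1"
      using l by (simp add: powr_add[symmetric])
    finally show ?thesis by simp
  qed
  with C(1) show ?thesis by blast
qed

text \<open>Cauchy--Schwarz on the product space replaces the Hardy--Littlewood--Sobolev inequality:
  the kernel only has to be square integrable in one variable, uniformly in the other one.\<close>

lemma trilinear_CS_snd:
  fixes F G K :: "pt \<Rightarrow> ennreal" and k :: "pt \<Rightarrow> pt \<Rightarrow> ennreal"
  assumes [measurable]: "F \<in> borel_measurable borel" "G \<in> borel_measurable borel" "K \<in> borel_measurable borel"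
     "(\<lambda>(\<xi>, \<eta>). k \<xi> \<eta>) \<in> borel_measurable (borel \<Otimes>\<^sub>M borel)"
    and k: "\<And>\<eta>. (\<integral>\<^sup>+\<xi>. (k \<xi> \<eta>)\<^sup>2 \<partial>lborel) \<le> C"
  shows "(\<integral>\<^sup>+(\<xi>, \<eta>). k \<xi> \<eta> * F (\<xi> - \<eta>) * G \<eta> * K \<xi> \<partial>lborel2)\<^sup>2
     \<le> C * (\<integral>\<^sup>+x. (F x)\<^sup>2 \<partial>lborel) * (\<integral>\<^sup>+x. (G x)\<^sup>2 \<partial>lborel) * (\<integral>\<^sup>+x. (K x)\<^sup>2 \<partial>lborel)"
proof -
  have "(\<integral>\<^sup>+(\<xi>, \<eta>). k \<xi> \<eta> * F (\<xi> - \<eta>) * G \<eta> * K \<xi> \<partial>lborel2)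
     = (\<integral>\<^sup>+p. (F (fst p - snd p) * K (fst p)) * (k (fst p) (snd p) * G (snd p)) \<partial>lborel2)"
    by (intro nn_integral_cong) (auto simp: mult_ac)
  then have 1: "(\<integral>\<^sup>+(\<xi>, \<eta>). k \<xi> \<eta> * F (\<xi> - \<eta>) * G \<eta> * K \<xi> \<partial>lborel2)\<^sup>2
     \<le> (\<integral>\<^sup>+p. (F (fst p - snd p) * K (fst p))\<^sup>2 \<partial>lborel2) * (\<integral>\<^sup>+p. (k (fst p) (snd p) * G (snd p))\<^sup>2 \<partial>lborel2)"
    using Cauchy_Schwarz_nn_integral[of "\<lambda>p. F (fst p - snd p) * K (fst p)" "lborel \<Otimes>\<^sub>M lborel" "\<lambda>p. k (fst p) (snd p) * G (snd p)"]
    by (simp add: split_beta')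
  \<comment> \<open>The factor free of the kernel: integrating in eta first removes the shift, and
    its square integral is a product of two norms.\<close>
  have 2: "(\<integral>\<^sup>+p. (F (fst p - snd p) * K (fst p))\<^sup>2 \<partial>lborel2) = (\<integral>\<^sup>+x. (F x)\<^sup>2 \<partial>lborel) * (\<integral>\<^sup>+x. (K x)\<^sup>2 \<partial>lborel)"
  proof -
    have "(\<integral>\<^sup>+p. (F (fst p - snd p) * K (fst p))\<^sup>2 \<partial>lborel2) = (\<integral>\<^sup>+\<xi>. \<integral>\<^sup>+\<eta>. (F (\<xi> - \<eta>) * K \<xi>)\<^sup>2 \<partial>lborel \<partial>lborel)"
      by (subst lborel.nn_integral_fst[symmetric]) auto
    also have "\<dots> = (\<integral>\<^sup>+\<xi>. (\<integral>\<^sup>+\<eta>. (F (\<xi> - \<eta>))\<^sup>2 \<partial>lborel) * (K \<xi>)\<^sup>2 \<partial>lborel)"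
      by (simp add: power_mult_distrib nn_integral_multc)
    also have "\<dots> = (\<integral>\<^sup>+x. (F x)\<^sup>2 \<partial>lborel) * (\<integral>\<^sup>+x. (K x)\<^sup>2 \<partial>lborel)"
      using nn_integral_reflect[of "\<lambda>x. (F x)\<^sup>2"] by (simp add: nn_integral_cmult)
    finally show ?thesis .
  qed
  have 3: "(\<integral>\<^sup>+p. (k (fst p) (snd p) * G (snd p))\<^sup>2 \<partial>lborel2) \<le> C * (\<integral>\<^sup>+x. (G x)\<^sup>2 \<partial>lborel)"
  proof -
    have "(\<integral>\<^sup>+p. (k (fst p) (snd p) * G (snd p))\<^sup>2 \<partial>lborel2) = (\<integral>\<^sup>+\<eta>. \<integral>\<^sup>+\<xi>. (k \<xi> \<eta> * G \<eta>)\<^sup>2 \<partial>lborel \<partial>lborel)"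
      by (subst lborel_pair.nn_integral_snd[symmetric]) (auto simp: split_beta')
    also have "\<dots> = (\<integral>\<^sup>+\<eta>. (\<integral>\<^sup>+\<xi>. (k \<xi> \<eta>)\<^sup>2 \<partial>lborel) * (G \<eta>)\<^sup>2 \<partial>lborel)"
      by (simp add: power_mult_distrib nn_integral_multc)
    also have "\<dots> \<le> (\<integral>\<^sup>+\<eta>. C * (G \<eta>)\<^sup>2 \<partial>lborel)"
      by (intro nn_integral_mono mult_right_mono k) simp
    also have "\<dots> = C * (\<integral>\<^sup>+x. (G x)\<^sup>2 \<partial>lborel)" by (simp add: nn_integral_cmult)
    finally show ?thesis .
  qed
  have "(\<integral>\<^sup>+(\<xi>, \<eta>). k \<xi> \<eta> * F (\<xi> - \<eta>) * G \<eta> * K \<xi> \<partial>lborel2)\<^sup>2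
     \<le> ((\<integral>\<^sup>+x. (F x)\<^sup>2 \<partial>lborel) * (\<integral>\<^sup>+x. (K x)\<^sup>2 \<partial>lborel)) * (C * (\<integral>\<^sup>+x. (G x)\<^sup>2 \<partial>lborel))"
    by (rule order_trans[OF 1]) (unfold 2, rule mult_left_mono[OF 3], simp)
  also have "\<dots> = C * (\<integral>\<^sup>+x. (F x)\<^sup>2 \<partial>lborel) * (\<integral>\<^sup>+x. (G x)\<^sup>2 \<partial>lborel) * (\<integral>\<^sup>+x. (K x)\<^sup>2 \<partial>lborel)"
    by (simp only: mult_ac)
  finally show ?thesis .
qed

text \<open>Exchanging the names of xi and eta turns this into \<open>trilinear_CS_snd\<close> with
  F reflected and G, K interchanged.\<close>

lemma trilinear_CS_fst:
  fixes F G K :: "pt \<Rightarrow> ennreal" and k :: "pt \<Rightarrow> pt \<Rightarrow> ennreal"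
  assumes [measurable]: "F \<in> borel_measurable borel" "G \<in> borel_measurable borel" "K \<in> borel_measurable borel"
     "(\<lambda>(\<xi>, \<eta>). k \<xi> \<eta>) \<in> borel_measurable (borel \<Otimes>\<^sub>M borel)"
    and k: "\<And>\<xi>. (\<integral>\<^sup>+\<eta>. (k \<xi> \<eta>)\<^sup>2 \<partial>lborel) \<le> C"
  shows "(\<integral>\<^sup>+(\<xi>, \<eta>). k \<xi> \<eta> * F (\<xi> - \<eta>) * G \<eta> * K \<xi> \<partial>lborel2)\<^sup>2
     \<le> C * (\<integral>\<^sup>+x. (F x)\<^sup>2 \<partial>lborel) * (\<integral>\<^sup>+x. (G x)\<^sup>2 \<partial>lborel) * (\<integral>\<^sup>+x. (K x)\<^sup>2 \<partial>lborel)"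
proof -
  have "(\<integral>\<^sup>+(\<xi>, \<eta>). k \<xi> \<eta> * F (\<xi> - \<eta>) * G \<eta> * K \<xi> \<partial>lborel2)
     = (\<integral>\<^sup>+\<eta>. \<integral>\<^sup>+\<xi>. k \<xi> \<eta> * F (\<xi> - \<eta>) * G \<eta> * K \<xi> \<partial>lborel \<partial>lborel)"
    by (subst lborel_pair.nn_integral_snd[symmetric]) auto
  also have "\<dots> = (\<integral>\<^sup>+(\<eta>, \<xi>). k \<xi> \<eta> * (F (- (\<eta> - \<xi>))) * K \<xi> * G \<eta> \<partial>lborel2)"
    by (subst lborel.nn_integral_fst[symmetric]) (auto simp: mult_ac)
  also have "\<dots>\<^sup>2 \<le> C * (\<integral>\<^sup>+x. (F (- x))\<^sup>2 \<partial>lborel) * (\<integral>\<^sup>+x. (K x)\<^sup>2 \<partial>lborel) * (\<integral>\<^sup>+x. (G x)\<^sup>2 \<partial>lborel)"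
    by (rule trilinear_CS_snd[where k="\<lambda>\<eta> \<xi>. k \<xi> \<eta>" and F="\<lambda>x. F (- x)"]) (use k in auto)
  also have "(\<integral>\<^sup>+x. (F (- x))\<^sup>2 \<partial>lborel) = (\<integral>\<^sup>+x. (F x)\<^sup>2 \<partial>lborel)"
    using nn_integral_reflect[of "\<lambda>x. (F x)\<^sup>2" 0] by simp
  finally show ?thesis by (simp add: mult_ac)
qed

text \<open>The three estimates correspond to the three frequencies xi - eta, eta, xi that may be
  the smallest. Each time one of xi and eta is integrated out with the large frequency fixed; in the
  first case a translation by eta brings the kernel into standard position.\<close>

lemma Hk_trilinear:
  assumes p: "0 \<le> p" "p < (1::real)"
  shows "\<exists>C\<ge>0. \<forall>A B D. L2c A \<longrightarrow> L2c B \<longrightarrow> L2c D \<longrightarrow>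
     (\<integral>\<^sup>+(\<xi>, \<eta>). ennreal (Hk p (\<xi> - \<eta>) \<eta> * cmod (A (\<xi> - \<eta>)) * cmod (B \<eta>) * cmod (D \<xi>)) \<partial>lborel2) \<le> ennreal (C * n2 A * n2 B * n2 D) \<and>
     (\<integral>\<^sup>+(\<xi>, \<eta>). ennreal (Hk p \<eta> \<xi> * cmod (A (\<xi> - \<eta>)) * cmod (B \<eta>) * cmod (D \<xi>)) \<partial>lborel2) \<le> ennreal (C * n2 A * n2 B * n2 D) \<and>
     (\<integral>\<^sup>+(\<xi>, \<eta>). ennreal (Hk p \<xi> \<eta> * cmod (A (\<xi> - \<eta>)) * cmod (B \<eta>) * cmod (D \<xi>)) \<partial>lborel2) \<le> ennreal (C * n2 A * n2 B * n2 D)"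
proof -
  obtain C where C: "0 \<le> C" "\<And>\<mu>. (\<integral>\<^sup>+\<sigma>. ennreal ((Hk p \<sigma> \<mu>)\<^sup>2) \<partial>lborel) \<le> ennreal C"
    using Hk_square_bound[OF p] by auto
  {
    fix A B D :: "pt \<Rightarrow> complex" assume L: "L2c A" "L2c B" "L2c D"
    have [measurable]: "A \<in> borel_measurable borel" "B \<in> borel_measurable borel" "D \<in> borel_measurable borel"
      using L by (auto dest!: L2c_measurable)
    have nn: "(\<integral>\<^sup>+x. (ennreal (cmod (f x)))\<^sup>2 \<partial>lborel) = ennreal ((n2 f)\<^sup>2)" if "L2c f" for f
      by (simp add: ennreal_power L2c_nn_integral[OF that])
    have fin: "(\<integral>\<^sup>+(\<xi>, \<eta>). ennreal (k \<xi> \<eta> * cmod (A (\<xi> - \<eta>)) * cmod (B \<eta>) * cmod (D \<xi>)) \<partial>lborel2) \<le> ennreal (sqrt C * n2 A * n2 B * n2 D)"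
      if k: "\<And>\<xi> \<eta>. 0 \<le> k \<xi> \<eta>"
        and le: "(\<integral>\<^sup>+(\<xi>, \<eta>). ennreal (k \<xi> \<eta>) * ennreal (cmod (A (\<xi> - \<eta>))) * ennreal (cmod (B \<eta>)) * ennreal (cmod (D \<xi>)) \<partial>lborel2)\<^sup>2
         \<le> ennreal C * (\<integral>\<^sup>+x. (ennreal (cmod (A x)))\<^sup>2 \<partial>lborel) * (\<integral>\<^sup>+x. (ennreal (cmod (B x)))\<^sup>2 \<partial>lborel) * (\<integral>\<^sup>+x. (ennreal (cmod (D x)))\<^sup>2 \<partial>lborel)" for k
    proof (rule ennreal_power2_le_D)
      have "(\<integral>\<^sup>+(\<xi>, \<eta>). ennreal (k \<xi> \<eta> * cmod (A (\<xi> - \<eta>)) * cmod (B \<eta>) * cmod (D \<xi>)) \<partial>lborel2)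
        = (\<integral>\<^sup>+(\<xi>, \<eta>). ennreal (k \<xi> \<eta>) * ennreal (cmod (A (\<xi> - \<eta>))) * ennreal (cmod (B \<eta>)) * ennreal (cmod (D \<xi>)) \<partial>lborel2)"
        using k by (intro nn_integral_cong) (auto simp: ennreal_mult)
      moreover have "ennreal C * ennreal ((n2 A)\<^sup>2) * ennreal ((n2 B)\<^sup>2) * ennreal ((n2 D)\<^sup>2) = (ennreal (sqrt C * n2 A * n2 B * n2 D))\<^sup>2"
        using C(1) by (simp add: ennreal_mult[symmetric] ennreal_power power_mult_distrib)
      ultimately show "(\<integral>\<^sup>+(\<xi>, \<eta>). ennreal (k \<xi> \<eta> * cmod (A (\<xi> - \<eta>)) * cmod (B \<eta>) * cmod (D \<xi>)) \<partial>lborel2)\<^sup>2 \<le> (ennreal (sqrt C * n2 A * n2 B * n2 D))\<^sup>2"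
        using le by (simp only: nn[OF L(1)] nn[OF L(2)] nn[OF L(3)])
    qed
    have shift: "(\<integral>\<^sup>+\<xi>. (ennreal (Hk p (\<xi> - \<eta>) \<eta>))\<^sup>2 \<partial>lborel) \<le> ennreal C" for \<eta>
      using C(2)[of \<eta>] nn_integral_shift[of "\<lambda>\<sigma>. ennreal ((Hk p \<sigma> \<eta>)\<^sup>2)" \<eta>] by (simp add: ennreal_power)
    have same: "(\<integral>\<^sup>+\<sigma>. (ennreal (Hk p \<sigma> \<mu>))\<^sup>2 \<partial>lborel) \<le> ennreal C" for \<mu>
      using C(2)[of \<mu>] by (simp add: ennreal_power)
    have "(\<integral>\<^sup>+(\<xi>, \<eta>). ennreal (Hk p (\<xi> - \<eta>) \<eta> * cmod (A (\<xi> - \<eta>)) * cmod (B \<eta>) * cmod (D \<xi>)) \<partial>lborel2) \<le> ennreal (sqrt C * n2 A * n2 B * n2 D)"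
      by (rule fin, simp, rule trilinear_CS_snd) (auto intro: shift)
    moreover have "(\<integral>\<^sup>+(\<xi>, \<eta>). ennreal (Hk p \<eta> \<xi> * cmod (A (\<xi> - \<eta>)) * cmod (B \<eta>) * cmod (D \<xi>)) \<partial>lborel2) \<le> ennreal (sqrt C * n2 A * n2 B * n2 D)"
      by (rule fin, simp, rule trilinear_CS_fst) (auto intro: same)
    moreover have "(\<integral>\<^sup>+(\<xi>, \<eta>). ennreal (Hk p \<xi> \<eta> * cmod (A (\<xi> - \<eta>)) * cmod (B \<eta>) * cmod (D \<xi>)) \<partial>lborel2) \<le> ennreal (sqrt C * n2 A * n2 B * n2 D)"
      by (rule fin, simp, rule trilinear_CS_snd) (auto intro: same)
    moreover note calculation
  }
  then show ?thesis using C(1) by (intro exI[of _ "sqrt C"]) auto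
qed

text \<open>Once y is at most twice z, the power of z is traded for one of y, with loss 2^r \<le> 2,
  and p + q + r = 1 turns the collected exponent -q - r into p - 1.\<close>

lemma power_region:
  fixes x y z :: real
  assumes "0 < x" "0 < y" "0 < z" "y \<le> 2 * z" "0 \<le> r" "r \<le> 1" "p + q + r = 1"
  shows "x powr (-p) * y powr (-q) * z powr (-r) \<le> 2 * (x powr (-p) * y powr (p - 1))"
proof -
  have "z powr (-r) \<le> (y / 2) powr (-r)" using assms by (intro powr_mono2') auto
  also have "\<dots> = 2 powr r * y powr (-r)" using assms by (simp add: powr_divide powr_minus divide_simps)
  also have "\<dots> \<le> 2 * y powr (-r)" using assms powr_mono[of r 1 2] by (intro mult_right_mono) auto
  finally have "x powr (-p) * y powr (-q) * z powr (-r) \<le> x powr (-p) * y powr (-q) * (2 * y powr (-r))"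
    by (intro mult_left_mono) auto
  also have "\<dots> = 2 * (x powr (-p) * (y powr (-q) * y powr (-r)))" by simp
  also have "y powr (-q) * y powr (-r) = y powr (p - 1)"
  proof -
    have "- q + - r = p - 1" using assms(7) by linarith
    then show ?thesis by (simp only: powr_add[symmetric])
  qed
  finally show ?thesis .
qed

text \<open>Of three vectors one of which is the sum of the other two, the two larger ones have
  lengths within a factor 2. The smallest length therefore selects which model kernel
  dominates.\<close>

lemma kernel_region:
  assumes p: "0 \<le> p" "0 \<le> q" "0 \<le> r" "p + q + r = 1"
  shows "norm (\<xi> - \<eta>) powr (-p) * norm \<eta> powr (-q) * norm (\<xi>::pt) powr (-r)
     \<le> 2 * (Hk p (\<xi> - \<eta>) \<eta> + Hk q \<eta> \<xi> + Hk r \<xi> \<eta>)" (is "?L \<le> 2 * (?A + ?B + ?C)")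
proof (cases "\<xi> - \<eta> = 0 \<or> \<eta> = 0 \<or> \<xi> = 0")
  case True
  \<comment> \<open>The convention \<open>0 powr a = 0\<close>, valid for every exponent including
    0, makes the left side vanish when one of the frequencies is 0.\<close>
  then have "?L = 0" by auto
  moreover have "0 \<le> 2 * (?A + ?B + ?C)" by (intro mult_nonneg_nonneg add_nonneg_nonneg) auto
  ultimately show ?thesis by (rule ord_eq_le_trans)
next
  case False
  then have z: "0 < norm (\<xi> - \<eta>)" "0 < norm \<eta>" "0 < norm \<xi>" by auto
  have t1: "norm \<eta> \<le> norm \<xi> + norm (\<xi> - \<eta>)" using norm_triangle_ineq4[of \<xi> "\<xi> - \<eta>"] by simp
  have t2: "norm \<xi> \<le> norm \<eta> + norm (\<xi> - \<eta>)" using norm_triangle_ineq[of \<eta> "\<xi> - \<eta>"] by simp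
  have nn: "0 \<le> ?A" "0 \<le> ?B" "0 \<le> ?C" by auto
  consider "norm (\<xi> - \<eta>) \<le> norm \<eta>" "norm (\<xi> - \<eta>) \<le> norm \<xi>" | "norm \<eta> \<le> norm (\<xi> - \<eta>)" "norm \<eta> \<le> norm \<xi>"
    | "norm \<xi> \<le> norm (\<xi> - \<eta>)" "norm \<xi> \<le> norm \<eta>" by linarith
  then show ?thesis
  proof cases
    case 1
    have "?L \<le> 2 * ?A" using power_region[OF z(1,2,3), of r p q] p t1 1 by (simp add: Hk_def)
    also have "\<dots> \<le> 2 * (?A + ?B + ?C)" using nn by simp
    finally show ?thesis .
  next
    case 2
    have "?L \<le> 2 * ?B" using power_region[OF z(2,3,1), of p q r] p t2 2 by (simp add: Hk_def mult_ac add_ac)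
    also have "\<dots> \<le> 2 * (?A + ?B + ?C)" using nn by simp
    finally show ?thesis .
  next
    case 3
    have "?L \<le> 2 * ?C" using power_region[OF z(3,2,1), of p r q] p t1 3 by (simp add: Hk_def mult_ac add_ac)
    also have "\<dots> \<le> 2 * (?A + ?B + ?C)" using nn by simp
    finally show ?thesis .
  qed
qed

text \<open>With sigma = xi - eta this is (sigma_2 eta_1 - sigma_1 eta_2) / |sigma|, the symbol of
  the velocity at sigma contracted with i eta, that is, of u . grad; replacing sigma by xi in the
  numerator changes nothing because the cross product of eta with itself is 0. On the diagonal
  division by zero gives 0.\<close>

definition kap :: "pt \<Rightarrow> pt \<Rightarrow> real" where
  "kap \<xi> \<eta> = (\<xi> $ 2 * \<eta> $ 1 - \<xi> $ 1 * \<eta> $ 2) / norm (\<xi> - \<eta>)"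

lemma kap_antisym: "kap \<eta> \<xi> = - kap \<xi> \<eta>"
  by (simp add: kap_def norm_minus_commute[of \<eta>] minus_divide_left)

lemma kap_minus: "kap (- \<xi>) (- \<eta>) = kap \<xi> \<eta>"
proof -
  have "norm (- \<xi> - - \<eta>) = norm (\<xi> - \<eta>)" by (simp add: norm_minus_commute)
  then show ?thesis by (simp add: kap_def)
qed

lemma kap_measurable [measurable (raw)]:
  assumes [measurable]: "f \<in> borel_measurable M" "g \<in> borel_measurable M"
  shows "(\<lambda>x. kap (f x) (g x)) \<in> borel_measurable M"
proof -
  have [measurable]: "(\<lambda>x. (x::pt) $ i) \<in> borel_measurable borel" for i
    by (intro borel_measurable_continuous_onI continuous_intros)
  show ?thesis unfolding kap_def by measurable
qed

lemma cross_bound: "\<bar>x $ 2 * y $ 1 - x $ 1 * y $ 2\<bar> \<le> norm x * norm y" for x y :: pt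
proof (rule power2_le_imp_le)
  have "(\<bar>x $ 2 * y $ 1 - x $ 1 * y $ 2\<bar>)\<^sup>2 + (x \<bullet> y)\<^sup>2 = (norm x * norm y)\<^sup>2"
    by (simp add: inner_pt power_mult_distrib norm_pt_sq) (simp add: power2_eq_square algebra_simps)
  then show "(\<bar>x $ 2 * y $ 1 - x $ 1 * y $ 2\<bar>)\<^sup>2 \<le> (norm x * norm y)\<^sup>2"
    using zero_le_power2[of "x \<bullet> y"] by linarith
qed simp

text \<open>The numerator is also the cross product of xi - eta and eta, so the denominator
  cancels.\<close>

lemma kap_le_eta: "\<bar>kap \<xi> \<eta>\<bar> \<le> norm \<eta>"
proof (cases "\<xi> = \<eta>")
  case False
  have "\<bar>\<xi> $ 2 * \<eta> $ 1 - \<xi> $ 1 * \<eta> $ 2\<bar> \<le> norm (\<xi> - \<eta>) * norm \<eta>"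
    using cross_bound[of "\<xi> - \<eta>" \<eta>] by (simp add: algebra_simps)
  then show ?thesis using False by (simp add: kap_def field_simps)
qed (simp add: kap_def)

lemma kap_le_xi: "\<bar>kap \<xi> \<eta>\<bar> \<le> norm \<xi>"
  using kap_le_eta[of \<eta> \<xi>] by (simp add: kap_antisym[of \<eta> \<xi>])

lemma kap_zero: "\<xi> - \<eta> = 0 \<or> \<eta> = 0 \<or> \<xi> = 0 \<Longrightarrow> kap \<xi> \<eta> = 0"
  by (auto simp: kap_def)

text \<open>The symbol of |D|^r acting on the transform. Since \<open>0 powr 0 = 0\<close>, even
  \<open>wt 0 f\<close> vanishes at the origin; this affects a single point only.\<close>

definition wt :: "real \<Rightarrow> (pt \<Rightarrow> complex) \<Rightarrow> pt \<Rightarrow> complex" where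
  "wt r f \<xi> = complex_of_real (norm \<xi> powr r) * f \<xi>"

lemma wt_measurable [measurable (raw)]: "f \<in> borel_measurable borel \<Longrightarrow> wt r f \<in> borel_measurable borel"
  unfolding wt_def[abs_def] by measurable

lemma cmod_wt: "cmod (wt r f \<xi>) = norm \<xi> powr r * cmod (f \<xi>)"
  by (simp add: wt_def norm_mult)

abbreviation kernel_form :: "(pt \<Rightarrow> pt \<Rightarrow> real) \<Rightarrow> (pt \<Rightarrow> complex) \<Rightarrow> (pt \<Rightarrow> complex) \<Rightarrow> (pt \<Rightarrow> complex) \<Rightarrow> ennreal" where
  "kernel_form k a b d \<equiv> (\<integral>\<^sup>+(\<xi>, \<eta>). ennreal (\<bar>k \<xi> \<eta>\<bar> * cmod (a (\<xi> - \<eta>)) * cmod (b \<eta>) * cmod (d \<xi>)) \<partial>lborel2)"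

abbreviation kap_form :: "(pt \<Rightarrow> complex) \<Rightarrow> (pt \<Rightarrow> complex) \<Rightarrow> (pt \<Rightarrow> complex) \<Rightarrow> ennreal" where
  "kap_form \<equiv> kernel_form kap"

text \<open>Stated for every kernel dominated by |eta| and not just for \<open>kap\<close>, because
  the two products u_1 d_1 theta and u_2 d_2 theta have to be integrable one by one, before their
  symbols combine into \<open>kap\<close>. The kernel has to vanish when some frequency is 0, as the
  weighted functions on the right do not see the values there. The derivative |eta| accounts for the
  1 in 1 + q, and the remaining weights must add up to 1.\<close>

lemma kernel_trilinear:
  assumes p: "0 \<le> p" "p < 1" "0 \<le> q" "q < 1" "0 \<le> r" "r < 1" "p + q + r = (1::real)"
  shows "\<exists>C\<ge>0. \<forall>k a b d. (\<forall>\<xi> \<eta>. \<bar>k \<xi> \<eta>\<bar> \<le> norm \<eta>) \<longrightarrow> (\<forall>\<xi> \<eta>. \<xi> - \<eta> = 0 \<or> \<eta> = 0 \<or> \<xi> = 0 \<longrightarrow> k \<xi> \<eta> = 0) \<longrightarrow> L2c (wt p a) \<longrightarrow> L2c (wt (1 + q) b) \<longrightarrow> L2c (wt r d) \<longrightarrow>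
     kernel_form k a b d
       \<le> ennreal (C * n2 (wt p a) * n2 (wt (1 + q) b) * n2 (wt r d))"
proof -
  obtain C1 where C1: "0 \<le> C1" "\<And>A B D. L2c A \<Longrightarrow> L2c B \<Longrightarrow> L2c D \<Longrightarrow>
     (\<integral>\<^sup>+(\<xi>, \<eta>). ennreal (Hk p (\<xi> - \<eta>) \<eta> * cmod (A (\<xi> - \<eta>)) * cmod (B \<eta>) * cmod (D \<xi>)) \<partial>lborel2) \<le> ennreal (C1 * n2 A * n2 B * n2 D)"
    using Hk_trilinear[OF p(1,2)] by blast
  obtain C2 where C2: "0 \<le> C2" "\<And>A B D. L2c A \<Longrightarrow> L2c B \<Longrightarrow> L2c D \<Longrightarrow>
     (\<integral>\<^sup>+(\<xi>, \<eta>). ennreal (Hk q \<eta> \<xi> * cmod (A (\<xi> - \<eta>)) * cmod (B \<eta>) * cmod (D \<xi>)) \<partial>lborel2) \<le> ennreal (C2 * n2 A * n2 B * n2 D)"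
    using Hk_trilinear[OF p(3,4)] by blast
  obtain C3 where C3: "0 \<le> C3" "\<And>A B D. L2c A \<Longrightarrow> L2c B \<Longrightarrow> L2c D \<Longrightarrow>
     (\<integral>\<^sup>+(\<xi>, \<eta>). ennreal (Hk r \<xi> \<eta> * cmod (A (\<xi> - \<eta>)) * cmod (B \<eta>) * cmod (D \<xi>)) \<partial>lborel2) \<le> ennreal (C3 * n2 A * n2 B * n2 D)"
    using Hk_trilinear[OF p(5,6)] by blast
  have main: "kernel_form k a b d
       \<le> ennreal (2 * (C1 + C2 + C3) * n2 (wt p a) * n2 (wt (1 + q) b) * n2 (wt r d))"
    if k1: "\<forall>\<xi> \<eta>. \<bar>k \<xi> \<eta>\<bar> \<le> norm \<eta>" and k2: "\<forall>\<xi> \<eta>. \<xi> - \<eta> = 0 \<or> \<eta> = 0 \<or> \<xi> = 0 \<longrightarrow> k \<xi> \<eta> = 0"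
      and L: "L2c (wt p a)" "L2c (wt (1 + q) b)" "L2c (wt r d)" for k :: "pt \<Rightarrow> pt \<Rightarrow> real" and a b d
  proof -
    note k = k1[rule_format] k2[rule_format]
    let ?A = "wt p a" and ?B = "wt (1 + q) b" and ?D = "wt r d"
    have [measurable]: "?A \<in> borel_measurable borel" "?B \<in> borel_measurable borel" "?D \<in> borel_measurable borel"
      using L by (auto dest!: L2c_measurable)
    let ?T = "\<lambda>H \<xi> \<eta>. H * cmod (?A (\<xi> - \<eta>)) * cmod (?B \<eta>) * cmod (?D \<xi>)"
    have pw: "\<bar>k \<xi> \<eta>\<bar> * cmod (a (\<xi> - \<eta>)) * cmod (b \<eta>) * cmod (d \<xi>)
       \<le> 2 * (?T (Hk p (\<xi> - \<eta>) \<eta>) \<xi> \<eta> + ?T (Hk q \<eta> \<xi>) \<xi> \<eta> + ?T (Hk r \<xi> \<eta>) \<xi> \<eta>)" for \<xi> \<eta>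
    proof (cases "\<xi> - \<eta> = 0 \<or> \<eta> = 0 \<or> \<xi> = 0")
      case True
      then show ?thesis using k(2)[OF True] by (simp add: add_nonneg_nonneg)
    next
      case False
      then have z: "0 < norm (\<xi> - \<eta>)" "0 < norm \<eta>" "0 < norm \<xi>" by auto
      have c: "x powr (-e) * (x powr e * y) = y" if "0 < x" for x e y :: real
        using that by (simp add: powr_minus field_simps)
      have c2: "norm \<eta> powr (-q) * (norm \<eta> powr (1 + q) * y) = norm \<eta> * y" for y
        using z by (simp add: powr_add powr_minus field_simps)
      have "\<bar>k \<xi> \<eta>\<bar> * cmod (a (\<xi> - \<eta>)) * cmod (b \<eta>) * cmod (d \<xi>) \<le> norm \<eta> * cmod (a (\<xi> - \<eta>)) * cmod (b \<eta>) * cmod (d \<xi>)"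
        by (intro mult_right_mono k(1)) auto
      also have "\<dots> = (norm (\<xi> - \<eta>) powr (-p) * cmod (?A (\<xi> - \<eta>))) * (norm \<eta> powr (-q) * cmod (?B \<eta>)) * (norm \<xi> powr (-r) * cmod (?D \<xi>))"
        unfolding cmod_wt c[OF z(1)] c[OF z(3)] c2 by (simp only: mult_ac)
      also have "\<dots> = ?T (norm (\<xi> - \<eta>) powr (-p) * norm \<eta> powr (-q) * norm \<xi> powr (-r)) \<xi> \<eta>"
        by (simp only: mult_ac)
      also have "\<dots> \<le> ?T (2 * (Hk p (\<xi> - \<eta>) \<eta> + Hk q \<eta> \<xi> + Hk r \<xi> \<eta>)) \<xi> \<eta>"
        by (intro mult_right_mono kernel_region p) auto
      also have "\<dots> = 2 * (?T (Hk p (\<xi> - \<eta>) \<eta>) \<xi> \<eta> + ?T (Hk q \<eta> \<xi>) \<xi> \<eta> + ?T (Hk r \<xi> \<eta>) \<xi> \<eta>)"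
        by (simp only: distrib_right distrib_left mult_ac)
      finally show ?thesis .
    qed
    have "kernel_form k a b d
       \<le> (\<integral>\<^sup>+z. 2 * ((case z of (\<xi>, \<eta>) \<Rightarrow> ennreal (?T (Hk p (\<xi> - \<eta>) \<eta>) \<xi> \<eta>)) + (case z of (\<xi>, \<eta>) \<Rightarrow> ennreal (?T (Hk q \<eta> \<xi>) \<xi> \<eta>)) + (case z of (\<xi>, \<eta>) \<Rightarrow> ennreal (?T (Hk r \<xi> \<eta>) \<xi> \<eta>))) \<partial>lborel2)"
    proof (intro nn_integral_mono, clarify)
      fix \<xi> \<eta>
      show "ennreal (\<bar>k \<xi> \<eta>\<bar> * cmod (a (\<xi> - \<eta>)) * cmod (b \<eta>) * cmod (d \<xi>)) \<le> 2 * (ennreal (?T (Hk p (\<xi> - \<eta>) \<eta>) \<xi> \<eta>) + ennreal (?T (Hk q \<eta> \<xi>) \<xi> \<eta>) + ennreal (?T (Hk r \<xi> \<eta>) \<xi> \<eta>))"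
        using ennreal_leI[OF pw[of \<xi> \<eta>]] by (simp add: ennreal_mult ennreal_plus)
    qed
    also have "\<dots> = 2 * ((\<integral>\<^sup>+(\<xi>, \<eta>). ennreal (?T (Hk p (\<xi> - \<eta>) \<eta>) \<xi> \<eta>) \<partial>lborel2) + (\<integral>\<^sup>+(\<xi>, \<eta>). ennreal (?T (Hk q \<eta> \<xi>) \<xi> \<eta>) \<partial>lborel2) + (\<integral>\<^sup>+(\<xi>, \<eta>). ennreal (?T (Hk r \<xi> \<eta>) \<xi> \<eta>) \<partial>lborel2))"
      by (simp add: nn_integral_cmult nn_integral_add)
    also have "\<dots> \<le> 2 * (ennreal (C1 * n2 ?A * n2 ?B * n2 ?D) + ennreal (C2 * n2 ?A * n2 ?B * n2 ?D) + ennreal (C3 * n2 ?A * n2 ?B * n2 ?D))"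
      by (intro mult_left_mono add_mono C1 C2 C3 L) auto
    also have "\<dots> = ennreal (2 * (C1 * n2 ?A * n2 ?B * n2 ?D + C2 * n2 ?A * n2 ?B * n2 ?D + C3 * n2 ?A * n2 ?B * n2 ?D))"
      using C1(1) C2(1) C3(1) by (simp add: ennreal_mult ennreal_plus)
    also have "2 * (C1 * n2 ?A * n2 ?B * n2 ?D + C2 * n2 ?A * n2 ?B * n2 ?D + C3 * n2 ?A * n2 ?B * n2 ?D) = 2 * (C1 + C2 + C3) * n2 ?A * n2 ?B * n2 ?D"
      by (simp add: algebra_simps)
    finally show ?thesis .
  qed
  have "0 \<le> 2 * (C1 + C2 + C3)" using C1(1) C2(1) C3(1) by simp
  then show ?thesis by (intro exI[of _ "2 * (C1 + C2 + C3)"] conjI allI impI main) blast+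
qed

text \<open>Three triples (p, q, r) occur later: (\<alpha>, 1 - 2\<alpha>, \<alpha>), which puts the
  weight s = 2 - 2\<alpha> on b, for the comparison of two solutions and for pairing a solution with
  itself; (2\<alpha>, 1 - 2\<alpha>, 0) for pairing with a function that is merely in L2; and (1/3,
  1/3, 1/3) where only finiteness matters.\<close>

lemma kap_trilinear:
  assumes p: "0 \<le> p" "p < 1" "0 \<le> q" "q < 1" "0 \<le> r" "r < 1" "p + q + r = (1::real)"
  shows "\<exists>C\<ge>0. \<forall>a b d. L2c (wt p a) \<longrightarrow> L2c (wt (1 + q) b) \<longrightarrow> L2c (wt r d) \<longrightarrow>
     kap_form a b d
       \<le> ennreal (C * n2 (wt p a) * n2 (wt (1 + q) b) * n2 (wt r d))"
proof -
  from kernel_trilinear[OF p] obtain C where C: "0 \<le> C" and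
    C2: "\<forall>k a b d. (\<forall>\<xi> \<eta>. \<bar>k \<xi> \<eta>\<bar> \<le> norm \<eta>) \<longrightarrow> (\<forall>\<xi> \<eta>. \<xi> - \<eta> = 0 \<or> \<eta> = 0 \<or> \<xi> = 0 \<longrightarrow> k \<xi> \<eta> = 0) \<longrightarrow> L2c (wt p a) \<longrightarrow> L2c (wt (1 + q) b) \<longrightarrow> L2c (wt r d) \<longrightarrow>
     kernel_form k a b d
       \<le> ennreal (C * n2 (wt p a) * n2 (wt (1 + q) b) * n2 (wt r d))" by (elim exE conjE)
  show ?thesis
    by (intro exI[of _ C] conjI C allI impI C2[rule_format, where k = kap]) (auto simp: kap_le_eta kap_zero)
qed

section \<open>The commutator estimate and the nonlinearity\<close>

text \<open>Mean value theorem, with the derivative bounded by its value at the larger point since e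
  - 1 \<ge> 0. The endpoint a = 0, where the derivative of the power is not at hand, is computed
  directly.\<close>

lemma powr_diff_bound:
  fixes a b e :: real
  assumes "0 \<le> a" "a \<le> b" "1 \<le> e"
  shows "b powr e - a powr e \<le> e * (b - a) * b powr (e - 1)"
proof (cases "a = 0 \<or> a = b")
  case True
  then show ?thesis
  proof
    assume a: "a = 0"
    show ?thesis
    proof (cases "b = 0")
      case False
      then have b: "0 < b" using assms by auto
      have "b powr e = b * b powr (e - 1)" using powr_add[of b 1 "e - 1"] b by simp
      also have "\<dots> \<le> e * (b * b powr (e - 1))" using assms b by (intro mult_right_mono[of 1 e, simplified]) auto
      finally show ?thesis using a by (simp add: mult.assoc)
    qed (use a in simp)
  qed simp
next
  case False
  then have ab: "0 < a" "a < b" using assms by auto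
  have "\<exists>z. a < z \<and> z < b \<and> b powr e - a powr e = (b - a) * (e * z powr (e - 1))"
    by (rule MVT2[OF ab(2)]) (use ab in \<open>auto intro!: derivative_eq_intros\<close>)
  then obtain z where z: "a < z" "z < b" "b powr e - a powr e = (b - a) * (e * z powr (e - 1))" by blast
  have "z powr (e - 1) \<le> b powr (e - 1)" using z ab assms by (intro powr_mono2) auto
  then have "(b - a) * (e * z powr (e - 1)) \<le> (b - a) * (e * b powr (e - 1))"
    using ab assms by (intro mult_left_mono) auto
  then show ?thesis using z(3) by (simp add: mult_ac)
qed

text \<open>The squared H^s weight, frozen beyond |xi| = R instead of cut to 0. It is bounded for
  fixed R, so it may be used as a multiplier before convergence is known, and it keeps the
  difference bounds of the full weight uniformly in R.\<close>

definition mR :: "real \<Rightarrow> real \<Rightarrow> pt \<Rightarrow> real" where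
  "mR s R \<xi> = (min (norm \<xi>) R) powr (2 * s)"

lemma mR_measurable [measurable]: "mR s R \<in> borel_measurable borel"
  unfolding mR_def[abs_def] by measurable

lemma mR_nonneg [simp]: "0 \<le> mR s R \<xi>"
  by (simp add: mR_def)

lemma mR_le: "0 \<le> s \<Longrightarrow> 0 < R \<Longrightarrow> mR s R \<xi> \<le> norm \<xi> powr (2 * s)"
  by (auto simp: mR_def intro!: powr_mono2)

lemma mR_le_R: "0 \<le> s \<Longrightarrow> 0 < R \<Longrightarrow> mR s R \<xi> \<le> R powr (2 * s)"
  by (auto simp: mR_def intro!: powr_mono2)

lemma mR_eq: "norm \<xi> \<le> R \<Longrightarrow> mR s R \<xi> = norm \<xi> powr (2 * s)"
  by (simp add: mR_def)

text \<open>x -> min x R is nondecreasing, at most x, and does not increase distances, so the power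
  estimate survives the truncation without any dependence on R.\<close>

lemma mR_diff_Lipschitz:
  assumes "1 \<le> 2 * s" "0 < R"
  shows "\<bar>mR s R \<xi> - mR s R \<eta>\<bar> \<le> 2 * s * norm (\<xi> - \<eta>) * (max (norm \<xi>) (norm \<eta>)) powr (2 * s - 1)"
proof -
  have gen: "(min x R) powr (2 * s) - (min y R) powr (2 * s) \<le> 2 * s * (x - y) * x powr (2 * s - 1)"
    if "0 \<le> y" "y \<le> x" for x y
  proof -
    have "(min x R) powr (2 * s) - (min y R) powr (2 * s) \<le> 2 * s * (min x R - min y R) * (min x R) powr (2 * s - 1)"
      using that assms by (intro powr_diff_bound) auto
    also have "\<dots> \<le> 2 * s * (x - y) * x powr (2 * s - 1)"
      using that assms by (intro mult_mono powr_mono2 mult_left_mono) auto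
    finally show ?thesis .
  qed
  have mono: "(min y R) powr (2 * s) \<le> (min x R) powr (2 * s)" if "0 \<le> y" "y \<le> x" for x y
    using that assms by (intro powr_mono2) auto
  have tri: "norm \<xi> - norm \<eta> \<le> norm (\<xi> - \<eta>)" "norm \<eta> - norm \<xi> \<le> norm (\<xi> - \<eta>)"
    using norm_triangle_ineq2[of \<xi> \<eta>] norm_triangle_ineq2[of \<eta> \<xi>] by (auto simp: norm_minus_commute)
  show ?thesis
  proof (cases "norm \<eta> \<le> norm \<xi>")
    case True
    have "\<bar>mR s R \<xi> - mR s R \<eta>\<bar> \<le> 2 * s * (norm \<xi> - norm \<eta>) * norm \<xi> powr (2 * s - 1)"
      using gen[OF _ True] mono[OF _ True] by (simp add: mR_def)
    also have "\<dots> \<le> 2 * s * norm (\<xi> - \<eta>) * norm \<xi> powr (2 * s - 1)"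
      using tri assms by (intro mult_right_mono mult_left_mono) auto
    finally show ?thesis using True by (simp add: max_absorb1)
  next
    case False
    then have le: "norm \<xi> \<le> norm \<eta>" by simp
    have "\<bar>mR s R \<xi> - mR s R \<eta>\<bar> \<le> 2 * s * (norm \<eta> - norm \<xi>) * norm \<eta> powr (2 * s - 1)"
      using gen[OF _ le] mono[OF _ le] by (simp add: mR_def abs_minus_commute)
    also have "\<dots> \<le> 2 * s * norm (\<xi> - \<eta>) * norm \<eta> powr (2 * s - 1)"
      using tri assms by (intro mult_right_mono mult_left_mono) auto
    finally show ?thesis using le by (simp add: max_absorb2)
  qed
qed

lemma mR_diff_max:
  assumes "0 \<le> s" "0 < R"
  shows "\<bar>mR s R \<xi> - mR s R \<eta>\<bar> \<le> (max (norm \<xi>) (norm \<eta>)) powr (2 * s)"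
proof -
  have "mR s R \<xi> \<le> (max (norm \<xi>) (norm \<eta>)) powr (2 * s)" "mR s R \<eta> \<le> (max (norm \<xi>) (norm \<eta>)) powr (2 * s)"
    using assms by (auto simp: mR_def intro!: powr_mono2)
  then show ?thesis using mR_nonneg[of s R \<xi>] mR_nonneg[of s R \<eta>] by linarith
qed

text \<open>Here x is the smallest frequency. The powers of y, namely s - 2 and twice s + \<alpha>,
  add up to 2 s exactly when s = 2 - 2\<alpha>: this is the point where the critical exponent enters
  the commutator. One factor of y is then traded for z at the cost 2^(s + \<alpha>).\<close>

lemma weight_region:
  fixes x y z s \<alpha> :: real
  assumes "0 < x" "0 < y" "0 < z" "y \<le> 2 * z" "s = 2 - 2 * \<alpha>" "0 \<le> s + \<alpha>"
  shows "x * y powr (2 * s) \<le> 2 powr (s + \<alpha>) * ((x powr (-(s - 1)) * y powr ((s - 1) - 1)) * (x powr s * y powr (s + \<alpha>) * z powr (s + \<alpha>)))"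
proof -
  have a: "y powr (s + \<alpha>) \<le> 2 powr (s + \<alpha>) * z powr (s + \<alpha>)"
    using powr_mono2[of "s + \<alpha>" y "2 * z"] assms by (simp add: powr_mult)
  have "x * y powr (2 * s) = (x powr (-(s - 1)) * x powr s) * (y powr ((s - 1) - 1) * y powr (s + \<alpha>) * y powr (s + \<alpha>))"
  proof -
    have "x powr (-(s - 1)) * x powr s = x" using assms(1) by (simp add: powr_add[symmetric])
    moreover have "y powr ((s - 1) - 1) * y powr (s + \<alpha>) * y powr (s + \<alpha>) = y powr (2 * s)"
      unfolding powr_add[symmetric] using assms(5) by (intro arg_cong[where f="\<lambda>e. y powr e"]) simp
    ultimately show ?thesis by simp
  qed
  also have "\<dots> \<le> (x powr (-(s - 1)) * x powr s) * (y powr ((s - 1) - 1) * y powr (s + \<alpha>) * (2 powr (s + \<alpha>) * z powr (s + \<alpha>)))"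
    by (intro mult_left_mono a) auto
  also have "\<dots> = 2 powr (s + \<alpha>) * ((x powr (-(s - 1)) * y powr ((s - 1) - 1)) * (x powr s * y powr (s + \<alpha>) * z powr (s + \<alpha>)))"
    by (simp only: mult_ac)
  finally show ?thesis .
qed

text \<open>In each region the kernel of the commutator is bounded by the smallest of the three
  frequencies times the \<open>2 s\<close>-th power of the largest; where \<open>\<xi> - \<eta>\<close> is the smallest, this is
  where the cancellation is needed.\<close>

lemma commutator_region:
  assumes s: "s = 2 - 2 * \<alpha>" and al: "0 < \<alpha>" "\<alpha> < 1/2" and R: "0 < R"
  defines "c \<equiv> 2 * s * 2 powr (2 * s - 1)"
  shows "\<bar>kap \<xi> \<eta>\<bar> * \<bar>mR s R \<xi> - mR s R \<eta>\<bar> \<le> c * 2 powr (s + \<alpha>) *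
     (Hk (s - 1) (\<xi> - \<eta>) \<eta> * (norm (\<xi> - \<eta>) powr s * norm \<eta> powr (s + \<alpha>) * norm \<xi> powr (s + \<alpha>))
    + Hk (s - 1) \<eta> \<xi> * (norm (\<xi> - \<eta>) powr (s + \<alpha>) * norm \<eta> powr s * norm \<xi> powr (s + \<alpha>))
    + Hk (s - 1) \<xi> \<eta> * (norm (\<xi> - \<eta>) powr (s + \<alpha>) * norm \<eta> powr (s + \<alpha>) * norm \<xi> powr s))"
   (is "?L \<le> c * ?d * (?A + ?B + ?C)")
proof -
  have s1: "1 < s" using s al by auto
  \<comment> \<open>The constant c comes from the Lipschitz bound in the first region. That it is at
    least 1 lets it also serve in the other two regions, where the constant is 1.\<close>
  have "1 \<le> (2::real) powr (2 * s - 1)" using s1 by (intro ge_one_powr_ge_zero) auto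
  then have "1 * 1 \<le> 2 * s * 2 powr (2 * s - 1)" using s1 by (intro mult_mono) auto
  then have c1: "1 \<le> c" by (simp add: c_def)
  have nn: "0 \<le> ?A" "0 \<le> ?B" "0 \<le> ?C" by auto
  have nnd: "0 \<le> c * ?d" using c1 by simp
  show ?thesis
  proof (cases "\<xi> - \<eta> = 0 \<or> \<eta> = 0 \<or> \<xi> = 0")
    case True
    have "?L = 0" using kap_zero[OF True] by simp
    moreover have "0 \<le> c * ?d * (?A + ?B + ?C)" 
      by (rule mult_nonneg_nonneg[OF nnd add_nonneg_nonneg[OF add_nonneg_nonneg[OF nn(1,2)] nn(3)]])
    ultimately show ?thesis by (rule ord_eq_le_trans)
  next
    case False
    then have z: "0 < norm (\<xi> - \<eta>)" "0 < norm \<eta>" "0 < norm \<xi>" by auto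
    have t1: "norm \<eta> \<le> norm \<xi> + norm (\<xi> - \<eta>)" using norm_triangle_ineq4[of \<xi> "\<xi> - \<eta>"] by simp
    have t2: "norm \<xi> \<le> norm \<eta> + norm (\<xi> - \<eta>)" using norm_triangle_ineq[of \<eta> "\<xi> - \<eta>"] by simp
    have fin: "?L \<le> c * ?d * (?A + ?B + ?C)"
      if L: "?L \<le> c * (x * y powr (2 * s))" and W: "x * y powr (2 * s) \<le> ?d * E" and E: "E \<le> ?A + ?B + ?C" for x y E
    proof -
      have "?L \<le> c * (?d * E)" using L W c1 by (meson mult_left_mono order_trans zero_le_one)
      also have "\<dots> = c * ?d * E" by simp
      also have "\<dots> \<le> c * ?d * (?A + ?B + ?C)" by (rule mult_left_mono[OF E nnd])
      finally show ?thesis .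
    qed
    consider "norm (\<xi> - \<eta>) \<le> norm \<eta>" "norm (\<xi> - \<eta>) \<le> norm \<xi>" | "norm \<eta> \<le> norm (\<xi> - \<eta>)" "norm \<eta> \<le> norm \<xi>"
      | "norm \<xi> \<le> norm (\<xi> - \<eta>)" "norm \<xi> \<le> norm \<eta>" by linarith
    then show ?thesis
    proof cases
      case 1
      have "max (norm \<xi>) (norm \<eta>) powr (2 * s - 1) \<le> (2 * norm \<eta>) powr (2 * s - 1)"
        using 1 t2 s1 by (intro powr_mono2) auto
      also have "\<dots> = 2 powr (2 * s - 1) * norm \<eta> powr (2 * s - 1)" by (simp add: powr_mult)
      finally have m: "max (norm \<xi>) (norm \<eta>) powr (2 * s - 1) \<le> 2 powr (2 * s - 1) * norm \<eta> powr (2 * s - 1)" .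
      have "?L \<le> norm \<eta> * (2 * s * norm (\<xi> - \<eta>) * max (norm \<xi>) (norm \<eta>) powr (2 * s - 1))"
        using s1 R by (intro mult_mono kap_le_eta mR_diff_Lipschitz) auto
      also have "\<dots> \<le> norm \<eta> * (2 * s * norm (\<xi> - \<eta>) * (2 powr (2 * s - 1) * norm \<eta> powr (2 * s - 1)))"
        using s1 by (intro mult_left_mono m) auto
      also have "\<dots> = c * (norm (\<xi> - \<eta>) * (norm \<eta> powr 1 * norm \<eta> powr (2 * s - 1)))"
        using z(2) unfolding c_def by simp
      also have "norm \<eta> powr 1 * norm \<eta> powr (2 * s - 1) = norm \<eta> powr (2 * s)"
        unfolding powr_add[symmetric] by simp
      finally have L: "?L \<le> c * (norm (\<xi> - \<eta>) * norm \<eta> powr (2 * s))" .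
      show ?thesis
        by (rule fin[OF L weight_region[OF z(1,2,3) _ s]]) (use 1 t1 s1 al nn in \<open>auto simp: Hk_def\<close>)
    next
      case 2
      have "?L \<le> norm \<eta> * max (norm \<xi>) (norm \<eta>) powr (2 * s)"
        using s1 R by (intro mult_mono kap_le_eta mR_diff_max) auto
      also have "max (norm \<xi>) (norm \<eta>) = norm \<xi>" using 2 by simp
      also have "norm \<eta> * norm \<xi> powr (2 * s) \<le> c * (norm \<eta> * norm \<xi> powr (2 * s))"
        using c1 by (intro mult_right_mono[of 1 c, simplified]) auto
      finally have L: "?L \<le> c * (norm \<eta> * norm \<xi> powr (2 * s))" .
      show ?thesis
        by (rule fin[OF L weight_region[OF z(2,3,1) _ s]]) (use 2 t2 s1 al nn in \<open>auto simp: Hk_def mult_ac\<close>)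
    next
      case 3
      have "?L \<le> norm \<xi> * max (norm \<xi>) (norm \<eta>) powr (2 * s)"
        using s1 R by (intro mult_mono kap_le_xi mR_diff_max) auto
      also have "max (norm \<xi>) (norm \<eta>) = norm \<eta>" using 3 by simp
      also have "norm \<xi> * norm \<eta> powr (2 * s) \<le> c * (norm \<xi> * norm \<eta> powr (2 * s))"
        using c1 by (intro mult_right_mono[of 1 c, simplified]) auto
      finally have L: "?L \<le> c * (norm \<xi> * norm \<eta> powr (2 * s))" .
      show ?thesis
        by (rule fin[OF L weight_region[OF z(3,2,1) _ s]]) (use 3 t1 s1 al nn in \<open>auto simp: Hk_def mult_ac\<close>)
    qed
  qed
qed

abbreviation commutator_form :: "real \<Rightarrow> real \<Rightarrow> (pt \<Rightarrow> complex) \<Rightarrow> ennreal" where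
  "commutator_form s R w \<equiv> (\<integral>\<^sup>+(\<xi>, \<eta>). ennreal (\<bar>kap \<xi> \<eta>\<bar> * \<bar>mR s R \<xi> - mR s R \<eta>\<bar> * cmod (w (\<xi> - \<eta>)) * cmod (w \<eta>) * cmod (w \<xi>)) \<partial>lborel2)"

text \<open>\<open>commutator_region\<close> leaves three forms with kernel exponent s - 1 = 1 -
  2\<alpha>, admissible because 0 < \<alpha> < 1/2. In each form the smallest frequency carries
  weight s and the two large ones s + \<alpha>, so the three bounds coincide. That C does not depend
  on R is what permits R to tend to infinity later.\<close>

lemma kap_commutator:
  assumes s: "s = 2 - 2 * \<alpha>" and al: "0 < \<alpha>" "\<alpha> < 1/2"
  shows "\<exists>C\<ge>0. \<forall>R w. 0 < R \<longrightarrow> L2c (wt s w) \<longrightarrow> L2c (wt (s + \<alpha>) w) \<longrightarrow>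
     commutator_form s R w
       \<le> ennreal (C * n2 (wt s w) * (n2 (wt (s + \<alpha>) w))\<^sup>2)"
proof -
  have p: "0 \<le> s - 1" "s - 1 < 1" using s al by auto
  obtain C1 where C1: "0 \<le> C1" "\<And>A B D. L2c A \<Longrightarrow> L2c B \<Longrightarrow> L2c D \<Longrightarrow>
     (\<integral>\<^sup>+(\<xi>, \<eta>). ennreal (Hk (s - 1) (\<xi> - \<eta>) \<eta> * cmod (A (\<xi> - \<eta>)) * cmod (B \<eta>) * cmod (D \<xi>)) \<partial>lborel2) \<le> ennreal (C1 * n2 A * n2 B * n2 D)"
    "\<And>A B D. L2c A \<Longrightarrow> L2c B \<Longrightarrow> L2c D \<Longrightarrow>
     (\<integral>\<^sup>+(\<xi>, \<eta>). ennreal (Hk (s - 1) \<eta> \<xi> * cmod (A (\<xi> - \<eta>)) * cmod (B \<eta>) * cmod (D \<xi>)) \<partial>lborel2) \<le> ennreal (C1 * n2 A * n2 B * n2 D)"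
    "\<And>A B D. L2c A \<Longrightarrow> L2c B \<Longrightarrow> L2c D \<Longrightarrow>
     (\<integral>\<^sup>+(\<xi>, \<eta>). ennreal (Hk (s - 1) \<xi> \<eta> * cmod (A (\<xi> - \<eta>)) * cmod (B \<eta>) * cmod (D \<xi>)) \<partial>lborel2) \<le> ennreal (C1 * n2 A * n2 B * n2 D)"
    using Hk_trilinear[OF p] by blast
  define c where "c = 2 * s * 2 powr (2 * s - 1) * 2 powr (s + \<alpha>)"
  have c0: "0 \<le> c" using p by (simp add: c_def)
  {
    fix R :: real and w assume R: "0 < R" and L: "L2c (wt s w)" "L2c (wt (s + \<alpha>) w)"
    let ?A = "wt s w" and ?B = "wt (s + \<alpha>) w"
    have [measurable]: "?A \<in> borel_measurable borel" "?B \<in> borel_measurable borel"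
      using L by (auto dest!: L2c_measurable)
    let ?T1 = "\<lambda>\<xi> \<eta>. Hk (s - 1) (\<xi> - \<eta>) \<eta> * cmod (?A (\<xi> - \<eta>)) * cmod (?B \<eta>) * cmod (?B \<xi>)"
    let ?T2 = "\<lambda>\<xi> \<eta>. Hk (s - 1) \<eta> \<xi> * cmod (?B (\<xi> - \<eta>)) * cmod (?A \<eta>) * cmod (?B \<xi>)"
    let ?T3 = "\<lambda>\<xi> \<eta>. Hk (s - 1) \<xi> \<eta> * cmod (?B (\<xi> - \<eta>)) * cmod (?B \<eta>) * cmod (?A \<xi>)"
    have pw: "\<bar>kap \<xi> \<eta>\<bar> * \<bar>mR s R \<xi> - mR s R \<eta>\<bar> * cmod (w (\<xi> - \<eta>)) * cmod (w \<eta>) * cmod (w \<xi>) \<le> c * (?T1 \<xi> \<eta> + ?T2 \<xi> \<eta> + ?T3 \<xi> \<eta>)" for \<xi> \<eta>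
    proof -
      have "\<bar>kap \<xi> \<eta>\<bar> * \<bar>mR s R \<xi> - mR s R \<eta>\<bar> * (cmod (w (\<xi> - \<eta>)) * cmod (w \<eta>) * cmod (w \<xi>)) \<le> c *
         (Hk (s - 1) (\<xi> - \<eta>) \<eta> * (norm (\<xi> - \<eta>) powr s * norm \<eta> powr (s + \<alpha>) * norm \<xi> powr (s + \<alpha>))
        + Hk (s - 1) \<eta> \<xi> * (norm (\<xi> - \<eta>) powr (s + \<alpha>) * norm \<eta> powr s * norm \<xi> powr (s + \<alpha>))
        + Hk (s - 1) \<xi> \<eta> * (norm (\<xi> - \<eta>) powr (s + \<alpha>) * norm \<eta> powr (s + \<alpha>) * norm \<xi> powr s)) * (cmod (w (\<xi> - \<eta>)) * cmod (w \<eta>) * cmod (w \<xi>))"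
        unfolding c_def by (intro mult_right_mono commutator_region s al R) auto
      also have "\<dots> = c * (?T1 \<xi> \<eta> + ?T2 \<xi> \<eta> + ?T3 \<xi> \<eta>)"
        unfolding cmod_wt by (simp only: distrib_left distrib_right mult_ac)
      finally show ?thesis by (simp only: mult.assoc)
    qed
    have "commutator_form s R w
       \<le> (\<integral>\<^sup>+z. ennreal c * ((case z of (\<xi>, \<eta>) \<Rightarrow> ennreal (?T1 \<xi> \<eta>)) + (case z of (\<xi>, \<eta>) \<Rightarrow> ennreal (?T2 \<xi> \<eta>)) + (case z of (\<xi>, \<eta>) \<Rightarrow> ennreal (?T3 \<xi> \<eta>))) \<partial>lborel2)"
    proof (intro nn_integral_mono, clarify)
      fix \<xi> \<eta>
      show "ennreal (\<bar>kap \<xi> \<eta>\<bar> * \<bar>mR s R \<xi> - mR s R \<eta>\<bar> * cmod (w (\<xi> - \<eta>)) * cmod (w \<eta>) * cmod (w \<xi>)) \<le> ennreal c * (ennreal (?T1 \<xi> \<eta>) + ennreal (?T2 \<xi> \<eta>) + ennreal (?T3 \<xi> \<eta>))"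
        using ennreal_leI[OF pw[of \<xi> \<eta>]] c0 by (simp add: ennreal_mult ennreal_plus)
    qed
    also have "\<dots> = ennreal c * ((\<integral>\<^sup>+(\<xi>, \<eta>). ennreal (?T1 \<xi> \<eta>) \<partial>lborel2) + (\<integral>\<^sup>+(\<xi>, \<eta>). ennreal (?T2 \<xi> \<eta>) \<partial>lborel2) + (\<integral>\<^sup>+(\<xi>, \<eta>). ennreal (?T3 \<xi> \<eta>) \<partial>lborel2))"
      by (simp add: nn_integral_cmult nn_integral_add)
    also have "\<dots> \<le> ennreal c * (ennreal (C1 * n2 ?A * n2 ?B * n2 ?B) + ennreal (C1 * n2 ?B * n2 ?A * n2 ?B) + ennreal (C1 * n2 ?B * n2 ?B * n2 ?A))"
      by (intro mult_left_mono add_mono C1 L) auto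
    also have "\<dots> = ennreal (c * (C1 * n2 ?A * n2 ?B * n2 ?B + C1 * n2 ?B * n2 ?A * n2 ?B + C1 * n2 ?B * n2 ?B * n2 ?A))"
    proof -
      have gen: "ennreal c * (ennreal x + ennreal y + ennreal z) = ennreal (c * (x + y + z))" if "0 \<le> x" "0 \<le> y" "0 \<le> z" for x y z
        using that c0 by (simp add: ennreal_mult)
      show ?thesis by (rule gen) (use C1(1) in auto)
    qed
    also have "c * (C1 * n2 ?A * n2 ?B * n2 ?B + C1 * n2 ?B * n2 ?A * n2 ?B + C1 * n2 ?B * n2 ?B * n2 ?A) = (3 * c * C1) * n2 ?A * (n2 ?B)\<^sup>2"
      by (simp add: algebra_simps power2_eq_square)
    finally have "commutator_form s R w \<le> ennreal ((3 * c * C1) * n2 ?A * (n2 ?B)\<^sup>2)" .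
  }
  then show ?thesis using C1(1) c0 by (intro exI[of _ "3 * c * C1"]) auto
qed

text \<open>The transform of u . grad theta as a bilinear expression: a enters through the velocity
  and b is transported. The factor is that of \<open>product_fourier\<close>.\<close>

definition NL :: "(pt \<Rightarrow> complex) \<Rightarrow> (pt \<Rightarrow> complex) \<Rightarrow> pt \<Rightarrow> complex" where
  "NL a b \<xi> = complex_of_real (1 / (2*pi)\<^sup>2) * (LINT \<eta>|lborel. complex_of_real (kap \<xi> \<eta>) * a (\<xi> - \<eta>) * b \<eta>)"

lemma L2c_reflect_arg:
  assumes "L2c a" shows "L2c (\<lambda>\<eta>. a (\<xi> - \<eta>))" "n2 (\<lambda>\<eta>. a (\<xi> - \<eta>)) = n2 a"
proof -
  have [measurable]: "a \<in> borel_measurable borel" using L2c_measurable[OF assms] by simp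
  show "L2c (\<lambda>\<eta>. a (\<xi> - \<eta>))" "n2 (\<lambda>\<eta>. a (\<xi> - \<eta>)) = n2 a"
    using integrable_reflect[OF L2c_integrable[OF assms], of \<xi>] integral_reflect[of "\<lambda>x. (cmod (a x))\<^sup>2" \<xi>]
    by (auto simp: L2c_def n2_def L2norm_sq_def)
qed

text \<open>Bounding \<open>kap\<close> by |xi| instead of |eta| puts the derivative on the output.
  The integral then converges at every xi for functions that are merely in L2, and it is Lipschitz
  in them at each fixed xi.\<close>

lemma NL_integrable_aux:
  assumes "L2c a" "L2c b"
  shows "integrable lborel (\<lambda>\<eta>. complex_of_real (kap \<xi> \<eta>) * a (\<xi> - \<eta>) * b \<eta>)"
    and "cmod (LINT \<eta>|lborel. complex_of_real (kap \<xi> \<eta>) * a (\<xi> - \<eta>) * b \<eta>) \<le> norm \<xi> * n2 a * n2 b"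
proof -
  have [measurable]: "a \<in> borel_measurable borel" "b \<in> borel_measurable borel"
    using L2c_measurable[OF assms(1)] L2c_measurable[OF assms(2)] by auto
  note L = L2c_reflect_arg[OF assms(1), of \<xi>]
  let ?w = "\<lambda>\<eta>. norm \<xi> * (cmod (a (\<xi> - \<eta>)) * cmod (b \<eta>))"
  have w: "integrable lborel ?w" by (intro integrable_mult_right L2c_mult_integrable_norm L assms)
  have le: "norm (complex_of_real (kap \<xi> \<eta>) * a (\<xi> - \<eta>) * b \<eta>) \<le> ?w \<eta>" for \<eta>
    unfolding norm_mult mult.assoc norm_of_real by (intro mult_right_mono kap_le_xi) auto
  show i: "integrable lborel (\<lambda>\<eta>. complex_of_real (kap \<xi> \<eta>) * a (\<xi> - \<eta>) * b \<eta>)"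
    by (rule Bochner_Integration.integrable_bound[OF w]) (use le in \<open>auto intro: order_trans[OF _ abs_ge_self]\<close>)
  have "cmod (LINT \<eta>|lborel. complex_of_real (kap \<xi> \<eta>) * a (\<xi> - \<eta>) * b \<eta>) \<le> (LINT \<eta>|lborel. ?w \<eta>)"
    by (rule order_trans[OF integral_norm_bound]) (rule integral_mono[OF integrable_norm[OF i] w le])
  also have "\<dots> = norm \<xi> * (LINT \<eta>|lborel. cmod (a (\<xi> - \<eta>)) * cmod (b \<eta>))" by (rule integral_mult_right_zero)
  also have "\<dots> \<le> norm \<xi> * (n2 a * n2 b)" using L2_CS[OF L(1) assms(2)] L(2) by (intro mult_left_mono) auto
  finally show "cmod (LINT \<eta>|lborel. complex_of_real (kap \<xi> \<eta>) * a (\<xi> - \<eta>) * b \<eta>) \<le> norm \<xi> * n2 a * n2 b" by (simp add: mult.assoc)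
qed

lemma inverse_2pi_sq: "0 < 1 / (2*pi)\<^sup>2" "1 / (2*pi)\<^sup>2 \<le> 1"
proof -
  have "1 \<le> 2 * pi" using pi_gt3 by simp
  then have "1 \<le> (2 * pi)\<^sup>2" by (rule one_le_power)
  then show "1 / (2*pi)\<^sup>2 \<le> 1" by (simp add: divide_le_eq_1)
qed simp

lemma cmod_inverse_2pi: "cmod (complex_of_real (1 / (2*pi)\<^sup>2) * z) \<le> cmod z"
  unfolding norm_mult norm_of_real abs_of_pos[OF inverse_2pi_sq(1)]
  by (rule mult_left_le_one_le[OF norm_ge_zero less_imp_le[OF inverse_2pi_sq(1)] inverse_2pi_sq(2)])

lemma NL_bound:
  assumes "L2c a" "L2c b"
  shows "cmod (NL a b \<xi>) \<le> norm \<xi> * n2 a * n2 b"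
  unfolding NL_def by (rule order_trans[OF cmod_inverse_2pi NL_integrable_aux(2)[OF assms]])

lemma NL_diff_left:
  assumes "L2c a" "L2c a'" "L2c b"
  shows "NL (\<lambda>x. a x - a' x) b \<xi> = NL a b \<xi> - NL a' b \<xi>"
  unfolding NL_def using NL_integrable_aux(1)[OF assms(1,3)] NL_integrable_aux(1)[OF assms(2,3)]
  by (simp add: left_diff_distrib right_diff_distrib del: of_real_divide)

lemma NL_diff_right:
  assumes "L2c a" "L2c b" "L2c b'"
  shows "NL a (\<lambda>x. b x - b' x) \<xi> = NL a b \<xi> - NL a b' \<xi>"
  unfolding NL_def using NL_integrable_aux(1)[OF assms(1,2)] NL_integrable_aux(1)[OF assms(1,3)]
  by (simp add: right_diff_distrib del: of_real_divide)

lemma NL_diff: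
  assumes "L2c a" "L2c b"
  shows "NL a a \<xi> - NL b b \<xi> = NL (\<lambda>x. a x - b x) a \<xi> + NL b (\<lambda>x. a x - b x) \<xi>"
  using NL_diff_left[OF assms assms(1)] NL_diff_right[OF assms(2) assms] by simp

lemma NL_lipschitz:
  assumes "L2c a" "L2c b"
  shows "cmod (NL a a \<xi> - NL b b \<xi>) \<le> norm \<xi> * (n2 a + n2 b) * n2 (\<lambda>x. a x - b x)"
proof -
  have d: "L2c (\<lambda>x. a x - b x)" using assms by auto
  have "cmod (NL a a \<xi> - NL b b \<xi>) \<le> norm \<xi> * n2 (\<lambda>x. a x - b x) * n2 a + norm \<xi> * n2 b * n2 (\<lambda>x. a x - b x)"
    unfolding NL_diff[OF assms]
    by (rule order_trans[OF norm_triangle_ineq add_mono[OF NL_bound[OF d assms(1)] NL_bound[OF assms(2) d]]])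
  then show ?thesis by (simp add: algebra_simps)
qed

lemma NL_cmult: "NL (\<lambda>x. c * a x) (\<lambda>x. c * b x) \<xi> = c\<^sup>2 * NL a b \<xi>"
proof -
  have "(LINT \<eta>|lborel. complex_of_real (kap \<xi> \<eta>) * (c * a (\<xi> - \<eta>)) * (c * b \<eta>)) = (LINT \<eta>|lborel. c\<^sup>2 * (complex_of_real (kap \<xi> \<eta>) * a (\<xi> - \<eta>) * b \<eta>))"
    by (rule Bochner_Integration.integral_cong) (simp_all add: power2_eq_square mult_ac)
  also have "\<dots> = c\<^sup>2 * (LINT \<eta>|lborel. complex_of_real (kap \<xi> \<eta>) * a (\<xi> - \<eta>) * b \<eta>)"
    by (rule integral_mult_right_zero)
  finally show ?thesis unfolding NL_def by (simp add: mult_ac)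
qed

text \<open>\<open>kap\<close> is unchanged when both arguments change sign; this keeps solutions
  with real data real.\<close>

lemma NL_hermitian:
  assumes "\<And>x. a (- x) = cnj (a x)" "\<And>x. b (- x) = cnj (b x)"
  shows "NL a b (- \<xi>) = cnj (NL a b \<xi>)"
proof -
  have "a (- \<xi> - - \<eta>) = cnj (a (\<xi> - \<eta>))" for \<eta>
  proof -
    have "- \<xi> - - \<eta> = - (\<xi> - \<eta>)" by simp
    then show ?thesis by (simp only: assms(1))
  qed
  then have "(LINT \<eta>|lborel. complex_of_real (kap (- \<xi>) (- \<eta>)) * a (- \<xi> - - \<eta>) * b (- \<eta>)) = cnj (LINT \<eta>|lborel. complex_of_real (kap \<xi> \<eta>) * a (\<xi> - \<eta>) * b \<eta>)"
    unfolding cnj_lint by (intro Bochner_Integration.integral_cong) (simp_all add: kap_minus assms(2))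
  then show ?thesis
    unfolding NL_def using integral_uminus[of "\<lambda>\<eta>. complex_of_real (kap (- \<xi>) \<eta>) * a (- \<xi> - \<eta>) * b \<eta>"] by simp
qed

text \<open>Instantiated with a jointly measurable w, this becomes a rule by which the
  \<open>measurable\<close> method decomposes any expression w (f x) (g x).\<close>

lemma measurable_pair_apply:
  assumes w: "(\<lambda>(t, \<xi>). w t \<xi>) \<in> borel_measurable (borel \<Otimes>\<^sub>M borel)"
    and "f \<in> borel_measurable M" "g \<in> borel_measurable M"
  shows "(\<lambda>x. w (f x) (g x)) \<in> borel_measurable M"
  using measurable_compose[OF measurable_Pair[OF assms(2,3)] w] by simp

lemma NL_measurable:
  fixes w :: "real \<Rightarrow> pt \<Rightarrow> complex"
  assumes w: "(\<lambda>(t, \<xi>). w t \<xi>) \<in> borel_measurable (borel \<Otimes>\<^sub>M borel)"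
  shows "(\<lambda>(t, \<xi>). NL (w t) (w t) \<xi>) \<in> borel_measurable (borel \<Otimes>\<^sub>M borel)"
proof -
  note [measurable (raw)] = measurable_pair_apply[OF w]
  show ?thesis unfolding NL_def split_beta' by measurable
qed

lemma NL_measurable1:
  assumes [measurable]: "a \<in> borel_measurable borel" "b \<in> borel_measurable borel"
  shows "NL a b \<in> borel_measurable borel"
  unfolding NL_def[abs_def] by measurable

lemma NL_pair_bound:
  assumes [measurable]: "a \<in> borel_measurable borel" "b \<in> borel_measurable borel" "d \<in> borel_measurable borel"
    and le: "kap_form a b d \<le> ennreal K" and K: "0 \<le> K"
  shows "integrable lborel (\<lambda>\<xi>. cmod (NL a b \<xi>) * cmod (d \<xi>))"
    and "(LINT \<xi>|lborel. cmod (NL a b \<xi>) * cmod (d \<xi>)) \<le> K"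
proof -
  note [measurable] = NL_measurable1[OF assms(1,2)]
  have "(\<integral>\<^sup>+\<xi>. ennreal (cmod (NL a b \<xi>) * cmod (d \<xi>)) \<partial>lborel) \<le> (\<integral>\<^sup>+\<xi>. \<integral>\<^sup>+\<eta>. ennreal (\<bar>kap \<xi> \<eta>\<bar> * cmod (a (\<xi> - \<eta>)) * cmod (b \<eta>) * cmod (d \<xi>)) \<partial>lborel \<partial>lborel)"
  proof (rule nn_integral_mono)
    fix \<xi>
    have "ennreal (cmod (NL a b \<xi>)) \<le> ennreal (cmod (LINT \<eta>|lborel. complex_of_real (kap \<xi> \<eta>) * a (\<xi> - \<eta>) * b \<eta>))"
      unfolding NL_def by (intro ennreal_leI cmod_inverse_2pi)
    \<comment> \<open>No L2 assumption guarantees the inner integral at this point; where it does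
      not exist, its default value 0 satisfies the bound.\<close>
    also have "\<dots> \<le> (\<integral>\<^sup>+\<eta>. ennreal (cmod (complex_of_real (kap \<xi> \<eta>) * a (\<xi> - \<eta>) * b \<eta>)) \<partial>lborel)"
      by (cases "integrable lborel (\<lambda>\<eta>. complex_of_real (kap \<xi> \<eta>) * a (\<xi> - \<eta>) * b \<eta>)")
         (auto simp: not_integrable_integral_eq intro: integral_norm_bound_ennreal)
    finally have "ennreal (cmod (NL a b \<xi>)) * ennreal (cmod (d \<xi>)) \<le> (\<integral>\<^sup>+\<eta>. ennreal (cmod (complex_of_real (kap \<xi> \<eta>) * a (\<xi> - \<eta>) * b \<eta>)) \<partial>lborel) * ennreal (cmod (d \<xi>))"
      by (rule mult_right_mono) simp
    also have "\<dots> = (\<integral>\<^sup>+\<eta>. ennreal (cmod (complex_of_real (kap \<xi> \<eta>) * a (\<xi> - \<eta>) * b \<eta>)) * ennreal (cmod (d \<xi>)) \<partial>lborel)"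
      by (rule nn_integral_multc[symmetric]) measurable
    also have "\<dots> = (\<integral>\<^sup>+\<eta>. ennreal (\<bar>kap \<xi> \<eta>\<bar> * cmod (a (\<xi> - \<eta>)) * cmod (b \<eta>) * cmod (d \<xi>)) \<partial>lborel)"
      by (simp add: norm_mult ennreal_mult)
    finally show "ennreal (cmod (NL a b \<xi>) * cmod (d \<xi>)) \<le> (\<integral>\<^sup>+\<eta>. ennreal (\<bar>kap \<xi> \<eta>\<bar> * cmod (a (\<xi> - \<eta>)) * cmod (b \<eta>) * cmod (d \<xi>)) \<partial>lborel)"
      by (simp add: ennreal_mult)
  qed
  also have "\<dots> = (kap_form a b d)"
    by (subst lborel.nn_integral_fst[symmetric]) auto
  also note le
  finally have *: "(\<integral>\<^sup>+\<xi>. ennreal (cmod (NL a b \<xi>) * cmod (d \<xi>)) \<partial>lborel) \<le> ennreal K" .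
  show i: "integrable lborel (\<lambda>\<xi>. cmod (NL a b \<xi>) * cmod (d \<xi>))"
    by (rule integrableI_bounded) (use le_less_trans[OF *] in \<open>auto simp: abs_mult\<close>)
  have "ennreal (LINT \<xi>|lborel. cmod (NL a b \<xi>) * cmod (d \<xi>)) \<le> ennreal K"
    using * nn_integral_eq_integral[OF i] by simp
  then show "(LINT \<xi>|lborel. cmod (NL a b \<xi>) * cmod (d \<xi>)) \<le> K" using K by (simp add: ennreal_le_iff)
qed

text \<open>Exchanging \<open>\<xi>\<close> and \<open>\<eta>\<close> conjugates the integrand and, since \<open>kap\<close> is antisymmetric, reverses its
  sign: this is the incompressibility of the velocity field.\<close>

lemma NL_symmetrize:
  assumes [measurable]: "a \<in> borel_measurable borel" "b \<in> borel_measurable borel"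
    and herm: "\<And>x. a (- x) = cnj (a x)"
    and fin: "(kap_form a b b) < \<infinity>"
    and m [measurable]: "m \<in> borel_measurable borel" and mb: "\<And>\<xi>. \<bar>m \<xi>\<bar> \<le> B"
  shows "integrable lborel (\<lambda>\<xi>. complex_of_real (m \<xi>) * (NL a b \<xi> * cnj (b \<xi>)))" (is ?I)
    and "ennreal \<bar>2 * Re (LINT \<xi>|lborel. complex_of_real (m \<xi>) * (NL a b \<xi> * cnj (b \<xi>)))\<bar> \<le>
       (\<integral>\<^sup>+(\<xi>, \<eta>). ennreal (\<bar>kap \<xi> \<eta>\<bar> * \<bar>m \<xi> - m \<eta>\<bar> * cmod (a (\<xi> - \<eta>)) * cmod (b \<eta>) * cmod (b \<xi>)) \<partial>lborel2)" (is ?E)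
proof -
  define X where "X = (\<lambda>(\<xi>, \<eta>). complex_of_real (kap \<xi> \<eta>) * a (\<xi> - \<eta>) * b \<eta> * cnj (b \<xi>))"
  have [measurable]: "X \<in> borel_measurable lborel2" unfolding X_def by measurable
  have X: "integrable lborel2 X"
    by (rule integrableI_bounded) (use fin in \<open>auto simp: X_def norm_mult split_beta'\<close>)
  have B0: "0 \<le> B" using mb[of 0] by linarith
  have bdd: "integrable lborel2 (\<lambda>p. complex_of_real (m (f p)) * X p)"
    if [measurable]: "f \<in> borel_measurable lborel2" for f
  proof (rule Bochner_Integration.integrable_bound[OF integrable_mult_right[OF X, of "complex_of_real B"]])
    have "cmod (complex_of_real (m (f p)) * X p) \<le> cmod (complex_of_real B * X p)" for p
      unfolding norm_mult using mb[of "f p"] B0 by (intro mult_right_mono) auto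
    then show "AE p in lborel \<Otimes>\<^sub>M lborel. cmod (complex_of_real (m (f p)) * X p) \<le> cmod (complex_of_real B * X p)" by simp
  qed measurable
  have i1: "integrable lborel2 (\<lambda>p. complex_of_real (m (fst p)) * X p)"
    and i2: "integrable lborel2 (\<lambda>p. complex_of_real (m (snd p)) * X p)"
    by (rule bdd, measurable)+
  let ?c = "complex_of_real (1 / (2*pi)\<^sup>2)"
  have inner: "?c * (LINT \<eta>|lborel. complex_of_real (m \<xi>) * X (\<xi>, \<eta>)) = complex_of_real (m \<xi>) * (NL a b \<xi> * cnj (b \<xi>))" for \<xi>
  proof -
    have "(LINT \<eta>|lborel. complex_of_real (m \<xi>) * X (\<xi>, \<eta>)) = (LINT \<eta>|lborel. (complex_of_real (m \<xi>) * cnj (b \<xi>)) * (complex_of_real (kap \<xi> \<eta>) * a (\<xi> - \<eta>) * b \<eta>))"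
      by (rule Bochner_Integration.integral_cong) (simp_all add: X_def mult_ac)
    also have "\<dots> = (complex_of_real (m \<xi>) * cnj (b \<xi>)) * (LINT \<eta>|lborel. complex_of_real (kap \<xi> \<eta>) * a (\<xi> - \<eta>) * b \<eta>)"
      by (rule integral_mult_right_zero)
    finally show ?thesis unfolding NL_def by (simp only: mult_ac)
  qed
  have i1': "integrable lborel2 (\<lambda>(\<xi>, \<eta>). complex_of_real (m \<xi>) * X (\<xi>, \<eta>))" using i1 by (simp add: split_beta')
  have "integrable lborel (\<lambda>\<xi>. ?c * (LINT \<eta>|lborel. complex_of_real (m \<xi>) * X (\<xi>, \<eta>)))"
    by (intro integrable_mult_right lborel_pair.integrable_fst[OF i1'])
  then show ?I unfolding inner .
  have J: "(LINT \<xi>|lborel. complex_of_real (m \<xi>) * (NL a b \<xi> * cnj (b \<xi>))) = ?c * (LINT p|lborel2. complex_of_real (m (fst p)) * X p)"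
  proof -
    have "(LINT \<xi>|lborel. complex_of_real (m \<xi>) * (NL a b \<xi> * cnj (b \<xi>))) = ?c * (LINT \<xi>|lborel. LINT \<eta>|lborel. complex_of_real (m \<xi>) * X (\<xi>, \<eta>))"
      unfolding inner[symmetric] by (rule integral_mult_right_zero)
    also have "(LINT \<xi>|lborel. LINT \<eta>|lborel. complex_of_real (m \<xi>) * X (\<xi>, \<eta>)) = (LINT p|lborel2. complex_of_real (m (fst p)) * X p)"
      using lborel_pair.integral_fst[OF i1'] by (simp add: split_beta')
    finally show ?thesis .
  qed
  have swap: "(LINT p|lborel2. complex_of_real (m (fst p)) * X p) = - cnj (LINT p|lborel2. complex_of_real (m (snd p)) * X p)"
  proof -
    have Xs: "X (\<eta>, \<xi>) = - cnj (X (\<xi>, \<eta>))" for \<xi> \<eta>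
      using herm[of "\<xi> - \<eta>"] by (simp add: X_def kap_antisym[of \<eta> \<xi>] mult_ac)
    have *: "complex_of_real (m \<eta>) * X (\<eta>, \<xi>) = - cnj (complex_of_real (m \<eta>) * X (\<xi>, \<eta>))" for \<xi> \<eta>
      by (simp only: Xs[of \<eta> \<xi>]) simp
    have "(LINT p|lborel2. complex_of_real (m (fst p)) * X p) = (LINT q|lborel2. (\<lambda>(\<xi>, \<eta>). complex_of_real (m \<eta>) * X (\<eta>, \<xi>)) q)"
      by (subst lborel_pair.integral_product_swap[symmetric]) (auto simp: split_beta')
    also have "\<dots> = (LINT p|lborel2. - cnj (complex_of_real (m (snd p)) * X p))"
      unfolding * by (simp add: split_beta')
    also have "\<dots> = - cnj (LINT p|lborel2. complex_of_real (m (snd p)) * X p)"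
      unfolding cnj_lint by (rule integral_minus)
    finally show ?thesis .
  qed
  \<comment> \<open>The real part of -cnj z is -Re z, so the expressions with m at xi and with m at
    eta differ by a sign; their mean contains only the difference of the two weights. For constant m
    nothing is left.\<close>
  have "2 * Re (LINT p|lborel2. complex_of_real (m (fst p)) * X p) =
    Re (LINT p|lborel2. complex_of_real (m (fst p)) * X p) - Re (LINT p|lborel2. complex_of_real (m (snd p)) * X p)"
    using arg_cong[OF swap, of Re] by simp
  also have "\<dots> = Re (LINT p|lborel2. complex_of_real (m (fst p)) * X p - complex_of_real (m (snd p)) * X p)"
    using Bochner_Integration.integral_diff[OF i1 i2] by simp
  finally have R: "2 * Re (LINT p|lborel2. complex_of_real (m (fst p)) * X p) = Re (LINT p|lborel2. complex_of_real (m (fst p)) * X p - complex_of_real (m (snd p)) * X p)" .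
  have "\<bar>2 * Re (LINT \<xi>|lborel. complex_of_real (m \<xi>) * (NL a b \<xi> * cnj (b \<xi>)))\<bar> = 1 / (2*pi)\<^sup>2 * \<bar>2 * Re (LINT p|lborel2. complex_of_real (m (fst p)) * X p)\<bar>"
  proof -
    have "2 * Re (complex_of_real r * z) = r * (2 * Re z)" for z r by simp
    then show ?thesis unfolding J by (simp only: abs_mult[of "1 / (2*pi)\<^sup>2"] abs_of_pos[OF inverse_2pi_sq(1)])
  qed
  also have "\<dots> \<le> \<bar>2 * Re (LINT p|lborel2. complex_of_real (m (fst p)) * X p)\<bar>"
    by (rule mult_left_le_one_le[OF abs_ge_zero less_imp_le[OF inverse_2pi_sq(1)] inverse_2pi_sq(2)])
  also have "\<dots> \<le> cmod (LINT p|lborel2. complex_of_real (m (fst p)) * X p - complex_of_real (m (snd p)) * X p)"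
    unfolding R by (rule abs_Re_le_cmod)
  finally have "ennreal \<bar>2 * Re (LINT \<xi>|lborel. complex_of_real (m \<xi>) * (NL a b \<xi> * cnj (b \<xi>)))\<bar> \<le> ennreal (cmod (LINT p|lborel2. complex_of_real (m (fst p)) * X p - complex_of_real (m (snd p)) * X p))"
    by (rule ennreal_leI)
  also have "\<dots> \<le> (\<integral>\<^sup>+p. ennreal (cmod (complex_of_real (m (fst p)) * X p - complex_of_real (m (snd p)) * X p)) \<partial>lborel2)"
    by (rule integral_norm_bound_ennreal) (rule Bochner_Integration.integrable_diff[OF i1 i2])
  also have "\<dots> = (\<integral>\<^sup>+(\<xi>, \<eta>). ennreal (\<bar>kap \<xi> \<eta>\<bar> * \<bar>m \<xi> - m \<eta>\<bar> * cmod (a (\<xi> - \<eta>)) * cmod (b \<eta>) * cmod (b \<xi>)) \<partial>lborel2)"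
  proof (rule nn_integral_cong, clarify)
    fix \<xi> \<eta>
    have "complex_of_real (m \<xi>) * X (\<xi>, \<eta>) - complex_of_real (m \<eta>) * X (\<xi>, \<eta>) = complex_of_real (m \<xi> - m \<eta>) * X (\<xi>, \<eta>)"
      by (simp add: left_diff_distrib)
    then have "cmod (complex_of_real (m \<xi>) * X (\<xi>, \<eta>) - complex_of_real (m \<eta>) * X (\<xi>, \<eta>)) = \<bar>m \<xi> - m \<eta>\<bar> * cmod (X (\<xi>, \<eta>))"
      by (simp only: norm_mult norm_of_real)
    then show "ennreal (cmod (complex_of_real (m (fst (\<xi>, \<eta>))) * X (\<xi>, \<eta>) - complex_of_real (m (snd (\<xi>, \<eta>))) * X (\<xi>, \<eta>))) = ennreal (\<bar>kap \<xi> \<eta>\<bar> * \<bar>m \<xi> - m \<eta>\<bar> * cmod (a (\<xi> - \<eta>)) * cmod (b \<eta>) * cmod (b \<xi>))"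
      by (simp add: X_def norm_mult mult_ac)
  qed
  finally show ?E .
qed

section \<open>Duhamel formula and continuity in L2\<close>

text \<open>The solution of y' = -l y - f with initial value w0, one scalar equation for each
  frequency, so that no integration of curves in L2 is involved.\<close>

definition duh :: "(pt \<Rightarrow> real) \<Rightarrow> (pt \<Rightarrow> complex) \<Rightarrow> (real \<Rightarrow> pt \<Rightarrow> complex) \<Rightarrow> real \<Rightarrow> pt \<Rightarrow> complex" where
  "duh l w0 f t \<xi> = complex_of_real (exp (- t * l \<xi>)) * w0 \<xi>
     - (LINT \<tau>:{0..t}|lborel. complex_of_real (exp (- (t - \<tau>) * l \<xi>)) * f \<tau> \<xi>)"

section \<open>Joint measurability in time and frequency, and calculus for the Duhamel
  formula\<close>

abbreviation jmeas :: "(real \<Rightarrow> pt \<Rightarrow> complex) \<Rightarrow> bool" where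
  "jmeas w \<equiv> (\<lambda>(t, \<xi>). w t \<xi>) \<in> borel_measurable (borel \<Otimes>\<^sub>M borel)"

lemma jmeas_slice: assumes "jmeas w" shows "w t \<in> borel_measurable borel"
  using measurable_pair_apply[OF assms, of "\<lambda>_. t" borel "\<lambda>x. x"] by simp

lemma jmeas_n2: assumes "jmeas w" shows "(\<lambda>t. n2 (w t)) \<in> borel_measurable borel"
proof -
  note [measurable (raw)] = measurable_pair_apply[OF assms]
  show ?thesis unfolding n2_def L2norm_sq_def by measurable
qed

lemma duh_measurable:
  assumes f: "jmeas f" and [measurable]: "l \<in> borel_measurable borel" "w0 \<in> borel_measurable borel"
  shows "jmeas (duh l w0 f)"
proof -
  note [measurable (raw)] = measurable_pair_apply[OF f]
  show ?thesis
    unfolding duh_def set_lebesgue_integral_def split_beta' indicator_def atLeastAtMost_iff by measurable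
qed

lemma set_integrable_continuous:
  fixes g :: "real \<Rightarrow> 'b::{banach, second_countable_topology}"
  assumes "continuous_on {0..} g" "0 \<le> r"
  shows "set_integrable lborel {r..t} g"
  by (rule borel_integrable_atLeastAtMost') (rule continuous_on_subset[OF assms(1)], use assms(2) in auto)

lemma at_within_Ici: assumes "0 \<le> (t::real)" shows "at t within {0..} = at t within {0..t+1}"
  by (rule at_within_nhd[of _ "{..<t+1}"]) auto

text \<open>Taking exp (-t l) out of the integral leaves an integrand independent of t, to which the
  fundamental theorem of calculus applies.\<close>

lemma duh_alt:
  fixes f :: "real \<Rightarrow> pt \<Rightarrow> complex"
  assumes c: "continuous_on {0..} (\<lambda>\<tau>. f \<tau> \<xi>)"
  shows "duh l w0 f t \<xi> = complex_of_real (exp (- t * l \<xi>)) * (w0 \<xi> - integral {0..t} (\<lambda>\<tau>. complex_of_real (exp (\<tau> * l \<xi>)) * f \<tau> \<xi>))"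
proof -
  let ?g = "\<lambda>\<tau>. complex_of_real (exp (\<tau> * l \<xi>)) * f \<tau> \<xi>"
  have cg: "continuous_on {0..} ?g" by (intro continuous_intros c)
  have "(LINT \<tau>:{0..t}|lborel. complex_of_real (exp (- (t - \<tau>) * l \<xi>)) * f \<tau> \<xi>) = (LINT \<tau>:{0..t}|lborel. complex_of_real (exp (- t * l \<xi>)) * ?g \<tau>)"
  proof (rule set_lebesgue_integral_cong)
    have "exp (- (t - \<tau>) * l \<xi>) = exp (- t * l \<xi>) * exp (\<tau> * l \<xi>)" for \<tau>
      unfolding exp_add[symmetric] by (rule arg_cong[where f=exp]) (simp add: algebra_simps)
    then show "\<forall>\<tau>. \<tau> \<in> {0..t} \<longrightarrow> complex_of_real (exp (- (t - \<tau>) * l \<xi>)) * f \<tau> \<xi> = complex_of_real (exp (- t * l \<xi>)) * ?g \<tau>"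
      by (simp add: mult.assoc)
  qed simp
  also have "\<dots> = complex_of_real (exp (- t * l \<xi>)) * (LINT \<tau>:{0..t}|lborel. ?g \<tau>)"
    by (rule set_integral_mult_right)
  also have "(LINT \<tau>:{0..t}|lborel. ?g \<tau>) = integral {0..t} ?g"
    using set_borel_integral_eq_integral(2)[OF set_integrable_continuous[OF cg, of 0 t]] by simp
  finally show ?thesis unfolding duh_def by (simp add: right_diff_distrib)
qed

lemma duh_deriv:
  fixes f :: "real \<Rightarrow> pt \<Rightarrow> complex"
  assumes c: "continuous_on {0..} (\<lambda>\<tau>. f \<tau> \<xi>)" and t: "0 \<le> t"
  shows "((\<lambda>t. duh l w0 f t \<xi>) has_vector_derivative (- complex_of_real (l \<xi>) * duh l w0 f t \<xi> - f t \<xi>)) (at t within {0..})"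
proof -
  let ?g = "\<lambda>\<tau>. complex_of_real (exp (\<tau> * l \<xi>)) * f \<tau> \<xi>"
  have cg: "continuous_on {0..t+1} ?g" by (intro continuous_intros continuous_on_subset[OF c]) auto
  have e1: "((\<lambda>t. complex_of_real (exp (- t * l \<xi>))) has_vector_derivative complex_of_real (- l \<xi> * exp (- t * l \<xi>))) (at t within {0..t+1})"
    unfolding has_real_derivative_iff_has_vector_derivative[symmetric]
    by (rule has_vector_derivative_of_real) (auto intro!: derivative_eq_intros simp: has_real_derivative_iff_has_vector_derivative[symmetric])
  have e2: "((\<lambda>t. w0 \<xi> - integral {0..t} ?g) has_vector_derivative (0 - ?g t)) (at t within {0..t+1})"
    by (intro derivative_intros integral_has_vector_derivative[OF cg]) (use t in auto)
  have "((\<lambda>t. complex_of_real (exp (- t * l \<xi>)) * (w0 \<xi> - integral {0..t} ?g)) has_vector_derivative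
      (complex_of_real (exp (- t * l \<xi>)) * (0 - ?g t) + complex_of_real (- l \<xi> * exp (- t * l \<xi>)) * (w0 \<xi> - integral {0..t} ?g))) (at t within {0..t+1})"
    by (rule has_vector_derivative_mult[OF e1 e2])
  moreover have E: "complex_of_real (exp (- t * l \<xi>)) * ?g t = f t \<xi>"
    by (simp add: mult.assoc[symmetric] of_real_mult[symmetric] exp_minus del: of_real_mult)
  have "complex_of_real (exp (- t * l \<xi>)) * (0 - ?g t) + complex_of_real (- l \<xi> * exp (- t * l \<xi>)) * (w0 \<xi> - integral {0..t} ?g)
    = - complex_of_real (l \<xi>) * (complex_of_real (exp (- t * l \<xi>)) * (w0 \<xi> - integral {0..t} ?g)) - complex_of_real (exp (- t * l \<xi>)) * ?g t"
    by simp
  ultimately show ?thesis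
    unfolding at_within_Ici[OF t] duh_alt[where f=f and \<xi>=\<xi>, OF c] E by (simp only:)
qed

text \<open>As l \<ge> 0, all exponential factors are at most 1 and the bound does not depend on l.
  Taking g = 0 and w1 = 0 also yields plain bounds on \<open>duh\<close>.\<close>

lemma duh_diff_bound:
  fixes f g :: "real \<Rightarrow> pt \<Rightarrow> complex"
  assumes c: "continuous_on {0..} (\<lambda>\<tau>. f \<tau> \<xi>)" "continuous_on {0..} (\<lambda>\<tau>. g \<tau> \<xi>)"
    and l: "0 \<le> l \<xi>" and t: "0 \<le> t"
    and h: "set_integrable lborel {0..t} h" "\<And>\<tau>. \<tau> \<in> {0..t} \<Longrightarrow> cmod (f \<tau> \<xi> - g \<tau> \<xi>) \<le> h \<tau>"
  shows "cmod (duh l w0 f t \<xi> - duh l w1 g t \<xi>) \<le> cmod (w0 \<xi> - w1 \<xi>) + (LINT \<tau>:{0..t}|lborel. h \<tau>)"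
proof -
  let ?e = "\<lambda>\<tau>. complex_of_real (exp (- (t - \<tau>) * l \<xi>))"
  have i: "set_integrable lborel {0..t} (\<lambda>\<tau>. ?e \<tau> * f \<tau> \<xi>)" "set_integrable lborel {0..t} (\<lambda>\<tau>. ?e \<tau> * g \<tau> \<xi>)"
    by (intro set_integrable_continuous continuous_intros c order_refl)+
  have eq: "duh l w0 f t \<xi> - duh l w1 g t \<xi> = complex_of_real (exp (- t * l \<xi>)) * (w0 \<xi> - w1 \<xi>) - (LINT \<tau>:{0..t}|lborel. ?e \<tau> * f \<tau> \<xi> - ?e \<tau> * g \<tau> \<xi>)"
    unfolding duh_def set_integral_diff(2)[OF i] by (simp add: algebra_simps)
  have 1: "cmod (complex_of_real (exp (- t * l \<xi>)) * (w0 \<xi> - w1 \<xi>)) \<le> cmod (w0 \<xi> - w1 \<xi>)"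
    unfolding norm_mult using l t by (intro mult_left_le_one_le) auto
  have 2: "cmod (LINT \<tau>:{0..t}|lborel. ?e \<tau> * f \<tau> \<xi> - ?e \<tau> * g \<tau> \<xi>) \<le> (LINT \<tau>:{0..t}|lborel. h \<tau>)"
  proof (rule order_trans[OF set_integral_norm_bound[OF set_integral_diff(1)[OF i]]], rule set_integral_mono)
    show "set_integrable lborel {0..t} (\<lambda>\<tau>. cmod (?e \<tau> * f \<tau> \<xi> - ?e \<tau> * g \<tau> \<xi>))"
      by (rule set_integrable_norm[OF set_integral_diff(1)[OF i]])
    fix \<tau> assume \<tau>: "\<tau> \<in> {0..t}"
    have "cmod (?e \<tau> * f \<tau> \<xi> - ?e \<tau> * g \<tau> \<xi>) = exp (- (t - \<tau>) * l \<xi>) * cmod (f \<tau> \<xi> - g \<tau> \<xi>)"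
      unfolding right_diff_distrib[symmetric] norm_mult by simp
    also have "\<dots> \<le> cmod (f \<tau> \<xi> - g \<tau> \<xi>)"
      using \<tau> l mult_nonpos_nonneg[of "\<tau> - t" "l \<xi>"] by (intro mult_left_le_one_le) auto
    also have "\<dots> \<le> h \<tau>" by (rule h(2)[OF \<tau>])
    finally show "cmod (?e \<tau> * f \<tau> \<xi> - ?e \<tau> * g \<tau> \<xi>) \<le> h \<tau>" .
  qed (rule h(1))
  show ?thesis unfolding eq by (rule order_trans[OF norm_triangle_ineq4 add_mono[OF 1 2]])
qed

section \<open>Curves continuous into L2\<close>

definition l2cont :: "(real \<Rightarrow> pt \<Rightarrow> complex) \<Rightarrow> bool" where
  "l2cont u \<longleftrightarrow> (\<forall>t\<ge>0. L2c (u t)) \<and> (\<forall>t\<ge>0. ((\<lambda>\<tau>. n2 (\<lambda>\<xi>. u \<tau> \<xi> - u t \<xi>)) \<longlongrightarrow> 0) (at t within {0..}))"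

lemma l2cont_L2c: "l2cont u \<Longrightarrow> 0 \<le> t \<Longrightarrow> L2c (u t)"
  by (simp add: l2cont_def)

lemma l2cont_dominated:
  assumes meas: "jmeas u" and cont: "\<And>\<xi>. continuous_on {0..} (\<lambda>t. u t \<xi>)"
    and dom: "\<And>T. 0 \<le> T \<Longrightarrow> \<exists>h. L2c h \<and> (\<forall>t\<in>{0..T}. \<forall>\<xi>. cmod (u t \<xi>) \<le> cmod (h \<xi>))"
  shows "l2cont u"
  unfolding l2cont_def
proof (intro conjI allI impI)
  note [measurable] = jmeas_slice[OF meas]
  show L: "L2c (u t)" if t: "0 \<le> t" for t
  proof -
    obtain h where h: "L2c h" "\<And>\<xi>. cmod (u t \<xi>) \<le> cmod (h \<xi>)" using dom[of t] t by auto
    show ?thesis by (rule L2c_mono(1)[OF h(1), where B=1]) (use h in auto)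
  qed
  fix t :: real assume t: "0 \<le> t"
  show "((\<lambda>\<tau>. n2 (\<lambda>\<xi>. u \<tau> \<xi> - u t \<xi>)) \<longlongrightarrow> 0) (at t within {0..})"
    unfolding tendsto_at_iff_sequentially
  proof (intro allI impI)
    fix X :: "nat \<Rightarrow> real" assume X: "\<forall>i. X i \<in> {0..} - {t}" "X \<longlonglongrightarrow> t"
    from convergent_imp_Bseq[OF convergentI[OF X(2)]] obtain T where T: "0 < T" "\<And>i. norm (X i) \<le> T" by (auto elim: BseqE)
    obtain h where h: "L2c h" "\<And>s \<xi>. s \<in> {0..T + t} \<Longrightarrow> cmod (u s \<xi>) \<le> cmod (h \<xi>)" using dom[of "T + t"] T t by auto
    have "(\<lambda>i. n2 (\<lambda>\<xi>. u (X i) \<xi> - u t \<xi>)) \<longlonglongrightarrow> 0"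
    proof (rule L2_dominated[OF _ L2c_cmult[OF h(1), of 2]])
      show "AE \<xi> in lborel. (\<lambda>i. u (X i) \<xi> - u t \<xi>) \<longlonglongrightarrow> 0"
      proof (rule AE_I2)
        fix \<xi>
        have "(\<lambda>i. u (X i) \<xi>) \<longlonglongrightarrow> u t \<xi>"
          by (rule continuous_on_tendsto_compose[OF cont X(2)]) (use X t in auto)
        then show "(\<lambda>i. u (X i) \<xi> - u t \<xi>) \<longlonglongrightarrow> 0" by (rule LIM_zero)
      qed
      show "AE \<xi> in lborel. cmod (u (X i) \<xi> - u t \<xi>) \<le> cmod (2 * h \<xi>)" for i
      proof (rule AE_I2)
        fix \<xi>
        have "X i \<in> {0..T+t}" "t \<in> {0..T+t}" using X(1) T(1) T(2)[of i] t by (auto simp: abs_le_iff)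
        then have "cmod (u (X i) \<xi> - u t \<xi>) \<le> cmod (h \<xi>) + cmod (h \<xi>)"
          by (intro order_trans[OF norm_triangle_ineq4 add_mono] h(2))
        then show "cmod (u (X i) \<xi> - u t \<xi>) \<le> cmod (2 * h \<xi>)" by (simp add: norm_mult)
      qed
    qed auto
    then show "((\<lambda>\<tau>. n2 (\<lambda>\<xi>. u \<tau> \<xi> - u t \<xi>)) \<circ> X) \<longlonglongrightarrow> 0" by (simp add: o_def)
  qed
qed

text \<open>The modulus C (1 + |b| + |a - b|) |a - b| is wide enough for a quadratic map such as
  \<open>NL\<close> at a fixed frequency and for the globally Lipschitz \<open>GN\<close>.\<close>

lemma l2cont_Lipschitz_continuous:
  fixes G :: "(pt \<Rightarrow> complex) \<Rightarrow> complex"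
  assumes u: "l2cont u"
    and G: "\<And>a b. L2c a \<Longrightarrow> L2c b \<Longrightarrow> cmod (G a - G b) \<le> C * (1 + n2 b + n2 (\<lambda>x. a x - b x)) * n2 (\<lambda>x. a x - b x)"
  shows "continuous_on {0..} (\<lambda>\<tau>. G (u \<tau>))"
  unfolding continuous_on_def
proof
  fix t :: real assume "t \<in> {0..}" then have t: "0 \<le> t" by simp
  have lim: "((\<lambda>\<tau>. n2 (\<lambda>\<xi>. u \<tau> \<xi> - u t \<xi>)) \<longlongrightarrow> 0) (at t within {0..})" using u t by (simp add: l2cont_def)
  have "((\<lambda>\<tau>. C * (1 + n2 (u t) + n2 (\<lambda>\<xi>. u \<tau> \<xi> - u t \<xi>)) * n2 (\<lambda>\<xi>. u \<tau> \<xi> - u t \<xi>)) \<longlongrightarrow> C * (1 + n2 (u t) + 0) * 0) (at t within {0..})"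
    by (intro tendsto_intros lim)
  then have lim2: "((\<lambda>\<tau>. C * (1 + n2 (u t) + n2 (\<lambda>\<xi>. u \<tau> \<xi> - u t \<xi>)) * n2 (\<lambda>\<xi>. u \<tau> \<xi> - u t \<xi>)) \<longlongrightarrow> 0) (at t within {0..})" by simp
  show "((\<lambda>\<tau>. G (u \<tau>)) \<longlongrightarrow> G (u t)) (at t within {0..})"
  proof (rule LIM_zero_cancel, rule tendsto_norm_zero_cancel, rule tendsto_sandwich[OF _ _ tendsto_const lim2])
    show "\<forall>\<^sub>F \<tau> in at t within {0..}. norm (G (u \<tau>) - G (u t)) \<le> C * (1 + n2 (u t) + n2 (\<lambda>\<xi>. u \<tau> \<xi> - u t \<xi>)) * n2 (\<lambda>\<xi>. u \<tau> \<xi> - u t \<xi>)"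
      unfolding eventually_at_filter using t by (intro always_eventually allI impI G l2cont_L2c[OF u]) auto
  qed auto
qed

lemma l2cont_n2_continuous:
  assumes u: "l2cont u" shows "continuous_on {0..} (\<lambda>\<tau>. n2 (u \<tau>))"
  unfolding continuous_on_def
proof
  fix t :: real assume "t \<in> {0..}" then have t: "0 \<le> t" by simp
  have lim: "((\<lambda>\<tau>. n2 (\<lambda>\<xi>. u \<tau> \<xi> - u t \<xi>)) \<longlongrightarrow> 0) (at t within {0..})" using u t by (simp add: l2cont_def)
  show "((\<lambda>\<tau>. n2 (u \<tau>)) \<longlongrightarrow> n2 (u t)) (at t within {0..})"
  proof (rule LIM_zero_cancel, rule tendsto_norm_zero_cancel, rule tendsto_sandwich[OF _ _ tendsto_const lim])
    show "\<forall>\<^sub>F \<tau> in at t within {0..}. norm (n2 (u \<tau>) - n2 (u t)) \<le> n2 (\<lambda>\<xi>. u \<tau> \<xi> - u t \<xi>)"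
      unfolding eventually_at_filter using t by (auto intro!: always_eventually n2_diff_le l2cont_L2c[OF u])
  qed auto
qed

lemma NL_continuous:
  assumes u: "l2cont u" shows "continuous_on {0..} (\<lambda>\<tau>. NL (u \<tau>) (u \<tau>) \<xi>)"
proof (rule l2cont_Lipschitz_continuous[where G="\<lambda>a. NL a a \<xi>" and C="2 * norm \<xi>", OF u])
  fix a b :: "pt \<Rightarrow> complex" assume L: "L2c a" "L2c b"
  have "n2 a \<le> n2 b + n2 (\<lambda>x. a x - b x)" using n2_diff_le[OF L] by linarith
  then have "n2 a + n2 b \<le> 2 * (1 + n2 b + n2 (\<lambda>x. a x - b x))" using n2_nonneg[of b] n2_nonneg[of "\<lambda>x. a x - b x"] unfolding distrib_left by linarith
  then have "norm \<xi> * (n2 a + n2 b) * n2 (\<lambda>x. a x - b x) \<le> norm \<xi> * (2 * (1 + n2 b + n2 (\<lambda>x. a x - b x))) * n2 (\<lambda>x. a x - b x)"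
    by (intro mult_right_mono mult_left_mono) auto
  with NL_lipschitz[OF L, of \<xi>] show "cmod (NL a a \<xi> - NL b b \<xi>) \<le> 2 * norm \<xi> * (1 + n2 b + n2 (\<lambda>x. a x - b x)) * n2 (\<lambda>x. a x - b x)"
    by (simp add: mult_ac)
qed

text \<open>Radial retraction onto the ball of radius \<open>M\<close> of L2; it makes the truncated
  nonlinearity globally Lipschitz without destroying its cancellations.\<close>

definition ret :: "real \<Rightarrow> (pt \<Rightarrow> complex) \<Rightarrow> real" where
  "ret M a = M / max M (n2 a)"

lemma ret_bounds: "0 < M \<Longrightarrow> 0 < ret M a" "0 < M \<Longrightarrow> ret M a \<le> 1" "0 < M \<Longrightarrow> ret M a * n2 a \<le> M"
proof -
  assume M: "0 < M"
  then have m: "0 < max M (n2 a)" by simp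
  show "0 < ret M a" using M m by (simp add: ret_def)
  show "ret M a \<le> 1" using M m by (simp add: ret_def)
  have "M * n2 a \<le> M * max M (n2 a)" using M by (intro mult_left_mono) auto
  then show "ret M a * n2 a \<le> M" using M m by (simp add: ret_def pos_divide_le_eq)
qed

text \<open>Splitting the difference as ret a (a - b) + (ret a - ret b) b, each part is at most |a -
  b|; for the second one, the factor n2 b is compensated by the denominator max M (n2 b).\<close>

lemma ret_lipschitz:
  assumes M: "0 < M" and L: "L2c a" "L2c b"
  shows "n2 (\<lambda>x. complex_of_real (ret M a) * a x - complex_of_real (ret M b) * b x) \<le> 2 * n2 (\<lambda>x. a x - b x)"
proof -
  let ?A = "max M (n2 a)" and ?B = "max M (n2 b)"
  have AB: "0 < ?A" "0 < ?B" using M by auto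
  have "\<bar>?B - ?A\<bar> \<le> \<bar>n2 a - n2 b\<bar>" by linarith
  also have "\<dots> \<le> n2 (\<lambda>x. a x - b x)" by (rule n2_diff_le[OF L])
  finally have d: "\<bar>?B - ?A\<bar> \<le> n2 (\<lambda>x. a x - b x)" .
  have "ret M a - ret M b = ret M a * ((?B - ?A) / ?B)" using AB by (simp add: ret_def field_simps)
  then have "\<bar>ret M a - ret M b\<bar> * n2 b = ret M a * (\<bar>?B - ?A\<bar> * (n2 b / ?B))"
    using ret_bounds(1)[OF M, of a] AB by (simp add: abs_mult)
  also have "\<dots> \<le> 1 * (n2 (\<lambda>x. a x - b x) * 1)"
    using ret_bounds(1,2)[OF M, of a] AB d by (intro mult_mono) (auto simp: divide_le_eq_1)
  finally have e: "\<bar>ret M a - ret M b\<bar> * n2 b \<le> n2 (\<lambda>x. a x - b x)" by simp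
  have eq: "(\<lambda>x. complex_of_real (ret M a) * a x - complex_of_real (ret M b) * b x) =
     (\<lambda>x. complex_of_real (ret M a) * (a x - b x) + complex_of_real (ret M a - ret M b) * b x)"
    by (simp add: algebra_simps)
  have "n2 (\<lambda>x. complex_of_real (ret M a) * a x - complex_of_real (ret M b) * b x)
     \<le> cmod (complex_of_real (ret M a)) * n2 (\<lambda>x. a x - b x) + cmod (complex_of_real (ret M a - ret M b)) * n2 b"
    unfolding eq n2_cmult[symmetric] by (intro n2_triangle L2c_cmult L2c_diff L)
  also have "\<dots> \<le> 1 * n2 (\<lambda>x. a x - b x) + n2 (\<lambda>x. a x - b x)"
    unfolding norm_of_real using ret_bounds(1,2)[OF M, of a] e by (intro add_mono mult_right_mono) auto
  finally show ?thesis by simp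
qed

definition GN :: "real \<Rightarrow> (pt \<Rightarrow> complex) \<Rightarrow> pt \<Rightarrow> complex" where
  "GN M a \<xi> = complex_of_real ((ret M a)\<^sup>2) * NL a a \<xi>"

lemma GN_alt: "GN M a \<xi> = NL (\<lambda>x. complex_of_real (ret M a) * a x) (\<lambda>x. complex_of_real (ret M a) * a x) \<xi>"
  unfolding GN_def NL_cmult by simp

lemma n2_ret: "0 < M \<Longrightarrow> n2 (\<lambda>x. complex_of_real (ret M a) * a x) \<le> M"
  unfolding n2_cmult using ret_bounds[of M a] by simp

lemma GN_bound: assumes "0 < M" "L2c a" shows "cmod (GN M a \<xi>) \<le> norm \<xi> * M\<^sup>2"
proof -
  have "cmod (GN M a \<xi>) \<le> norm \<xi> * n2 (\<lambda>x. complex_of_real (ret M a) * a x) * n2 (\<lambda>x. complex_of_real (ret M a) * a x)"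
    unfolding GN_alt by (intro NL_bound L2c_cmult assms)
  also have "\<dots> \<le> norm \<xi> * M * M" using assms by (intro mult_mono n2_ret) auto
  finally show ?thesis by (simp add: power2_eq_square mult.assoc)
qed

lemma GN_lipschitz: assumes M: "0 < M" and L: "L2c a" "L2c b"
  shows "cmod (GN M a \<xi> - GN M b \<xi>) \<le> norm \<xi> * (4 * M) * n2 (\<lambda>x. a x - b x)"
proof -
  let ?a = "\<lambda>x. complex_of_real (ret M a) * a x" and ?b = "\<lambda>x. complex_of_real (ret M b) * b x"
  have "cmod (GN M a \<xi> - GN M b \<xi>) \<le> norm \<xi> * (n2 ?a + n2 ?b) * n2 (\<lambda>x. ?a x - ?b x)"
    unfolding GN_alt by (intro NL_lipschitz L2c_cmult L)
  also have "\<dots> \<le> norm \<xi> * (M + M) * (2 * n2 (\<lambda>x. a x - b x))"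
    using M by (intro mult_mono add_mono n2_ret ret_lipschitz L mult_nonneg_nonneg) auto
  finally show ?thesis by (simp add: mult_ac)
qed

lemma GN_continuous:
  assumes M: "0 < M" and u: "l2cont u" shows "continuous_on {0..} (\<lambda>\<tau>. GN M (u \<tau>) \<xi>)"
proof (rule l2cont_Lipschitz_continuous[where G="\<lambda>a. GN M a \<xi>" and C="norm \<xi> * (4 * M)", OF u])
  fix a b :: "pt \<Rightarrow> complex" assume L: "L2c a" "L2c b"
  have "norm \<xi> * (4 * M) * n2 (\<lambda>x. a x - b x) \<le> norm \<xi> * (4 * M) * (1 + n2 b + n2 (\<lambda>x. a x - b x)) * n2 (\<lambda>x. a x - b x)"
  proof (rule mult_right_mono)
    have "1 \<le> 1 + n2 b + n2 (\<lambda>x. a x - b x)" by simp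
    from mult_left_mono[OF this, of "norm \<xi> * (4 * M)"] M
    show "norm \<xi> * (4 * M) \<le> norm \<xi> * (4 * M) * (1 + n2 b + n2 (\<lambda>x. a x - b x))" by simp
  qed simp
  with GN_lipschitz[OF M L, of \<xi>] show "cmod (GN M a \<xi> - GN M b \<xi>) \<le> norm \<xi> * (4 * M) * (1 + n2 b + n2 (\<lambda>x. a x - b x)) * n2 (\<lambda>x. a x - b x)"
    by linarith
qed

lemma GN_measurable:
  assumes w: "jmeas w" shows "jmeas (\<lambda>t. GN M (w t))"
proof -
  note [measurable (raw)] = measurable_pair_apply[OF NL_measurable[OF w]]
  note [measurable] = jmeas_n2[OF w]
  show ?thesis unfolding GN_def ret_def split_beta' by measurable
qed

lemma GN_hermitian:
  assumes "\<And>x. a (- x) = cnj (a x)" shows "GN M a (- \<xi>) = cnj (GN M a \<xi>)"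
  unfolding GN_def NL_hermitian[where a=a and b=a, OF assms assms] by simp

section \<open>Picard iteration\<close>

text \<open>Integration reproduces the growth exp (b t) with a gain 1/b. With b large, iteration in
  this weighted norm contracts on all of [0, infinity) at once.\<close>

lemma exp_integral_bound:
  fixes b t C :: real
  assumes "0 < b" "0 \<le> t" "0 \<le> C"
  shows "set_integrable lborel {0..t} (\<lambda>\<tau>. C * exp (b * \<tau>))"
    and "(LINT \<tau>:{0..t}|lborel. C * exp (b * \<tau>)) \<le> C * exp (b * t) / b"
proof -
  show i: "set_integrable lborel {0..t} (\<lambda>\<tau>. C * exp (b * \<tau>))"
    by (rule set_integrable_continuous) (auto intro!: continuous_intros)
  have "(LINT \<tau>:{0..t}|lborel. C * exp (b * \<tau>)) = C * exp (b * t) / b - C * exp (b * 0) / b"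
    unfolding set_lebesgue_integral_def
  proof (rule integral_FTC_Icc)
    show "((\<lambda>\<tau>. C * exp (b * \<tau>) / b) has_vector_derivative C * exp (b * \<tau>)) (at \<tau> within {0..t})" for \<tau>
      unfolding has_real_derivative_iff_has_vector_derivative[symmetric]
      using assms by (auto intro!: derivative_eq_intros)
  qed (use assms in \<open>auto intro!: continuous_intros\<close>)
  also have "\<dots> \<le> C * exp (b * t) / b" using assms by simp
  finally show "(LINT \<tau>:{0..t}|lborel. C * exp (b * \<tau>)) \<le> C * exp (b * t) / b" .
qed

lemma geometric_limit:
  fixes x :: "nat \<Rightarrow> complex"
  assumes d: "\<And>k. cmod (x (Suc k) - x k) \<le> c * (1/2)^k"
  shows "x \<longlonglongrightarrow> lim x" "cmod (x k - lim x) \<le> 2 * c * (1/2)^k"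
proof -
  have c: "0 \<le> c" using order_trans[OF norm_ge_zero d[of 0]] by simp
  have "summable (\<lambda>k. x (Suc k) - x k)"
    by (rule summable_comparison_test[OF _ summable_mult[OF summable_geometric[of "1/2::real"], of c]]) (use d in auto)
  then have "convergent (\<lambda>n. \<Sum>k<n. x (Suc k) - x k)" by (simp add: summable_iff_convergent)
  then have "convergent (\<lambda>n. x n - x 0)" by (simp only: sum_lessThan_telescope)
  from convergent_add[OF this convergent_const[of "x 0"]] have "convergent x" by simp
  then show l: "x \<longlonglongrightarrow> lim x" by (simp add: convergent_LIMSEQ_iff)
  have tail: "cmod (x k - x (k + j)) \<le> 2 * c * (1/2)^k * (1 - (1/2)^j)" for j
  proof (induction j)
    case (Suc j)
    have "cmod (x k - x (k + Suc j)) \<le> cmod (x k - x (k + j)) + cmod (x (k + j) - x (Suc (k + j)))"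
      using norm_triangle_ineq[of "x k - x (k + j)" "x (k + j) - x (Suc (k + j))"] by simp
    also have "\<dots> \<le> 2 * c * (1/2)^k * (1 - (1/2)^j) + c * (1/2)^(k + j)"
      using Suc d[of "k + j"] by (intro add_mono) (auto simp: norm_minus_commute)
    also have "\<dots> = 2 * c * (1/2)^k * (1 - (1/2)^(Suc j))" by (simp add: field_simps power_add)
    finally show ?case .
  qed simp
  have "(\<lambda>j. cmod (x k - x (k + j))) \<longlonglongrightarrow> cmod (x k - lim x)"
    using LIMSEQ_ignore_initial_segment[OF l, of k] by (intro tendsto_intros) (simp add: add.commute)
  then show "cmod (x k - lim x) \<le> 2 * c * (1/2)^k"
  proof (rule LIMSEQ_le_const2, intro exI allI impI)
    fix j
    have "2 * c * (1/2)^k * (1 - (1/2)^j) \<le> 2 * c * (1/2)^k * 1" using c by (intro mult_left_mono) auto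
    with tail[of j] show "cmod (x k - x (k + j)) \<le> 2 * c * (1/2)^k" by simp
  qed
qed

lemma l2cont_uniform_limit:
  assumes W: "\<And>k::nat. l2cont (W k)" and w: "\<And>t. 0 \<le> t \<Longrightarrow> L2c (w t)"
    and lim: "\<And>T e. 0 < e \<Longrightarrow> \<exists>k. \<forall>t\<in>{0..T}. n2 (\<lambda>\<xi>. W k t \<xi> - w t \<xi>) \<le> e"
  shows "l2cont w"
  unfolding l2cont_def
proof (intro conjI allI impI)
  fix t :: real assume t: "0 \<le> t"
  show "L2c (w t)" by (rule w[OF t])
  show "((\<lambda>\<tau>. n2 (\<lambda>\<xi>. w \<tau> \<xi> - w t \<xi>)) \<longlongrightarrow> 0) (at t within {0..})"
    unfolding tendsto_iff
  proof (intro allI impI)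
    fix e :: real assume e: "0 < e"
    obtain k where k': "\<forall>s\<in>{0..t+1}. n2 (\<lambda>\<xi>. W k s \<xi> - w s \<xi>) \<le> e/4"
      using lim[of "e/4" "t+1"] e by auto
    note k = bspec[OF k']
    have "((\<lambda>\<tau>. n2 (\<lambda>\<xi>. W k \<tau> \<xi> - W k t \<xi>)) \<longlongrightarrow> 0) (at t within {0..})" using W[of k] t by (simp add: l2cont_def)
    then have "\<forall>\<^sub>F \<tau> in at t within {0..}. n2 (\<lambda>\<xi>. W k \<tau> \<xi> - W k t \<xi>) < e/4" using e by (intro order_tendstoD) auto
    moreover have "\<forall>\<^sub>F \<tau> in at t within {0..}. \<tau> \<in> {0..t+1}"
      unfolding eventually_at by (intro exI[of _ 1]) (auto simp: dist_real_def)
    ultimately show "\<forall>\<^sub>F \<tau> in at t within {0..}. dist (n2 (\<lambda>\<xi>. w \<tau> \<xi> - w t \<xi>)) 0 < e"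
    proof eventually_elim
      case (elim \<tau>)
      then have \<tau>: "0 \<le> \<tau>" by simp
      note L = l2cont_L2c[OF W \<tau>, of k] l2cont_L2c[OF W t, of k] w[OF \<tau>] w[OF t]
      have "n2 (\<lambda>\<xi>. w \<tau> \<xi> - w t \<xi>) \<le> n2 (\<lambda>\<xi>. w \<tau> \<xi> - W k \<tau> \<xi>) + n2 (\<lambda>\<xi>. W k \<tau> \<xi> - w t \<xi>)"
        by (rule n2_triangle_diff[OF L(3,1,4)])
      also have "n2 (\<lambda>\<xi>. W k \<tau> \<xi> - w t \<xi>) \<le> n2 (\<lambda>\<xi>. W k \<tau> \<xi> - W k t \<xi>) + n2 (\<lambda>\<xi>. W k t \<xi> - w t \<xi>)"
        by (rule n2_triangle_diff[OF L(1,2,4)])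
      finally have "n2 (\<lambda>\<xi>. w \<tau> \<xi> - w t \<xi>) \<le> n2 (\<lambda>\<xi>. W k \<tau> \<xi> - w \<tau> \<xi>) + (n2 (\<lambda>\<xi>. W k \<tau> \<xi> - W k t \<xi>) + n2 (\<lambda>\<xi>. W k t \<xi> - w t \<xi>))"
        by (simp add: n2_minus_commute[of "w \<tau>" "W k \<tau>"])
      then show ?case using elim k[of \<tau>] k[of t] t e by simp
    qed
  qed
qed

section \<open>Functions supported in a frequency ball and the Picard map\<close>

lemma L2c_ball_const:
  shows "L2c (\<lambda>\<xi>. if norm \<xi> \<le> n then c else 0)"
  unfolding L2c_def
  by (auto intro!: integrable_bounded_support[where R=n and B="(cmod c)\<^sup>2"])

lemma L2c_cutoff: "L2c a \<Longrightarrow> L2c (\<lambda>\<xi>. if norm \<xi> \<le> n then a \<xi> else 0)"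
  by (rule L2c_mono(1)[where B=1 and f=a]) (auto dest!: L2c_measurable)

text \<open>The square root of the area of the ball, the factor by which a uniform bound becomes an
  L2 bound.\<close>

definition ballnorm :: "real \<Rightarrow> real" where
  "ballnorm n = n2 (\<lambda>\<xi>. if norm \<xi> \<le> n then 1 else 0)"

lemma n2_ball_bound:
  assumes [measurable]: "f \<in> borel_measurable lborel" and z: "\<And>\<xi>. norm \<xi> > n \<Longrightarrow> f \<xi> = 0" and b: "\<And>\<xi>. norm \<xi> \<le> n \<Longrightarrow> cmod (f \<xi>) \<le> B" and B: "0 \<le> B"
  shows "L2c f" "n2 f \<le> B * ballnorm n"
proof -
  have "AE \<xi> in lborel. cmod (f \<xi>) \<le> B * cmod (if norm \<xi> \<le> n then 1 else 0)"
    using z b by (auto intro!: AE_I2 simp: not_le)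
  from L2c_mono[OF L2c_ball_const _ this B] show "L2c f" "n2 f \<le> B * ballnorm n" by (auto simp: ballnorm_def)
qed

definition picard :: "(pt \<Rightarrow> real) \<Rightarrow> (pt \<Rightarrow> complex) \<Rightarrow> real \<Rightarrow> real \<Rightarrow> (real \<Rightarrow> pt \<Rightarrow> complex) \<Rightarrow> real \<Rightarrow> pt \<Rightarrow> complex" where
  "picard l w0 M n u t \<xi> = (if norm \<xi> \<le> n then duh l w0 (\<lambda>\<tau>. GN M (u \<tau>)) t \<xi> else 0)"

lemma picard_bound:
  assumes M: "0 < M" and l: "0 \<le> l \<xi>" and u: "l2cont u" and t: "0 \<le> t" and n: "norm \<xi> \<le> n"
  shows "cmod (duh l w0 (\<lambda>\<tau>. GN M (u \<tau>)) t \<xi>) \<le> cmod (w0 \<xi>) + t * (n * M\<^sup>2)"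
proof -
  \<comment> \<open>Comparison with the Duhamel formula for zero data and zero force, which is
    0.\<close>
  have "cmod (duh l w0 (\<lambda>\<tau>. GN M (u \<tau>)) t \<xi> - duh l (\<lambda>_. 0) (\<lambda>_ _. 0) t \<xi>) \<le> cmod (w0 \<xi> - 0) + (LINT \<tau>:{0..t}|lborel. n * M\<^sup>2)"
  proof (rule duh_diff_bound[where l=l])
    fix \<tau> assume "\<tau> \<in> {0..t}"
    then have "cmod (GN M (u \<tau>) \<xi>) \<le> norm \<xi> * M\<^sup>2" by (intro GN_bound M l2cont_L2c[OF u]) auto
    also have "\<dots> \<le> n * M\<^sup>2" using n by (intro mult_right_mono) auto
    finally show "cmod (GN M (u \<tau>) \<xi> - 0) \<le> n * M\<^sup>2" by simp
  qed (use GN_continuous[OF M u] l t in \<open>auto intro!: set_integrable_continuous continuous_intros\<close>)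
  also have "(LINT \<tau>:{0..t}|lborel. n * M\<^sup>2) = t * (n * M\<^sup>2)"
    using t by (simp add: set_lebesgue_integral_def)
  finally show ?thesis by (simp add: duh_def set_lebesgue_integral_def)
qed

text \<open>The dominating function in the last part gives the continuity into L2, and it is stated
  separately because a fixed point inherits it: it is the majorant needed later in the energy
  identity.\<close>

lemma picard_l2cont:
  assumes M: "0 < M" and l: "\<And>\<xi>. 0 \<le> l \<xi>" "l \<in> borel_measurable borel" and w0: "L2c w0"
    and u: "l2cont u" "jmeas u"
  shows "jmeas (picard l w0 M n u)" "l2cont (picard l w0 M n u)"
    and "0 \<le> T \<Longrightarrow> \<exists>h. L2c h \<and> (\<forall>t\<in>{0..T}. \<forall>\<xi>. cmod (picard l w0 M n u t \<xi>) \<le> cmod (h \<xi>))"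
proof -
  have w0m: "w0 \<in> borel_measurable borel" using L2c_measurable[OF w0] by simp
  note [measurable (raw)] = measurable_pair_apply[OF duh_measurable[OF GN_measurable[OF u(2), of M] l(2) w0m]]
  show m: "jmeas (picard l w0 M n u)" unfolding picard_def split_beta' by measurable
  show dom: "\<exists>h. L2c h \<and> (\<forall>t\<in>{0..T}. \<forall>\<xi>. cmod (picard l w0 M n u t \<xi>) \<le> cmod (h \<xi>))" if "0 \<le> T" for T
  proof (intro exI conjI ballI allI)
    let ?h = "\<lambda>\<xi>. (if norm \<xi> \<le> n then complex_of_real (cmod (w0 \<xi>)) else 0) + (if norm \<xi> \<le> n then complex_of_real (T * (n * M\<^sup>2)) else 0)"
    have "L2c (\<lambda>\<xi>. complex_of_real (cmod (w0 \<xi>)))" by (rule L2c_mono(1)[OF w0, where B=1]) (use w0m in auto)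
    then show "L2c ?h" by (intro L2c_add L2c_cutoff L2c_ball_const)
    fix t \<xi> assume t: "t \<in> {0..T}"
    show "cmod (picard l w0 M n u t \<xi>) \<le> cmod (?h \<xi>)"
    proof (cases "norm \<xi> \<le> n")
      case True
      then have n0: "0 \<le> n" using norm_ge_zero order_trans by blast
      have "cmod (picard l w0 M n u t \<xi>) \<le> cmod (w0 \<xi>) + t * (n * M\<^sup>2)"
        using picard_bound[where l=l and \<xi>=\<xi>, OF M l(1) u(1) _ True] t True by (simp add: picard_def)
      also have "\<dots> \<le> cmod (w0 \<xi>) + T * (n * M\<^sup>2)" using t n0 by (intro add_left_mono mult_right_mono) auto
      also have "\<dots> \<le> cmod (?h \<xi>)" using True complex_Re_le_cmod[of "?h \<xi>"] by simp
      finally show ?thesis .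
    qed (simp add: picard_def)
  qed
  show "l2cont (picard l w0 M n u)"
  proof (rule l2cont_dominated[OF m _ dom])
    fix \<xi>
    have "continuous_on {0..} (\<lambda>t. duh l w0 (\<lambda>\<tau>. GN M (u \<tau>)) t \<xi>)"
      by (rule continuous_on_vector_derivative) (rule duh_deriv, rule GN_continuous[OF M u(1)], auto)
    then show "continuous_on {0..} (\<lambda>t. picard l w0 M n u t \<xi>)" unfolding picard_def by (cases "norm \<xi> \<le> n") auto
  qed
qed

lemma picard_hermitian:
  assumes l: "\<And>\<xi>. l (- \<xi>) = l \<xi>" and w0: "\<And>\<xi>. w0 (- \<xi>) = cnj (w0 \<xi>)"
    and u: "\<And>t \<xi>. 0 \<le> t \<Longrightarrow> u t (- \<xi>) = cnj (u t \<xi>)"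
  shows "picard l w0 M n u t (- \<xi>) = cnj (picard l w0 M n u t \<xi>)"
proof -
  have "(LINT \<tau>:{0..t}|lborel. complex_of_real (exp (- (t - \<tau>) * l (- \<xi>))) * GN M (u \<tau>) (- \<xi>)) = (LINT \<tau>:{0..t}|lborel. cnj (complex_of_real (exp (- (t - \<tau>) * l \<xi>)) * GN M (u \<tau>) \<xi>))"
  proof (rule set_lebesgue_integral_cong)
    have "GN M (u \<tau>) (- \<xi>) = cnj (GN M (u \<tau>) \<xi>)" if "0 \<le> \<tau>" for \<tau>
      by (rule GN_hermitian) (rule u[OF that])
    then show "\<forall>\<tau>. \<tau> \<in> {0..t} \<longrightarrow> complex_of_real (exp (- (t - \<tau>) * l (- \<xi>))) * GN M (u \<tau>) (- \<xi>) = cnj (complex_of_real (exp (- (t - \<tau>) * l \<xi>)) * GN M (u \<tau>) \<xi>)"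
      by (simp add: l)
  qed simp
  also have "\<dots> = cnj (LINT \<tau>:{0..t}|lborel. complex_of_real (exp (- (t - \<tau>) * l \<xi>)) * GN M (u \<tau>) \<xi>)"
    unfolding set_lebesgue_integral_def cnj_lint by simp
  finally show ?thesis unfolding picard_def duh_def by (simp add: l w0)
qed

text \<open>The Lipschitz constant of \<open>GN\<close> at a frequency in the ball is at most 4 M n,
  and integrating exp (b t) gains 1/b. The conclusion is pointwise in xi, so the same estimate
  serves for the norm and for the limit at each frequency.\<close>

lemma picard_contraction:
  assumes M: "0 < M" and l: "\<And>\<xi>. 0 \<le> l \<xi>" and u: "l2cont u" and v: "l2cont v" and t: "0 \<le> t" and n: "0 \<le> n"
    and b: "0 < b" and D: "\<And>\<tau>. 0 \<le> \<tau> \<Longrightarrow> n2 (\<lambda>\<xi>. u \<tau> \<xi> - v \<tau> \<xi>) \<le> D * exp (b * \<tau>)" and D0: "0 \<le> D"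
  shows "cmod (picard l w0 M n u t \<xi> - picard l w0 M n v t \<xi>) \<le> n * (4 * M) * D * exp (b * t) / b"
proof (cases "norm \<xi> \<le> n")
  case True
  have "cmod (duh l w0 (\<lambda>\<tau>. GN M (u \<tau>)) t \<xi> - duh l w0 (\<lambda>\<tau>. GN M (v \<tau>)) t \<xi>) \<le> cmod (w0 \<xi> - w0 \<xi>) + (LINT \<tau>:{0..t}|lborel. n * (4 * M) * D * exp (b * \<tau>))"
  proof (rule duh_diff_bound[where l=l])
    fix \<tau> assume \<tau>: "\<tau> \<in> {0..t}"
    have "cmod (GN M (u \<tau>) \<xi> - GN M (v \<tau>) \<xi>) \<le> norm \<xi> * (4 * M) * n2 (\<lambda>\<xi>. u \<tau> \<xi> - v \<tau> \<xi>)"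
      using \<tau> by (intro GN_lipschitz M l2cont_L2c[OF u] l2cont_L2c[OF v]) auto
    also have "\<dots> \<le> n * (4 * M) * (D * exp (b * \<tau>))"
      using True M n D[of \<tau>] \<tau> by (intro mult_mono) auto
    finally show "cmod (GN M (u \<tau>) \<xi> - GN M (v \<tau>) \<xi>) \<le> n * (4 * M) * D * exp (b * \<tau>)" by (simp add: mult.assoc)
  qed (use GN_continuous[OF M u] GN_continuous[OF M v] l t exp_integral_bound(1)[OF b t] M n D0 in auto)
  also have "(LINT \<tau>:{0..t}|lborel. n * (4 * M) * D * exp (b * \<tau>)) \<le> n * (4 * M) * D * exp (b * t) / b"
    by (rule exp_integral_bound(2)[OF b t]) (use M n D0 in auto)
  finally show ?thesis using True by (simp add: picard_def)
qed (use M n D0 b in \<open>auto simp: picard_def\<close>)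

lemma galerkin_fixpoint:
  assumes M: "0 < M" and n: "0 < n" and l: "\<And>\<xi>. 0 \<le> l \<xi>" "l \<in> borel_measurable borel" "\<And>\<xi>. l (- \<xi>) = l \<xi>"
    and w0: "L2c w0" "\<And>\<xi>. w0 (- \<xi>) = cnj (w0 \<xi>)"
  shows "\<exists>w. jmeas w \<and> l2cont w \<and> (\<forall>t\<ge>0. \<forall>\<xi>. w t (- \<xi>) = cnj (w t \<xi>)) \<and> (\<forall>t\<ge>0. \<forall>\<xi>. w t \<xi> = picard l w0 M n w t \<xi>)"
proof -
  define V where "V = ballnorm n"
  \<comment> \<open>The first summand makes the contraction factor 4 M n V / b at most 1/2. The
    second keeps b positive without a lower bound on V.\<close>
  define b where "b = 8 * M * n * V + 8 * M * n"
  \<comment> \<open>Bounds the first iterate in the weighted norm: it grows at most like n2 w0 + t n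
    M^2 V, and t is at most exp (b t) / b.\<close>
  define A where "A = n2 w0 + V * (n * M\<^sup>2) / b"
  have V0: "0 \<le> V" by (simp add: V_def ballnorm_def)
  have b0: "0 < b" unfolding b_def using M n V0 by (intro add_nonneg_pos) auto
  have A0: "0 \<le> A" unfolding A_def using V0 b0 n by simp
  define W where "W k = (picard l w0 M n ^^ k) (\<lambda>_ _. 0)" for k
  have W0: "W 0 = (\<lambda>_ _. 0)" and WS: "W (Suc k) = picard l w0 M n (W k)" for k by (simp_all add: W_def)
  have inv: "jmeas (W k) \<and> l2cont (W k) \<and> (\<forall>t\<ge>0. \<forall>\<xi>. W k t (- \<xi>) = cnj (W k t \<xi>))" for k
  proof (induction k)
    case 0 show ?case by (auto simp: W0 l2cont_def)
  next
    case (Suc k)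
    then show ?case unfolding WS
      using picard_l2cont[OF M l(1,2) w0(1), of "W k" n] picard_hermitian[of l w0 "W k" M n, OF l(3) w0(2)] by blast
  qed
  have Wj: "jmeas (W k)" and Wc: "l2cont (W k)" and Wh: "0 \<le> t \<Longrightarrow> W k t (- \<xi>) = cnj (W k t \<xi>)" for k t \<xi> using inv[of k] by auto
  have Ws: "norm \<xi> > n \<Longrightarrow> W k t \<xi> = 0" for k t \<xi> by (cases k) (auto simp: W0 WS picard_def)
  have Wm: "W k t \<in> borel_measurable lborel" for k t using jmeas_slice[OF Wj] by simp
  have half: "V * (n * (4 * M) * x * e / b) \<le> x / 2 * e" if "0 \<le> x" "0 \<le> e" for x e
  proof -
    have "8 * M * n * V \<le> b" using M n by (simp add: b_def)
    then have "(8 * M * n * V) * (x * e) \<le> b * (x * e)" using that by (intro mult_right_mono) auto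
    then show ?thesis using b0 by (simp add: field_simps)
  qed
  have D: "n2 (\<lambda>\<xi>. W (Suc k) t \<xi> - W k t \<xi>) \<le> A * (1/2)^k * exp (b * t)" if "0 \<le> t" for k t
    using that
  proof (induction k arbitrary: t)
    case 0
    define x where "x = t * (n * M\<^sup>2)"
    have x0: "0 \<le> x" using 0 n by (simp add: x_def)
    have pb: "cmod (W (Suc 0) t \<xi>) \<le> cmod (w0 \<xi>) + x" if "norm \<xi> \<le> n" for \<xi>
      using picard_bound[where l=l and \<xi>=\<xi>, OF M l(1) Wc 0 that] that by (simp add: WS picard_def x_def)
    let ?h = "\<lambda>\<xi>. complex_of_real (cmod (w0 \<xi>)) + (if norm \<xi> \<le> n then complex_of_real x else 0)"
    have cw: "L2c (\<lambda>\<xi>. complex_of_real (cmod (w0 \<xi>)))" by (rule L2c_mono(1)[OF w0(1), where B=1]) (use L2c_measurable[OF w0(1)] in auto)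
    have "n2 (W (Suc 0) t) \<le> 1 * n2 ?h"
    proof (rule L2c_mono(2)[OF _ Wm])
      show "L2c ?h" by (intro L2c_add cw L2c_ball_const)
      show "AE \<xi> in lborel. cmod (W (Suc 0) t \<xi>) \<le> 1 * cmod (?h \<xi>)"
      proof (rule AE_I2)
        fix \<xi> show "cmod (W (Suc 0) t \<xi>) \<le> 1 * cmod (?h \<xi>)"
          using pb[of \<xi>] Ws[of \<xi> "Suc 0" t] complex_Re_le_cmod[of "?h \<xi>"] by (cases "norm \<xi> \<le> n") auto
      qed
    qed simp
    also have "1 * n2 ?h \<le> n2 (\<lambda>\<xi>. complex_of_real (cmod (w0 \<xi>))) + n2 (\<lambda>\<xi>. if norm \<xi> \<le> n then complex_of_real x else 0)"
      using n2_triangle[OF cw L2c_ball_const, of n "complex_of_real x"] by simp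
    also have "n2 (\<lambda>\<xi>. complex_of_real (cmod (w0 \<xi>))) = n2 w0" by (simp add: n2_def L2norm_sq_def)
    also have "n2 (\<lambda>\<xi>. if norm \<xi> \<le> n then complex_of_real x else 0) \<le> x * V"
      unfolding V_def using x0 by (intro n2_ball_bound(2)) auto
    also have "n2 w0 + x * V \<le> A * exp (b * t)"
    proof -
      have "b * t \<le> exp (b * t)" using exp_ge_add_one_self[of "b * t"] by linarith
      then have "t \<le> exp (b * t) / b" using b0 by (simp add: field_simps)
      then have "t * (n * M\<^sup>2 * V) \<le> exp (b * t) / b * (n * M\<^sup>2 * V)" using n V0 by (intro mult_right_mono) auto
      moreover have "n2 w0 * 1 \<le> n2 w0 * exp (b * t)" using 0 b0 by (intro mult_left_mono) auto
      ultimately show ?thesis unfolding A_def x_def by (simp add: algebra_simps)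
    qed
    finally show ?case by (simp add: W0)
  next
    case (Suc k)
    have "n2 (\<lambda>\<xi>. W (Suc (Suc k)) t \<xi> - W (Suc k) t \<xi>) \<le> (n * (4 * M) * (A * (1/2)^k) * exp (b * t) / b) * ballnorm n"
    proof (rule n2_ball_bound(2))
      show "cmod (W (Suc (Suc k)) t \<xi> - W (Suc k) t \<xi>) \<le> n * (4 * M) * (A * (1/2)^k) * exp (b * t) / b" for \<xi>
        unfolding WS[of "Suc k"] WS[of k]
        by (rule picard_contraction[OF M l(1)], unfold WS[symmetric]) (use Wc Suc n b0 A0 in auto)
    qed (use Wm Ws A0 M n b0 in auto)
    also have "\<dots> \<le> (A * (1/2)^k) / 2 * exp (b * t)"
      using half[of "A * (1/2)^k" "exp (b * t)"] A0 by (simp add: V_def mult.commute)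
    finally show ?case by simp
  qed
  define B where "B = n * (4 * M) * A / b"
  have B0: "0 \<le> B" using n M A0 b0 by (simp add: B_def)
  have E: "cmod (W (Suc (Suc k)) t \<xi> - W (Suc k) t \<xi>) \<le> B * exp (b * t) * (1/2)^k" if t: "0 \<le> t" for k t \<xi>
  proof -
    have "cmod (picard l w0 M n (W (Suc k)) t \<xi> - picard l w0 M n (W k) t \<xi>) \<le> n * (4 * M) * (A * (1/2)^k) * exp (b * t) / b"
      by (rule picard_contraction[OF M l(1) Wc Wc t _ b0 D]) (use n A0 in auto)
    then show ?thesis unfolding WS[of "Suc k"] WS[of k] by (simp add: B_def mult_ac WS)
  qed
  \<comment> \<open>The sequence starts at index 1: the difference of the first two iterates
    contains w0, which need not be bounded, while from then on all differences are uniformly small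
    at every frequency.\<close>
  define w where "w t \<xi> = lim (\<lambda>k. W (Suc k) t \<xi>)" for t \<xi>
  have wl: "(\<lambda>k. W (Suc k) t \<xi>) \<longlonglongrightarrow> w t \<xi>" and wd: "cmod (W (Suc k) t \<xi> - w t \<xi>) \<le> 2 * (B * exp (b * t)) * (1/2)^k" if t: "0 \<le> t" for t \<xi> k
    unfolding w_def using geometric_limit[of "\<lambda>k. W (Suc k) t \<xi>" "B * exp (b * t)", OF E[OF t]] by auto
  have wj: "jmeas w"
  proof -
    note [measurable (raw)] = measurable_pair_apply[OF Wj]
    show ?thesis unfolding w_def split_beta' by measurable
  qed
  have wm: "w t \<in> borel_measurable lborel" for t using jmeas_slice[OF wj] by simp
  have ws: "w t \<xi> = 0" if "0 \<le> t" "norm \<xi> > n" for t \<xi>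
    using wl[OF that(1), of \<xi>] Ws[OF that(2)] by (simp add: LIMSEQ_const_iff)
  have dn: "L2c (\<lambda>\<xi>. W (Suc k) t \<xi> - w t \<xi>)" "n2 (\<lambda>\<xi>. W (Suc k) t \<xi> - w t \<xi>) \<le> (2 * B * V * (1/2)^k) * exp (b * t)" if t: "0 \<le> t" for k t
  proof -
    note * = n2_ball_bound[of "\<lambda>\<xi>. W (Suc k) t \<xi> - w t \<xi>" n "2 * (B * exp (b * t)) * (1/2)^k"]
    have "L2c (\<lambda>\<xi>. W (Suc k) t \<xi> - w t \<xi>)" "n2 (\<lambda>\<xi>. W (Suc k) t \<xi> - w t \<xi>) \<le> 2 * (B * exp (b * t)) * (1/2)^k * ballnorm n"
      by (rule *; use Wm wm Ws ws[OF t] wd[OF t] B0 in auto)+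
    then show "L2c (\<lambda>\<xi>. W (Suc k) t \<xi> - w t \<xi>)" "n2 (\<lambda>\<xi>. W (Suc k) t \<xi> - w t \<xi>) \<le> (2 * B * V * (1/2)^k) * exp (b * t)"
      by (simp_all add: V_def mult_ac)
  qed
  have wL: "L2c (w t)" if "0 \<le> t" for t
    using L2c_diff[OF l2cont_L2c[OF Wc that] dn(1)[OF that], of "Suc 0" 0] by simp
  have pow0: "(\<lambda>k. C * (1/2)^k) \<longlonglongrightarrow> 0" for C :: real
    using tendsto_mult_right_zero[OF LIMSEQ_power_zero[of "1/2::real"], of C] by simp
  have wc: "l2cont w"
  proof (rule l2cont_uniform_limit[of "\<lambda>k. W (Suc k)", OF Wc wL])
    fix T e :: real assume e: "0 < e"
    from order_tendstoD(2)[OF pow0[of "2 * B * V * exp (b * T)"] e] obtain k where k: "2 * B * V * exp (b * T) * (1/2)^k < e"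
      by (auto dest: eventually_happens)
    have "n2 (\<lambda>\<xi>. W (Suc k) t \<xi> - w t \<xi>) \<le> e" if "t \<in> {0..T}" for t
    proof -
      have "n2 (\<lambda>\<xi>. W (Suc k) t \<xi> - w t \<xi>) \<le> (2 * B * V * (1/2)^k) * exp (b * t)" using that by (intro dn(2)) auto
      also have "\<dots> \<le> (2 * B * V * (1/2)^k) * exp (b * T)" using that b0 B0 V0 by (intro mult_left_mono) auto
      also have "\<dots> < e" using k by (simp add: mult_ac)
      finally show ?thesis by simp
    qed
    then show "\<exists>k. \<forall>t\<in>{0..T}. n2 (\<lambda>\<xi>. W (Suc k) t \<xi> - w t \<xi>) \<le> e" by blast
  qed
  have fxp: "w t \<xi> = picard l w0 M n w t \<xi>" if t: "0 \<le> t" for t \<xi>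
  proof (rule LIMSEQ_unique)
    show "(\<lambda>k. W (Suc (Suc k)) t \<xi>) \<longlonglongrightarrow> w t \<xi>" using LIMSEQ_Suc[OF wl[OF t, of \<xi>]] .
    have ineq: "cmod (W (Suc (Suc k)) t \<xi> - picard l w0 M n w t \<xi>) \<le> (n * (4 * M) * (2 * B * V) * exp (b * t) / b) * (1/2)^k" for k
    proof -
      have "cmod (picard l w0 M n (W (Suc k)) t \<xi> - picard l w0 M n w t \<xi>) \<le> n * (4 * M) * (2 * B * V * (1/2)^k) * exp (b * t) / b"
        by (rule picard_contraction[OF M l(1) Wc wc t _ b0 dn(2)]) (use n B0 V0 in auto)
      then show ?thesis unfolding WS[of "Suc k"] by (simp add: mult_ac)
    qed
    show "(\<lambda>k. W (Suc (Suc k)) t \<xi>) \<longlonglongrightarrow> picard l w0 M n w t \<xi>"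
    proof (rule LIM_zero_cancel, rule tendsto_norm_zero_cancel, rule tendsto_sandwich[OF _ _ tendsto_const pow0])
      show "\<forall>\<^sub>F k in sequentially. cmod (W (Suc (Suc k)) t \<xi> - picard l w0 M n w t \<xi>) \<le> (n * (4 * M) * (2 * B * V) * exp (b * t) / b) * (1/2)^k"
        by (intro always_eventually allI ineq)
    qed simp
  qed
  have wh: "w t (- \<xi>) = cnj (w t \<xi>)" if t: "0 \<le> t" for t \<xi>
  proof (rule LIMSEQ_unique[OF wl[OF t]])
    show "(\<lambda>k. W (Suc k) t (- \<xi>)) \<longlonglongrightarrow> cnj (w t \<xi>)" unfolding Wh[OF t] by (intro tendsto_intros wl[OF t])
  qed
  show ?thesis using wj wc wh fxp by blast
qed

section \<open>Energy identities\<close>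

lemma cmod_square_deriv:
  assumes d: "(y has_vector_derivative y') (at x within S)"
  shows "((\<lambda>t. (cmod (y t))\<^sup>2) has_vector_derivative 2 * Re (y' * cnj (y x))) (at x within S)"
proof -
  have "((\<lambda>t. y t * cnj (y t)) has_vector_derivative (y x * cnj y' + y' * cnj (y x))) (at x within S)"
    by (rule has_vector_derivative_mult[OF d has_vector_derivative_cnj[OF d]])
  from bounded_linear.has_vector_derivative[OF bounded_linear_Re this]
  have "((\<lambda>t. Re (y t * cnj (y t))) has_vector_derivative Re (y x * cnj y' + y' * cnj (y x))) (at x within S)" .
  moreover have "Re (y t * cnj (y t)) = (cmod (y t))\<^sup>2" for t unfolding cmod_power2 by (simp add: power2_eq_square)
  moreover have "Re (y x * cnj y' + y' * cnj (y x)) = 2 * Re (y' * cnj (y x))" by simp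
  ultimately show ?thesis by simp
qed

text \<open>The squared modulus is differentiated and integrated in time at each frequency, then
  multiplied by m and integrated in xi. The assumptions I1 and I2 are the absolute integrability
  that allows the two integrations to be exchanged; it has different causes for truncated solutions
  and for their limit.\<close>

lemma energy_identity:
  fixes y f :: "real \<Rightarrow> pt \<Rightarrow> complex" and l m :: "pt \<Rightarrow> real"
  assumes jy: "jmeas y" and jf: "jmeas f"
    and [measurable]: "l \<in> borel_measurable borel" "m \<in> borel_measurable borel"
    and ode: "\<And>t \<xi>. 0 \<le> t \<Longrightarrow> ((\<lambda>t. y t \<xi>) has_vector_derivative (- complex_of_real (l \<xi>) * y t \<xi> - f t \<xi>)) (at t within {0..})"
    and cf: "\<And>\<xi>. continuous_on {0..} (\<lambda>t. f t \<xi>)"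
    and rt: "0 \<le> r" "r \<le> t"
    and ir: "integrable lborel (\<lambda>\<xi>. m \<xi> * (cmod (y r \<xi>))\<^sup>2)" and it: "integrable lborel (\<lambda>\<xi>. m \<xi> * (cmod (y t \<xi>))\<^sup>2)"
    and I1: "integrable lborel2 (\<lambda>(\<tau>, \<xi>). indicator {r..t} \<tau> * (m \<xi> * l \<xi> * (cmod (y \<tau> \<xi>))\<^sup>2))"
    and I2: "integrable lborel2 (\<lambda>(\<tau>, \<xi>). indicator {r..t} \<tau> * (m \<xi> * Re (f \<tau> \<xi> * cnj (y \<tau> \<xi>))))"
  shows "set_integrable lborel {r..t} (\<lambda>\<tau>. LINT \<xi>|lborel. m \<xi> * l \<xi> * (cmod (y \<tau> \<xi>))\<^sup>2)" (is ?S1)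
    and "set_integrable lborel {r..t} (\<lambda>\<tau>. LINT \<xi>|lborel. m \<xi> * Re (f \<tau> \<xi> * cnj (y \<tau> \<xi>)))" (is ?S2)
    and "(LINT \<xi>|lborel. m \<xi> * (cmod (y t \<xi>))\<^sup>2) = (LINT \<xi>|lborel. m \<xi> * (cmod (y r \<xi>))\<^sup>2)
       - 2 * (LINT \<tau>:{r..t}|lborel. LINT \<xi>|lborel. m \<xi> * l \<xi> * (cmod (y \<tau> \<xi>))\<^sup>2)
       - 2 * (LINT \<tau>:{r..t}|lborel. LINT \<xi>|lborel. m \<xi> * Re (f \<tau> \<xi> * cnj (y \<tau> \<xi>)))" (is ?E)
proof -
  have cy: "continuous_on {0..} (\<lambda>t. y t \<xi>)" for \<xi>
    by (rule continuous_on_vector_derivative) (rule ode, simp)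
  let ?a = "\<lambda>\<tau> \<xi>. m \<xi> * l \<xi> * (cmod (y \<tau> \<xi>))\<^sup>2" and ?b = "\<lambda>\<tau> \<xi>. m \<xi> * Re (f \<tau> \<xi> * cnj (y \<tau> \<xi>))"
  show ?S1 using lborel_pair.integrable_fst[OF I1] by (simp add: set_integrable_def)
  show ?S2 using lborel_pair.integrable_fst[OF I2] by (simp add: set_integrable_def)
  have pw: "m \<xi> * (cmod (y t \<xi>))\<^sup>2 - m \<xi> * (cmod (y r \<xi>))\<^sup>2 = - 2 * (LINT \<tau>|lborel. indicator {r..t} \<tau> * ?a \<tau> \<xi>) - 2 * (LINT \<tau>|lborel. indicator {r..t} \<tau> * ?b \<tau> \<xi>)" for \<xi>
  proof -
    let ?y' = "\<lambda>\<tau>. - complex_of_real (l \<xi>) * y \<tau> \<xi> - f \<tau> \<xi>"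
    have c': "continuous_on {r..t} (\<lambda>\<tau>. 2 * Re (?y' \<tau> * cnj (y \<tau> \<xi>)))"
      using rt by (intro continuous_intros continuous_on_subset[OF cy] continuous_on_subset[OF cf]) auto
    have "(LINT \<tau>|lborel. indicator {r..t} \<tau> *\<^sub>R (2 * Re (?y' \<tau> * cnj (y \<tau> \<xi>)))) = (cmod (y t \<xi>))\<^sup>2 - (cmod (y r \<xi>))\<^sup>2"
    proof (rule integral_FTC_Icc[OF rt(2) _ c'])
      fix \<tau> assume "r \<le> \<tau>" "\<tau> \<le> t"
      then have "((\<lambda>t. (cmod (y t \<xi>))\<^sup>2) has_vector_derivative 2 * Re (?y' \<tau> * cnj (y \<tau> \<xi>))) (at \<tau> within {0..})"
        using rt by (intro cmod_square_deriv[OF ode]) auto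
      then show "((\<lambda>t. (cmod (y t \<xi>))\<^sup>2) has_vector_derivative 2 * Re (?y' \<tau> * cnj (y \<tau> \<xi>))) (at \<tau> within {r..t})"
        by (rule has_vector_derivative_within_subset) (use rt in auto)
    qed
    moreover have "indicator {r..t} \<tau> *\<^sub>R (2 * Re (?y' \<tau> * cnj (y \<tau> \<xi>))) = - 2 * (indicator {r..t} \<tau> * (l \<xi> * (cmod (y \<tau> \<xi>))\<^sup>2)) - 2 * (indicator {r..t} \<tau> * Re (f \<tau> \<xi> * cnj (y \<tau> \<xi>)))" for \<tau>
    proof -
      have "Re (?y' \<tau> * cnj (y \<tau> \<xi>)) = - (l \<xi> * (cmod (y \<tau> \<xi>))\<^sup>2) - Re (f \<tau> \<xi> * cnj (y \<tau> \<xi>))"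
        unfolding cmod_power2 by (simp add: power2_eq_square algebra_simps)
      then show ?thesis by (simp add: algebra_simps)
    qed
    moreover have i1: "integrable lborel (\<lambda>\<tau>. indicator {r..t} \<tau> * (l \<xi> * (cmod (y \<tau> \<xi>))\<^sup>2))"
    proof -
      have "continuous_on {0..} (\<lambda>\<tau>. l \<xi> * (cmod (y \<tau> \<xi>))\<^sup>2)" by (intro continuous_intros cy)
      from set_integrable_continuous[OF this rt(1), of t] show ?thesis by (simp only: set_integrable_def real_scaleR_def)
    qed
    moreover have i2: "integrable lborel (\<lambda>\<tau>. indicator {r..t} \<tau> * Re (f \<tau> \<xi> * cnj (y \<tau> \<xi>)))"
      using set_integrable_continuous[of "\<lambda>\<tau>. Re (f \<tau> \<xi> * cnj (y \<tau> \<xi>))" r t, OF _ rt(1)] continuous_on_Re[OF continuous_on_mult[OF cf[of \<xi>] continuous_on_cnj[OF cy[of \<xi>]]]]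
      by (simp only: set_integrable_def real_scaleR_def)
    ultimately have *: "(cmod (y t \<xi>))\<^sup>2 - (cmod (y r \<xi>))\<^sup>2 = - 2 * (LINT \<tau>|lborel. indicator {r..t} \<tau> * (l \<xi> * (cmod (y \<tau> \<xi>))\<^sup>2)) - 2 * (LINT \<tau>|lborel. indicator {r..t} \<tau> * Re (f \<tau> \<xi> * cnj (y \<tau> \<xi>)))"
      by (simp del: times_complex.sel)
    have a: "(LINT \<tau>|lborel. indicator {r..t} \<tau> * ?a \<tau> \<xi>) = m \<xi> * (LINT \<tau>|lborel. indicator {r..t} \<tau> * (l \<xi> * (cmod (y \<tau> \<xi>))\<^sup>2))"
      unfolding integral_mult_right_zero[symmetric] by (rule Bochner_Integration.integral_cong) (simp_all only: mult_ac)
    have b: "(LINT \<tau>|lborel. indicator {r..t} \<tau> * ?b \<tau> \<xi>) = m \<xi> * (LINT \<tau>|lborel. indicator {r..t} \<tau> * Re (f \<tau> \<xi> * cnj (y \<tau> \<xi>)))"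
      unfolding integral_mult_right_zero[symmetric] by (rule Bochner_Integration.integral_cong) (simp_all only: mult_ac)
    show ?thesis unfolding a b right_diff_distrib[symmetric] * by (simp only: right_diff_distrib mult_ac)
  qed
  have "(LINT \<xi>|lborel. m \<xi> * (cmod (y t \<xi>))\<^sup>2) - (LINT \<xi>|lborel. m \<xi> * (cmod (y r \<xi>))\<^sup>2) =
     (LINT \<xi>|lborel. - 2 * (LINT \<tau>|lborel. indicator {r..t} \<tau> * ?a \<tau> \<xi>) - 2 * (LINT \<tau>|lborel. indicator {r..t} \<tau> * ?b \<tau> \<xi>))"
    unfolding Bochner_Integration.integral_diff[OF it ir, symmetric] pw ..
  also have "\<dots> = - 2 * (LINT \<xi>|lborel. LINT \<tau>|lborel. indicator {r..t} \<tau> * ?a \<tau> \<xi>) - 2 * (LINT \<xi>|lborel. LINT \<tau>|lborel. indicator {r..t} \<tau> * ?b \<tau> \<xi>)"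
  proof -
    have "integrable lborel (\<lambda>\<xi>. - 2 * (LINT \<tau>|lborel. indicator {r..t} \<tau> * ?a \<tau> \<xi>))" "integrable lborel (\<lambda>\<xi>. 2 * (LINT \<tau>|lborel. indicator {r..t} \<tau> * ?b \<tau> \<xi>))"
      by (intro integrable_mult_right lborel_pair.integrable_snd[OF I1] lborel_pair.integrable_snd[OF I2])+
    from Bochner_Integration.integral_diff[OF this] show ?thesis by (simp only: integral_mult_right_zero)
  qed
  also have "(LINT \<xi>|lborel. LINT \<tau>|lborel. indicator {r..t} \<tau> * ?a \<tau> \<xi>) = (LINT \<tau>:{r..t}|lborel. LINT \<xi>|lborel. ?a \<tau> \<xi>)"
    unfolding lborel_pair.Fubini_integral[OF I1] set_lebesgue_integral_def by simp
  also have "(LINT \<xi>|lborel. LINT \<tau>|lborel. indicator {r..t} \<tau> * ?b \<tau> \<xi>) = (LINT \<tau>:{r..t}|lborel. LINT \<xi>|lborel. ?b \<tau> \<xi>)"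
    unfolding lborel_pair.Fubini_integral[OF I2] set_lebesgue_integral_def by (simp del: times_complex.sel)
  finally show ?E by (simp del: times_complex.sel)
qed

lemma integrable_time_dominated:
  fixes u :: "real \<Rightarrow> pt \<Rightarrow> real"
  assumes u: "(\<lambda>(\<tau>, \<xi>). u \<tau> \<xi>) \<in> borel_measurable (borel \<Otimes>\<^sub>M borel)" and g: "integrable lborel g"
    and le: "\<And>\<tau> \<xi>. \<tau> \<in> {r..t} \<Longrightarrow> \<bar>u \<tau> \<xi>\<bar> \<le> g \<xi>"
  shows "integrable lborel2 (\<lambda>(\<tau>, \<xi>). indicator {r..t} \<tau> * u \<tau> \<xi>)"
proof -
  have [measurable]: "g \<in> borel_measurable borel" using borel_measurable_integrable[OF g] by simp
  have "(\<lambda>p. u (fst p) (snd p)) \<in> borel_measurable (borel \<Otimes>\<^sub>M borel)" using u by (simp add: split_beta')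
  then have [measurable]: "(\<lambda>p. u (fst p) (snd p)) \<in> borel_measurable lborel2" by simp
  have i: "integrable lborel2 (\<lambda>(\<tau>, \<xi>). complex_of_real (indicator {r..t} \<tau>) * complex_of_real (g \<xi>))"
    by (rule integrable_prod_mult) (use g in \<open>auto intro!: integrable_of_real integrable_real_indicator simp: emeasure_lborel_Icc_eq\<close>)
  show ?thesis
  proof (rule Bochner_Integration.integrable_bound[OF i])
    show "AE p in lborel \<Otimes>\<^sub>M lborel. norm (case p of (\<tau>, \<xi>) \<Rightarrow> indicator {r..t} \<tau> * u \<tau> \<xi>) \<le> norm (case p of (\<tau>, \<xi>) \<Rightarrow> complex_of_real (indicator {r..t} \<tau>) * complex_of_real (g \<xi>))"
    proof (rule AE_I2, clarify)
      fix \<tau> :: real and \<xi> :: pt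
      show "norm (indicator {r..t} \<tau> * u \<tau> \<xi>) \<le> norm (complex_of_real (indicator {r..t} \<tau>) * complex_of_real (g \<xi>))"
        using order_trans[OF le abs_ge_self] by (cases "\<tau> \<in> {r..t}") (auto simp: norm_mult)
    qed
  qed (simp add: split_beta')
qed

text \<open>Inside a fixed ball the symbol, the weight and the force are bounded, so one L2 majorant
  of the solution gives all the integrability that \<open>energy_identity\<close> requires. It is
  applied to one truncated solution and to the difference of two.\<close>

lemma ball_energy:
  fixes y f :: "real \<Rightarrow> pt \<Rightarrow> complex" and l m :: "pt \<Rightarrow> real"
  assumes jy: "jmeas y" and jf: "jmeas f"
    and lm [measurable]: "l \<in> borel_measurable borel" and mm [measurable]: "m \<in> borel_measurable borel"
    and ode: "\<And>t \<xi>. 0 \<le> t \<Longrightarrow> ((\<lambda>t. y t \<xi>) has_vector_derivative (- complex_of_real (l \<xi>) * y t \<xi> - f t \<xi>)) (at t within {0..})"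
    and cf: "\<And>\<xi>. continuous_on {0..} (\<lambda>t. f t \<xi>)"
    and rt: "0 \<le> r" "r \<le> t"
    and supp: "\<And>t \<xi>. 0 \<le> t \<Longrightarrow> norm \<xi> > N \<Longrightarrow> y t \<xi> = 0"
    and bl: "\<And>\<xi>. norm \<xi> \<le> N \<Longrightarrow> \<bar>l \<xi>\<bar> \<le> Bl" and bm: "\<And>\<xi>. norm \<xi> \<le> N \<Longrightarrow> \<bar>m \<xi>\<bar> \<le> Bm" and B0: "0 \<le> Bl" "0 \<le> Bm" "0 \<le> K"
    and dom: "L2c h" "\<And>\<tau> \<xi>. \<tau> \<in> {0..t} \<Longrightarrow> cmod (y \<tau> \<xi>) \<le> cmod (h \<xi>)"
    and fb: "\<And>\<tau> \<xi>. \<tau> \<in> {0..t} \<Longrightarrow> norm \<xi> \<le> N \<Longrightarrow> cmod (f \<tau> \<xi>) \<le> K"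
  shows "set_integrable lborel {r..t} (\<lambda>\<tau>. LINT \<xi>|lborel. m \<xi> * l \<xi> * (cmod (y \<tau> \<xi>))\<^sup>2)"
    and "set_integrable lborel {r..t} (\<lambda>\<tau>. LINT \<xi>|lborel. m \<xi> * Re (f \<tau> \<xi> * cnj (y \<tau> \<xi>)))"
    and "(LINT \<xi>|lborel. m \<xi> * (cmod (y t \<xi>))\<^sup>2) = (LINT \<xi>|lborel. m \<xi> * (cmod (y r \<xi>))\<^sup>2)
       - 2 * (LINT \<tau>:{r..t}|lborel. LINT \<xi>|lborel. m \<xi> * l \<xi> * (cmod (y \<tau> \<xi>))\<^sup>2)
       - 2 * (LINT \<tau>:{r..t}|lborel. LINT \<xi>|lborel. m \<xi> * Re (f \<tau> \<xi> * cnj (y \<tau> \<xi>)))"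
proof -
  note [measurable] = jmeas_slice[OF jy]
  note [measurable (raw)] = measurable_pair_apply[OF jy] measurable_pair_apply[OF jf]
  have h2: "(cmod (y \<tau> \<xi>))\<^sup>2 \<le> (cmod (h \<xi>))\<^sup>2" if "\<tau> \<in> {0..t}" for \<tau> \<xi>
    by (intro power_mono dom(2)[OF that]) simp
  have hi: "integrable lborel (\<lambda>\<xi>. (cmod (h \<xi>))\<^sup>2)" by (rule L2c_integrable[OF dom(1)])
  have b1: "\<bar>m \<xi> * (cmod (y \<tau> \<xi>))\<^sup>2\<bar> \<le> Bm * (cmod (h \<xi>))\<^sup>2" if "\<tau> \<in> {0..t}" for \<tau> \<xi>
  proof (cases "norm \<xi> \<le> N")
    case True
    show ?thesis unfolding abs_mult using bm[OF True] h2[OF that, of \<xi>] B0 by (intro mult_mono) auto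
  qed (use supp[of \<tau> \<xi>] that B0 in auto)
  have im: "integrable lborel (\<lambda>\<xi>. m \<xi> * (cmod (y \<tau> \<xi>))\<^sup>2)" if "\<tau> \<in> {0..t}" for \<tau>
    by (rule Bochner_Integration.integrable_bound[OF integrable_mult_right[OF hi, of Bm]]) (use b1[OF that] in \<open>auto intro: order_trans[OF _ abs_ge_self]\<close>)
  have I1: "integrable lborel2 (\<lambda>(\<tau>, \<xi>). indicator {r..t} \<tau> * (m \<xi> * l \<xi> * (cmod (y \<tau> \<xi>))\<^sup>2))"
  proof (rule integrable_time_dominated[where g="\<lambda>\<xi>. Bl * (Bm * (cmod (h \<xi>))\<^sup>2)"])
    show "(\<lambda>(\<tau>, \<xi>). m \<xi> * l \<xi> * (cmod (y \<tau> \<xi>))\<^sup>2) \<in> borel_measurable (borel \<Otimes>\<^sub>M borel)" unfolding split_beta' by measurable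
    show "integrable lborel (\<lambda>\<xi>. Bl * (Bm * (cmod (h \<xi>))\<^sup>2))" by (intro integrable_mult_right hi)
    fix \<tau> \<xi> assume "\<tau> \<in> {r..t}"
    then have \<tau>: "\<tau> \<in> {0..t}" using rt by auto
    show "\<bar>m \<xi> * l \<xi> * (cmod (y \<tau> \<xi>))\<^sup>2\<bar> \<le> Bl * (Bm * (cmod (h \<xi>))\<^sup>2)"
    proof (cases "norm \<xi> \<le> N")
      case True
      have "\<bar>m \<xi> * l \<xi> * (cmod (y \<tau> \<xi>))\<^sup>2\<bar> = \<bar>l \<xi>\<bar> * \<bar>m \<xi> * (cmod (y \<tau> \<xi>))\<^sup>2\<bar>" by (simp add: abs_mult)
      also have "\<dots> \<le> Bl * (Bm * (cmod (h \<xi>))\<^sup>2)" using bl[OF True] b1[OF \<tau>, of \<xi>] B0 by (intro mult_mono) auto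
      finally show ?thesis .
    qed (use supp[of \<tau> \<xi>] \<tau> B0 in auto)
  qed
  let ?i = "\<lambda>\<xi>. if norm \<xi> \<le> N then 1 else (0::complex)"
  have I2: "integrable lborel2 (\<lambda>(\<tau>, \<xi>). indicator {r..t} \<tau> * (m \<xi> * Re (f \<tau> \<xi> * cnj (y \<tau> \<xi>))))"
  proof (rule integrable_time_dominated[where g="\<lambda>\<xi>. Bm * K * (cmod (?i \<xi>) * cmod (h \<xi>))"])
    show "(\<lambda>(\<tau>, \<xi>). m \<xi> * Re (f \<tau> \<xi> * cnj (y \<tau> \<xi>))) \<in> borel_measurable (borel \<Otimes>\<^sub>M borel)" unfolding split_beta' by measurable
    show "integrable lborel (\<lambda>\<xi>. Bm * K * (cmod (?i \<xi>) * cmod (h \<xi>)))"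
      by (intro integrable_mult_right L2c_mult_integrable_norm L2c_ball_const dom(1))
    fix \<tau> \<xi> assume "\<tau> \<in> {r..t}"
    then have \<tau>: "\<tau> \<in> {0..t}" using rt by auto
    show "\<bar>m \<xi> * Re (f \<tau> \<xi> * cnj (y \<tau> \<xi>))\<bar> \<le> Bm * K * (cmod (?i \<xi>) * cmod (h \<xi>))"
    proof (cases "norm \<xi> \<le> N")
      case True
      have "\<bar>Re (f \<tau> \<xi> * cnj (y \<tau> \<xi>))\<bar> \<le> cmod (f \<tau> \<xi>) * cmod (y \<tau> \<xi>)"
        using abs_Re_le_cmod[of "f \<tau> \<xi> * cnj (y \<tau> \<xi>)"] unfolding norm_mult complex_mod_cnj .
      also have "\<dots> \<le> K * cmod (h \<xi>)" using fb[OF \<tau> True] dom(2)[OF \<tau>, of \<xi>] B0 by (intro mult_mono) auto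
      finally have "\<bar>m \<xi>\<bar> * \<bar>Re (f \<tau> \<xi> * cnj (y \<tau> \<xi>))\<bar> \<le> Bm * (K * cmod (h \<xi>))" using bm[OF True] B0 by (intro mult_mono) auto
      then show ?thesis using True unfolding abs_mult by (simp only: if_True norm_one mult_1 mult.assoc)
    qed (use supp[of \<tau> \<xi>] \<tau> B0 in auto)
  qed
  have "r \<in> {0..t}" "t \<in> {0..t}" using rt by auto
  note E = energy_identity[OF jy jf lm mm ode cf rt im[OF this(1)] im[OF this(2)] I1 I2]
  show "set_integrable lborel {r..t} (\<lambda>\<tau>. LINT \<xi>|lborel. m \<xi> * l \<xi> * (cmod (y \<tau> \<xi>))\<^sup>2)"
    by (rule E(1))
  show "set_integrable lborel {r..t} (\<lambda>\<tau>. LINT \<xi>|lborel. m \<xi> * Re (f \<tau> \<xi> * cnj (y \<tau> \<xi>)))"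
    by (rule E(2))
  show "(LINT \<xi>|lborel. m \<xi> * (cmod (y t \<xi>))\<^sup>2) = (LINT \<xi>|lborel. m \<xi> * (cmod (y r \<xi>))\<^sup>2)
       - 2 * (LINT \<tau>:{r..t}|lborel. LINT \<xi>|lborel. m \<xi> * l \<xi> * (cmod (y \<tau> \<xi>))\<^sup>2)
       - 2 * (LINT \<tau>:{r..t}|lborel. LINT \<xi>|lborel. m \<xi> * Re (f \<tau> \<xi> * cnj (y \<tau> \<xi>)))"
    by (rule E(3))
qed

section \<open>The dissipation symbol and the truncated system\<close>

definition lamb :: "real \<Rightarrow> pt \<Rightarrow> real" where "lamb \<alpha> \<xi> = norm \<xi> powr (2 * \<alpha>)"

lemma lamb_measurable [measurable]: "lamb \<alpha> \<in> borel_measurable borel"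
  unfolding lamb_def[abs_def] by measurable

lemma lamb_nonneg [simp]: "0 \<le> lamb \<alpha> \<xi>" by (simp add: lamb_def)

lemma lamb_even: "lamb \<alpha> (- \<xi>) = lamb \<alpha> \<xi>" by (simp add: lamb_def)

lemma powr_half_square: "(x powr a)\<^sup>2 = x powr (2 * a)" for x :: real
  by (simp add: power2_eq_square powr_add[symmetric])

lemma cmod_wt_square: "(cmod (wt r f \<xi>))\<^sup>2 = norm \<xi> powr (2 * r) * (cmod (f \<xi>))\<^sup>2"
  unfolding cmod_wt power_mult_distrib powr_half_square ..

lemma n2_wt_square: "(n2 (wt r f))\<^sup>2 = (LINT \<xi>|lborel. norm \<xi> powr (2 * r) * (cmod (f \<xi>))\<^sup>2)"
  unfolding n2_squared L2norm_sq_def cmod_wt_square ..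

lemma L2c_wt_supp:
  assumes a: "L2c a" and z: "\<And>\<xi>. norm \<xi> > N \<Longrightarrow> a \<xi> = 0" and r: "0 \<le> r"
  shows "L2c (wt r a)" "n2 (wt r a) \<le> N powr r * n2 a"
proof -
  have m: "wt r a \<in> borel_measurable lborel" using wt_measurable[of a r] L2c_measurable[OF a] by simp
  have "cmod (wt r a \<xi>) \<le> N powr r * cmod (a \<xi>)" for \<xi>
  proof (cases "norm \<xi> \<le> N")
    case True then show ?thesis unfolding cmod_wt using r by (intro mult_right_mono powr_mono2) auto
  next
    case False then show ?thesis using z[of \<xi>] by (simp add: cmod_wt)
  qed
  then have "AE \<xi> in lborel. cmod (wt r a \<xi>) \<le> N powr r * cmod (a \<xi>)" by simp
  from L2c_mono[OF a m this] show "L2c (wt r a)" "n2 (wt r a) \<le> N powr r * n2 a" by auto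
qed

lemma wt_diff: "wt r (\<lambda>\<xi>. a \<xi> - b \<xi>) = (\<lambda>\<xi>. wt r a \<xi> - wt r b \<xi>)"
  by (simp add: wt_def[abs_def] right_diff_distrib)

lemma duh_0: "continuous_on {0..} (\<lambda>\<tau>. f \<tau> \<xi>) \<Longrightarrow> duh l w0 f 0 \<xi> = w0 \<xi>"
  by (subst duh_alt) auto

text \<open>The L2 bound is part of the notion: it is what removes the retraction used in the
  construction, and the equation can be written with \<open>NL\<close>. The equation is required at
  every frequency and for every t \<ge> 0.\<close>

definition galerkin :: "real \<Rightarrow> real \<Rightarrow> (pt \<Rightarrow> complex) \<Rightarrow> (real \<Rightarrow> pt \<Rightarrow> complex) \<Rightarrow> bool" where
  "galerkin \<alpha> n w0 w \<longleftrightarrow> jmeas w \<and> l2cont w \<and> (\<forall>t\<ge>0. \<forall>\<xi>. w t (- \<xi>) = cnj (w t \<xi>)) \<and>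
     (\<forall>t\<ge>0. n2 (w t) \<le> n2 w0) \<and>
     (\<forall>t\<ge>0. \<forall>\<xi>. w t \<xi> = (if norm \<xi> \<le> n then duh (lamb \<alpha>) w0 (\<lambda>\<tau>. NL (w \<tau>) (w \<tau>)) t \<xi> else 0))"

lemma duhamel_ode:
  assumes eq: "\<And>t. 0 \<le> t \<Longrightarrow> w t \<xi> = (if norm \<xi> \<le> n then duh l w0 f t \<xi> else 0)"
    and c: "continuous_on {0..} (\<lambda>\<tau>. f \<tau> \<xi>)" and t: "0 \<le> t"
  shows "((\<lambda>t. w t \<xi>) has_vector_derivative (- complex_of_real (l \<xi>) * w t \<xi> - (if norm \<xi> \<le> n then f t \<xi> else 0))) (at t within {0..})"
proof (cases "norm \<xi> \<le> n")
  case True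
  have "((\<lambda>t. duh l w0 f t \<xi>) has_vector_derivative (- complex_of_real (l \<xi>) * duh l w0 f t \<xi> - f t \<xi>)) (at t within {0..})"
    by (rule duh_deriv[where f=f and \<xi>=\<xi>, OF c t])
  then show ?thesis using True eq t by (auto intro: has_vector_derivative_transform[rotated 2])
next
  case False
  have "((\<lambda>t. 0) has_vector_derivative (0::complex)) (at t within {0..})" by simp
  then have "((\<lambda>t. w t \<xi>) has_vector_derivative 0) (at t within {0..})"
    by (rule has_vector_derivative_transform[rotated 2]) (use False eq t in auto)
  then show ?thesis using False eq[OF t] by simp
qed

lemma kap_trilinear_supp_finite:
  assumes L: "L2c a" "L2c b" "L2c d" and z: "\<And>\<xi>. norm \<xi> > N \<Longrightarrow> a \<xi> = 0" "\<And>\<xi>. norm \<xi> > N \<Longrightarrow> b \<xi> = 0" "\<And>\<xi>. norm \<xi> > N \<Longrightarrow> d \<xi> = 0"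
  shows "(kap_form a b d) < \<infinity>"
proof -
  \<comment> \<open>The equal exponents 1/3 are a convenient admissible triple; on functions of
    bounded support every nonnegative weight is harmless.\<close>
  obtain C where C: "\<forall>a b d. L2c (wt (1/3) a) \<longrightarrow> L2c (wt (1 + 1/3) b) \<longrightarrow> L2c (wt (1/3) d) \<longrightarrow>
     kap_form a b d
       \<le> ennreal (C * n2 (wt (1/3) a) * n2 (wt (1 + 1/3) b) * n2 (wt (1/3) d))"
    using kap_trilinear[of "1/3" "1/3" "1/3"] by auto
  have "L2c (wt (1/3) a)" "L2c (wt (1 + 1/3) b)" "L2c (wt (1/3) d)"
    by (rule L2c_wt_supp(1)[OF L(1) z(1)] L2c_wt_supp(1)[OF L(2) z(2)] L2c_wt_supp(1)[OF L(3) z(3)]; simp)+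
  from le_less_trans[OF C[rule_format, OF this]] show ?thesis by simp
qed

text \<open>The case m = 1 of \<open>NL_symmetrize\<close>, in which the difference of weights
  vanishes. The velocity factor a has to be Hermitian, the transported b is arbitrary; this freedom
  is used with b a difference of two solutions.\<close>

lemma NL_cancel_supp:
  assumes L: "L2c a" "L2c b" and z: "\<And>\<xi>. norm \<xi> > N \<Longrightarrow> a \<xi> = 0" "\<And>\<xi>. norm \<xi> > N \<Longrightarrow> b \<xi> = 0"
    and h: "\<And>\<xi>. a (- \<xi>) = cnj (a \<xi>)"
  shows "(LINT \<xi>|lborel. Re (NL a b \<xi> * cnj (b \<xi>))) = 0" "integrable lborel (\<lambda>\<xi>. NL a b \<xi> * cnj (b \<xi>))"
proof -
  have m: "a \<in> borel_measurable borel" "b \<in> borel_measurable borel" using L by (auto dest!: L2c_measurable)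
  note S = NL_symmetrize[OF m h kap_trilinear_supp_finite[where N=N, OF L L(2) z z(2)], where m="\<lambda>_. 1" and B=1]
  show i: "integrable lborel (\<lambda>\<xi>. NL a b \<xi> * cnj (b \<xi>))" using S(1) by simp
  have "ennreal \<bar>2 * Re (LINT \<xi>|lborel. NL a b \<xi> * cnj (b \<xi>))\<bar> \<le> 0" using S(2) by (simp add: split_beta')
  then have "Re (LINT \<xi>|lborel. NL a b \<xi> * cnj (b \<xi>)) = 0" by (simp add: ennreal_eq_0_iff)
  then show "(LINT \<xi>|lborel. Re (NL a b \<xi> * cnj (b \<xi>))) = 0" using integral_Re[OF i] by simp
qed

lemma galerkin_exists:
  assumes al: "0 < \<alpha>" and n: "0 < n" and w0: "L2c w0" "\<And>\<xi>. w0 (- \<xi>) = cnj (w0 \<xi>)"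
  shows "\<exists>w. galerkin \<alpha> n w0 w"
proof -
  \<comment> \<open>A radius above the norm of the data. Since \<open>GN\<close> is a multiple of
    \<open>NL\<close>, it does no work in the L2 energy, so the solution stays inside this ball and
    the retraction never acts.\<close>
  define M where "M = n2 w0 + 1"
  have M: "0 < M" by (simp add: M_def add_nonneg_pos)
  obtain w where W: "jmeas w \<and> l2cont w \<and> (\<forall>t\<ge>0. \<forall>\<xi>. w t (- \<xi>) = cnj (w t \<xi>)) \<and> (\<forall>t\<ge>0. \<forall>\<xi>. w t \<xi> = picard (lamb \<alpha>) w0 M n w t \<xi>)"
    using galerkin_fixpoint[of M n "lamb \<alpha>" w0, OF M n lamb_nonneg lamb_measurable lamb_even w0] by (rule exE)
  have jw: "jmeas w" and cw: "l2cont w" using W by (simp_all only:)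
  have hw: "w t (- \<xi>) = cnj (w t \<xi>)" if "0 \<le> t" for t \<xi>
    by (rule W[THEN conjunct2, THEN conjunct2, THEN conjunct1, rule_format, OF that])
  have ew: "w t \<xi> = picard (lamb \<alpha>) w0 M n w t \<xi>" if "0 \<le> t" for t \<xi>
    by (rule W[THEN conjunct2, THEN conjunct2, THEN conjunct2, rule_format, OF that])
  note L = l2cont_L2c[OF cw]
  have z: "w t \<xi> = 0" if "0 \<le> t" "norm \<xi> > n" for t \<xi> using ew[OF that(1), of \<xi>] that(2) by (simp add: picard_def)
  define f where "f t \<xi> = (if norm \<xi> \<le> n then GN M (w t) \<xi> else 0)" for t \<xi>
  have jf: "jmeas f"
  proof -
    note [measurable (raw)] = measurable_pair_apply[OF GN_measurable[OF jw, of M]]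
    show ?thesis unfolding f_def split_beta' by measurable
  qed
  have cf: "continuous_on {0..} (\<lambda>t. f t \<xi>)" for \<xi>
    unfolding f_def using GN_continuous[OF M cw] by (cases "norm \<xi> \<le> n") auto
  have ode: "((\<lambda>t. w t \<xi>) has_vector_derivative (- complex_of_real (lamb \<alpha> \<xi>) * w t \<xi> - f t \<xi>)) (at t within {0..})" if "0 \<le> t" for t \<xi>
    unfolding f_def by (rule duhamel_ode[OF _ GN_continuous[OF M cw] that]) (use ew in \<open>simp add: picard_def\<close>)
  have w00: "w 0 \<xi> = (if norm \<xi> \<le> n then w0 \<xi> else 0)" for \<xi>
    using ew[of 0 \<xi>] duh_0[OF GN_continuous[OF M cw]] by (simp add: picard_def)
  have le: "n2 (w t) \<le> n2 w0" if t: "0 \<le> t" for t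
  proof -
    obtain h where h: "L2c h" "\<forall>\<tau>\<in>{0..t}. \<forall>\<xi>. cmod (picard (lamb \<alpha>) w0 M n w \<tau> \<xi>) \<le> cmod (h \<xi>)"
      using picard_l2cont(3)[OF M lamb_nonneg lamb_measurable w0(1) cw jw t, of \<alpha> n] by blast
    have E: "(LINT \<xi>|lborel. 1 * (cmod (w t \<xi>))\<^sup>2) = (LINT \<xi>|lborel. 1 * (cmod (w 0 \<xi>))\<^sup>2)
       - 2 * (LINT \<tau>:{0..t}|lborel. LINT \<xi>|lborel. 1 * lamb \<alpha> \<xi> * (cmod (w \<tau> \<xi>))\<^sup>2)
       - 2 * (LINT \<tau>:{0..t}|lborel. LINT \<xi>|lborel. 1 * Re (f \<tau> \<xi> * cnj (w \<tau> \<xi>)))"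
    proof (rule ball_energy(3)[OF jw jf _ _ ode cf order_refl t z, where h=h and K="n * M\<^sup>2" and Bl="n powr (2*\<alpha>)" and Bm=1])
      show "\<bar>lamb \<alpha> \<xi>\<bar> \<le> n powr (2 * \<alpha>)" if "norm \<xi> \<le> n" for \<xi> using that al by (simp add: lamb_def powr_mono2)
      show "cmod (w \<tau> \<xi>) \<le> cmod (h \<xi>)" if "\<tau> \<in> {0..t}" for \<tau> \<xi> using h(2) that ew[of \<tau> \<xi>] by auto
      show "cmod (f \<tau> \<xi>) \<le> n * M\<^sup>2" if "\<tau> \<in> {0..t}" "norm \<xi> \<le> n" for \<tau> \<xi>
      proof -
        have "cmod (f \<tau> \<xi>) \<le> norm \<xi> * M\<^sup>2" using that GN_bound[OF M L, of \<tau> \<xi>] by (simp add: f_def)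
        also have "\<dots> \<le> n * M\<^sup>2" using that by (intro mult_right_mono) auto
        finally show ?thesis .
      qed
    qed (use h(1) n in auto)
    have "(LINT \<xi>|lborel. 1 * Re (f \<tau> \<xi> * cnj (w \<tau> \<xi>))) = 0" if "0 \<le> \<tau>" for \<tau>
    proof -
      have "1 * Re (f \<tau> \<xi> * cnj (w \<tau> \<xi>)) = (ret M (w \<tau>))\<^sup>2 * Re (NL (w \<tau>) (w \<tau>) \<xi> * cnj (w \<tau> \<xi>))" for \<xi>
        using z[OF that, of \<xi>] by (cases "norm \<xi> \<le> n") (auto simp: f_def GN_def mult.assoc algebra_simps)
      then have "(LINT \<xi>|lborel. 1 * Re (f \<tau> \<xi> * cnj (w \<tau> \<xi>))) = (ret M (w \<tau>))\<^sup>2 * (LINT \<xi>|lborel. Re (NL (w \<tau>) (w \<tau>) \<xi> * cnj (w \<tau> \<xi>)))"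
        by (simp only: integral_mult_right_zero)
      then show ?thesis using NL_cancel_supp(1)[OF L[OF that] L[OF that] z[OF that] z[OF that] hw[OF that]] by simp
    qed
    then have "(LINT \<tau>:{0..t}|lborel. LINT \<xi>|lborel. 1 * Re (f \<tau> \<xi> * cnj (w \<tau> \<xi>))) = (LINT \<tau>:{0..t}|lborel. 0)"
      by (intro set_lebesgue_integral_cong) auto
    then have e0: "(LINT \<tau>:{0..t}|lborel. LINT \<xi>|lborel. 1 * Re (f \<tau> \<xi> * cnj (w \<tau> \<xi>))) = 0" by (simp add: set_lebesgue_integral_def)
    have "0 \<le> (LINT \<tau>:{0..t}|lborel. LINT \<xi>|lborel. 1 * lamb \<alpha> \<xi> * (cmod (w \<tau> \<xi>))\<^sup>2)"
      unfolding set_lebesgue_integral_def by (intro integral_nonneg_AE) auto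
    then have "L2norm_sq (w t) \<le> L2norm_sq (w 0)" using E e0 unfolding L2norm_sq_def by simp
    then have "n2 (w t) \<le> n2 (w 0)" by (simp add: n2_def)
    also have "n2 (w 0) \<le> 1 * n2 w0"
      by (rule L2c_mono(2)[OF w0(1) L2c_measurable[OF L[OF order_refl]]]) (auto simp: w00)
    finally show ?thesis by simp
  qed
  have GNL: "GN M (w t) \<xi> = NL (w t) (w t) \<xi>" if "0 \<le> t" for t \<xi>
  proof -
    have "ret M (w t) = 1" using le[OF that] M unfolding ret_def M_def by simp
    then show ?thesis by (simp add: GN_def)
  qed
  have "duh (lamb \<alpha>) w0 (\<lambda>\<tau>. GN M (w \<tau>)) t \<xi> = duh (lamb \<alpha>) w0 (\<lambda>\<tau>. NL (w \<tau>) (w \<tau>)) t \<xi>" for t \<xi>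
    unfolding duh_def using GNL by (intro arg_cong2[where f="(-)"] refl set_lebesgue_integral_cong) auto
  then have "galerkin \<alpha> n w0 w"
    unfolding galerkin_def using jw cw hw le ew by (simp add: picard_def)
  then show ?thesis by blast
qed

section \<open>A priori estimates\<close>

text \<open>Continuity argument. If Y exceeded K, there would be a first time z with Y z = K; up to
  z the bound holds, so the step gives K = Y z \<le> Y 0 < K. The strict inequality at time 0 is
  essential.\<close>

lemma bootstrap:
  fixes Y :: "real \<Rightarrow> real"
  assumes c: "continuous_on {0..} Y" and Y0: "Y 0 < K"
    and step: "\<And>t. 0 \<le> t \<Longrightarrow> (\<And>\<tau>. \<tau> \<in> {0..t} \<Longrightarrow> Y \<tau> \<le> K) \<Longrightarrow> Y t \<le> Y 0"
    and t: "0 \<le> t"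
  shows "Y t \<le> Y 0"
proof (rule step[OF t], rule ccontr)
  fix b assume b: "b \<in> {0..t}" and "\<not> Y b \<le> K"
  then have Yb: "K \<le> Y b" and b0: "0 \<le> b" by auto
  have cs: "continuous_on {0..x} Y" for x by (rule continuous_on_subset[OF c]) auto
  define S where "S = {\<tau> \<in> {0..b}. Y \<tau> = K}"
  have "closed S" unfolding S_def by (rule continuous_closed_preimage_constant[OF cs]) simp
  then have "compact S" unfolding compact_eq_bounded_closed
    by (auto simp: S_def intro: bounded_subset[of "{0..b}"])
  moreover have "S \<noteq> {}" using IVT'[OF less_imp_le[OF Y0] Yb b0 cs] by (auto simp: S_def)
  ultimately obtain z where z: "z \<in> S" "\<And>y. y \<in> S \<Longrightarrow> z \<le> y" using compact_attains_inf[of S] by auto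
  have "Y \<tau> \<le> K" if \<tau>: "\<tau> \<in> {0..z}" for \<tau>
  proof (rule ccontr)
    assume "\<not> Y \<tau> \<le> K"
    then have K: "K \<le> Y \<tau>" "Y \<tau> \<noteq> K" by auto
    have \<tau>0: "0 \<le> \<tau>" using \<tau> by simp
    obtain x where x: "0 \<le> x" "x \<le> \<tau>" "Y x = K" using IVT'[OF less_imp_le[OF Y0] K(1) \<tau>0 cs] by auto
    then have "x \<in> S" using z(1) \<tau> by (auto simp: S_def)
    with z(2) have "z \<le> x" by blast
    with x \<tau> have "x = \<tau>" by auto
    with x K show False by simp
  qed
  then have "Y z \<le> Y 0" using z(1) by (intro step) (auto simp: S_def)
  with z(1) Y0 show False by (auto simp: S_def)
qed

section \<open>Bounds and energy of truncated solutions\<close>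

lemma galerkinD:
  assumes "galerkin \<alpha> n w0 w"
  shows "jmeas w" "l2cont w" "0 \<le> t \<Longrightarrow> w t (- \<xi>) = cnj (w t \<xi>)" "0 \<le> t \<Longrightarrow> n2 (w t) \<le> n2 w0"
    "0 \<le> t \<Longrightarrow> w t \<xi> = (if norm \<xi> \<le> n then duh (lamb \<alpha>) w0 (\<lambda>\<tau>. NL (w \<tau>) (w \<tau>)) t \<xi> else 0)"
    "0 \<le> t \<Longrightarrow> norm \<xi> > n \<Longrightarrow> w t \<xi> = 0" "0 \<le> t \<Longrightarrow> L2c (w t)"
proof -
  note G = assms[unfolded galerkin_def]
  note g = G[THEN conjunct1] G[THEN conjunct2, THEN conjunct1] G[THEN conjunct2, THEN conjunct2, THEN conjunct1]
    G[THEN conjunct2, THEN conjunct2, THEN conjunct2, THEN conjunct1] G[THEN conjunct2, THEN conjunct2, THEN conjunct2, THEN conjunct2]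
  show "jmeas w" by (rule g(1))
  show "l2cont w" by (rule g(2))
  show "0 \<le> t \<Longrightarrow> w t (- \<xi>) = cnj (w t \<xi>)" by (rule g(3)[rule_format])
  show "0 \<le> t \<Longrightarrow> n2 (w t) \<le> n2 w0" by (rule g(4)[rule_format])
  show e: "0 \<le> t \<Longrightarrow> w t \<xi> = (if norm \<xi> \<le> n then duh (lamb \<alpha>) w0 (\<lambda>\<tau>. NL (w \<tau>) (w \<tau>)) t \<xi> else 0)" by (rule g(5)[rule_format])
  show "0 \<le> t \<Longrightarrow> norm \<xi> > n \<Longrightarrow> w t \<xi> = 0" using e by simp
  show "0 \<le> t \<Longrightarrow> L2c (w t)" by (rule l2cont_L2c[OF g(2)])
qed

lemma galerkin_NL_bound:
  assumes g: "galerkin \<alpha> n w0 w" and t: "0 \<le> t" and n: "norm \<xi> \<le> n"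
  shows "cmod (NL (w t) (w t) \<xi>) \<le> n * (n2 w0)\<^sup>2"
proof -
  have "cmod (NL (w t) (w t) \<xi>) \<le> norm \<xi> * n2 (w t) * n2 (w t)" by (intro NL_bound galerkinD(7)[OF g t])
  also have "\<dots> \<le> n * n2 w0 * n2 w0" using galerkinD(4)[OF g t] n order_trans[OF norm_ge_zero n] by (intro mult_mono) auto
  finally show ?thesis by (simp add: power2_eq_square mult.assoc)
qed

lemma galerkin_init: assumes "galerkin \<alpha> n w0 w" shows "w 0 \<xi> = (if norm \<xi> \<le> n then w0 \<xi> else 0)"
  using galerkinD(5)[OF assms order_refl, of \<xi>] duh_0[of "\<lambda>\<tau>. NL (w \<tau>) (w \<tau>)" \<xi> "lamb \<alpha>" w0, OF NL_continuous[OF galerkinD(2)[OF assms]]] by simp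

lemma galerkin_pointwise:
  assumes g: "galerkin \<alpha> n w0 w" and t: "0 \<le> t" and n: "norm \<xi> \<le> n"
  shows "cmod (w t \<xi>) \<le> cmod (w0 \<xi>) + t * (n * (n2 w0)\<^sup>2)"
proof -
  have "cmod (duh (lamb \<alpha>) w0 (\<lambda>\<tau>. NL (w \<tau>) (w \<tau>)) t \<xi> - duh (lamb \<alpha>) (\<lambda>_. 0) (\<lambda>_ _. 0) t \<xi>) \<le> cmod (w0 \<xi> - 0) + (LINT \<tau>:{0..t}|lborel. n * (n2 w0)\<^sup>2)"
    by (rule duh_diff_bound[where l="lamb \<alpha>"]) (use NL_continuous[OF galerkinD(2)[OF g]] galerkin_NL_bound[OF g _ n] t in \<open>auto intro!: set_integrable_continuous continuous_intros\<close>)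
  also have "(LINT \<tau>:{0..t}|lborel. n * (n2 w0)\<^sup>2) = t * (n * (n2 w0)\<^sup>2)"
    using t by (simp add: set_lebesgue_integral_def)
  finally show ?thesis using galerkinD(5)[OF g t, of \<xi>] n by (simp add: duh_def set_lebesgue_integral_def)
qed

definition gforce :: "real \<Rightarrow> (real \<Rightarrow> pt \<Rightarrow> complex) \<Rightarrow> real \<Rightarrow> pt \<Rightarrow> complex" where
  "gforce n w t \<xi> = (if norm \<xi> \<le> n then NL (w t) (w t) \<xi> else 0)"

lemma gforce_props:
  assumes g: "galerkin \<alpha> n w0 w"
  shows "jmeas (gforce n w)" "continuous_on {0..} (\<lambda>t. gforce n w t \<xi>)"
    "0 \<le> t \<Longrightarrow> ((\<lambda>t. w t \<xi>) has_vector_derivative (- complex_of_real (lamb \<alpha> \<xi>) * w t \<xi> - gforce n w t \<xi>)) (at t within {0..})"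
    "0 \<le> t \<Longrightarrow> 0 \<le> n \<Longrightarrow> cmod (gforce n w t \<xi>) \<le> n * (n2 w0)\<^sup>2"
proof -
  note [measurable (raw)] = measurable_pair_apply[OF NL_measurable[OF galerkinD(1)[OF g]]]
  show "jmeas (gforce n w)" unfolding gforce_def split_beta' by measurable
  note c = NL_continuous[OF galerkinD(2)[OF g]]
  show "continuous_on {0..} (\<lambda>t. gforce n w t \<xi>)" unfolding gforce_def using c by (cases "norm \<xi> \<le> n") auto
  show "0 \<le> t \<Longrightarrow> ((\<lambda>t. w t \<xi>) has_vector_derivative (- complex_of_real (lamb \<alpha> \<xi>) * w t \<xi> - gforce n w t \<xi>)) (at t within {0..})"
    unfolding gforce_def
    by (rule duhamel_ode[where f="\<lambda>\<tau>. NL (w \<tau>) (w \<tau>)" and ?w0.0=w0, OF galerkinD(5)[OF g] c])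
  show "0 \<le> t \<Longrightarrow> 0 \<le> n \<Longrightarrow> cmod (gforce n w t \<xi>) \<le> n * (n2 w0)\<^sup>2"
    using galerkin_NL_bound[OF g] by (simp add: gforce_def)
qed

lemma ball_dom_L2c:
  assumes "L2c w0" shows "L2c (\<lambda>\<xi>. if norm \<xi> \<le> n then complex_of_real (c * cmod (w0 \<xi>) + d) else 0)"
proof -
  have [measurable]: "w0 \<in> borel_measurable borel" using L2c_measurable[OF assms] by simp
  have "L2c (\<lambda>\<xi>. complex_of_real (cmod (w0 \<xi>)))" by (rule L2c_mono(1)[OF assms, where B=1]) auto
  from L2c_add[OF L2c_cutoff[OF L2c_cmult[OF this, of "complex_of_real c"], of n] L2c_ball_const[of n "complex_of_real d"]]
  show ?thesis by (rule L2c_cong_AE) auto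
qed

lemma galerkin_energy:
  assumes g: "galerkin \<alpha> n w0 w" and w0: "L2c w0" and al: "0 < \<alpha>" and n: "0 < n" and t: "0 \<le> t"
    and m: "m \<in> borel_measurable borel" and bm: "\<And>\<xi>. norm \<xi> \<le> n \<Longrightarrow> \<bar>m \<xi>\<bar> \<le> Bm" "0 \<le> Bm"
  shows "set_integrable lborel {0..t} (\<lambda>\<tau>. LINT \<xi>|lborel. m \<xi> * lamb \<alpha> \<xi> * (cmod (w \<tau> \<xi>))\<^sup>2)"
    and "set_integrable lborel {0..t} (\<lambda>\<tau>. LINT \<xi>|lborel. m \<xi> * Re (NL (w \<tau>) (w \<tau>) \<xi> * cnj (w \<tau> \<xi>)))"
    and "(LINT \<xi>|lborel. m \<xi> * (cmod (w t \<xi>))\<^sup>2) = (LINT \<xi>|lborel. m \<xi> * (cmod (w 0 \<xi>))\<^sup>2)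
       - 2 * (LINT \<tau>:{0..t}|lborel. LINT \<xi>|lborel. m \<xi> * lamb \<alpha> \<xi> * (cmod (w \<tau> \<xi>))\<^sup>2)
       - 2 * (LINT \<tau>:{0..t}|lborel. LINT \<xi>|lborel. m \<xi> * Re (NL (w \<tau>) (w \<tau>) \<xi> * cnj (w \<tau> \<xi>)))"
proof -
  \<comment> \<open>The majorant on [0, t]: the data plus the largest possible contribution of the
    force, cut off to the ball.\<close>
  let ?h = "\<lambda>\<xi>. if norm \<xi> \<le> n then complex_of_real (1 * cmod (w0 \<xi>) + t * (n * (n2 w0)\<^sup>2)) else 0"
  have hb: "cmod (w \<tau> \<xi>) \<le> cmod (?h \<xi>)" if \<tau>: "\<tau> \<in> {0..t}" for \<tau> \<xi>
  proof (cases "norm \<xi> \<le> n")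
    case True
    have "cmod (w \<tau> \<xi>) \<le> cmod (w0 \<xi>) + \<tau> * (n * (n2 w0)\<^sup>2)" using galerkin_pointwise[OF g _ True] \<tau> by auto
    also have "\<dots> \<le> cmod (w0 \<xi>) + t * (n * (n2 w0)\<^sup>2)" using \<tau> n by (intro add_left_mono mult_right_mono) auto
    also have "\<dots> \<le> cmod (?h \<xi>)" using True complex_Re_le_cmod[of "?h \<xi>"] by simp
    finally show ?thesis .
  qed (use galerkinD(6)[OF g] \<tau> in auto)
  have bl: "\<bar>lamb \<alpha> \<xi>\<bar> \<le> n powr (2 * \<alpha>)" if "norm \<xi> \<le> n" for \<xi> using that al by (simp add: lamb_def powr_mono2)
  have fb: "cmod (gforce n w \<tau> \<xi>) \<le> n * (n2 w0)\<^sup>2" if "\<tau> \<in> {0..t}" "norm \<xi> \<le> n" for \<tau> \<xi>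
    using gforce_props(4)[OF g] that n by auto
  have K: "0 \<le> n * (n2 w0)\<^sup>2" "0 \<le> n powr (2 * \<alpha>)" using n by auto
  note E = ball_energy[OF galerkinD(1)[OF g] gforce_props(1)[OF g] lamb_measurable m gforce_props(3)[OF g] gforce_props(2)[OF g] order_refl t galerkinD(6)[OF g] bl bm(1) K(2) bm(2) K(1) ball_dom_L2c[OF w0] hb fb]
  have same: "(LINT \<xi>|lborel. m \<xi> * Re (gforce n w \<tau> \<xi> * cnj (w \<tau> \<xi>))) = (LINT \<xi>|lborel. m \<xi> * Re (NL (w \<tau>) (w \<tau>) \<xi> * cnj (w \<tau> \<xi>)))" if "0 \<le> \<tau>" for \<tau>
    by (rule Bochner_Integration.integral_cong) (auto simp: gforce_def galerkinD(6)[OF g that])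
  have same': "set_integrable lborel {0..t} (\<lambda>\<tau>. LINT \<xi>|lborel. m \<xi> * Re (gforce n w \<tau> \<xi> * cnj (w \<tau> \<xi>))) \<longleftrightarrow> set_integrable lborel {0..t} (\<lambda>\<tau>. LINT \<xi>|lborel. m \<xi> * Re (NL (w \<tau>) (w \<tau>) \<xi> * cnj (w \<tau> \<xi>)))"
    by (rule set_integrable_cong) (use same in auto)
  have same'': "(LINT \<tau>:{0..t}|lborel. LINT \<xi>|lborel. m \<xi> * Re (gforce n w \<tau> \<xi> * cnj (w \<tau> \<xi>))) = (LINT \<tau>:{0..t}|lborel. LINT \<xi>|lborel. m \<xi> * Re (NL (w \<tau>) (w \<tau>) \<xi> * cnj (w \<tau> \<xi>)))"
    by (rule set_lebesgue_integral_cong) (use same in auto)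
  show "set_integrable lborel {0..t} (\<lambda>\<tau>. LINT \<xi>|lborel. m \<xi> * lamb \<alpha> \<xi> * (cmod (w \<tau> \<xi>))\<^sup>2)" by (rule E(1))
  show "set_integrable lborel {0..t} (\<lambda>\<tau>. LINT \<xi>|lborel. m \<xi> * Re (NL (w \<tau>) (w \<tau>) \<xi> * cnj (w \<tau> \<xi>)))" using E(2) unfolding same' .
  show "(LINT \<xi>|lborel. m \<xi> * (cmod (w t \<xi>))\<^sup>2) = (LINT \<xi>|lborel. m \<xi> * (cmod (w 0 \<xi>))\<^sup>2)
       - 2 * (LINT \<tau>:{0..t}|lborel. LINT \<xi>|lborel. m \<xi> * lamb \<alpha> \<xi> * (cmod (w \<tau> \<xi>))\<^sup>2)
       - 2 * (LINT \<tau>:{0..t}|lborel. LINT \<xi>|lborel. m \<xi> * Re (NL (w \<tau>) (w \<tau>) \<xi> * cnj (w \<tau> \<xi>)))" using E(3) unfolding same'' .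
qed

text \<open>The balance is exact from time 0 on; the inequality appears only because the solution
  starts from the truncation of w0.\<close>

lemma galerkin_L2_energy:
  assumes g: "galerkin \<alpha> n w0 w" and w0: "L2c w0" and al: "0 < \<alpha>" and n: "0 < n" and t: "0 \<le> t"
  shows "set_integrable lborel {0..t} (\<lambda>\<tau>. (n2 (wt \<alpha> (w \<tau>)))\<^sup>2)"
    and "(n2 (w t))\<^sup>2 + 2 * (LINT \<tau>:{0..t}|lborel. (n2 (wt \<alpha> (w \<tau>)))\<^sup>2) \<le> (n2 w0)\<^sup>2"
proof -
  note E = galerkin_energy[OF g w0 al n t, where m="\<lambda>_. 1" and Bm=1]
  show "set_integrable lborel {0..t} (\<lambda>\<tau>. (n2 (wt \<alpha> (w \<tau>)))\<^sup>2)" using E(1) by (simp add: n2_wt_square lamb_def)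
  have "(LINT \<tau>:{0..t}|lborel. LINT \<xi>|lborel. Re (NL (w \<tau>) (w \<tau>) \<xi> * cnj (w \<tau> \<xi>))) = (LINT \<tau>:{0..t}|lborel. 0)"
  proof (rule set_lebesgue_integral_cong)
    show "\<forall>\<tau>. \<tau> \<in> {0..t} \<longrightarrow> (LINT \<xi>|lborel. Re (NL (w \<tau>) (w \<tau>) \<xi> * cnj (w \<tau> \<xi>))) = 0"
      using NL_cancel_supp(1)[where N=n] galerkinD(3,6,7)[OF g] by auto
  qed simp
  then have z: "(LINT \<tau>:{0..t}|lborel. LINT \<xi>|lborel. 1 * Re (NL (w \<tau>) (w \<tau>) \<xi> * cnj (w \<tau> \<xi>))) = 0" by (simp add: set_lebesgue_integral_def)
  have "(n2 (w t))\<^sup>2 = (n2 (w 0))\<^sup>2 - 2 * (LINT \<tau>:{0..t}|lborel. (n2 (wt \<alpha> (w \<tau>)))\<^sup>2)"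
    using E(3) unfolding z n2_wt_square by (simp add: n2_squared L2norm_sq_def lamb_def)
  moreover have "n2 (w 0) \<le> n2 w0" using galerkinD(4)[OF g order_refl] .
  then have "(n2 (w 0))\<^sup>2 \<le> (n2 w0)\<^sup>2" by (intro power_mono) auto
  ultimately show "(n2 (w t))\<^sup>2 + 2 * (LINT \<tau>:{0..t}|lborel. (n2 (wt \<alpha> (w \<tau>)))\<^sup>2) \<le> (n2 w0)\<^sup>2" by linarith
qed

text \<open>Finiteness of \<open>kap_form\<close> is used qualitatively, to justify the
  symmetrisation; the size of the pairing comes from the commutator constant alone, uniformly in
  R.\<close>

lemma commutator_pairing:
  assumes C: "\<And>R w. 0 < R \<Longrightarrow> L2c (wt s w) \<Longrightarrow> L2c (wt (s + \<alpha>) w) \<Longrightarrow>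
     commutator_form s R w
       \<le> ennreal (C * n2 (wt s w) * (n2 (wt (s + \<alpha>) w))\<^sup>2)" and C0: "0 \<le> C"
    and w: "w \<in> borel_measurable borel" "\<And>\<xi>. w (- \<xi>) = cnj (w \<xi>)" "L2c (wt s w)" "L2c (wt (s + \<alpha>) w)"
    and fin: "(kap_form w w w) < \<infinity>"
    and R: "0 < R" and s: "0 \<le> s"
  shows "\<bar>2 * (LINT \<xi>|lborel. mR s R \<xi> * Re (NL w w \<xi> * cnj (w \<xi>)))\<bar> \<le> C * n2 (wt s w) * (n2 (wt (s + \<alpha>) w))\<^sup>2"
proof -
  have mb: "\<bar>mR s R \<xi>\<bar> \<le> R powr (2 * s)" for \<xi> using mR_le_R[OF s R, of \<xi>] by simp
  note S = NL_symmetrize[OF w(1) w(1) w(2) fin mR_measurable mb]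
  have "(LINT \<xi>|lborel. mR s R \<xi> * Re (NL w w \<xi> * cnj (w \<xi>))) = (LINT \<xi>|lborel. Re (complex_of_real (mR s R \<xi>) * (NL w w \<xi> * cnj (w \<xi>))))"
    by (rule Bochner_Integration.integral_cong) simp_all
  also have "\<dots> = Re (LINT \<xi>|lborel. complex_of_real (mR s R \<xi>) * (NL w w \<xi> * cnj (w \<xi>)))" by (rule integral_Re[OF S(1)])
  finally have e: "(LINT \<xi>|lborel. mR s R \<xi> * Re (NL w w \<xi> * cnj (w \<xi>))) = Re (LINT \<xi>|lborel. complex_of_real (mR s R \<xi>) * (NL w w \<xi> * cnj (w \<xi>)))" .
  have "ennreal \<bar>2 * (LINT \<xi>|lborel. mR s R \<xi> * Re (NL w w \<xi> * cnj (w \<xi>)))\<bar> \<le> ennreal (C * n2 (wt s w) * (n2 (wt (s + \<alpha>) w))\<^sup>2)"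
    unfolding e by (rule order_trans[OF S(2) C[OF R w(3,4)]])
  then show ?thesis using C0 by (subst (asm) ennreal_le_iff) auto
qed

text \<open>With Y the H^s norm and D the dissipation, the energy identity gives Y(t)^2 + 2
  (integral of D) \<le> Y(0)^2 + (integral of C Y D). As long as C Y \<le> 1 the last integral takes
  one of the two copies of D, so Y does not exceed its initial value, and a continuity argument with
  threshold 1/C closes the loop. Nothing depends on n.\<close>

lemma galerkin_apriori:
  assumes s: "s = 2 - 2 * \<alpha>" and al: "0 < \<alpha>" "\<alpha> < 1/2"
  shows "\<exists>C\<ge>1. \<forall>n w0 w. 0 < n \<longrightarrow> galerkin \<alpha> n w0 w \<longrightarrow> L2c w0 \<longrightarrow> L2c (wt s w0) \<longrightarrow> C * n2 (wt s w0) < 1 \<longrightarrow>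
     (\<forall>t\<ge>0. set_integrable lborel {0..t} (\<lambda>\<tau>. (n2 (wt (s + \<alpha>) (w \<tau>)))\<^sup>2) \<and>
       (n2 (wt s (w t)))\<^sup>2 + (LINT \<tau>:{0..t}|lborel. (n2 (wt (s + \<alpha>) (w \<tau>)))\<^sup>2) \<le> (n2 (wt s w0))\<^sup>2)"
proof -
  have s1: "1 < s" using s al by auto
  obtain C2 where C2: "0 \<le> C2" "\<And>R w. 0 < R \<Longrightarrow> L2c (wt s w) \<Longrightarrow> L2c (wt (s + \<alpha>) w) \<Longrightarrow>
     commutator_form s R w
       \<le> ennreal (C2 * n2 (wt s w) * (n2 (wt (s + \<alpha>) w))\<^sup>2)"
    using kap_commutator[OF s al] by blast
  \<comment> \<open>The added 1 keeps C positive, so that 1/C is a meaningful threshold even if C2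
    is 0.\<close>
  define C where "C = C2 + 1"
  have C1: "1 \<le> C" "C2 \<le> C" using C2(1) by (auto simp: C_def)
  {
    fix n :: real and w0 w assume n: "0 < n" and g: "galerkin \<alpha> n w0 w" and w0: "L2c w0" "L2c (wt s w0)" and small: "C * n2 (wt s w0) < 1"
    define Y where "Y t = n2 (wt s (w t))" for t
    define D where "D t = (n2 (wt (s + \<alpha>) (w t)))\<^sup>2" for t
    note L = galerkinD(7)[OF g] and z = galerkinD(6)[OF g]
    have Ls: "L2c (wt s (w t))" and Lsa: "L2c (wt (s + \<alpha>) (w t))" if "0 \<le> t" for t
      using L2c_wt_supp(1)[OF L[OF that] z[OF that]] s1 al by auto
    have Y0: "Y 0 \<le> n2 (wt s w0)"
    proof -
      have "n2 (wt s (w 0)) \<le> 1 * n2 (wt s w0)"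
        by (rule L2c_mono(2)[OF w0(2) L2c_measurable[OF Ls[OF order_refl]]]) (auto simp: wt_def galerkin_init[OF g])
      then show ?thesis by (simp add: Y_def)
    qed
    have cY: "continuous_on {0..} Y"
    proof -
      \<comment> \<open>On the ball of radius n the weight is at most n^s, so continuity into L2
        already gives continuity of the H^s norm, though not uniformly in n.\<close>
      have "l2cont (\<lambda>t. wt s (w t))" unfolding l2cont_def
      proof (intro conjI allI impI)
        fix t :: real assume t: "0 \<le> t"
        show "L2c (wt s (w t))" by (rule Ls[OF t])
        have l: "((\<lambda>\<tau>. n2 (\<lambda>\<xi>. w \<tau> \<xi> - w t \<xi>)) \<longlongrightarrow> 0) (at t within {0..})" using galerkinD(2)[OF g] t by (simp add: l2cont_def)
        have le: "n2 (\<lambda>\<xi>. wt s (w \<tau>) \<xi> - wt s (w t) \<xi>) \<le> n powr s * n2 (\<lambda>\<xi>. w \<tau> \<xi> - w t \<xi>)" if \<tau>: "0 \<le> \<tau>" for \<tau>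
          unfolding wt_diff[symmetric] by (rule L2c_wt_supp(2)[OF L2c_diff[OF L[OF \<tau>] L[OF t]]]) (use z[OF \<tau>] z[OF t] s1 in auto)
        show "((\<lambda>\<tau>. n2 (\<lambda>\<xi>. wt s (w \<tau>) \<xi> - wt s (w t) \<xi>)) \<longlongrightarrow> 0) (at t within {0..})"
        proof (rule tendsto_sandwich[OF _ _ tendsto_const tendsto_mult_right_zero[OF l, of "n powr s"]])
          show "\<forall>\<^sub>F \<tau> in at t within {0..}. n2 (\<lambda>\<xi>. wt s (w \<tau>) \<xi> - wt s (w t) \<xi>) \<le> n powr s * n2 (\<lambda>\<xi>. w \<tau> \<xi> - w t \<xi>)"
            unfolding eventually_at_filter by (intro always_eventually allI impI le) auto
        qed simp
      qed
      then show ?thesis unfolding Y_def by (rule l2cont_n2_continuous)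
    qed
    \<comment> \<open>The weight frozen at R = n coincides with the full one on the support of the
      solution.\<close>
    have Eq: "(LINT \<xi>|lborel. mR s n \<xi> * (cmod (w t \<xi>))\<^sup>2) = (Y t)\<^sup>2" "(LINT \<xi>|lborel. mR s n \<xi> * lamb \<alpha> \<xi> * (cmod (w t \<xi>))\<^sup>2) = D t" if t: "0 \<le> t" for t
    proof -
      have 1: "mR s n \<xi> * (cmod (w t \<xi>))\<^sup>2 = norm \<xi> powr (2 * s) * (cmod (w t \<xi>))\<^sup>2" for \<xi>
        using z[OF t, of \<xi>] by (cases "norm \<xi> \<le> n") (auto simp: mR_eq)
      have pw: "norm \<xi> powr (2 * s) * norm \<xi> powr (2 * \<alpha>) = norm \<xi> powr (2 * (s + \<alpha>))" for \<xi> :: pt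
        unfolding powr_add[symmetric] by (simp add: distrib_left)
      have 2: "mR s n \<xi> * lamb \<alpha> \<xi> * (cmod (w t \<xi>))\<^sup>2 = norm \<xi> powr (2 * (s + \<alpha>)) * (cmod (w t \<xi>))\<^sup>2" for \<xi>
      proof -
        have "mR s n \<xi> * lamb \<alpha> \<xi> * (cmod (w t \<xi>))\<^sup>2 = (mR s n \<xi> * (cmod (w t \<xi>))\<^sup>2) * lamb \<alpha> \<xi>" by (simp only: mult_ac)
        also have "\<dots> = (norm \<xi> powr (2 * s) * norm \<xi> powr (2 * \<alpha>)) * (cmod (w t \<xi>))\<^sup>2" unfolding 1 lamb_def by (simp only: mult_ac)
        finally show ?thesis unfolding pw .
      qed
      show "(LINT \<xi>|lborel. mR s n \<xi> * (cmod (w t \<xi>))\<^sup>2) = (Y t)\<^sup>2" unfolding 1 Y_def n2_wt_square ..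
      show "(LINT \<xi>|lborel. mR s n \<xi> * lamb \<alpha> \<xi> * (cmod (w t \<xi>))\<^sup>2) = D t" unfolding 2 D_def n2_wt_square ..
    qed
    define G where "G \<tau> = (LINT \<xi>|lborel. mR s n \<xi> * Re (NL (w \<tau>) (w \<tau>) \<xi> * cnj (w \<tau> \<xi>)))" for \<tau>
    have Gb: "\<bar>2 * G \<tau>\<bar> \<le> C * Y \<tau> * D \<tau>" if \<tau>: "0 \<le> \<tau>" for \<tau>
    proof -
      have "\<bar>2 * G \<tau>\<bar> \<le> C2 * n2 (wt s (w \<tau>)) * (n2 (wt (s + \<alpha>) (w \<tau>)))\<^sup>2"
        unfolding G_def
        by (rule commutator_pairing[OF C2(2,1) jmeas_slice[OF galerkinD(1)[OF g]] galerkinD(3)[OF g \<tau>] Ls[OF \<tau>] Lsa[OF \<tau>] kap_trilinear_supp_finite[where N=n] n])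
           (use L[OF \<tau>] z[OF \<tau>] s1 in auto)
      also have "\<dots> \<le> C * Y \<tau> * D \<tau>" unfolding Y_def D_def using C1 by (intro mult_right_mono) auto
      finally show ?thesis .
    qed
    have mb: "\<bar>mR s n \<xi>\<bar> \<le> n powr (2 * s)" for \<xi> using mR_le_R[of s n \<xi>] s1 n by simp
    note E = galerkin_energy[OF g w0(1) al(1) n _ mR_measurable mb powr_ge_zero]
    have iD: "set_integrable lborel {0..t} D" if t: "0 \<le> t" for t
    proof -
      have "set_integrable lborel {0..t} (\<lambda>\<tau>. LINT \<xi>|lborel. mR s n \<xi> * lamb \<alpha> \<xi> * (cmod (w \<tau> \<xi>))\<^sup>2) \<longleftrightarrow> set_integrable lborel {0..t} D"
        by (rule set_integrable_cong) (use Eq(2) in auto)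
      with E(1)[OF t] show ?thesis by blast
    qed
    have iG: "set_integrable lborel {0..t} G" if t: "0 \<le> t" for t using E(2)[OF t] unfolding G_def .
    have id: "(Y t)\<^sup>2 = (Y 0)\<^sup>2 - 2 * (LINT \<tau>:{0..t}|lborel. D \<tau>) - 2 * (LINT \<tau>:{0..t}|lborel. G \<tau>)" if t: "0 \<le> t" for t
    proof -
      have "(LINT \<tau>:{0..t}|lborel. LINT \<xi>|lborel. mR s n \<xi> * lamb \<alpha> \<xi> * (cmod (w \<tau> \<xi>))\<^sup>2) = (LINT \<tau>:{0..t}|lborel. D \<tau>)"
        by (rule set_lebesgue_integral_cong) (use Eq(2) in auto)
      then show ?thesis using E(3)[OF t] Eq(1)[OF t] Eq(1)[OF order_refl] unfolding G_def by simp
    qed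
    have main: "(Y t)\<^sup>2 + (LINT \<tau>:{0..t}|lborel. D \<tau>) \<le> (Y 0)\<^sup>2" if t: "0 \<le> t" and b: "\<And>\<tau>. \<tau> \<in> {0..t} \<Longrightarrow> Y \<tau> \<le> 1 / C" for t
    proof -
      have "(LINT \<tau>:{0..t}|lborel. - D \<tau>) \<le> (LINT \<tau>:{0..t}|lborel. 2 * G \<tau>)"
      proof (rule set_integral_mono)
        show "set_integrable lborel {0..t} (\<lambda>\<tau>. - D \<tau>)"
          using iD[OF t] by (simp add: set_integrable_def)
        show "set_integrable lborel {0..t} (\<lambda>\<tau>. 2 * G \<tau>)"
          by (rule set_integrable_mult_right) (rule iG[OF t])
        fix \<tau> assume \<tau>: "\<tau> \<in> {0..t}"
        have "C * Y \<tau> \<le> 1" using b[OF \<tau>] C1 by (simp add: field_simps)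
        then have "C * Y \<tau> * D \<tau> \<le> 1 * D \<tau>" by (intro mult_right_mono) (auto simp: D_def)
        then show "- D \<tau> \<le> 2 * G \<tau>" using Gb[of \<tau>] \<tau> by auto
      qed
      moreover have "(LINT \<tau>:{0..t}|lborel. - D \<tau>) = - (LINT \<tau>:{0..t}|lborel. D \<tau>)"
        by (simp add: set_lebesgue_integral_def)
      moreover have "(LINT \<tau>:{0..t}|lborel. 2 * G \<tau>) = 2 * (LINT \<tau>:{0..t}|lborel. G \<tau>)"
        by (rule set_integral_mult_right)
      ultimately show ?thesis using id[OF t] by linarith
    qed
    have bs: "Y t \<le> Y 0" if t: "0 \<le> t" for t
    proof (rule bootstrap[OF cY _ _ t])
      show "Y 0 < 1 / C"
      proof -
        have "C * Y 0 \<le> C * n2 (wt s w0)" using Y0 C1 by (intro mult_left_mono) auto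
        then have "Y 0 * C < 1" using small by (simp add: mult.commute)
        then show ?thesis using C1 by (simp add: pos_less_divide_eq)
      qed
      fix t assume t: "0 \<le> t" and b: "\<And>\<tau>. \<tau> \<in> {0..t} \<Longrightarrow> Y \<tau> \<le> 1 / C"
      have "0 \<le> (LINT \<tau>:{0..t}|lborel. D \<tau>)" unfolding set_lebesgue_integral_def by (intro integral_nonneg_AE) (auto simp: D_def)
      then have "(Y t)\<^sup>2 \<le> (Y 0)\<^sup>2" using main[OF t b] by linarith
      then show "Y t \<le> Y 0" by (rule power2_le_imp_le) (simp add: Y_def)
    qed
    have "set_integrable lborel {0..t} D \<and> (Y t)\<^sup>2 + (LINT \<tau>:{0..t}|lborel. D \<tau>) \<le> (n2 (wt s w0))\<^sup>2" if t: "0 \<le> t" for t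
    proof (intro conjI iD[OF t])
      have "Y \<tau> \<le> 1 / C" if "\<tau> \<in> {0..t}" for \<tau>
      proof -
        have "C * Y \<tau> \<le> C * n2 (wt s w0)" using bs[of \<tau>] Y0 that C1 by (intro mult_left_mono) auto
        then have "Y \<tau> * C \<le> 1" using small by (simp add: mult.commute)
        then show ?thesis using C1 by (simp add: pos_le_divide_eq)
      qed
      from main[OF t this] have "(Y t)\<^sup>2 + (LINT \<tau>:{0..t}|lborel. D \<tau>) \<le> (Y 0)\<^sup>2" .
      also have "\<dots> \<le> (n2 (wt s w0))\<^sup>2" using Y0 by (intro power_mono) (auto simp: Y_def)
      finally show "(Y t)\<^sup>2 + (LINT \<tau>:{0..t}|lborel. D \<tau>) \<le> (n2 (wt s w0))\<^sup>2" .
    qed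
    then have "\<forall>t\<ge>0. set_integrable lborel {0..t} (\<lambda>\<tau>. (n2 (wt (s + \<alpha>) (w \<tau>)))\<^sup>2) \<and>
       (n2 (wt s (w t)))\<^sup>2 + (LINT \<tau>:{0..t}|lborel. (n2 (wt (s + \<alpha>) (w \<tau>)))\<^sup>2) \<le> (n2 (wt s w0))\<^sup>2"
      unfolding Y_def D_def by blast
  }
  then show ?thesis using C1(1) by blast
qed

section \<open>Stability of truncated solutions\<close>

lemma has_vector_derivative_difference:
  assumes "(f has_vector_derivative f') F" "(g has_vector_derivative g') F"
  shows "((\<lambda>t. f t - g t) has_vector_derivative (f' - g')) F"
  by (rule has_vector_derivative_diff[OF assms])

text \<open>The difference delta = w - v is tested with itself. The force splits into three terms:
  transport of delta by v, which cancels; \<open>NL\<close> of delta and w, which smallness absorbs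
  into the dissipation of delta; and an error in which w acts on the part of v beyond frequency n.
  On that part the weight \<alpha> is controlled by n^(-s) times the weight s + \<alpha>, whose
  square is integrable in time. Together with the truncation of the data this produces the rate
  n^(-s).\<close>

lemma galerkin_difference:
  assumes s: "s = 2 - 2 * \<alpha>" and al: "0 < \<alpha>" "\<alpha> < 1/2"
    and C: "\<And>a b d. L2c (wt \<alpha> a) \<Longrightarrow> L2c (wt s b) \<Longrightarrow> L2c (wt \<alpha> d) \<Longrightarrow>
     kap_form a b d
       \<le> ennreal (C * n2 (wt \<alpha> a) * n2 (wt s b) * n2 (wt \<alpha> d))" and C0: "0 \<le> C"
    and nm: "1 \<le> n" "n \<le> m" and gw: "galerkin \<alpha> n w0 w" and gv: "galerkin \<alpha> m w0 v" and w0: "L2c w0" "L2c (wt s w0)"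
    and small: "\<And>t. 0 \<le> t \<Longrightarrow> C * n2 (wt s (w t)) \<le> 1"
    and av: "\<And>t. 0 \<le> t \<Longrightarrow> set_integrable lborel {0..t} (\<lambda>\<tau>. (n2 (wt (s + \<alpha>) (v \<tau>)))\<^sup>2)"
       "\<And>t. 0 \<le> t \<Longrightarrow> (LINT \<tau>:{0..t}|lborel. (n2 (wt (s + \<alpha>) (v \<tau>)))\<^sup>2) \<le> (n2 (wt s w0))\<^sup>2"
    and t: "0 \<le> t"
  shows "(n2 (\<lambda>\<xi>. w t \<xi> - v t \<xi>))\<^sup>2 \<le> n powr (- s) * (2 * (n2 (wt s w0))\<^sup>2 + (n2 w0)\<^sup>2)"
proof -
  have s1: "1 < s" using s al by auto
  have n0: "0 < n" "0 < m" using nm by auto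
  define \<delta> where "\<delta> t \<xi> = w t \<xi> - v t \<xi>" for t \<xi>
  define f where "f t \<xi> = gforce n w t \<xi> - gforce m v t \<xi>" for t \<xi>
  note Lw = galerkinD(7)[OF gw] and Lv = galerkinD(7)[OF gv] and zw = galerkinD(6)[OF gw] and zv = galerkinD(6)[OF gv]
  have zw': "w t \<xi> = 0" if "0 \<le> t" "norm \<xi> > m" for t \<xi> using zw[OF that(1), of \<xi>] that nm by auto
  have z\<delta>: "\<delta> t \<xi> = 0" if "0 \<le> t" "norm \<xi> > m" for t \<xi> using zw'[OF that] zv[OF that] by (simp add: \<delta>_def)
  have L\<delta>: "L2c (\<delta> t)" if "0 \<le> t" for t unfolding \<delta>_def using Lw[OF that] Lv[OF that] by auto
  have j\<delta>: "jmeas \<delta>"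
  proof -
    note [measurable (raw)] = measurable_pair_apply[OF galerkinD(1)[OF gw]] measurable_pair_apply[OF galerkinD(1)[OF gv]]
    show ?thesis unfolding \<delta>_def split_beta' by measurable
  qed
  have jf: "jmeas f"
  proof -
    note [measurable (raw)] = measurable_pair_apply[OF gforce_props(1)[OF gw]] measurable_pair_apply[OF gforce_props(1)[OF gv]]
    show ?thesis unfolding f_def split_beta' by measurable
  qed
  have cf: "continuous_on {0..} (\<lambda>t. f t \<xi>)" for \<xi>
    unfolding f_def by (intro continuous_on_diff gforce_props(2)[OF gw] gforce_props(2)[OF gv])
  have ode: "((\<lambda>t. \<delta> t \<xi>) has_vector_derivative (- complex_of_real (lamb \<alpha> \<xi>) * \<delta> t \<xi> - f t \<xi>)) (at t within {0..})" if "0 \<le> t" for t \<xi>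
  proof -
    have "- complex_of_real (lamb \<alpha> \<xi>) * \<delta> t \<xi> - f t \<xi> = (- complex_of_real (lamb \<alpha> \<xi>) * w t \<xi> - gforce n w t \<xi>) - (- complex_of_real (lamb \<alpha> \<xi>) * v t \<xi> - gforce m v t \<xi>)"
      by (simp add: \<delta>_def f_def algebra_simps)
    then show ?thesis unfolding \<delta>_def
      using has_vector_derivative_difference[OF gforce_props(3)[OF gw that, of \<xi>] gforce_props(3)[OF gv that, of \<xi>]] by (simp add: \<delta>_def)
  qed
  let ?N = "(n2 w0)\<^sup>2"
  let ?h = "\<lambda>\<xi>. if norm \<xi> \<le> m then complex_of_real (2 * cmod (w0 \<xi>) + 2 * (t * (m * ?N))) else 0"
  have hb: "cmod (\<delta> \<tau> \<xi>) \<le> cmod (?h \<xi>)" if \<tau>: "\<tau> \<in> {0..t}" for \<tau> \<xi>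
  proof (cases "norm \<xi> \<le> m")
    case True
    have \<tau>0: "0 \<le> \<tau>" using \<tau> by simp
    have mono: "\<tau> * (m * ?N) \<le> t * (m * ?N)" "\<tau> * (n * ?N) \<le> t * (m * ?N)" using \<tau> nm n0 by (auto intro!: mult_mono)
    have 1: "cmod (w \<tau> \<xi>) \<le> cmod (w0 \<xi>) + t * (m * ?N)"
    proof (cases "norm \<xi> \<le> n")
      case True then show ?thesis using galerkin_pointwise[OF gw \<tau>0 True] mono by linarith
    next
      case False then show ?thesis using zw[OF \<tau>0, of \<xi>] t n0 by simp
    qed
    have 2: "cmod (v \<tau> \<xi>) \<le> cmod (w0 \<xi>) + t * (m * ?N)" using galerkin_pointwise[OF gv \<tau>0 True] mono by linarith
    have "cmod (\<delta> \<tau> \<xi>) \<le> cmod (w \<tau> \<xi>) + cmod (v \<tau> \<xi>)" unfolding \<delta>_def by (rule norm_triangle_ineq4)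
    also have "\<dots> \<le> 2 * cmod (w0 \<xi>) + 2 * (t * (m * ?N))" using 1 2 by linarith
    also have "\<dots> \<le> cmod (?h \<xi>)" using True complex_Re_le_cmod[of "?h \<xi>"] by simp
    finally show ?thesis .
  qed (use z\<delta> \<tau> in auto)
  have bl: "\<bar>lamb \<alpha> \<xi>\<bar> \<le> m powr (2 * \<alpha>)" if "norm \<xi> \<le> m" for \<xi> using that al by (simp add: lamb_def powr_mono2)
  have fb: "cmod (f \<tau> \<xi>) \<le> n * ?N + m * ?N" if "\<tau> \<in> {0..t}" "norm \<xi> \<le> m" for \<tau> \<xi>
    unfolding f_def by (rule order_trans[OF norm_triangle_ineq4 add_mono]) (use gforce_props(4)[OF gw] gforce_props(4)[OF gv] that n0 in auto)
  have K: "0 \<le> n * ?N + m * ?N" "0 \<le> m powr (2 * \<alpha>)" using n0 by auto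
  have one: "\<bar>1::real\<bar> \<le> 1" "0 \<le> (1::real)" by auto
  note E = ball_energy[OF j\<delta> jf lamb_measurable borel_measurable_const[of 1] ode cf order_refl t z\<delta> bl one(1) K(2) one(2) K(1) ball_dom_L2c[OF w0(1)] hb fb]
  define D where "D \<tau> = (n2 (wt \<alpha> (\<delta> \<tau>)))\<^sup>2" for \<tau>
  define G where "G \<tau> = (LINT \<xi>|lborel. Re (f \<tau> \<xi> * cnj (\<delta> \<tau> \<xi>)))" for \<tau>
  \<comment> \<open>The two dissipations whose product bounds the truncation error; by the energy
    estimates the time integral of P is at most that of the data.\<close>
  define P where "P \<tau> = (n2 (wt \<alpha> (w \<tau>)))\<^sup>2 + (n2 (wt (s + \<alpha>) (v \<tau>)))\<^sup>2" for \<tau>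
  have iD: "set_integrable lborel {0..t} D" using E(1) by (simp add: D_def[abs_def] n2_wt_square lamb_def)
  have iG: "set_integrable lborel {0..t} G" using E(2) unfolding G_def by (simp del: times_complex.sel)
  have id: "(n2 (\<delta> t))\<^sup>2 = (n2 (\<delta> 0))\<^sup>2 - 2 * (LINT \<tau>:{0..t}|lborel. D \<tau>) - 2 * (LINT \<tau>:{0..t}|lborel. G \<tau>)"
    using E(3) unfolding D_def n2_wt_square G_def by (simp add: n2_squared L2norm_sq_def lamb_def del: times_complex.sel)
  have iP: "set_integrable lborel {0..t} P"
    using galerkin_L2_energy(1)[OF gw w0(1) al(1) n0(1) t] av(1)[OF t] unfolding P_def by (rule set_integral_add(1))
  have IP: "(LINT \<tau>:{0..t}|lborel. P \<tau>) \<le> ?N + (n2 (wt s w0))\<^sup>2"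
  proof -
    have "(LINT \<tau>:{0..t}|lborel. P \<tau>) = (LINT \<tau>:{0..t}|lborel. (n2 (wt \<alpha> (w \<tau>)))\<^sup>2) + (LINT \<tau>:{0..t}|lborel. (n2 (wt (s + \<alpha>) (v \<tau>)))\<^sup>2)"
      unfolding P_def by (rule set_integral_add(2)[OF galerkin_L2_energy(1)[OF gw w0(1) al(1) n0(1) t] av(1)[OF t]])
    moreover have "0 \<le> (LINT \<tau>:{0..t}|lborel. (n2 (wt \<alpha> (w \<tau>)))\<^sup>2)" unfolding set_lebesgue_integral_def by (intro integral_nonneg_AE) auto
    ultimately show ?thesis using galerkin_L2_energy(2)[OF gw w0(1) al(1) n0(1) t] av(2)[OF t] zero_le_power2[of "n2 (w t)"] by linarith
  qed
  have Gb: "- D \<tau> - n powr (- s) * P \<tau> / 2 \<le> G \<tau>" if \<tau>: "0 \<le> \<tau>" for \<tau>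
  proof -
    \<comment> \<open>The part of v at frequencies that the smaller truncation does not see.\<close>
    define v' where "v' \<xi> = (if norm \<xi> > n then v \<tau> \<xi> else 0)" for \<xi>
    have vm: "v \<tau> \<in> borel_measurable borel" "w \<tau> \<in> borel_measurable borel" "\<delta> \<tau> \<in> borel_measurable borel"
      using jmeas_slice[OF galerkinD(1)[OF gv]] jmeas_slice[OF galerkinD(1)[OF gw]] jmeas_slice[OF j\<delta>] by auto
    note [measurable] = vm
    have v'm [measurable]: "v' \<in> borel_measurable borel" unfolding v'_def by measurable
    have La: "L2c (wt \<alpha> (\<delta> \<tau>))" "L2c (wt \<alpha> (w \<tau>))" "L2c (wt s (w \<tau>))" "L2c (wt (s + \<alpha>) (v \<tau>))"
      using L2c_wt_supp(1)[where N=m, OF L\<delta>[OF \<tau>] z\<delta>[OF \<tau>]] L2c_wt_supp(1)[where N=n, OF Lw[OF \<tau>] zw[OF \<tau>]] L2c_wt_supp(1)[where N=m, OF Lv[OF \<tau>] zv[OF \<tau>]] al s1 by auto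
    have v'le: "cmod (wt \<alpha> v' \<xi>) \<le> n powr (- s) * cmod (wt (s + \<alpha>) (v \<tau>) \<xi>)" for \<xi>
    proof (cases "norm \<xi> > n")
      case True
      then have x: "0 < norm \<xi>" using n0 by linarith
      have "1 \<le> n powr (- s) * norm \<xi> powr s"
      proof -
        have "n powr s \<le> norm \<xi> powr s" using True n0 s1 by (intro powr_mono2) auto
        then show ?thesis using n0 by (simp add: powr_minus field_simps)
      qed
      then have "1 * (norm \<xi> powr \<alpha> * cmod (v \<tau> \<xi>)) \<le> (n powr (- s) * norm \<xi> powr s) * (norm \<xi> powr \<alpha> * cmod (v \<tau> \<xi>))" by (intro mult_right_mono) auto
      then show ?thesis using True by (simp add: cmod_wt v'_def powr_add mult_ac)
    qed (simp add: cmod_wt v'_def)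
    have Lv': "L2c (wt \<alpha> v')" "n2 (wt \<alpha> v') \<le> n powr (- s) * n2 (wt (s + \<alpha>) (v \<tau>))"
      using L2c_mono[OF La(4), of "wt \<alpha> v'" "n powr (- s)"] v'le wt_measurable[OF v'm] by auto
    define K1 where "K1 = C * n2 (wt \<alpha> (\<delta> \<tau>)) * n2 (wt s (w \<tau>)) * n2 (wt \<alpha> (\<delta> \<tau>))"
    define K2 where "K2 = C * n2 (wt \<alpha> (w \<tau>)) * n2 (wt s (w \<tau>)) * n2 (wt \<alpha> v')"
    have K0: "0 \<le> K1" "0 \<le> K2" using C0 by (auto simp: K1_def K2_def)
    note B1 = NL_pair_bound[OF vm(3,2,3) C[OF La(1,3,1)] K0(1)[unfolded K1_def]]
    note B2 = NL_pair_bound[OF vm(2,2) v'm C[OF La(2,3) Lv'(1)] K0(2)[unfolded K2_def]]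
    \<comment> \<open>Transport of delta by the velocity of v does no work in L2.\<close>
    note B3 = NL_cancel_supp[where N=m, OF Lv[OF \<tau>] L\<delta>[OF \<tau>] zv[OF \<tau>] z\<delta>[OF \<tau>] galerkinD(3)[OF gv \<tau>]]
    note [measurable] = NL_measurable1[OF vm(3,2)] NL_measurable1[OF vm(2,2)]
    have b: "\<bar>Re (x * cnj y)\<bar> \<le> cmod x * cmod y" for x y using abs_Re_le_cmod[of "x * cnj y"] unfolding norm_mult complex_mod_cnj .
    have i1: "integrable lborel (\<lambda>\<xi>. Re (NL (\<delta> \<tau>) (w \<tau>) \<xi> * cnj (\<delta> \<tau> \<xi>)))"
      by (rule Bochner_Integration.integrable_bound[OF B1(1)]) (use b in \<open>auto simp del: times_complex.sel\<close>)
    have i2: "integrable lborel (\<lambda>\<xi>. Re (NL (w \<tau>) (w \<tau>) \<xi> * cnj (v' \<xi>)))"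
      by (rule Bochner_Integration.integrable_bound[OF B2(1)]) (use b in \<open>auto simp del: times_complex.sel\<close>)
    have i3: "integrable lborel (\<lambda>\<xi>. Re (NL (v \<tau>) (\<delta> \<tau>) \<xi> * cnj (\<delta> \<tau> \<xi>)))" by (rule integrable_Re[OF B3(2)])
    \<comment> \<open>For n < |xi| \<le> m only v is present: the force is -NL v v and delta is -v.
      Writing the force as the full difference of nonlinearities there adds NL w w paired with -v,
      which the last term compensates.\<close>
    have pw: "Re (f \<tau> \<xi> * cnj (\<delta> \<tau> \<xi>)) = Re (NL (\<delta> \<tau>) (w \<tau>) \<xi> * cnj (\<delta> \<tau> \<xi>)) + Re (NL (v \<tau>) (\<delta> \<tau>) \<xi> * cnj (\<delta> \<tau> \<xi>)) + Re (NL (w \<tau>) (w \<tau>) \<xi> * cnj (v' \<xi>))" for \<xi>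
    proof -
      have d: "NL (w \<tau>) (w \<tau>) \<xi> - NL (v \<tau>) (v \<tau>) \<xi> = NL (\<delta> \<tau>) (w \<tau>) \<xi> + NL (v \<tau>) (\<delta> \<tau>) \<xi>"
        using NL_diff[OF Lw[OF \<tau>] Lv[OF \<tau>], of \<xi>] by (simp add: \<delta>_def[abs_def])
      have "f \<tau> \<xi> * cnj (\<delta> \<tau> \<xi>) = (NL (w \<tau>) (w \<tau>) \<xi> - NL (v \<tau>) (v \<tau>) \<xi>) * cnj (\<delta> \<tau> \<xi>) + NL (w \<tau>) (w \<tau>) \<xi> * cnj (v' \<xi>)"
      proof (cases "norm \<xi> \<le> n")
        case True then show ?thesis using nm by (simp add: f_def gforce_def v'_def)
      next
        case False
        then have ww: "w \<tau> \<xi> = 0" using zw[OF \<tau>, of \<xi>] by simp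
        show ?thesis
        proof (cases "norm \<xi> \<le> m")
          case True then show ?thesis using False ww by (simp add: f_def gforce_def v'_def \<delta>_def algebra_simps)
        next
          case F: False then show ?thesis using False ww zv[OF \<tau>, of \<xi>] by (simp add: f_def gforce_def v'_def \<delta>_def)
        qed
      qed
      then show ?thesis unfolding d by (simp only: distrib_right plus_complex.sel)
    qed
    have Geq: "G \<tau> = (LINT \<xi>|lborel. Re (NL (\<delta> \<tau>) (w \<tau>) \<xi> * cnj (\<delta> \<tau> \<xi>))) + (LINT \<xi>|lborel. Re (NL (w \<tau>) (w \<tau>) \<xi> * cnj (v' \<xi>)))"
    proof -
      have "G \<tau> = (LINT \<xi>|lborel. Re (NL (\<delta> \<tau>) (w \<tau>) \<xi> * cnj (\<delta> \<tau> \<xi>))) + (LINT \<xi>|lborel. Re (NL (v \<tau>) (\<delta> \<tau>) \<xi> * cnj (\<delta> \<tau> \<xi>))) + (LINT \<xi>|lborel. Re (NL (w \<tau>) (w \<tau>) \<xi> * cnj (v' \<xi>)))"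
        unfolding G_def pw Bochner_Integration.integral_add[OF Bochner_Integration.integrable_add[OF i1 i3] i2] Bochner_Integration.integral_add[OF i1 i3] ..
      with B3(1) show ?thesis by linarith
    qed
    have c1: "- (LINT \<xi>|lborel. cmod (NL (\<delta> \<tau>) (w \<tau>) \<xi>) * cmod (\<delta> \<tau> \<xi>)) \<le> (LINT \<xi>|lborel. Re (NL (\<delta> \<tau>) (w \<tau>) \<xi> * cnj (\<delta> \<tau> \<xi>)))"
      unfolding Bochner_Integration.integral_minus[symmetric] by (rule integral_mono[OF Bochner_Integration.integrable_minus[OF B1(1)] i1]) (use b abs_le_D2 in \<open>metis minus_le_iff\<close>)
    have c2: "- (LINT \<xi>|lborel. cmod (NL (w \<tau>) (w \<tau>) \<xi>) * cmod (v' \<xi>)) \<le> (LINT \<xi>|lborel. Re (NL (w \<tau>) (w \<tau>) \<xi> * cnj (v' \<xi>)))"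
      unfolding Bochner_Integration.integral_minus[symmetric] by (rule integral_mono[OF Bochner_Integration.integrable_minus[OF B2(1)] i2]) (use b abs_le_D2 in \<open>metis minus_le_iff\<close>)
    have "- K1 - K2 \<le> G \<tau>" using Geq c1 c2 B1(2) B2(2) unfolding K1_def K2_def by linarith
    moreover have "K1 \<le> D \<tau>"
    proof -
      \<comment> \<open>Here smallness enters: C times the H^s norm of w is at most 1, so this term
        is covered by one of the two copies of the dissipation of delta.\<close>
      have "K1 = (C * n2 (wt s (w \<tau>))) * D \<tau>" by (simp add: K1_def D_def power2_eq_square)
      also have "\<dots> \<le> 1 * D \<tau>" by (intro mult_right_mono small \<tau>) (simp add: D_def)
      finally show ?thesis by simp
    qed
    moreover have "K2 \<le> n powr (- s) * P \<tau> / 2"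
    proof -
      have "K2 = (C * n2 (wt s (w \<tau>))) * (n2 (wt \<alpha> (w \<tau>)) * n2 (wt \<alpha> v'))" by (simp add: K2_def)
      also have "\<dots> \<le> 1 * (n2 (wt \<alpha> (w \<tau>)) * (n powr (- s) * n2 (wt (s + \<alpha>) (v \<tau>))))"
        using C0 by (intro mult_mono small \<tau> Lv'(2)) auto
      also have "\<dots> = n powr (- s) * (n2 (wt \<alpha> (w \<tau>)) * n2 (wt (s + \<alpha>) (v \<tau>)))" by simp
      also have "\<dots> \<le> n powr (- s) * (P \<tau> / 2)"
        using sum_squares_bound[of "n2 (wt \<alpha> (w \<tau>))" "n2 (wt (s + \<alpha>) (v \<tau>))"] by (intro mult_left_mono) (auto simp: P_def)
      finally show ?thesis by simp
    qed
    ultimately show ?thesis by linarith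
  qed
  have iDP: "set_integrable lborel {0..t} (\<lambda>\<tau>. (- 1) * D \<tau>)" "set_integrable lborel {0..t} (\<lambda>\<tau>. (n powr (- s) / 2) * P \<tau>)"
    using iD iP by (auto intro!: set_integrable_mult_right simp only:)
  have "(LINT \<tau>:{0..t}|lborel. (- 1) * D \<tau> - (n powr (- s) / 2) * P \<tau>) \<le> (LINT \<tau>:{0..t}|lborel. G \<tau>)"
  proof (rule set_integral_mono[OF set_integral_diff(1)[OF iDP] iG])
    show "(- 1) * D \<tau> - (n powr (- s) / 2) * P \<tau> \<le> G \<tau>" if "\<tau> \<in> {0..t}" for \<tau> using Gb[of \<tau>] that by simp
  qed
  moreover have "(LINT \<tau>:{0..t}|lborel. (- 1) * D \<tau> - (n powr (- s) / 2) * P \<tau>) = (- 1) * (LINT \<tau>:{0..t}|lborel. D \<tau>) - (n powr (- s) / 2) * (LINT \<tau>:{0..t}|lborel. P \<tau>)"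
    unfolding set_integral_diff(2)[OF iDP] set_integral_mult_right ..
  ultimately have "(n2 (\<delta> t))\<^sup>2 \<le> (n2 (\<delta> 0))\<^sup>2 + n powr (- s) * (LINT \<tau>:{0..t}|lborel. P \<tau>)" using id by simp
  also have "n powr (- s) * (LINT \<tau>:{0..t}|lborel. P \<tau>) \<le> n powr (- s) * (?N + (n2 (wt s w0))\<^sup>2)" by (intro mult_left_mono IP) auto
  also have "(n2 (\<delta> 0))\<^sup>2 \<le> n powr (- s) * (n2 (wt s w0))\<^sup>2"
  proof -
    have le: "cmod (\<delta> 0 \<xi>) \<le> n powr (- s) * cmod (wt s w0 \<xi>)" for \<xi>
    proof (cases "norm \<xi> > n")
      case True
      have "n powr s \<le> norm \<xi> powr s" using True n0 s1 by (intro powr_mono2) auto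
      then have "1 \<le> n powr (- s) * norm \<xi> powr s" using n0 by (simp add: powr_minus field_simps)
      then have "1 * cmod (w0 \<xi>) \<le> (n powr (- s) * norm \<xi> powr s) * cmod (w0 \<xi>)" by (intro mult_right_mono) auto
      moreover have "cmod (\<delta> 0 \<xi>) \<le> cmod (w0 \<xi>)" using True by (auto simp: \<delta>_def galerkin_init[OF gw] galerkin_init[OF gv])
      ultimately show ?thesis by (simp add: cmod_wt mult.assoc)
    next
      case False then show ?thesis using nm by (simp add: \<delta>_def galerkin_init[OF gw] galerkin_init[OF gv])
    qed
    then have "n2 (\<delta> 0) \<le> n powr (- s) * n2 (wt s w0)"
      by (intro L2c_mono(2)[OF w0(2) L2c_measurable[OF L\<delta>[OF order_refl]]]) auto
    then have "(n2 (\<delta> 0))\<^sup>2 \<le> (n powr (- s) * n2 (wt s w0))\<^sup>2" by (intro power_mono) auto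
    also have "\<dots> = n powr (- s) * (n powr (- s) * (n2 (wt s w0))\<^sup>2)" by (simp add: power2_eq_square)
    \<comment> \<open>The initial difference decays even like n^(-2s); one factor is given up, using
      n \<ge> 1, to match the rate of the error term.\<close>
    also have "\<dots> \<le> n powr (- s) * (1 * (n2 (wt s w0))\<^sup>2)"
    proof -
      have "n powr (- s) \<le> n powr 0" using nm s1 by (intro powr_mono) auto
      then show ?thesis using nm by (intro mult_left_mono mult_right_mono) auto
    qed
    finally show ?thesis by simp
  qed
  finally show ?thesis unfolding \<delta>_def by (simp add: algebra_simps)
qed

section \<open>The limit of truncated solutions\<close>

lemma nn_integral_two_weights:
  assumes "L2c (wt p u)" "L2c (wt q u)" and u: "u \<in> borel_measurable borel"
  shows "(\<integral>\<^sup>+\<xi>. ennreal ((norm \<xi> powr (2 * p) + norm \<xi> powr (2 * q)) * (cmod (u \<xi>))\<^sup>2) \<partial>lborel) = ennreal ((n2 (wt p u))\<^sup>2 + (n2 (wt q u))\<^sup>2)"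
proof -
  note [measurable] = u wt_measurable[OF u]
  have "(\<integral>\<^sup>+\<xi>. ennreal ((norm \<xi> powr (2 * p) + norm \<xi> powr (2 * q)) * (cmod (u \<xi>))\<^sup>2) \<partial>lborel) = (\<integral>\<^sup>+\<xi>. ennreal ((cmod (wt p u \<xi>))\<^sup>2) + ennreal ((cmod (wt q u \<xi>))\<^sup>2) \<partial>lborel)"
    unfolding cmod_wt_square by (rule nn_integral_cong) (simp add: distrib_right)
  also have "\<dots> = (\<integral>\<^sup>+\<xi>. ennreal ((cmod (wt p u \<xi>))\<^sup>2) \<partial>lborel) + (\<integral>\<^sup>+\<xi>. ennreal ((cmod (wt q u \<xi>))\<^sup>2) \<partial>lborel)"
    by (rule nn_integral_add) auto
  also have "\<dots> = ennreal ((n2 (wt p u))\<^sup>2 + (n2 (wt q u))\<^sup>2)" by (simp add: L2c_nn_integral assms)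
  finally show ?thesis .
qed

lemma nn_integral_one_weight:
  assumes "L2c u" "L2c (wt q u)" and u: "u \<in> borel_measurable borel"
  shows "(\<integral>\<^sup>+\<xi>. ennreal ((1 + norm \<xi> powr (2 * q)) * (cmod (u \<xi>))\<^sup>2) \<partial>lborel) = ennreal ((n2 u)\<^sup>2 + (n2 (wt q u))\<^sup>2)"
proof -
  note [measurable] = u wt_measurable[OF u]
  have "(\<integral>\<^sup>+\<xi>. ennreal ((1 + norm \<xi> powr (2 * q)) * (cmod (u \<xi>))\<^sup>2) \<partial>lborel) = (\<integral>\<^sup>+\<xi>. ennreal ((cmod (u \<xi>))\<^sup>2) + ennreal ((cmod (wt q u \<xi>))\<^sup>2) \<partial>lborel)"
    unfolding cmod_wt_square by (rule nn_integral_cong) (simp add: distrib_right)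
  also have "\<dots> = (\<integral>\<^sup>+\<xi>. ennreal ((cmod (u \<xi>))\<^sup>2) \<partial>lborel) + (\<integral>\<^sup>+\<xi>. ennreal ((cmod (wt q u \<xi>))\<^sup>2) \<partial>lborel)"
    by (rule nn_integral_add) auto
  also have "\<dots> = ennreal ((n2 u)\<^sup>2 + (n2 (wt q u))\<^sup>2)" by (simp add: L2c_nn_integral assms)
  finally show ?thesis .
qed

text \<open>The norm at time t and the dissipation up to time t in a single nonnegative function on
  time and frequency. The first term has no time variable and is spread over the interval [0, 1] of
  length 1, so its integral is unchanged. One application of Fatou's lemma then preserves the whole
  energy inequality.\<close>

definition enfun :: "real \<Rightarrow> real \<Rightarrow> (real \<Rightarrow> pt \<Rightarrow> complex) \<Rightarrow> real \<Rightarrow> real \<times> pt \<Rightarrow> ennreal" where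
  "enfun s \<alpha> u t p = indicator {0..1} (fst p) * ennreal ((1 + norm (snd p) powr (2 * s)) * (cmod (u t (snd p)))\<^sup>2)
     + indicator {0..t} (fst p) * ennreal ((norm (snd p) powr (2 * \<alpha>) + norm (snd p) powr (2 * (s + \<alpha>))) * (cmod (u (fst p) (snd p)))\<^sup>2)"

lemma enfun_measurable:
  assumes u: "jmeas u" shows "enfun s \<alpha> u t \<in> borel_measurable lborel2"
proof -
  note [measurable (raw)] = measurable_pair_apply[OF u]
  show ?thesis unfolding enfun_def[abs_def] by measurable
qed

lemma enfun_integral:
  assumes u: "jmeas u"
  shows "(\<integral>\<^sup>+p. enfun s \<alpha> u t p \<partial>lborel2) = (\<integral>\<^sup>+\<xi>. ennreal ((1 + norm \<xi> powr (2 * s)) * (cmod (u t \<xi>))\<^sup>2) \<partial>lborel)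
     + (\<integral>\<^sup>+\<tau>. indicator {0..t} \<tau> * (\<integral>\<^sup>+\<xi>. ennreal ((norm \<xi> powr (2 * \<alpha>) + norm \<xi> powr (2 * (s + \<alpha>))) * (cmod (u \<tau> \<xi>))\<^sup>2) \<partial>lborel) \<partial>lborel)"
proof -
  note [measurable (raw)] = measurable_pair_apply[OF u]
  note [measurable] = jmeas_slice[OF u]
  let ?A = "\<lambda>\<xi>. ennreal ((1 + norm \<xi> powr (2 * s)) * (cmod (u t \<xi>))\<^sup>2)"
  let ?B = "\<lambda>\<tau> \<xi>. ennreal ((norm \<xi> powr (2 * \<alpha>) + norm \<xi> powr (2 * (s + \<alpha>))) * (cmod (u \<tau> \<xi>))\<^sup>2)"
  have "(\<integral>\<^sup>+p. enfun s \<alpha> u t p \<partial>lborel2) = (\<integral>\<^sup>+\<tau>. \<integral>\<^sup>+\<xi>. enfun s \<alpha> u t (\<tau>, \<xi>) \<partial>lborel \<partial>lborel)"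
    by (rule lborel.nn_integral_fst[symmetric]) (rule enfun_measurable[OF u])
  also have "\<dots> = (\<integral>\<^sup>+\<tau>. indicator {0..1} \<tau> * (\<integral>\<^sup>+\<xi>. ?A \<xi> \<partial>lborel) + indicator {0..t} \<tau> * (\<integral>\<^sup>+\<xi>. ?B \<tau> \<xi> \<partial>lborel) \<partial>lborel)"
  proof (rule nn_integral_cong)
    fix \<tau> :: real
    show "(\<integral>\<^sup>+\<xi>. enfun s \<alpha> u t (\<tau>, \<xi>) \<partial>lborel) = indicator {0..1} \<tau> * (\<integral>\<^sup>+\<xi>. ?A \<xi> \<partial>lborel) + indicator {0..t} \<tau> * (\<integral>\<^sup>+\<xi>. ?B \<tau> \<xi> \<partial>lborel)"
      unfolding enfun_def fst_conv snd_conv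
      by (subst nn_integral_add) (auto simp: nn_integral_cmult)
  qed
  also have "\<dots> = (\<integral>\<^sup>+\<tau>. indicator {0..1} \<tau> * (\<integral>\<^sup>+\<xi>. ?A \<xi> \<partial>lborel) \<partial>(lborel::real measure)) + (\<integral>\<^sup>+\<tau>. indicator {0..t} \<tau> * (\<integral>\<^sup>+\<xi>. ?B \<tau> \<xi> \<partial>lborel) \<partial>lborel)"
    by (rule nn_integral_add) auto
  also have "(\<integral>\<^sup>+\<tau>. indicator {0..1} \<tau> * (\<integral>\<^sup>+\<xi>. ?A \<xi> \<partial>lborel) \<partial>(lborel::real measure)) = (\<integral>\<^sup>+\<xi>. ?A \<xi> \<partial>lborel)"
    by (subst nn_integral_multc) auto
  finally show ?thesis .
qed

lemma nn_set_integral_eq: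
  fixes t :: real
  assumes i: "set_integrable lborel {0..t} F" and F: "\<And>\<tau>. 0 \<le> F \<tau>"
  shows "(\<integral>\<^sup>+\<tau>. indicator {0..t} \<tau> * ennreal (F \<tau>) \<partial>lborel) = ennreal (LINT \<tau>:{0..t}|lborel. F \<tau>)"
proof -
  have "(\<integral>\<^sup>+\<tau>. indicator {0..t} \<tau> * ennreal (F \<tau>) \<partial>lborel) = (\<integral>\<^sup>+\<tau>. ennreal (indicator {0..t} \<tau> *\<^sub>R F \<tau>) \<partial>lborel)"
    by (rule nn_integral_cong) (auto simp: indicator_def)
  also have "\<dots> = ennreal (LINT \<tau>:{0..t}|lborel. F \<tau>)"
    unfolding set_lebesgue_integral_def using i F by (intro nn_integral_eq_integral) (auto simp: set_integrable_def)
  finally show ?thesis .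
qed

text \<open>Only the homogeneous, scaling-invariant norm of the data has to be small. C is large
  enough both for the a priori estimate and for the comparison of truncations. The differences decay
  in L2, the Duhamel formula upgrades this to convergence at every frequency, and both kinds of
  convergence are needed: the first for the nonlinearity and for continuity, the second for the
  equation and for Fatou's lemma.\<close>

lemma fourier_solution:
  assumes s: "s = 2 - 2 * \<alpha>" and al: "0 < \<alpha>" "\<alpha> < 1/2"
  shows "\<exists>C\<ge>1. \<forall>w0. L2c w0 \<longrightarrow> L2c (wt s w0) \<longrightarrow> (\<forall>\<xi>. w0 (- \<xi>) = cnj (w0 \<xi>)) \<longrightarrow> C * n2 (wt s w0) < 1 \<longrightarrow>
    (\<exists>w. jmeas w \<and> l2cont w \<and> (\<forall>t\<ge>0. \<forall>\<xi>. w t (- \<xi>) = cnj (w t \<xi>)) \<and>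
      (\<forall>t\<ge>0. \<forall>\<xi>. w t \<xi> = duh (lamb \<alpha>) w0 (\<lambda>\<tau>. NL (w \<tau>) (w \<tau>)) t \<xi>) \<and>
      (\<forall>t\<ge>0. (\<integral>\<^sup>+p. enfun s \<alpha> w t p \<partial>lborel2) \<le> ennreal ((n2 w0)\<^sup>2 + (n2 (wt s w0))\<^sup>2)))"
proof -
  have s1: "1 < s" using s al by auto
  obtain C1 where C1: "0 \<le> C1" "\<And>a b d. L2c (wt \<alpha> a) \<Longrightarrow> L2c (wt s b) \<Longrightarrow> L2c (wt \<alpha> d) \<Longrightarrow>
     kap_form a b d
       \<le> ennreal (C1 * n2 (wt \<alpha> a) * n2 (wt s b) * n2 (wt \<alpha> d))"
  proof -
    \<comment> \<open>The exponents (\<alpha>, 1 - 2\<alpha>, \<alpha>) put the weight s on the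
      transported factor and the dissipation weight on the other two.\<close>
    have e: "1 + (1 - 2 * \<alpha>) = s" using s by simp
    have "\<exists>C\<ge>0. \<forall>a b d. L2c (wt \<alpha> a) \<longrightarrow> L2c (wt (1 + (1 - 2 * \<alpha>)) b) \<longrightarrow> L2c (wt \<alpha> d) \<longrightarrow>
     kap_form a b d
       \<le> ennreal (C * n2 (wt \<alpha> a) * n2 (wt (1 + (1 - 2 * \<alpha>)) b) * n2 (wt \<alpha> d))"
      by (rule kap_trilinear) (use al in auto)
    then show thesis unfolding e using that by blast
  qed
  obtain C2 where C2: "1 \<le> C2" "\<And>n w0 w t. 0 < n \<Longrightarrow> galerkin \<alpha> n w0 w \<Longrightarrow> L2c w0 \<Longrightarrow> L2c (wt s w0) \<Longrightarrow> C2 * n2 (wt s w0) < 1 \<Longrightarrow> 0 \<le> t \<Longrightarrow>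
     set_integrable lborel {0..t} (\<lambda>\<tau>. (n2 (wt (s + \<alpha>) (w \<tau>)))\<^sup>2) \<and>
       (n2 (wt s (w t)))\<^sup>2 + (LINT \<tau>:{0..t}|lborel. (n2 (wt (s + \<alpha>) (w \<tau>)))\<^sup>2) \<le> (n2 (wt s w0))\<^sup>2"
    using galerkin_apriori[OF s al] by blast
  define C where "C = C1 + C2"
  have C: "1 \<le> C" "C1 \<le> C" "C2 \<le> C" using C1(1) C2(1) by (auto simp: C_def)
  {
    fix w0 assume w0: "L2c w0" "L2c (wt s w0)" and h0: "\<forall>\<xi>. w0 (- \<xi>) = cnj (w0 \<xi>)" and small: "C * n2 (wt s w0) < 1"
    have "C2 * n2 (wt s w0) \<le> C * n2 (wt s w0)" "C1 * n2 (wt s w0) \<le> C * n2 (wt s w0)" using C by (auto intro!: mult_right_mono)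
    then have sm: "C2 * n2 (wt s w0) < 1" "C1 * n2 (wt s w0) \<le> 1" using small by linarith+
    have "\<forall>k. \<exists>w. galerkin \<alpha> (real (Suc k)) w0 w" using galerkin_exists[OF al(1) _ w0(1)] h0 by auto
    \<comment> \<open>The radii start at 1, as the comparison of truncations requires.\<close>
    then obtain W where g: "\<And>k. galerkin \<alpha> (real (Suc k)) w0 (W k)" by (metis (no_types))
    note gD = galerkinD[OF g]
    have AP: "set_integrable lborel {0..t} (\<lambda>\<tau>. (n2 (wt (s + \<alpha>) (W k \<tau>)))\<^sup>2)"
       "(n2 (wt s (W k t)))\<^sup>2 + (LINT \<tau>:{0..t}|lborel. (n2 (wt (s + \<alpha>) (W k \<tau>)))\<^sup>2) \<le> (n2 (wt s w0))\<^sup>2" if "0 \<le> t" for k t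
      using C2(2)[OF _ g w0 sm(1) that, of k] by auto
    have pos: "0 \<le> (LINT \<tau>:{0..t}|lborel. (F \<tau>)\<^sup>2)" for t :: real and F :: "real \<Rightarrow> real"
      unfolding set_lebesgue_integral_def by (intro integral_nonneg_AE) auto
    have AY: "n2 (wt s (W k t)) \<le> n2 (wt s w0)" if "0 \<le> t" for k t
    proof (rule power2_le_imp_le)
      show "(n2 (wt s (W k t)))\<^sup>2 \<le> (n2 (wt s w0))\<^sup>2" using AP(2)[OF that, of k] pos[of t "\<lambda>\<tau>. n2 (wt (s + \<alpha>) (W k \<tau>))"] by linarith
    qed simp
    have AD: "(LINT \<tau>:{0..t}|lborel. (n2 (wt (s + \<alpha>) (W k \<tau>)))\<^sup>2) \<le> (n2 (wt s w0))\<^sup>2" if "0 \<le> t" for k t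
      using AP(2)[OF that, of k] zero_le_power2[of "n2 (wt s (W k t))"] by linarith
    have sm2: "C1 * n2 (wt s (W k t)) \<le> 1" if "0 \<le> t" for k t
      using mult_left_mono[OF AY[OF that, of k] C1(1)] sm(2) by linarith
    define K where "K = 2 * (n2 (wt s w0))\<^sup>2 + (n2 w0)\<^sup>2"
    \<comment> \<open>The square root of the bound of \<open>galerkin_difference\<close>: uniform in
      time and in the larger truncation.\<close>
    define B where "B i = sqrt (real (Suc i) powr (- s) * K)" for i
    have K0: "0 \<le> K" by (simp add: K_def)
    have B0: "0 \<le> B i" for i using K0 by (simp add: B_def)
    have Blim: "B \<longlonglongrightarrow> 0"
    proof -
      have "(\<lambda>i. real (Suc i) powr (- s)) \<longlonglongrightarrow> 0"
        by (rule tendsto_neg_powr) (use s1 filterlim_compose[OF filterlim_real_sequentially filterlim_Suc] in auto)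
      then have "(\<lambda>i. sqrt (real (Suc i) powr (- s) * K)) \<longlonglongrightarrow> sqrt (0 * K)" by (intro tendsto_intros)
      then show ?thesis unfolding B_def by simp
    qed
    have diff: "n2 (\<lambda>\<xi>. W i t \<xi> - W j t \<xi>) \<le> B i" if "i \<le> j" "0 \<le> t" for i j t
      unfolding B_def
    proof (rule real_le_rsqrt)
      show "(n2 (\<lambda>\<xi>. W i t \<xi> - W j t \<xi>))\<^sup>2 \<le> real (Suc i) powr (- s) * K"
        unfolding K_def
        by (rule galerkin_difference[OF s al C1(2,1) _ _ g g w0 sm2 AP(1) AD that(2)]) (use that(1) in auto)
    qed
    have cNL: "continuous_on {0..} (\<lambda>\<tau>. NL (W k \<tau>) (W k \<tau>) \<xi>)" for k \<xi> by (rule NL_continuous[OF gD(2)])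
    have lip: "cmod (NL a a \<xi> - NL b b \<xi>) \<le> norm \<xi> * (2 * n2 w0) * d" if "L2c a" "L2c b" "n2 a \<le> n2 w0" "n2 b \<le> n2 w0" "n2 (\<lambda>x. a x - b x) \<le> d" for a b d \<xi>
    proof -
      have "norm \<xi> * (n2 a + n2 b) * n2 (\<lambda>x. a x - b x) \<le> norm \<xi> * (2 * n2 w0) * d"
        using that(3-5) by (intro mult_mono) auto
      then show ?thesis using NL_lipschitz[OF that(1,2), of \<xi>] by linarith
    qed
    have dd: "cmod (duh (lamb \<alpha>) w0 f t \<xi> - duh (lamb \<alpha>) w0 f' t \<xi>) \<le> t * c"
      if "continuous_on {0..} (\<lambda>\<tau>. f \<tau> \<xi>)" "continuous_on {0..} (\<lambda>\<tau>. f' \<tau> \<xi>)" "0 \<le> t" "\<And>\<tau>. \<tau> \<in> {0..t} \<Longrightarrow> cmod (f \<tau> \<xi> - f' \<tau> \<xi>) \<le> c" for f f' t \<xi> c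
    proof -
      have "cmod (duh (lamb \<alpha>) w0 f t \<xi> - duh (lamb \<alpha>) w0 f' t \<xi>) \<le> cmod (w0 \<xi> - w0 \<xi>) + (LINT \<tau>:{0..t}|lborel. c)"
        by (rule duh_diff_bound[where f=f and g=f' and l="lamb \<alpha>" and \<xi>=\<xi> and h="\<lambda>_. c", OF that(1,2) lamb_nonneg that(3) _ that(4)]) (auto intro!: set_integrable_continuous continuous_intros)
      also have "\<dots> = t * c" using that(3) by (simp add: set_lebesgue_integral_def)
      finally show ?thesis .
    qed
    \<comment> \<open>From L2 to pointwise: at a fixed frequency inside both balls the two solutions
      obey the same Duhamel formula with the same data, and \<open>NL\<close> at that frequency is
      Lipschitz in L2.\<close>
    have pd: "cmod (W i t \<xi> - W j t \<xi>) \<le> t * (norm \<xi> * (2 * n2 w0) * B i)" if "i \<le> j" "0 \<le> t" "norm \<xi> \<le> real (Suc i)" for i j t \<xi>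
    proof -
      have "norm \<xi> \<le> real (Suc j)" using that by linarith
      then have "W i t \<xi> = duh (lamb \<alpha>) w0 (\<lambda>\<tau>. NL (W i \<tau>) (W i \<tau>)) t \<xi>" "W j t \<xi> = duh (lamb \<alpha>) w0 (\<lambda>\<tau>. NL (W j \<tau>) (W j \<tau>)) t \<xi>"
        using gD(5)[OF that(2), of i \<xi>] gD(5)[OF that(2), of j \<xi>] that(3) by (simp_all only: if_True)
      moreover have "cmod (NL (W i \<tau>) (W i \<tau>) \<xi> - NL (W j \<tau>) (W j \<tau>) \<xi>) \<le> norm \<xi> * (2 * n2 w0) * B i" if \<tau>: "\<tau> \<in> {0..t}" for \<tau>
      proof -
        have \<tau>0: "0 \<le> \<tau>" using \<tau> by simp
        show ?thesis by (rule lip[OF gD(7)[OF \<tau>0] gD(7)[OF \<tau>0] gD(4)[OF \<tau>0] gD(4)[OF \<tau>0] diff[OF \<open>i \<le> j\<close> \<tau>0]])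
      qed
      from dd[where f="\<lambda>\<tau>. NL (W i \<tau>) (W i \<tau>)" and f'="\<lambda>\<tau>. NL (W j \<tau>) (W j \<tau>)" and \<xi>=\<xi>, OF cNL cNL that(2) this]
      have "cmod (duh (lamb \<alpha>) w0 (\<lambda>\<tau>. NL (W i \<tau>) (W i \<tau>)) t \<xi> - duh (lamb \<alpha>) w0 (\<lambda>\<tau>. NL (W j \<tau>) (W j \<tau>)) t \<xi>) \<le> t * (norm \<xi> * (2 * n2 w0) * B i)" .
      ultimately show ?thesis by (simp only:)
    qed
    have clim: "(\<lambda>i. t * (norm \<xi> * (2 * n2 w0) * B i)) \<longlonglongrightarrow> 0" for t and \<xi> :: pt
      using tendsto_mult[OF tendsto_const[of t] tendsto_mult[OF tendsto_const[of "norm \<xi> * (2 * n2 w0)"] Blim]] by simp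
    have evn: "\<forall>\<^sub>F i in sequentially. norm \<xi> \<le> real (Suc i)" for \<xi> :: pt
    proof -
      obtain m :: nat where "norm \<xi> \<le> real m" using real_arch_simple by blast
      then have "norm \<xi> \<le> real (Suc i)" if "i \<ge> m" for i using that by linarith
      then show ?thesis unfolding eventually_sequentially by blast
    qed
    define w where "w t \<xi> = lim (\<lambda>k. W k t \<xi>)" for t \<xi>
    have wl: "(\<lambda>k. W k t \<xi>) \<longlonglongrightarrow> w t \<xi>" if t: "0 \<le> t" for t \<xi>
    proof -
      have "Cauchy (\<lambda>k. W k t \<xi>)"
      proof (rule CauchyI')
        fix e :: real assume e: "0 < e"
        from eventually_conj[OF order_tendstoD(2)[OF clim[of t \<xi>] e] evn[of \<xi>]]
        obtain M where M: "\<And>i. i \<ge> M \<Longrightarrow> t * (norm \<xi> * (2 * n2 w0) * B i) < e \<and> norm \<xi> \<le> real (Suc i)"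
          unfolding eventually_sequentially by blast
        have "norm (W i t \<xi> - W j t \<xi>) < e" if "i \<ge> M" "j > i" for i j
          by (rule le_less_trans[OF pd[OF less_imp_le[OF that(2)] t conjunct2[OF M[OF that(1)]]] conjunct1[OF M[OF that(1)]]])
        then show "\<exists>M. \<forall>m\<ge>M. \<forall>n>m. dist (W m t \<xi>) (W n t \<xi>) < e" unfolding dist_norm by (intro exI[of _ M] allI impI)
      qed
      then show ?thesis unfolding w_def by (rule convergent_LIMSEQ_iff[THEN iffD1, OF Cauchy_convergent])
    qed
    have jw: "jmeas w"
    proof -
      note [measurable (raw)] = measurable_pair_apply[OF gD(1)]
      show ?thesis unfolding w_def split_beta' by measurable
    qed
    have wm: "w t \<in> borel_measurable lborel" for t using jmeas_slice[OF jw] by simp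
    have Wm: "W k t \<in> borel_measurable lborel" for k t using jmeas_slice[OF gD(1)] by simp
    have wL: "L2c (w t)" "n2 (w t) \<le> n2 w0" if t: "0 \<le> t" for t
      using L2_fatou[of "\<lambda>k. W k t" "w t" "n2 w0", OF gD(7)[OF t] wm] wl[OF t] gD(4)[OF t] by auto
    \<comment> \<open>Fatou's lemma in j with i fixed transfers the rate to the limit.\<close>
    have wd: "n2 (\<lambda>\<xi>. W i t \<xi> - w t \<xi>) \<le> B i" if t: "0 \<le> t" for i t
    proof (rule L2_fatou(2)[of "\<lambda>j \<xi>. W i t \<xi> - W j t \<xi>"])
      show "L2c (\<lambda>\<xi>. W i t \<xi> - W j t \<xi>)" for j by (rule L2c_diff[OF gD(7)[OF t] gD(7)[OF t]])
      show "AE \<xi> in lborel. (\<lambda>j. W i t \<xi> - W j t \<xi>) \<longlonglongrightarrow> W i t \<xi> - w t \<xi>" by (intro AE_I2 tendsto_intros wl[OF t])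
      show "\<forall>\<^sub>F j in sequentially. n2 (\<lambda>\<xi>. W i t \<xi> - W j t \<xi>) \<le> B i"
        unfolding eventually_sequentially using diff[OF _ t] by blast
    qed (use Wm wm in measurable)
    have cw: "l2cont w"
    proof (rule l2cont_uniform_limit[of W, OF gD(2) wL(1)])
      fix T e :: real assume "0 < e"
      from order_tendstoD(2)[OF Blim this] obtain k where "B k < e" by (auto dest: eventually_happens)
      then have "n2 (\<lambda>\<xi>. W k t \<xi> - w t \<xi>) \<le> e" if "t \<in> {0..T}" for t using wd[of t k] that by auto
      then show "\<exists>k. \<forall>t\<in>{0..T}. n2 (\<lambda>\<xi>. W k t \<xi> - w t \<xi>) \<le> e" by blast
    qed
    have hw: "w t (- \<xi>) = cnj (w t \<xi>)" if t: "0 \<le> t" for t \<xi>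
    proof (rule LIMSEQ_unique[OF wl[OF t]])
      show "(\<lambda>k. W k t (- \<xi>)) \<longlonglongrightarrow> cnj (w t \<xi>)" unfolding gD(3)[OF t] by (intro tendsto_intros wl[OF t])
    qed
    have ew: "w t \<xi> = duh (lamb \<alpha>) w0 (\<lambda>\<tau>. NL (w \<tau>) (w \<tau>)) t \<xi>" if t: "0 \<le> t" for t \<xi>
    proof (rule LIMSEQ_unique[OF wl[OF t]], rule LIM_zero_cancel, rule tendsto_norm_zero_cancel, rule tendsto_sandwich[OF _ _ tendsto_const clim])
      show "\<forall>\<^sub>F k in sequentially. norm (W k t \<xi> - duh (lamb \<alpha>) w0 (\<lambda>\<tau>. NL (w \<tau>) (w \<tau>)) t \<xi>) \<le> t * (norm \<xi> * (2 * n2 w0) * B k)"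
        using evn[of \<xi>]
      proof eventually_elim
        case (elim k)
        have "W k t \<xi> = duh (lamb \<alpha>) w0 (\<lambda>\<tau>. NL (W k \<tau>) (W k \<tau>)) t \<xi>" using gD(5)[OF t, of k \<xi>] elim by (simp only: if_True)
        moreover have "cmod (NL (W k \<tau>) (W k \<tau>) \<xi> - NL (w \<tau>) (w \<tau>) \<xi>) \<le> norm \<xi> * (2 * n2 w0) * B k" if \<tau>: "\<tau> \<in> {0..t}" for \<tau>
        proof -
          have \<tau>0: "0 \<le> \<tau>" using \<tau> by simp
          show ?thesis by (rule lip[OF gD(7)[OF \<tau>0] wL(1)[OF \<tau>0] gD(4)[OF \<tau>0] wL(2)[OF \<tau>0] wd[OF \<tau>0]])
        qed
        from dd[where f="\<lambda>\<tau>. NL (W k \<tau>) (W k \<tau>)" and f'="\<lambda>\<tau>. NL (w \<tau>) (w \<tau>)" and \<xi>=\<xi>, OF cNL NL_continuous[OF cw] t this]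
        have "cmod (duh (lamb \<alpha>) w0 (\<lambda>\<tau>. NL (W k \<tau>) (W k \<tau>)) t \<xi> - duh (lamb \<alpha>) w0 (\<lambda>\<tau>. NL (w \<tau>) (w \<tau>)) t \<xi>) \<le> t * (norm \<xi> * (2 * n2 w0) * B k)" .
        ultimately show ?case by (simp only:)
      qed
    qed simp
    have EN: "(\<integral>\<^sup>+p. enfun s \<alpha> w t p \<partial>lborel2) \<le> ennreal ((n2 w0)\<^sup>2 + (n2 (wt s w0))\<^sup>2)" if t: "0 \<le> t" for t
    proof -
      have Ek: "(\<integral>\<^sup>+p. enfun s \<alpha> (W k) t p \<partial>lborel2) \<le> ennreal ((n2 w0)\<^sup>2 + (n2 (wt s w0))\<^sup>2)" for k
      proof -
        have Lr: "L2c (wt r (W k \<tau>))" if "0 \<le> \<tau>" "0 \<le> r" for r \<tau>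
          by (rule L2c_wt_supp(1)[where N="real (Suc k)", OF gD(7)[OF that(1)] gD(6)[OF that(1)] that(2)])
        have m: "W k \<tau> \<in> borel_measurable borel" for \<tau> by (rule jmeas_slice[OF gD(1)])
        have i1: "set_integrable lborel {0..t} (\<lambda>\<tau>. (n2 (wt \<alpha> (W k \<tau>)))\<^sup>2)" and e1: "(n2 (W k t))\<^sup>2 + 2 * (LINT \<tau>:{0..t}|lborel. (n2 (wt \<alpha> (W k \<tau>)))\<^sup>2) \<le> (n2 w0)\<^sup>2"
          using galerkin_L2_energy[OF g w0(1) al(1) _ t, of k] by auto
        have "(\<integral>\<^sup>+\<tau>. indicator {0..t} \<tau> * (\<integral>\<^sup>+\<xi>. ennreal ((norm \<xi> powr (2 * \<alpha>) + norm \<xi> powr (2 * (s + \<alpha>))) * (cmod (W k \<tau> \<xi>))\<^sup>2) \<partial>lborel) \<partial>lborel)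
          = (\<integral>\<^sup>+\<tau>. indicator {0..t} \<tau> * ennreal ((n2 (wt \<alpha> (W k \<tau>)))\<^sup>2 + (n2 (wt (s + \<alpha>) (W k \<tau>)))\<^sup>2) \<partial>lborel)"
        proof (rule nn_integral_cong)
          fix \<tau> :: real
          show "indicator {0..t} \<tau> * (\<integral>\<^sup>+\<xi>. ennreal ((norm \<xi> powr (2 * \<alpha>) + norm \<xi> powr (2 * (s + \<alpha>))) * (cmod (W k \<tau> \<xi>))\<^sup>2) \<partial>lborel) = indicator {0..t} \<tau> * ennreal ((n2 (wt \<alpha> (W k \<tau>)))\<^sup>2 + (n2 (wt (s + \<alpha>) (W k \<tau>)))\<^sup>2)"
          proof (cases "\<tau> \<in> {0..t}")
            case True
            then have "L2c (wt \<alpha> (W k \<tau>))" "L2c (wt (s + \<alpha>) (W k \<tau>))" using al s1 by (auto intro!: Lr)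
            from nn_integral_two_weights[OF this m] show ?thesis by simp
          qed simp
        qed
        also have "\<dots> = ennreal (LINT \<tau>:{0..t}|lborel. (n2 (wt \<alpha> (W k \<tau>)))\<^sup>2 + (n2 (wt (s + \<alpha>) (W k \<tau>)))\<^sup>2)"
          by (rule nn_set_integral_eq[OF set_integral_add(1)[OF i1 AP(1)[OF t]]]) simp
        also have "(LINT \<tau>:{0..t}|lborel. (n2 (wt \<alpha> (W k \<tau>)))\<^sup>2 + (n2 (wt (s + \<alpha>) (W k \<tau>)))\<^sup>2) = (LINT \<tau>:{0..t}|lborel. (n2 (wt \<alpha> (W k \<tau>)))\<^sup>2) + (LINT \<tau>:{0..t}|lborel. (n2 (wt (s + \<alpha>) (W k \<tau>)))\<^sup>2)"
          by (rule set_integral_add(2)[OF i1 AP(1)[OF t]])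
        finally have Z: "(\<integral>\<^sup>+\<tau>. indicator {0..t} \<tau> * (\<integral>\<^sup>+\<xi>. ennreal ((norm \<xi> powr (2 * \<alpha>) + norm \<xi> powr (2 * (s + \<alpha>))) * (cmod (W k \<tau> \<xi>))\<^sup>2) \<partial>lborel) \<partial>lborel)
          = ennreal ((LINT \<tau>:{0..t}|lborel. (n2 (wt \<alpha> (W k \<tau>)))\<^sup>2) + (LINT \<tau>:{0..t}|lborel. (n2 (wt (s + \<alpha>) (W k \<tau>)))\<^sup>2))" .
        have Ls: "L2c (wt s (W k t))" using s1 by (intro Lr t) auto
        have "(\<integral>\<^sup>+p. enfun s \<alpha> (W k) t p \<partial>lborel2) = ennreal ((n2 (W k t))\<^sup>2 + (n2 (wt s (W k t)))\<^sup>2) + ennreal ((LINT \<tau>:{0..t}|lborel. (n2 (wt \<alpha> (W k \<tau>)))\<^sup>2) + (LINT \<tau>:{0..t}|lborel. (n2 (wt (s + \<alpha>) (W k \<tau>)))\<^sup>2))"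
          unfolding enfun_integral[OF gD(1)] Z nn_integral_one_weight[OF gD(7)[OF t] Ls m] ..
        also have "\<dots> = ennreal (((n2 (W k t))\<^sup>2 + (n2 (wt s (W k t)))\<^sup>2) + ((LINT \<tau>:{0..t}|lborel. (n2 (wt \<alpha> (W k \<tau>)))\<^sup>2) + (LINT \<tau>:{0..t}|lborel. (n2 (wt (s + \<alpha>) (W k \<tau>)))\<^sup>2)))"
          by (rule ennreal_plus[symmetric]) (auto intro!: add_nonneg_nonneg pos)
        also have "\<dots> \<le> ennreal ((n2 w0)\<^sup>2 + (n2 (wt s w0))\<^sup>2)"
          using e1 AP(2)[OF t, of k] pos[of t "\<lambda>\<tau>. n2 (wt \<alpha> (W k \<tau>))"] by (intro ennreal_leI) linarith
        finally show ?thesis .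
      qed
      have "(\<integral>\<^sup>+p. enfun s \<alpha> w t p \<partial>lborel2) = (\<integral>\<^sup>+p. liminf (\<lambda>k. enfun s \<alpha> (W k) t p) \<partial>lborel2)"
      proof (rule nn_integral_cong)
        fix p :: "real \<times> pt"
        have g: "(\<lambda>k. indicator S x * ennreal (c * (cmod (f k))\<^sup>2)) \<longlonglongrightarrow> indicator S x * ennreal (c * (cmod l)\<^sup>2)"
          if "x \<in> S \<Longrightarrow> f \<longlonglongrightarrow> l" for S :: "real set" and x c f l
        proof (cases "x \<in> S")
          case True
          have "(\<lambda>k. ennreal (c * (cmod (f k))\<^sup>2)) \<longlonglongrightarrow> ennreal (c * (cmod l)\<^sup>2)" by (intro tendsto_ennrealI tendsto_intros that True)
          then show ?thesis using True by simp
        qed simp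
        have "(\<lambda>k. enfun s \<alpha> (W k) t p) \<longlonglongrightarrow> enfun s \<alpha> w t p"
          unfolding enfun_def by (intro tendsto_add g wl) (use t in auto)
        then show "enfun s \<alpha> w t p = liminf (\<lambda>k. enfun s \<alpha> (W k) t p)" by (rule lim_imp_Liminf[OF sequentially_bot, symmetric])
      qed
      also have "\<dots> \<le> liminf (\<lambda>k. \<integral>\<^sup>+p. enfun s \<alpha> (W k) t p \<partial>lborel2)"
        by (rule nn_integral_liminf) (rule enfun_measurable[OF gD(1)])
      also have "\<dots> \<le> liminf (\<lambda>k. ennreal ((n2 w0)\<^sup>2 + (n2 (wt s w0))\<^sup>2))"
        by (intro Liminf_mono always_eventually allI Ek)
      also have "\<dots> = ennreal ((n2 w0)\<^sup>2 + (n2 (wt s w0))\<^sup>2)" by (rule Liminf_const[OF sequentially_bot])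
      finally show ?thesis .
    qed
    have "\<exists>w. jmeas w \<and> l2cont w \<and> (\<forall>t\<ge>0. \<forall>\<xi>. w t (- \<xi>) = cnj (w t \<xi>)) \<and>
      (\<forall>t\<ge>0. \<forall>\<xi>. w t \<xi> = duh (lamb \<alpha>) w0 (\<lambda>\<tau>. NL (w \<tau>) (w \<tau>)) t \<xi>) \<and>
      (\<forall>t\<ge>0. (\<integral>\<^sup>+p. enfun s \<alpha> w t p \<partial>lborel2) \<le> ennreal ((n2 w0)\<^sup>2 + (n2 (wt s w0))\<^sup>2))"
      by (intro exI[of _ w] conjI allI impI jw cw hw ew EN)
  }
  then show ?thesis using C(1) by (intro exI[of _ C] conjI allI impI) blast+
qed

section \<open>Regularity of the limit\<close>

text \<open>|xi|^r is at most 1 + |xi|^s, by the cases |xi| \<le> 1 and |xi| > 1. This covers all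
  intermediate weights.\<close>

lemma wt_interpolation:
  assumes u: "L2c u" "L2c (wt s u)" and r: "0 \<le> r" "r \<le> s"
  shows "L2c (wt r u)" "n2 (wt r u) \<le> n2 u + n2 (wt s u)"
proof -
  have [measurable]: "u \<in> borel_measurable borel" using L2c_measurable[OF u(1)] by simp
  let ?a = "\<lambda>\<xi>. complex_of_real (cmod (u \<xi>))" and ?b = "\<lambda>\<xi>. complex_of_real (cmod (wt s u \<xi>))"
  have ab: "L2c ?a" "L2c ?b" "n2 ?a = n2 u" "n2 ?b = n2 (wt s u)"
    using u by (auto simp: L2c_def n2_def L2norm_sq_def)
  have le: "cmod (wt r u \<xi>) \<le> 1 * cmod (?a \<xi> + ?b \<xi>)" for \<xi>
  proof -
    have "norm \<xi> powr r \<le> 1 + norm \<xi> powr s"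
    proof (cases "norm \<xi> \<le> 1")
      case True
      then have "norm \<xi> powr r \<le> 1 powr r" by (intro powr_mono2 r) auto
      then show ?thesis by (simp add: add_increasing2)
    next
      case False
      then have "norm \<xi> powr r \<le> norm \<xi> powr s" using r by (intro powr_mono) auto
      then show ?thesis by simp
    qed
    then have "norm \<xi> powr r * cmod (u \<xi>) \<le> (1 + norm \<xi> powr s) * cmod (u \<xi>)" by (rule mult_right_mono) simp
    also have "\<dots> = cmod (complex_of_real (cmod (u \<xi>) + cmod (wt s u \<xi>)))"
      unfolding norm_of_real cmod_wt by (simp add: distrib_right)
    finally show ?thesis unfolding cmod_wt of_real_add by simp
  qed
  note * = L2c_mono[OF L2c_add[OF ab(1,2)] _ AE_I2[OF le]]
  show "L2c (wt r u)" by (rule *(1)) auto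
  have "n2 (wt r u) \<le> 1 * n2 (\<lambda>\<xi>. ?a \<xi> + ?b \<xi>)" by (rule *(2)) auto
  also have "\<dots> \<le> n2 u + n2 (wt s u)" using n2_triangle[OF ab(1,2)] ab(3,4) by simp
  finally show "n2 (wt r u) \<le> n2 u + n2 (wt s u)" .
qed

text \<open>Pointwise convergence together with convergence of the norms gives strong convergence.
  The function 2|f|^2 + 2|g|^2 - |f - g|^2 is nonnegative and tends to 4|g|^2; Fatou's lemma for it
  leaves no room for |f - g|^2 in the limit.\<close>

lemma L2_strong_limit:
  assumes f: "\<And>i::nat. L2c (f i)" and g: "L2c g" and lim: "\<And>x. (\<lambda>i. f i x) \<longlonglongrightarrow> g x"
    and nl: "(\<lambda>i. (n2 (f i))\<^sup>2) \<longlonglongrightarrow> (n2 g)\<^sup>2"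
  shows "(\<lambda>i. n2 (\<lambda>x. f i x - g x)) \<longlonglongrightarrow> 0"
proof -
  note [measurable] = L2c_measurable[OF f] L2c_measurable[OF g]
  define h where "h i x = 2 * (cmod (f i x))\<^sup>2 + 2 * (cmod (g x))\<^sup>2 - (cmod (f i x - g x))\<^sup>2" for i x
  define D where "D i = (n2 (\<lambda>x. f i x - g x))\<^sup>2" for i
  have h0: "0 \<le> h i x" for i x
  proof -
    have "(cmod (f i x - g x))\<^sup>2 \<le> (cmod (f i x) + cmod (g x))\<^sup>2" by (intro power_mono norm_triangle_ineq4) auto
    moreover have "0 \<le> (cmod (f i x) - cmod (g x))\<^sup>2" by simp
    ultimately show ?thesis unfolding h_def power2_sum power2_diff by simp
  qed
  note I = L2c_integrable[OF f] L2c_integrable[OF g] L2c_integrable[OF L2c_diff[OF f g]]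
  have ih: "integrable lborel (h i)" for i unfolding h_def using I by auto
  have Ih: "(LINT x|lborel. h i x) = 2 * (n2 (f i))\<^sup>2 + 2 * (n2 g)\<^sup>2 - D i" for i
    unfolding h_def D_def n2_squared L2norm_sq_def using I by simp
  have "ennreal (4 * (n2 g)\<^sup>2) = (\<integral>\<^sup>+x. liminf (\<lambda>i. ennreal (h i x)) \<partial>lborel)"
  proof -
    have "ennreal (4 * (n2 g)\<^sup>2) = (\<integral>\<^sup>+x. ennreal (4 * (cmod (g x))\<^sup>2) \<partial>lborel)"
      unfolding n2_squared L2norm_sq_def using I(2) by (subst nn_integral_eq_integral) auto
    also have "\<dots> = (\<integral>\<^sup>+x. liminf (\<lambda>i. ennreal (h i x)) \<partial>lborel)"
    proof (rule nn_integral_cong)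
      fix x
      have "(\<lambda>i. h i x) \<longlonglongrightarrow> 2 * (cmod (g x))\<^sup>2 + 2 * (cmod (g x))\<^sup>2 - (cmod (g x - g x))\<^sup>2"
        unfolding h_def by (intro tendsto_intros lim)
      then have "(\<lambda>i. ennreal (h i x)) \<longlonglongrightarrow> ennreal (4 * (cmod (g x))\<^sup>2)" by (intro tendsto_ennrealI) simp
      then show "ennreal (4 * (cmod (g x))\<^sup>2) = liminf (\<lambda>i. ennreal (h i x))" by (rule lim_imp_Liminf[OF sequentially_bot, symmetric])
    qed
    finally show ?thesis .
  qed
  also have "\<dots> \<le> liminf (\<lambda>i. \<integral>\<^sup>+x. ennreal (h i x) \<partial>lborel)"
    by (rule nn_integral_liminf) (simp add: h_def)
  also have "(\<lambda>i. \<integral>\<^sup>+x. ennreal (h i x) \<partial>lborel) = (\<lambda>i. ennreal (2 * (n2 (f i))\<^sup>2 + 2 * (n2 g)\<^sup>2 - D i))"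
    using nn_integral_eq_integral[OF ih] h0 Ih by simp
  finally have F: "ennreal (4 * (n2 g)\<^sup>2) \<le> liminf (\<lambda>i. ennreal (2 * (n2 (f i))\<^sup>2 + 2 * (n2 g)\<^sup>2 - D i))" .
  have "D \<longlonglongrightarrow> 0"
  proof (rule order_tendstoI)
    fix a :: real assume "a < 0"
    then show "\<forall>\<^sub>F i in sequentially. a < D i" unfolding D_def by (intro always_eventually allI) (meson less_le_trans zero_le_power2)
  next
    fix a :: real assume a: "0 < a"
    \<comment> \<open>\<open>ennreal\<close> sends negative numbers to 0, so a negative lower bound
      has to be handled apart.\<close>
    have 1: "\<forall>\<^sub>F i in sequentially. 4 * (n2 g)\<^sup>2 - a / 2 < 2 * (n2 (f i))\<^sup>2 + 2 * (n2 g)\<^sup>2 - D i"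
    proof (cases "4 * (n2 g)\<^sup>2 - a / 2 < 0")
      case True
      have "0 \<le> 2 * (n2 (f i))\<^sup>2 + 2 * (n2 g)\<^sup>2 - D i" for i
        unfolding Ih[symmetric] by (rule integral_nonneg_AE) (simp add: h0)
      then show ?thesis using True by (intro always_eventually allI) (rule less_le_trans)
    next
      case False
      then have "ennreal (4 * (n2 g)\<^sup>2 - a / 2) < ennreal (4 * (n2 g)\<^sup>2)" using a by (intro ennreal_lessI) auto
      from less_LiminfD[OF less_le_trans[OF this F]]
      have "\<forall>\<^sub>F i in sequentially. ennreal (4 * (n2 g)\<^sup>2 - a / 2) < ennreal (2 * (n2 (f i))\<^sup>2 + 2 * (n2 g)\<^sup>2 - D i)" .
      then show ?thesis by eventually_elim (use False in \<open>simp add: ennreal_less_iff\<close>)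
    qed
    have 2: "\<forall>\<^sub>F i in sequentially. (n2 (f i))\<^sup>2 < (n2 g)\<^sup>2 + a / 4" using order_tendstoD(2)[OF nl] a by simp
    from 1 2 show "\<forall>\<^sub>F i in sequentially. D i < a" by eventually_elim (simp add: field_simps)
  qed
  then have "(\<lambda>i. sqrt (D i)) \<longlonglongrightarrow> sqrt 0" by (rule tendsto_real_sqrt)
  then show ?thesis by (simp add: D_def)
qed

lemma jmeas_wt: assumes "jmeas w" shows "jmeas (\<lambda>t. wt r (w t))"
proof -
  note [measurable (raw)] = measurable_pair_apply[OF assms]
  show ?thesis unfolding wt_def split_beta' by measurable
qed

text \<open>What is retained of the limit once the truncations have been left behind: the equation
  at every frequency and one energy bound K. Regularity and the weak formulation are derived from
  these facts alone.\<close>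

locale fourier_sqg =
  fixes s \<alpha> K :: real and w0 :: "pt \<Rightarrow> complex" and w :: "real \<Rightarrow> pt \<Rightarrow> complex"
  assumes s: "s = 2 - 2 * \<alpha>" and al: "0 < \<alpha>" "\<alpha> < 1/2" and K: "0 \<le> K"
    and jw: "jmeas w" and cw: "l2cont w" and hw: "\<And>t \<xi>. 0 \<le> t \<Longrightarrow> w t (- \<xi>) = cnj (w t \<xi>)"
    and ew: "\<And>t \<xi>. 0 \<le> t \<Longrightarrow> w t \<xi> = duh (lamb \<alpha>) w0 (\<lambda>\<tau>. NL (w \<tau>) (w \<tau>)) t \<xi>"
    and EN: "\<And>t. 0 \<le> t \<Longrightarrow> (\<integral>\<^sup>+p. enfun s \<alpha> w t p \<partial>lborel2) \<le> ennreal K"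
begin

lemma s1: "1 < s" using s al by auto

lemma Lw: "0 \<le> t \<Longrightarrow> L2c (w t)" by (rule l2cont_L2c[OF cw])

lemma mw: "w t \<in> borel_measurable borel" by (rule jmeas_slice[OF jw])

text \<open>Kept in \<open>ennreal\<close>: the energy bound makes the dissipation finite for almost
  every time only, and H^(s + \<alpha>) regularity can be claimed only there.\<close>

definition dis :: "real \<Rightarrow> ennreal" where
  "dis \<tau> = (\<integral>\<^sup>+\<xi>. ennreal ((norm \<xi> powr (2 * \<alpha>) + norm \<xi> powr (2 * (s + \<alpha>))) * (cmod (w \<tau> \<xi>))\<^sup>2) \<partial>lborel)"

lemma dis_measurable [measurable]: "dis \<in> borel_measurable borel"
proof -
  note [measurable (raw)] = measurable_pair_apply[OF jw]
  show ?thesis unfolding dis_def[abs_def] by measurable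
qed

lemma energy_split:
  assumes "0 \<le> t"
  shows "(\<integral>\<^sup>+\<xi>. ennreal ((1 + norm \<xi> powr (2 * s)) * (cmod (w t \<xi>))\<^sup>2) \<partial>lborel) + (\<integral>\<^sup>+\<tau>. indicator {0..t} \<tau> * dis \<tau> \<partial>lborel) \<le> ennreal K"
  using EN[OF assms] unfolding enfun_integral[OF jw] dis_def .

lemma Ls: assumes t: "0 \<le> t" shows "L2c (wt s (w t))"
proof (rule L2c_nn_leI(1)[where B="sqrt K"])
  show "wt s (w t) \<in> borel_measurable lborel" using wt_measurable[OF mw] by simp
  have "(\<integral>\<^sup>+\<xi>. ennreal ((cmod (wt s (w t) \<xi>))\<^sup>2) \<partial>lborel) \<le> (\<integral>\<^sup>+\<xi>. ennreal ((1 + norm \<xi> powr (2 * s)) * (cmod (w t \<xi>))\<^sup>2) \<partial>lborel)"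
    unfolding cmod_wt_square by (intro nn_integral_mono ennreal_leI mult_right_mono) auto
  also have "\<dots> \<le> ennreal K" by (rule order_trans[OF _ energy_split[OF t]]) simp
  finally show "(\<integral>\<^sup>+\<xi>. ennreal ((cmod (wt s (w t) \<xi>))\<^sup>2) \<partial>lborel) \<le> ennreal ((sqrt K)\<^sup>2)" using K by simp
qed (use K in simp)

lemma AE_dis_finite: "AE \<tau> in lborel. 0 \<le> \<tau> \<longrightarrow> dis \<tau> < \<infinity>"
proof -
  have "AE \<tau> in lborel. indicator {0..real n} \<tau> * dis \<tau> \<noteq> \<infinity>" for n
  proof (rule nn_integral_noteq_infinite)
    have "(\<integral>\<^sup>+\<tau>. indicator {0..real n} \<tau> * dis \<tau> \<partial>lborel) \<le> ennreal K"
      by (rule order_trans[OF _ energy_split[of "real n"]]) auto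
    also have "\<dots> < \<infinity>" by simp
    finally show "(\<integral>\<^sup>+\<tau>. indicator {0..real n} \<tau> * dis \<tau> \<partial>lborel) \<noteq> \<infinity>" by simp
  qed simp
  then have "AE \<tau> in lborel. \<forall>n. indicator {0..real n} \<tau> * dis \<tau> \<noteq> \<infinity>" by (simp add: AE_all_countable)
  then show ?thesis
  proof eventually_elim
    case (elim \<tau>)
    obtain n :: nat where "\<tau> \<le> real n" using real_arch_simple by blast
    then show ?case using elim[rule_format, of n] by (auto simp: indicator_def top.not_eq_extremum)
  qed
qed

lemma L2c_wt_of_dis:
  assumes fin: "dis \<tau> < \<infinity>" shows "L2c (wt \<alpha> (w \<tau>))" "L2c (wt (s + \<alpha>) (w \<tau>))"
proof -
  obtain c where c: "dis \<tau> = ennreal c" "0 \<le> c" using fin by (cases "dis \<tau>") auto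
  have le: "(\<integral>\<^sup>+\<xi>. ennreal ((cmod (wt r (w \<tau>) \<xi>))\<^sup>2) \<partial>lborel) \<le> ennreal ((sqrt c)\<^sup>2)" if "r = \<alpha> \<or> r = s + \<alpha>" for r
  proof -
    have "(\<integral>\<^sup>+\<xi>. ennreal ((cmod (wt r (w \<tau>) \<xi>))\<^sup>2) \<partial>lborel) \<le> dis \<tau>"
      unfolding cmod_wt_square dis_def using that by (intro nn_integral_mono ennreal_leI mult_right_mono) auto
    then show ?thesis using c by simp
  qed
  have m: "wt r (w \<tau>) \<in> borel_measurable lborel" for r using wt_measurable[OF mw] by simp
  show "L2c (wt \<alpha> (w \<tau>))" by (rule L2c_nn_leI(1)[OF m le]) (use c in auto)
  show "L2c (wt (s + \<alpha>) (w \<tau>))" by (rule L2c_nn_leI(1)[OF m le]) (use c in auto)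
qed

lemma AE_L2c: "AE \<tau> in lborel. 0 \<le> \<tau> \<longrightarrow> L2c (wt \<alpha> (w \<tau>)) \<and> L2c (wt (s + \<alpha>) (w \<tau>))"
  using AE_dis_finite by eventually_elim (auto intro: L2c_wt_of_dis)

lemma n2_wt_measurable [measurable]: "(\<lambda>\<tau>. n2 (wt r (w \<tau>))) \<in> borel_measurable borel"
  by (rule jmeas_n2[OF jmeas_wt[OF jw]])

lemma energy_integrable:
  assumes t: "0 \<le> t"
  shows "set_integrable lborel {0..t} (\<lambda>\<tau>. (n2 (wt \<alpha> (w \<tau>)))\<^sup>2 + (n2 (wt (s + \<alpha>) (w \<tau>)))\<^sup>2)" (is ?I)
    and "(n2 (w t))\<^sup>2 + (n2 (wt s (w t)))\<^sup>2 + (LINT \<tau>:{0..t}|lborel. (n2 (wt \<alpha> (w \<tau>)))\<^sup>2 + (n2 (wt (s + \<alpha>) (w \<tau>)))\<^sup>2) \<le> K"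
proof -
  let ?d = "\<lambda>\<tau>. (n2 (wt \<alpha> (w \<tau>)))\<^sup>2 + (n2 (wt (s + \<alpha>) (w \<tau>)))\<^sup>2"
  have e: "(\<integral>\<^sup>+\<tau>. indicator {0..t} \<tau> * ennreal (?d \<tau>) \<partial>lborel) = (\<integral>\<^sup>+\<tau>. indicator {0..t} \<tau> * dis \<tau> \<partial>lborel)"
  proof (rule nn_integral_cong_AE)
    show "AE \<tau> in lborel. indicator {0..t} \<tau> * ennreal (?d \<tau>) = indicator {0..t} \<tau> * dis \<tau>"
      using AE_L2c
    proof eventually_elim
      case (elim \<tau>)
      show ?case
      proof (cases "\<tau> \<in> {0..t}")
        case True
        then have "L2c (wt \<alpha> (w \<tau>))" "L2c (wt (s + \<alpha>) (w \<tau>))" using elim by auto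
        from nn_integral_two_weights[OF this mw] show ?thesis unfolding dis_def by simp
      qed simp
    qed
  qed
  have le: "(\<integral>\<^sup>+\<tau>. indicator {0..t} \<tau> * dis \<tau> \<partial>lborel) \<le> ennreal K"
    by (rule order_trans[OF _ energy_split[OF t]]) simp
  show I: ?I unfolding set_integrable_def
  proof (rule integrableI_nonneg)
    have "(\<integral>\<^sup>+\<tau>. ennreal (indicator {0..t} \<tau> *\<^sub>R ?d \<tau>) \<partial>lborel) = (\<integral>\<^sup>+\<tau>. indicator {0..t} \<tau> * ennreal (?d \<tau>) \<partial>lborel)"
      by (rule nn_integral_cong) (auto simp: indicator_def)
    then show "(\<integral>\<^sup>+\<tau>. ennreal (indicator {0..t} \<tau> *\<^sub>R ?d \<tau>) \<partial>lborel) < \<infinity>"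
      unfolding e using le_less_trans[OF le, of \<infinity>] by simp
  qed auto
  have d0: "0 \<le> (LINT \<tau>:{0..t}|lborel. ?d \<tau>)" unfolding set_lebesgue_integral_def by (intro integral_nonneg_AE) auto
  have "ennreal ((n2 (w t))\<^sup>2 + (n2 (wt s (w t)))\<^sup>2) + ennreal (LINT \<tau>:{0..t}|lborel. ?d \<tau>) \<le> ennreal K"
    using energy_split[OF t] unfolding nn_integral_one_weight[OF Lw[OF t] Ls[OF t] mw] e[symmetric] nn_set_integral_eq[OF I add_nonneg_nonneg[OF zero_le_power2 zero_le_power2]] .
  then have "ennreal ((n2 (w t))\<^sup>2 + (n2 (wt s (w t)))\<^sup>2 + (LINT \<tau>:{0..t}|lborel. ?d \<tau>)) \<le> ennreal K"
    by (subst ennreal_plus) (use d0 in auto)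
  then show "(n2 (w t))\<^sup>2 + (n2 (wt s (w t)))\<^sup>2 + (LINT \<tau>:{0..t}|lborel. ?d \<tau>) \<le> K" using K by (simp only: ennreal_le_iff)
qed

lemma n2_le_sqrt_K: assumes t: "0 \<le> t" shows "n2 (w t) \<le> sqrt K" "n2 (wt s (w t)) \<le> sqrt K"
proof -
  have "0 \<le> (LINT \<tau>:{0..t}|lborel. (n2 (wt \<alpha> (w \<tau>)))\<^sup>2 + (n2 (wt (s + \<alpha>) (w \<tau>)))\<^sup>2)"
    unfolding set_lebesgue_integral_def by (intro integral_nonneg_AE) auto
  then have "(n2 (w t))\<^sup>2 + (n2 (wt s (w t)))\<^sup>2 \<le> K" using energy_integrable(2)[OF t] by linarith
  then have "(n2 (w t))\<^sup>2 \<le> K" "(n2 (wt s (w t)))\<^sup>2 \<le> K"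
    using zero_le_power2[of "n2 (w t)"] zero_le_power2[of "n2 (wt s (w t))"] by linarith+
  then show "n2 (w t) \<le> sqrt K" "n2 (wt s (w t)) \<le> sqrt K" by (auto intro: real_le_rsqrt)
qed

lemma dissipation_integrable:
  assumes t: "0 \<le> t" shows "set_integrable lborel {0..t} (\<lambda>\<tau>. (n2 (wt (s + \<alpha>) (w \<tau>)))\<^sup>2)"
  unfolding set_integrable_def
  by (rule Bochner_Integration.integrable_bound[OF energy_integrable(1)[OF t, unfolded set_integrable_def]]) (auto simp: indicator_def)

lemma wt_bound:
  assumes t: "0 \<le> t" and r: "0 \<le> r" "r \<le> s" shows "L2c (wt r (w t))" "n2 (wt r (w t)) \<le> 2 * sqrt K"
  using wt_interpolation[OF Lw[OF t] Ls[OF t] r] n2_le_sqrt_K[OF t] by auto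

text \<open>The weights \<alpha>, s, \<alpha> all lie below or at s, so the bound holds at every
  time and uniformly, whereas the commutator bound needs a time of finite dissipation.\<close>

lemma NL_pairing:
  "\<exists>B\<ge>0. \<forall>\<tau>\<ge>0. kap_form (w \<tau>) (w \<tau>) (w \<tau>) \<le> ennreal B"
proof -
  have "\<exists>C\<ge>0. \<forall>a b d. L2c (wt \<alpha> a) \<longrightarrow> L2c (wt (1 + (1 - 2 * \<alpha>)) b) \<longrightarrow> L2c (wt \<alpha> d) \<longrightarrow>
     kap_form a b d
       \<le> ennreal (C * n2 (wt \<alpha> a) * n2 (wt (1 + (1 - 2 * \<alpha>)) b) * n2 (wt \<alpha> d))"
    using al by (intro kap_trilinear) auto
  moreover have "1 + (1 - 2 * \<alpha>) = s" using s by simp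
  ultimately obtain C where C: "0 \<le> C" and T: "\<forall>a b d. L2c (wt \<alpha> a) \<longrightarrow> L2c (wt s b) \<longrightarrow> L2c (wt \<alpha> d) \<longrightarrow>
     kap_form a b d
       \<le> ennreal (C * n2 (wt \<alpha> a) * n2 (wt s b) * n2 (wt \<alpha> d))" by (simp only:) (elim exE conjE)
  have "kap_form (w \<tau>) (w \<tau>) (w \<tau>) \<le> ennreal (C * (2 * sqrt K) * (2 * sqrt K) * (2 * sqrt K))"
    if \<tau>: "0 \<le> \<tau>" for \<tau>
  proof (rule order_trans[OF T[rule_format, OF wt_bound(1)[OF \<tau>] Ls[OF \<tau>] wt_bound(1)[OF \<tau>]]])
    show "ennreal (C * n2 (wt \<alpha> (w \<tau>)) * n2 (wt s (w \<tau>)) * n2 (wt \<alpha> (w \<tau>))) \<le> ennreal (C * (2 * sqrt K) * (2 * sqrt K) * (2 * sqrt K))"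
      using C K al s1 by (intro ennreal_leI mult_mono wt_bound \<tau>) auto
  qed (use al s1 in auto)
  then show ?thesis using C K by (intro exI[of _ "C * (2 * sqrt K) * (2 * sqrt K) * (2 * sqrt K)"] conjI allI impI) auto
qed

lemma ode: "0 \<le> t \<Longrightarrow> ((\<lambda>t. w t \<xi>) has_vector_derivative (- complex_of_real (lamb \<alpha> \<xi>) * w t \<xi> - NL (w t) (w t) \<xi>)) (at t within {0..})"
proof -
  assume t: "0 \<le> t"
  have "((\<lambda>t. duh (lamb \<alpha>) w0 (\<lambda>\<tau>. NL (w \<tau>) (w \<tau>)) t \<xi>) has_vector_derivative (- complex_of_real (lamb \<alpha> \<xi>) * w t \<xi> - NL (w t) (w t) \<xi>)) (at t within {0..})"
    using duh_deriv[where f="\<lambda>\<tau>. NL (w \<tau>) (w \<tau>)" and l="lamb \<alpha>" and ?w0.0=w0 and \<xi>=\<xi>, OF NL_continuous[OF cw] t] unfolding ew[OF t, symmetric] .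
  then show ?thesis by (rule has_vector_derivative_transform[rotated 2]) (use t ew in auto)
qed

lemma w_continuous: "continuous_on {0..} (\<lambda>t. w t \<xi>)"
  by (rule continuous_on_vector_derivative) (rule ode, simp)

lemma NL_jmeas: "jmeas (\<lambda>t. NL (w t) (w t))" by (rule NL_measurable[OF jw])

lemma truncated_integrable1:
  assumes R: "0 < R" and rt: "0 \<le> r" "r \<le> t"
  shows "integrable lborel2 (\<lambda>(\<tau>, \<xi>). indicator {r..t} \<tau> * (mR s R \<xi> * lamb \<alpha> \<xi> * (cmod (w \<tau> \<xi>))\<^sup>2))"
proof (rule integrableI_bounded)
  note [measurable (raw)] = measurable_pair_apply[OF jw]
  show "(\<lambda>(\<tau>, \<xi>). indicator {r..t} \<tau> * (mR s R \<xi> * lamb \<alpha> \<xi> * (cmod (w \<tau> \<xi>))\<^sup>2)) \<in> borel_measurable lborel2"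
    by measurable
  have pw: "norm (indicator {r..t} \<tau> * (mR s R \<xi> * lamb \<alpha> \<xi> * (cmod (w \<tau> \<xi>))\<^sup>2)) \<le> indicator {0..t} \<tau> * ((norm \<xi> powr (2 * \<alpha>) + norm \<xi> powr (2 * (s + \<alpha>))) * (cmod (w \<tau> \<xi>))\<^sup>2)" for \<tau> \<xi>
  proof -
    have "mR s R \<xi> * lamb \<alpha> \<xi> \<le> norm \<xi> powr (2 * s) * norm \<xi> powr (2 * \<alpha>)"
      unfolding lamb_def using mR_le[of s R \<xi>] s1 R by (intro mult_right_mono) auto
    also have "\<dots> \<le> norm \<xi> powr (2 * \<alpha>) + norm \<xi> powr (2 * (s + \<alpha>))" unfolding powr_add[symmetric] by (simp add: distrib_left)
    finally have "mR s R \<xi> * lamb \<alpha> \<xi> * (cmod (w \<tau> \<xi>))\<^sup>2 \<le> (norm \<xi> powr (2 * \<alpha>) + norm \<xi> powr (2 * (s + \<alpha>))) * (cmod (w \<tau> \<xi>))\<^sup>2" by (rule mult_right_mono) simp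
    moreover have "0 \<le> mR s R \<xi> * lamb \<alpha> \<xi> * (cmod (w \<tau> \<xi>))\<^sup>2" by (intro mult_nonneg_nonneg lamb_nonneg) auto
    ultimately have "norm (mR s R \<xi> * lamb \<alpha> \<xi> * (cmod (w \<tau> \<xi>))\<^sup>2) \<le> (norm \<xi> powr (2 * \<alpha>) + norm \<xi> powr (2 * (s + \<alpha>))) * (cmod (w \<tau> \<xi>))\<^sup>2" by simp
    then show ?thesis unfolding norm_mult[of "indicator {r..t} \<tau> :: real"] using rt by (intro mult_mono) (auto simp: indicator_def)
  qed
  have "(\<integral>\<^sup>+p. ennreal (norm (case p of (\<tau>, \<xi>) \<Rightarrow> indicator {r..t} \<tau> * (mR s R \<xi> * lamb \<alpha> \<xi> * (cmod (w \<tau> \<xi>))\<^sup>2))) \<partial>lborel2)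
     \<le> (\<integral>\<^sup>+p. enfun s \<alpha> w t p \<partial>lborel2)"
  proof (intro nn_integral_mono, clarify)
    fix \<tau> :: real and \<xi> :: pt
    have "ennreal (norm (indicator {r..t} \<tau> * (mR s R \<xi> * lamb \<alpha> \<xi> * (cmod (w \<tau> \<xi>))\<^sup>2)))
       \<le> indicator {0..t} \<tau> * ennreal ((norm \<xi> powr (2 * \<alpha>) + norm \<xi> powr (2 * (s + \<alpha>))) * (cmod (w \<tau> \<xi>))\<^sup>2)"
      by (rule order_trans[OF ennreal_leI[OF pw]]) (auto simp: indicator_def)
    also have "\<dots> \<le> enfun s \<alpha> w t (\<tau>, \<xi>)" unfolding enfun_def fst_conv snd_conv by (rule add_increasing) simp_all
    finally show "ennreal (norm (indicator {r..t} \<tau> * (mR s R \<xi> * lamb \<alpha> \<xi> * (cmod (w \<tau> \<xi>))\<^sup>2))) \<le> enfun s \<alpha> w t (\<tau>, \<xi>)" .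
  qed
  also have "\<dots> \<le> ennreal K" by (rule EN) (use rt in simp)
  also have "\<dots> < \<infinity>" by simp
  finally show "(\<integral>\<^sup>+p. ennreal (norm (case p of (\<tau>, \<xi>) \<Rightarrow> indicator {r..t} \<tau> * (mR s R \<xi> * lamb \<alpha> \<xi> * (cmod (w \<tau> \<xi>))\<^sup>2))) \<partial>lborel2) < \<infinity>" .
qed

text \<open>The majorant grows like R^(2 s); it serves only to justify the exchange of integrals for
  fixed R.\<close>

lemma truncated_integrable2:
  assumes R: "0 < R" and rt: "0 \<le> r" "r \<le> t"
  shows "integrable lborel2 (\<lambda>(\<tau>, \<xi>). indicator {r..t} \<tau> * (mR s R \<xi> * Re (NL (w \<tau>) (w \<tau>) \<xi> * cnj (w \<tau> \<xi>))))"
proof (rule integrableI_bounded)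
  note [measurable (raw)] = measurable_pair_apply[OF jw] measurable_pair_apply[OF NL_jmeas]
  show "(\<lambda>(\<tau>, \<xi>). indicator {r..t} \<tau> * (mR s R \<xi> * Re (NL (w \<tau>) (w \<tau>) \<xi> * cnj (w \<tau> \<xi>)))) \<in> borel_measurable lborel2"
    by measurable
  obtain B where B: "0 \<le> B" and BB: "\<And>\<tau>. 0 \<le> \<tau> \<Longrightarrow> kap_form (w \<tau>) (w \<tau>) (w \<tau>) \<le> ennreal B"
    using NL_pairing by blast
  have sl: "(\<integral>\<^sup>+\<xi>. ennreal (cmod (NL (w \<tau>) (w \<tau>) \<xi>) * cmod (w \<tau> \<xi>)) \<partial>lborel) \<le> ennreal B" if \<tau>: "0 \<le> \<tau>" for \<tau>
    using NL_pair_bound[OF mw mw mw BB[OF \<tau>] B] by (subst nn_integral_eq_integral) (auto intro: ennreal_leI)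
  have pw: "ennreal (norm (indicator {r..t} \<tau> * (mR s R \<xi> * Re (NL (w \<tau>) (w \<tau>) \<xi> * cnj (w \<tau> \<xi>)))))
       \<le> (indicator {r..t} \<tau> * ennreal (R powr (2 * s))) * ennreal (cmod (NL (w \<tau>) (w \<tau>) \<xi>) * cmod (w \<tau> \<xi>))" for \<tau> \<xi>
  proof -
    have "\<bar>mR s R \<xi> * Re (NL (w \<tau>) (w \<tau>) \<xi> * cnj (w \<tau> \<xi>))\<bar> \<le> R powr (2 * s) * cmod (NL (w \<tau>) (w \<tau>) \<xi> * cnj (w \<tau> \<xi>))"
      unfolding abs_mult using mR_le_R[of s R \<xi>] s1 R by (intro mult_mono abs_Re_le_cmod) auto
    then have "ennreal \<bar>mR s R \<xi> * Re (NL (w \<tau>) (w \<tau>) \<xi> * cnj (w \<tau> \<xi>))\<bar> \<le> ennreal (R powr (2 * s)) * ennreal (cmod (NL (w \<tau>) (w \<tau>) \<xi>) * cmod (w \<tau> \<xi>))"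
      unfolding norm_mult complex_mod_cnj by (subst ennreal_mult[symmetric]) (auto intro: ennreal_leI)
    then show ?thesis by (cases "\<tau> \<in> {r..t}") (simp_all del: times_complex.sel)
  qed
  have "(\<integral>\<^sup>+p. ennreal (norm (case p of (\<tau>, \<xi>) \<Rightarrow> indicator {r..t} \<tau> * (mR s R \<xi> * Re (NL (w \<tau>) (w \<tau>) \<xi> * cnj (w \<tau> \<xi>))))) \<partial>lborel2)
     \<le> (\<integral>\<^sup>+(\<tau>, \<xi>). (indicator {r..t} \<tau> * ennreal (R powr (2 * s))) * ennreal (cmod (NL (w \<tau>) (w \<tau>) \<xi>) * cmod (w \<tau> \<xi>)) \<partial>lborel2)"
    by (intro nn_integral_mono, clarify) (rule pw)
  also have "\<dots> = (\<integral>\<^sup>+\<tau>. \<integral>\<^sup>+\<xi>. (indicator {r..t} \<tau> * ennreal (R powr (2 * s))) * ennreal (cmod (NL (w \<tau>) (w \<tau>) \<xi>) * cmod (w \<tau> \<xi>)) \<partial>lborel \<partial>lborel)"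
    by (subst lborel.nn_integral_fst[symmetric]) auto
  also have "\<dots> \<le> (\<integral>\<^sup>+\<tau>. indicator {r..t} \<tau> * (ennreal (R powr (2 * s)) * ennreal B) \<partial>lborel)"
  proof (rule nn_integral_mono)
    fix \<tau> :: real
    note [measurable] = jmeas_slice[OF jw] jmeas_slice[OF NL_jmeas]
    show "(\<integral>\<^sup>+\<xi>. (indicator {r..t} \<tau> * ennreal (R powr (2 * s))) * ennreal (cmod (NL (w \<tau>) (w \<tau>) \<xi>) * cmod (w \<tau> \<xi>)) \<partial>lborel) \<le> indicator {r..t} \<tau> * (ennreal (R powr (2 * s)) * ennreal B)"
    proof (cases "\<tau> \<in> {r..t}")
      case True
      then show ?thesis using sl[of \<tau>] rt by (subst nn_integral_cmult) (auto intro: mult_left_mono)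
    qed simp
  qed
  also have "\<dots> < \<infinity>" by (subst nn_integral_multc) (use rt in \<open>auto simp: ennreal_mult_less_top\<close>)
  finally show "(\<integral>\<^sup>+p. ennreal (norm (case p of (\<tau>, \<xi>) \<Rightarrow> indicator {r..t} \<tau> * (mR s R \<xi> * Re (NL (w \<tau>) (w \<tau>) \<xi> * cnj (w \<tau> \<xi>))))) \<partial>lborel2) < \<infinity>" .
qed

lemma truncated_norm_increment:
  assumes C0: "0 \<le> C" and C: "\<And>R w. 0 < R \<Longrightarrow> L2c (wt s w) \<Longrightarrow> L2c (wt (s + \<alpha>) w) \<Longrightarrow>
     commutator_form s R w
       \<le> ennreal (C * n2 (wt s w) * (n2 (wt (s + \<alpha>) w))\<^sup>2)"
    and R: "0 < R" and rt: "0 \<le> r" "r \<le> t"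
  shows "\<bar>(LINT \<xi>|lborel. mR s R \<xi> * (cmod (w t \<xi>))\<^sup>2) - (LINT \<xi>|lborel. mR s R \<xi> * (cmod (w r \<xi>))\<^sup>2)\<bar>
    \<le> (2 + C * sqrt K) * (LINT \<tau>:{r..t}|lborel. (n2 (wt (s + \<alpha>) (w \<tau>)))\<^sup>2)"
proof -
  define D where "D \<tau> = (n2 (wt (s + \<alpha>) (w \<tau>)))\<^sup>2" for \<tau>
  define E where "E \<tau> = (LINT \<xi>|lborel. mR s R \<xi> * lamb \<alpha> \<xi> * (cmod (w \<tau> \<xi>))\<^sup>2)" for \<tau>
  define G where "G \<tau> = (LINT \<xi>|lborel. mR s R \<xi> * Re (NL (w \<tau>) (w \<tau>) \<xi> * cnj (w \<tau> \<xi>)))" for \<tau>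
  note [measurable] = jmeas_slice[OF jw]
  have mI: "integrable lborel (\<lambda>\<xi>. mR s R \<xi> * (cmod (w \<tau> \<xi>))\<^sup>2)" if \<tau>: "0 \<le> \<tau>" for \<tau>
    by (rule Bochner_Integration.integrable_bound[OF L2c_integrable[OF Ls[OF \<tau>]]])
       (use mR_le[of s R] s1 R in \<open>auto simp: cmod_wt_square abs_mult intro!: mult_right_mono\<close>)
  note E = energy_identity[OF jw NL_jmeas lamb_measurable mR_measurable ode NL_continuous[OF cw] rt mI[OF rt(1)] mI[OF order_trans[OF rt]] truncated_integrable1[OF R rt] truncated_integrable2[OF R rt], folded E_def G_def]
  obtain B where "\<And>\<tau>. 0 \<le> \<tau> \<Longrightarrow> kap_form (w \<tau>) (w \<tau>) (w \<tau>) \<le> ennreal B"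
    using NL_pairing by blast
  then have fin: "(kap_form (w \<tau>) (w \<tau>) (w \<tau>)) < \<infinity>" if "0 \<le> \<tau>" for \<tau>
    by (rule le_less_trans) (use that in auto)
  have Eb: "0 \<le> E \<tau>" "E \<tau> \<le> D \<tau>" if L: "L2c (wt (s + \<alpha>) (w \<tau>))" for \<tau>
  proof -
    show "0 \<le> E \<tau>" unfolding E_def by (intro integral_nonneg_AE AE_I2 mult_nonneg_nonneg lamb_nonneg) auto
    have pw: "mR s R \<xi> * lamb \<alpha> \<xi> * (cmod (w \<tau> \<xi>))\<^sup>2 \<le> norm \<xi> powr (2 * (s + \<alpha>)) * (cmod (w \<tau> \<xi>))\<^sup>2" for \<xi>
    proof (rule mult_right_mono)
      have "mR s R \<xi> * lamb \<alpha> \<xi> \<le> norm \<xi> powr (2 * s) * norm \<xi> powr (2 * \<alpha>)"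
        unfolding lamb_def using mR_le[of s R \<xi>] s1 R by (intro mult_right_mono) auto
      then show "mR s R \<xi> * lamb \<alpha> \<xi> \<le> norm \<xi> powr (2 * (s + \<alpha>))" unfolding powr_add[symmetric] distrib_left .
    qed simp
    have i: "integrable lborel (\<lambda>\<xi>. norm \<xi> powr (2 * (s + \<alpha>)) * (cmod (w \<tau> \<xi>))\<^sup>2)" using L2c_integrable[OF L] unfolding cmod_wt_square .
    show "E \<tau> \<le> D \<tau>" unfolding E_def D_def n2_wt_square
    proof (rule integral_mono[OF _ i pw])
      show "integrable lborel (\<lambda>\<xi>. mR s R \<xi> * lamb \<alpha> \<xi> * (cmod (w \<tau> \<xi>))\<^sup>2)"
      proof (rule Bochner_Integration.integrable_bound[OF i])
        show "AE \<xi> in lborel. norm (mR s R \<xi> * lamb \<alpha> \<xi> * (cmod (w \<tau> \<xi>))\<^sup>2) \<le> norm (norm \<xi> powr (2 * (s + \<alpha>)) * (cmod (w \<tau> \<xi>))\<^sup>2)"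
        proof (rule AE_I2)
          fix \<xi>
          have "0 \<le> mR s R \<xi> * lamb \<alpha> \<xi> * (cmod (w \<tau> \<xi>))\<^sup>2" by (intro mult_nonneg_nonneg lamb_nonneg) auto
          then show "norm (mR s R \<xi> * lamb \<alpha> \<xi> * (cmod (w \<tau> \<xi>))\<^sup>2) \<le> norm (norm \<xi> powr (2 * (s + \<alpha>)) * (cmod (w \<tau> \<xi>))\<^sup>2)" using pw[of \<xi>] by simp
        qed
      qed simp
    qed
  qed
  have Gb: "\<bar>2 * G \<tau>\<bar> \<le> C * sqrt K * D \<tau>" if \<tau>: "0 \<le> \<tau>" and L: "L2c (wt (s + \<alpha>) (w \<tau>))" for \<tau>
  proof -
    have "\<bar>2 * G \<tau>\<bar> \<le> C * n2 (wt s (w \<tau>)) * D \<tau>" unfolding G_def D_def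
      by (rule commutator_pairing[OF C C0 mw hw[OF \<tau>] Ls[OF \<tau>] L fin[OF \<tau>] R]) (use s1 in auto)
    also have "\<dots> \<le> C * sqrt K * D \<tau>" by (intro mult_right_mono mult_left_mono n2_le_sqrt_K \<tau> C0) (simp add: D_def)
    finally show ?thesis .
  qed
  have iD: "set_integrable lborel {r..t} D"
    by (rule set_integrable_subset[OF dissipation_integrable[of t, folded D_def]]) (use rt in auto)
  have sI: "set_integrable lborel {r..t} (\<lambda>\<tau>. 2 * E \<tau> + 2 * G \<tau>)"
    by (intro set_integral_add set_integrable_mult_right E)
  have "(LINT \<xi>|lborel. mR s R \<xi> * (cmod (w t \<xi>))\<^sup>2) - (LINT \<xi>|lborel. mR s R \<xi> * (cmod (w r \<xi>))\<^sup>2) = - (LINT \<tau>:{r..t}|lborel. 2 * E \<tau> + 2 * G \<tau>)"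
  proof -
    have "(LINT \<tau>:{r..t}|lborel. 2 * E \<tau> + 2 * G \<tau>) = 2 * (LINT \<tau>:{r..t}|lborel. E \<tau>) + 2 * (LINT \<tau>:{r..t}|lborel. G \<tau>)"
      by (subst set_integral_add(2)) (auto intro!: set_integrable_mult_right E)
    then show ?thesis using E(3) by linarith
  qed
  also have "\<bar>- (LINT \<tau>:{r..t}|lborel. 2 * E \<tau> + 2 * G \<tau>)\<bar> \<le> (LINT \<tau>:{r..t}|lborel. (2 + C * sqrt K) * D \<tau>)"
    unfolding abs_minus_cancel unfolding set_lebesgue_integral_def real_norm_def[symmetric]
  proof (rule order_trans[OF integral_norm_bound], rule integral_mono_AE)
    show "integrable lborel (\<lambda>\<tau>. norm (indicator {r..t} \<tau> *\<^sub>R (2 * E \<tau> + 2 * G \<tau>)))" using sI unfolding set_integrable_def by (rule integrable_norm)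
    show "integrable lborel (\<lambda>\<tau>. indicator {r..t} \<tau> *\<^sub>R ((2 + C * sqrt K) * D \<tau>))" using set_integrable_mult_right[OF iD] unfolding set_integrable_def by simp
    show "AE \<tau> in lborel. norm (indicator {r..t} \<tau> *\<^sub>R (2 * E \<tau> + 2 * G \<tau>)) \<le> indicator {r..t} \<tau> *\<^sub>R ((2 + C * sqrt K) * D \<tau>)"
      using AE_L2c
    proof eventually_elim
      case (elim \<tau>)
      show ?case
      proof (cases "\<tau> \<in> {r..t}")
        case True
        then have \<tau>: "0 \<le> \<tau>" and L: "L2c (wt (s + \<alpha>) (w \<tau>))" using rt elim by auto
        have "\<bar>2 * E \<tau> + 2 * G \<tau>\<bar> \<le> 2 * D \<tau> + C * sqrt K * D \<tau>" using Eb[OF L] Gb[OF \<tau> L] by linarith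
        then show ?thesis using True by (simp add: distrib_right)
      qed simp
    qed
  qed
  also have "\<dots> = (2 + C * sqrt K) * (LINT \<tau>:{r..t}|lborel. D \<tau>)" by (rule set_integral_mult_right)
  finally show ?thesis unfolding D_def .
qed

text \<open>R tends to infinity in \<open>truncated_norm_increment\<close>; at each single time the
  full weight is an integrable majorant, because the solution is in H^s at every time.\<close>

lemma norm_increment:
  "\<exists>M\<ge>0. \<forall>r t. 0 \<le> r \<longrightarrow> r \<le> t \<longrightarrow> \<bar>(n2 (wt s (w t)))\<^sup>2 - (n2 (wt s (w r)))\<^sup>2\<bar> \<le> M * (LINT \<tau>:{r..t}|lborel. (n2 (wt (s + \<alpha>) (w \<tau>)))\<^sup>2)"
proof -
  obtain C where C0: "0 \<le> C" and C: "\<And>R w. 0 < R \<Longrightarrow> L2c (wt s w) \<Longrightarrow> L2c (wt (s + \<alpha>) w) \<Longrightarrow>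
     commutator_form s R w
       \<le> ennreal (C * n2 (wt s w) * (n2 (wt (s + \<alpha>) w))\<^sup>2)"
    using kap_commutator[OF s al] by blast
  note [measurable] = jmeas_slice[OF jw]
  have lim: "(\<lambda>k. LINT \<xi>|lborel. mR s (real (Suc k)) \<xi> * (cmod (w t \<xi>))\<^sup>2) \<longlonglongrightarrow> (n2 (wt s (w t)))\<^sup>2" if t: "0 \<le> t" for t
    unfolding n2_wt_square
  proof (rule integral_dominated_convergence)
    show "integrable lborel (\<lambda>\<xi>. norm \<xi> powr (2 * s) * (cmod (w t \<xi>))\<^sup>2)" using L2c_integrable[OF Ls[OF t]] unfolding cmod_wt_square .
    show "AE \<xi> in lborel. norm (mR s (real (Suc k)) \<xi> * (cmod (w t \<xi>))\<^sup>2) \<le> norm \<xi> powr (2 * s) * (cmod (w t \<xi>))\<^sup>2" for k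
      by (rule AE_I2) (use mR_le[of s "real (Suc k)"] s1 in \<open>auto simp: abs_mult intro!: mult_right_mono\<close>)
    show "AE \<xi> in lborel. (\<lambda>k. mR s (real (Suc k)) \<xi> * (cmod (w t \<xi>))\<^sup>2) \<longlonglongrightarrow> norm \<xi> powr (2 * s) * (cmod (w t \<xi>))\<^sup>2"
    proof (rule AE_I2)
      fix \<xi> :: pt
      obtain m :: nat where m: "norm \<xi> \<le> real m" using real_arch_simple by blast
      have "\<forall>\<^sub>F k in sequentially. mR s (real (Suc k)) \<xi> * (cmod (w t \<xi>))\<^sup>2 = norm \<xi> powr (2 * s) * (cmod (w t \<xi>))\<^sup>2"
        unfolding eventually_sequentially by (intro exI[of _ m] allI impI) (use m in \<open>simp add: mR_eq\<close>)
      then show "(\<lambda>k. mR s (real (Suc k)) \<xi> * (cmod (w t \<xi>))\<^sup>2) \<longlonglongrightarrow> norm \<xi> powr (2 * s) * (cmod (w t \<xi>))\<^sup>2" by (rule tendsto_eventually)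
    qed
  qed auto
  have "\<bar>(n2 (wt s (w t)))\<^sup>2 - (n2 (wt s (w r)))\<^sup>2\<bar> \<le> (2 + C * sqrt K) * (LINT \<tau>:{r..t}|lborel. (n2 (wt (s + \<alpha>) (w \<tau>)))\<^sup>2)" if rt: "0 \<le> r" "r \<le> t" for r t
  proof (rule LIMSEQ_le_const2[OF tendsto_rabs[OF tendsto_diff[OF lim[OF order_trans[OF rt]] lim[OF rt(1)]]]])
    show "\<exists>N. \<forall>n\<ge>N. \<bar>(LINT \<xi>|lborel. mR s (real (Suc n)) \<xi> * (cmod (w t \<xi>))\<^sup>2) - (LINT \<xi>|lborel. mR s (real (Suc n)) \<xi> * (cmod (w r \<xi>))\<^sup>2)\<bar> \<le> (2 + C * sqrt K) * (LINT \<tau>:{r..t}|lborel. (n2 (wt (s + \<alpha>) (w \<tau>)))\<^sup>2)"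
      by (intro exI[of _ 0] allI impI truncated_norm_increment[OF C0 C _ rt]) auto
  qed
  moreover have "0 \<le> 2 + C * sqrt K" using C0 K by simp
  ultimately show ?thesis by blast
qed

text \<open>The increment of the squared H^s norm is controlled by that of the primitive of the
  dissipation, a continuous function of time. Hence the norms converge along every sequence of
  times, the solution converges at each frequency, and \<open>L2_strong_limit\<close> combines the
  two.\<close>

lemma Hs_continuous:
  assumes t: "0 \<le> t"
  shows "((\<lambda>\<tau>. n2 (\<lambda>\<xi>. wt s (w \<tau>) \<xi> - wt s (w t) \<xi>)) \<longlongrightarrow> 0) (at t within {0..})"
  unfolding tendsto_at_iff_sequentially comp_def
proof (intro allI impI)
  fix X :: "nat \<Rightarrow> real" assume X: "\<forall>i. X i \<in> {0..} - {t}" and Xt: "X \<longlonglongrightarrow> t"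
  have X0: "0 \<le> X i" for i using X by auto
  obtain T where T: "\<And>i. X i \<le> T"
    using Bseq_bdd_above[OF convergent_imp_Bseq[OF convergentI[OF Xt]]] by (auto simp: bdd_above_def)
  have tT: "t \<le> T" by (rule LIMSEQ_le_const2[OF Xt]) (use T in auto)
  define D where "D \<tau> = (n2 (wt (s + \<alpha>) (w \<tau>)))\<^sup>2" for \<tau>
  \<comment> \<open>A primitive, so that times approaching t from the left and from the right are
    treated alike.\<close>
  define P where "P x = integral {0..x} D" for x
  have iD: "set_integrable lborel {a..b} D" if "0 \<le> a" "a \<le> b" for a b
    by (rule set_integrable_subset[OF dissipation_integrable[of b, folded D_def]]) (use that in auto)
  have PD: "(LINT \<tau>:{a..b}|lborel. D \<tau>) = P b - P a" if "0 \<le> a" "a \<le> b" for a b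
  proof -
    have "integral {0..a} D + integral {a..b} D = integral {0..b} D"
      by (rule Henstock_Kurzweil_Integration.integral_combine) (use that set_borel_integral_eq_integral(1)[OF iD[of 0 b]] in auto)
    then show ?thesis using set_borel_integral_eq_integral(2)[OF iD[OF that]] unfolding P_def by simp
  qed
  have cP: "continuous_on {0..T} P" unfolding P_def
    by (rule indefinite_integral_continuous_1) (use set_borel_integral_eq_integral(1)[OF iD[of 0 T]] t tT in auto)
  have lP: "(\<lambda>i. P (X i)) \<longlonglongrightarrow> P t"
    by (rule continuous_on_tendsto_compose[OF cP Xt]) (use t tT T X0 in auto)
  obtain M where M: "0 \<le> M" "\<And>r t. 0 \<le> r \<Longrightarrow> r \<le> t \<Longrightarrow> \<bar>(n2 (wt s (w t)))\<^sup>2 - (n2 (wt s (w r)))\<^sup>2\<bar> \<le> M * (LINT \<tau>:{r..t}|lborel. D \<tau>)"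
    using norm_increment unfolding D_def by blast
  have le: "\<bar>(n2 (wt s (w (X i))))\<^sup>2 - (n2 (wt s (w t)))\<^sup>2\<bar> \<le> M * \<bar>P (X i) - P t\<bar>" for i
  proof (cases "X i \<le> t")
    case True
    have "M * (P t - P (X i)) \<le> M * \<bar>P (X i) - P t\<bar>" using M(1) by (intro mult_left_mono) auto
    then show ?thesis using M(2)[OF X0 True] unfolding PD[OF X0 True] by linarith
  next
    case False
    then have f: "t \<le> X i" by simp
    have "M * (P (X i) - P t) \<le> M * \<bar>P (X i) - P t\<bar>" using M(1) by (intro mult_left_mono) auto
    then show ?thesis using M(2)[OF t f] unfolding PD[OF t f] by linarith
  qed
  have z: "(\<lambda>i. M * \<bar>P (X i) - P t\<bar>) \<longlonglongrightarrow> 0"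
    using tendsto_mult[OF tendsto_const[of M] tendsto_rabs[OF LIM_zero[OF lP]]] by simp
  have nl: "(\<lambda>i. (n2 (wt s (w (X i))))\<^sup>2) \<longlonglongrightarrow> (n2 (wt s (w t)))\<^sup>2"
    by (rule LIM_zero_cancel, rule Lim_null_comparison[OF _ z]) (use le in \<open>auto intro!: always_eventually\<close>)
  show "(\<lambda>i. n2 (\<lambda>\<xi>. wt s (w (X i)) \<xi> - wt s (w t) \<xi>)) \<longlonglongrightarrow> 0"
  proof (rule L2_strong_limit[OF Ls[OF X0] Ls[OF t] _ nl])
    fix \<xi> :: pt
    have "(\<lambda>i. w (X i) \<xi>) \<longlonglongrightarrow> w t \<xi>" by (rule continuous_on_tendsto_compose[OF w_continuous Xt]) (use t X0 in auto)
    then show "(\<lambda>i. wt s (w (X i)) \<xi>) \<longlonglongrightarrow> wt s (w t) \<xi>" unfolding wt_def by (intro tendsto_intros)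
  qed
qed

text \<open>The bound K on [0, k] does not depend on k, so it passes to the half-line by Fatou's
  lemma.\<close>

lemma dissipation_integrable_at_top: "set_integrable lborel {0..} (\<lambda>\<tau>. (n2 (wt (s + \<alpha>) (w \<tau>)))\<^sup>2)"
  unfolding set_integrable_def
proof (rule integrableI_nonneg)
  let ?D = "\<lambda>\<tau>. (n2 (wt (s + \<alpha>) (w \<tau>)))\<^sup>2"
  have lim: "(\<lambda>k. ennreal (indicator {0..real k} \<tau> *\<^sub>R ?D \<tau>)) \<longlonglongrightarrow> ennreal (indicator {0..} \<tau> *\<^sub>R ?D \<tau>)" for \<tau>
  proof (rule tendsto_eventually)
    obtain m :: nat where m: "\<tau> \<le> real m" using real_arch_simple by blast
    show "\<forall>\<^sub>F k in sequentially. ennreal (indicator {0..real k} \<tau> *\<^sub>R ?D \<tau>) = ennreal (indicator {0..} \<tau> *\<^sub>R ?D \<tau>)"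
      unfolding eventually_sequentially by (intro exI[of _ m] allI impI) (use m in \<open>auto simp: indicator_def\<close>)
  qed
  have le: "(\<integral>\<^sup>+\<tau>. ennreal (indicator {0..real k} \<tau> *\<^sub>R ?D \<tau>) \<partial>lborel) \<le> ennreal K" for k
  proof -
    have "(\<integral>\<^sup>+\<tau>. ennreal (indicator {0..real k} \<tau> *\<^sub>R ?D \<tau>) \<partial>lborel) = ennreal (LINT \<tau>:{0..real k}|lborel. ?D \<tau>)"
      unfolding set_lebesgue_integral_def using dissipation_integrable[of "real k"] by (intro nn_integral_eq_integral) (auto simp: set_integrable_def)
    also have "(LINT \<tau>:{0..real k}|lborel. ?D \<tau>) \<le> (LINT \<tau>:{0..real k}|lborel. (n2 (wt \<alpha> (w \<tau>)))\<^sup>2 + ?D \<tau>)"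
      by (intro set_integral_mono dissipation_integrable energy_integrable(1)) auto
    also have "\<dots> \<le> K" using energy_integrable(2)[of "real k"] zero_le_power2[of "n2 (w (real k))"] zero_le_power2[of "n2 (wt s (w (real k)))"] by linarith
    finally show ?thesis by (simp add: ennreal_leI)
  qed
  have "(\<integral>\<^sup>+\<tau>. ennreal (indicator {0..} \<tau> *\<^sub>R ?D \<tau>) \<partial>lborel) = (\<integral>\<^sup>+\<tau>. liminf (\<lambda>k. ennreal (indicator {0..real k} \<tau> *\<^sub>R ?D \<tau>)) \<partial>lborel)"
    by (rule nn_integral_cong) (rule lim_imp_Liminf[OF sequentially_bot lim, symmetric])
  also have "\<dots> \<le> liminf (\<lambda>k. \<integral>\<^sup>+\<tau>. ennreal (indicator {0..real k} \<tau> *\<^sub>R ?D \<tau>) \<partial>lborel)"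
    by (rule nn_integral_liminf) simp
  also have "\<dots> \<le> liminf (\<lambda>k::nat. ennreal K)" by (intro Liminf_mono always_eventually allI le)
  also have "\<dots> = ennreal K" by (rule Liminf_const[OF sequentially_bot])
  also have "\<dots> < \<infinity>" by simp
  finally show "(\<integral>\<^sup>+\<tau>. ennreal (indicator {0..} \<tau> *\<^sub>R ?D \<tau>) \<partial>lborel) < \<infinity>" .
qed auto

end

section \<open>Back to physical space\<close>

lemma FTL2_wt_AE:
  assumes "is_FT f g" shows "AE \<xi> in lborel. p \<xi> * (cmod (FTL2 f \<xi>))\<^sup>2 = p \<xi> * (cmod (g \<xi>))\<^sup>2"
  using is_FT_FTL2[OF assms] by eventually_elim simp

lemma FTL2_measurable: "L2c f \<Longrightarrow> FTL2 f \<in> borel_measurable borel"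
  using L2c_measurable[OF is_FT_L2c(2)[OF FTL2_is_FT]] by simp

lemma hdot_norm_sq_FT:
  assumes f: "is_FT f g" shows "hdot_norm_sq r f = (1 / (2*pi)\<^sup>2) * (n2 (wt r g))\<^sup>2"
proof -
  note [measurable] = FTL2_measurable[OF is_FT_L2c(1)[OF f]]
  have [measurable]: "g \<in> borel_measurable borel" using L2c_measurable[OF is_FT_L2c(2)[OF f]] by simp
  have "(LINT \<xi>|lborel. norm \<xi> powr (2 * r) * (cmod (FTL2 f \<xi>))\<^sup>2) = (LINT \<xi>|lborel. norm \<xi> powr (2 * r) * (cmod (g \<xi>))\<^sup>2)"
    by (rule integral_cong_AE[OF _ _ FTL2_wt_AE[OF f]]) auto
  then show ?thesis unfolding hdot_norm_sq_def n2_wt_square by simp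
qed

lemma sob_norm_sq_FT:
  assumes f: "is_FT f g" shows "sob_norm_sq r f = (1 / (2*pi)\<^sup>2) * ((n2 g)\<^sup>2 + (n2 (wt r g))\<^sup>2)"
  unfolding sob_norm_sq_def hdot_norm_sq_FT[OF f] is_FT_n2[OF f] n2_squared[of f, symmetric]
  by (simp add: power_mult_distrib distrib_left)

lemma power2_powr: "0 \<le> (x::real) \<Longrightarrow> (x\<^sup>2) powr r = x powr (2 * r)"
  by (cases "x = 0") (auto simp: powr_powr[symmetric] powr_numeral)

lemma in_Hdot_FT:
  assumes f: "is_FT f g" and g: "L2c (wt r g)" shows "in_Hdot r f"
proof -
  note [measurable] = FTL2_measurable[OF is_FT_L2c(1)[OF f]]
  have [measurable]: "g \<in> borel_measurable borel" using L2c_measurable[OF is_FT_L2c(2)[OF f]] by simp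
  have "integrable lborel (\<lambda>\<xi>. norm \<xi> powr (2 * r) * (cmod (FTL2 f \<xi>))\<^sup>2) \<longleftrightarrow> integrable lborel (\<lambda>\<xi>. norm \<xi> powr (2 * r) * (cmod (g \<xi>))\<^sup>2)"
    by (rule integrable_cong_AE[OF _ _ FTL2_wt_AE[OF f]]) auto
  then show ?thesis unfolding in_Hdot_def using f L2c_integrable[OF g] unfolding cmod_wt_square by auto
qed

text \<open>The weight (1 + |xi|^2)^r is at most 2^r (1 + |xi|^(2 r)), which reduces the
  inhomogeneous condition to the unweighted and the homogeneous one.\<close>

lemma in_H_FT:
  assumes f: "is_FT f g" and g: "L2c (wt r g)" and r: "0 \<le> r" shows "in_H r f"
proof -
  note [measurable] = FTL2_measurable[OF is_FT_L2c(1)[OF f]]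
  have [measurable]: "g \<in> borel_measurable borel" using L2c_measurable[OF is_FT_L2c(2)[OF f]] by simp
  have le: "(1 + (norm \<xi>)\<^sup>2) powr r \<le> 2 powr r * (1 + norm \<xi> powr (2 * r))" for \<xi> :: pt
  proof (cases "norm \<xi> \<le> 1")
    case True
    then have "(norm \<xi>)\<^sup>2 \<le> 1" by (simp add: power_le_one)
    then have "(1 + (norm \<xi>)\<^sup>2) powr r \<le> 2 powr r * 1" using r by (simp add: powr_mono2)
    also have "\<dots> \<le> 2 powr r * (1 + norm \<xi> powr (2 * r))" by (intro mult_left_mono) auto
    finally show ?thesis .
  next
    case False
    then have "1 \<le> (norm \<xi>)\<^sup>2" by (simp add: one_le_power)
    then have "(1 + (norm \<xi>)\<^sup>2) powr r \<le> (2 * (norm \<xi>)\<^sup>2) powr r" using r by (intro powr_mono2) auto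
    also have "\<dots> = 2 powr r * norm \<xi> powr (2 * r)" by (simp add: powr_mult power2_powr)
    also have "\<dots> \<le> 2 powr r * (1 + norm \<xi> powr (2 * r))" by (intro mult_left_mono) auto
    finally show ?thesis .
  qed
  have "integrable lborel (\<lambda>\<xi>. 2 powr r * ((cmod (g \<xi>))\<^sup>2 + norm \<xi> powr (2 * r) * (cmod (g \<xi>))\<^sup>2))"
    using L2c_integrable[OF is_FT_L2c(2)[OF f]] L2c_integrable[OF g] unfolding cmod_wt_square by auto
  then have "integrable lborel (\<lambda>\<xi>. (1 + (norm \<xi>)\<^sup>2) powr r * (cmod (g \<xi>))\<^sup>2)"
  proof (rule Bochner_Integration.integrable_bound)
    show "AE \<xi> in lborel. norm ((1 + (norm \<xi>)\<^sup>2) powr r * (cmod (g \<xi>))\<^sup>2) \<le> norm (2 powr r * ((cmod (g \<xi>))\<^sup>2 + norm \<xi> powr (2 * r) * (cmod (g \<xi>))\<^sup>2))"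
    proof (rule AE_I2)
      fix \<xi>
      have "(1 + (norm \<xi>)\<^sup>2) powr r * (cmod (g \<xi>))\<^sup>2 \<le> 2 powr r * (1 + norm \<xi> powr (2 * r)) * (cmod (g \<xi>))\<^sup>2" by (rule mult_right_mono[OF le]) simp
      also have "\<dots> = 2 powr r * ((cmod (g \<xi>))\<^sup>2 + norm \<xi> powr (2 * r) * (cmod (g \<xi>))\<^sup>2)" by (simp add: distrib_left distrib_right)
      finally show "norm ((1 + (norm \<xi>)\<^sup>2) powr r * (cmod (g \<xi>))\<^sup>2) \<le> norm (2 powr r * ((cmod (g \<xi>))\<^sup>2 + norm \<xi> powr (2 * r) * (cmod (g \<xi>))\<^sup>2))" by simp
    qed
  qed simp
  moreover have "integrable lborel (\<lambda>\<xi>. (1 + (norm \<xi>)\<^sup>2) powr r * (cmod (FTL2 f \<xi>))\<^sup>2) \<longleftrightarrow> integrable lborel (\<lambda>\<xi>. (1 + (norm \<xi>)\<^sup>2) powr r * (cmod (g \<xi>))\<^sup>2)"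
    by (rule integrable_cong_AE[OF _ _ FTL2_wt_AE[OF f]]) auto
  ultimately show ?thesis unfolding in_H_def using f by auto
qed

lemma in_H_D:
  assumes f: "in_H r f" and r: "0 \<le> r" shows "is_FT f (FTL2 f)" "L2c (wt r (FTL2 f))"
proof -
  have L: "L2c f" using f by (auto simp: in_H_def is_FT_def)
  then show "is_FT f (FTL2 f)" by (rule FTL2_is_FT)
  note [measurable] = FTL2_measurable[OF L]
  have "integrable lborel (\<lambda>\<xi>. (cmod (wt r (FTL2 f) \<xi>))\<^sup>2)"
  proof (rule Bochner_Integration.integrable_bound)
    show "integrable lborel (\<lambda>\<xi>. (1 + (norm \<xi>)\<^sup>2) powr r * (cmod (FTL2 f \<xi>))\<^sup>2)" using f by (simp add: in_H_def)
    show "AE \<xi> in lborel. norm ((cmod (wt r (FTL2 f) \<xi>))\<^sup>2) \<le> norm ((1 + (norm \<xi>)\<^sup>2) powr r * (cmod (FTL2 f \<xi>))\<^sup>2)"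
    proof (rule AE_I2)
      fix \<xi> :: pt
      have "norm \<xi> powr (2 * r) = ((norm \<xi>)\<^sup>2) powr r" by (simp add: power2_powr)
      also have "\<dots> \<le> (1 + (norm \<xi>)\<^sup>2) powr r" using r by (intro powr_mono2) auto
      finally have "norm \<xi> powr (2 * r) * (cmod (FTL2 f \<xi>))\<^sup>2 \<le> (1 + (norm \<xi>)\<^sup>2) powr r * (cmod (FTL2 f \<xi>))\<^sup>2" by (rule mult_right_mono) simp
      then show "norm ((cmod (wt r (FTL2 f) \<xi>))\<^sup>2) \<le> norm ((1 + (norm \<xi>)\<^sup>2) powr r * (cmod (FTL2 f \<xi>))\<^sup>2)" unfolding cmod_wt_square by simp
    qed
  qed simp
  then show "L2c (wt r (FTL2 f))" unfolding L2c_def by simp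
qed

text \<open>\<open>fmult\<close> rests on two choices, a transform of f and a preimage of the
  product. Square integrability of the product makes the second one meaningful, by inversion, and
  the first is irrelevant up to null sets.\<close>

lemma fmult_is_FT:
  assumes f: "is_FT f g" and [measurable]: "m \<in> borel_measurable borel" and L: "L2c (\<lambda>\<xi>. m \<xi> * g \<xi>)"
  shows "is_FT (fmult m f) (\<lambda>\<xi>. m \<xi> * g \<xi>)"
proof -
  note [measurable] = FTL2_measurable[OF is_FT_L2c(1)[OF f]]
  have [measurable]: "g \<in> borel_measurable borel" using L2c_measurable[OF is_FT_L2c(2)[OF f]] by simp
  have AE: "AE \<xi> in lborel. m \<xi> * g \<xi> = m \<xi> * FTL2 f \<xi>" using is_FT_FTL2[OF f] by eventually_elim simp
  have "L2c (\<lambda>\<xi>. m \<xi> * FTL2 f \<xi>)" by (rule L2c_cong_AE[OF L _ AE]) simp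
  from someI_ex[OF is_FT_inverse_exists[OF this]] have *: "is_FT (fmult m f) (\<lambda>\<xi>. m \<xi> * FTL2 f \<xi>)" unfolding fmult_def .
  have [measurable]: "fmult m f \<in> borel_measurable lborel" by (rule L2c_measurable[OF is_FT_L2c(1)[OF *]])
  show ?thesis by (rule is_FT_cong_AE[OF *]) (use AE in auto)
qed

lemma Dpow_is_FT: "is_FT f g \<Longrightarrow> L2c (wt r g) \<Longrightarrow> is_FT (Dpow r f) (wt r g)"
  unfolding Dpow_def wt_def[abs_def] by (rule fmult_is_FT) auto

lemma convolution_integrable:
  assumes al: "0 < \<alpha>" "\<alpha> < 1/2"
    and a: "L2c (wt (2 * \<alpha>) a)" and b: "L2c (wt (2 - 2 * \<alpha>) b)" and d: "L2c d"
    and [measurable]: "U \<in> borel_measurable borel" "V \<in> borel_measurable borel"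
    and U: "\<And>z. cmod (U z) \<le> cmod (a z)" "U 0 = 0" and V: "\<And>\<eta>. cmod (V \<eta>) \<le> norm \<eta> * cmod (b \<eta>)"
  shows "integrable lborel2 (\<lambda>(\<xi>, \<eta>). U (\<xi> - \<eta>) * V \<eta> * d \<xi>)"
proof (rule integrableI_bounded)
  have [measurable]: "d \<in> borel_measurable borel" using L2c_measurable[OF d] by simp
  show "(\<lambda>(\<xi>, \<eta>). U (\<xi> - \<eta>) * V \<eta> * d \<xi>) \<in> borel_measurable lborel2" by measurable
  have d0: "L2c (wt 0 d)" by (rule L2c_mono(1)[OF d, where B=1]) (auto simp: wt_def norm_mult mult_le_cancel_right1)
  have "\<exists>C\<ge>0. \<forall>k a b d. (\<forall>\<xi> \<eta>. \<bar>k \<xi> \<eta>\<bar> \<le> norm \<eta>) \<longrightarrow> (\<forall>\<xi> \<eta>. \<xi> - \<eta> = 0 \<or> \<eta> = 0 \<or> \<xi> = 0 \<longrightarrow> k \<xi> \<eta> = 0) \<longrightarrow> L2c (wt (2 * \<alpha>) a) \<longrightarrow> L2c (wt (1 + (1 - 2 * \<alpha>)) b) \<longrightarrow> L2c (wt 0 d) \<longrightarrow>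
     kernel_form k a b d
       \<le> ennreal (C * n2 (wt (2 * \<alpha>) a) * n2 (wt (1 + (1 - 2 * \<alpha>)) b) * n2 (wt 0 d))"
    using al by (intro kernel_trilinear) auto
  then obtain C where T: "\<forall>k a b d. (\<forall>\<xi> \<eta>. \<bar>k \<xi> \<eta>\<bar> \<le> norm \<eta>) \<longrightarrow> (\<forall>\<xi> \<eta>. \<xi> - \<eta> = 0 \<or> \<eta> = 0 \<or> \<xi> = 0 \<longrightarrow> k \<xi> \<eta> = 0) \<longrightarrow> L2c (wt (2 * \<alpha>) a) \<longrightarrow> L2c (wt (1 + (1 - 2 * \<alpha>)) b) \<longrightarrow> L2c (wt 0 d) \<longrightarrow>
     kernel_form k a b d
       \<le> ennreal (C * n2 (wt (2 * \<alpha>) a) * n2 (wt (1 + (1 - 2 * \<alpha>)) b) * n2 (wt 0 d))" by (elim exE conjE)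
  define k where "k \<xi> \<eta> = (if \<xi> - \<eta> = 0 \<or> \<eta> = 0 \<or> \<xi> = 0 then 0 else norm \<eta>)" for \<xi> \<eta> :: pt
  have b': "L2c (wt (1 + (1 - 2 * \<alpha>)) b)" using b by (simp add: algebra_simps)
  have k: "\<forall>\<xi> \<eta>. \<bar>k \<xi> \<eta>\<bar> \<le> norm \<eta>" "\<forall>\<xi> \<eta>. \<xi> - \<eta> = 0 \<or> \<eta> = 0 \<or> \<xi> = 0 \<longrightarrow> k \<xi> \<eta> = 0" by (auto simp: k_def)
  have le: "cmod (U (\<xi> - \<eta>) * V \<eta> * d \<xi>) \<le> \<bar>k \<xi> \<eta>\<bar> * cmod (a (\<xi> - \<eta>)) * cmod (b \<eta>) * cmod (d \<xi>)" if x: "\<xi> \<noteq> 0" for \<xi> \<eta>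
  proof (cases "\<xi> - \<eta> = 0 \<or> \<eta> = 0")
    case True
    then have uv: "U (\<xi> - \<eta>) * V \<eta> = 0" using U(2) V[of 0] by auto
    show ?thesis unfolding uv by simp
  next
    case False
    have "cmod (U (\<xi> - \<eta>) * V \<eta> * d \<xi>) \<le> cmod (a (\<xi> - \<eta>)) * (norm \<eta> * cmod (b \<eta>)) * cmod (d \<xi>)"
      unfolding norm_mult by (intro mult_right_mono mult_mono U V) auto
    also have "\<dots> = \<bar>k \<xi> \<eta>\<bar> * cmod (a (\<xi> - \<eta>)) * cmod (b \<eta>) * cmod (d \<xi>)" using False x by (simp add: k_def)
    finally show ?thesis .
  qed
  let ?G = "\<lambda>\<xi> \<eta>. ennreal (cmod (U (\<xi> - \<eta>) * V \<eta> * (if \<xi> = 0 then 0 else d \<xi>)))"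
  have "(\<integral>\<^sup>+p. ennreal (norm (case p of (\<xi>, \<eta>) \<Rightarrow> U (\<xi> - \<eta>) * V \<eta> * d \<xi>)) \<partial>lborel2) = (\<integral>\<^sup>+\<xi>. \<integral>\<^sup>+\<eta>. ennreal (cmod (U (\<xi> - \<eta>) * V \<eta> * d \<xi>)) \<partial>lborel \<partial>lborel)"
    by (subst lborel.nn_integral_fst[symmetric]) auto
  also have "\<dots> = (\<integral>\<^sup>+\<xi>. \<integral>\<^sup>+\<eta>. ?G \<xi> \<eta> \<partial>lborel \<partial>lborel)"
  proof (rule nn_integral_cong_AE)
    \<comment> \<open>\<open>kernel_trilinear\<close> wants a kernel that vanishes for xi = 0;
      removing this null line from the double integral makes it applicable.\<close>
    have "AE \<xi> in (lborel :: pt measure). \<xi> \<noteq> 0" by (rule AE_lborel_singleton)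
    then show "AE \<xi> in lborel. (\<integral>\<^sup>+\<eta>. ennreal (cmod (U (\<xi> - \<eta>) * V \<eta> * d \<xi>)) \<partial>lborel) = (\<integral>\<^sup>+\<eta>. ?G \<xi> \<eta> \<partial>lborel)"
      by eventually_elim simp
  qed
  also have "\<dots> = (\<integral>\<^sup>+(\<xi>, \<eta>). ?G \<xi> \<eta> \<partial>lborel2)" by (subst lborel.nn_integral_fst[symmetric]) auto
  also have "\<dots> \<le> (kernel_form k a b d)"
    by (intro nn_integral_mono, clarify) (use le in \<open>auto intro!: ennreal_leI\<close>)
  also have "\<dots> \<le> ennreal (C * n2 (wt (2 * \<alpha>) a) * n2 (wt (1 + (1 - 2 * \<alpha>)) b) * n2 (wt 0 d))"
    by (rule T[rule_format, OF k[rule_format] a b' d0])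
  also have "\<dots> < \<infinity>" by simp
  finally show "(\<integral>\<^sup>+p. ennreal (norm (case p of (\<xi>, \<eta>) \<Rightarrow> U (\<xi> - \<eta>) * V \<eta> * d \<xi>)) \<partial>lborel2) < \<infinity>" .
qed

lemma L2c_mult_testc_integrable:
  assumes "L2c f" "L2c g" "testc \<phi>" shows "integrable lborel (\<lambda>x. f x * g x * \<phi> x)"
proof -
  note [measurable] = L2c_measurable[OF assms(1)] L2c_measurable[OF assms(2)] testc_measurable[OF assms(3)]
  obtain B where B: "0 < B" "\<And>x. cmod (\<phi> x) \<le> B" using testc_bound[OF assms(3)] by metis
  show ?thesis
  proof (rule Bochner_Integration.integrable_bound[OF integrable_mult_left[OF L2c_mult_integrable[OF assms(1,2)], of "complex_of_real B"]])
    show "AE x in lborel. norm (f x * g x * \<phi> x) \<le> norm (f x * g x * complex_of_real B)"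
      unfolding norm_mult using B by (intro AE_I2 mult_left_mono) auto
  qed measurable
qed

lemma component_ratio_le: "\<bar>(\<xi>::pt) $ j / norm \<xi>\<bar> \<le> 1"
  using component_le_norm_cart[of \<xi> j] by (cases "\<xi> = 0") (auto simp: divide_le_eq_1)

context fourier_sqg
begin

text \<open>The exponents (2\<alpha>, 1 - 2\<alpha>, 0) leave d without weight, and 2\<alpha> < 1 <
  s makes the bound uniform in time.\<close>

lemma NL_test_bound:
  assumes d: "L2c d"
  shows "\<exists>B\<ge>0. \<forall>\<tau>\<ge>0. integrable lborel (\<lambda>\<xi>. cmod (NL (w \<tau>) (w \<tau>) \<xi>) * cmod (d \<xi>)) \<and> (LINT \<xi>|lborel. cmod (NL (w \<tau>) (w \<tau>) \<xi>) * cmod (d \<xi>)) \<le> B"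
proof -
  have [measurable]: "d \<in> borel_measurable borel" using L2c_measurable[OF d] by simp
  have d0: "L2c (wt 0 d)" by (rule L2c_mono(1)[OF d, where B=1]) (auto simp: wt_def norm_mult mult_le_cancel_right1)
  have "\<exists>C\<ge>0. \<forall>a b d. L2c (wt (2 * \<alpha>) a) \<longrightarrow> L2c (wt (1 + (1 - 2 * \<alpha>)) b) \<longrightarrow> L2c (wt 0 d) \<longrightarrow>
     kap_form a b d
       \<le> ennreal (C * n2 (wt (2 * \<alpha>) a) * n2 (wt (1 + (1 - 2 * \<alpha>)) b) * n2 (wt 0 d))"
    using al by (intro kap_trilinear) auto
  moreover have "1 + (1 - 2 * \<alpha>) = s" using s by simp
  ultimately obtain C where C: "0 \<le> C" and T: "\<forall>a b d. L2c (wt (2 * \<alpha>) a) \<longrightarrow> L2c (wt s b) \<longrightarrow> L2c (wt 0 d) \<longrightarrow>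
     kap_form a b d
       \<le> ennreal (C * n2 (wt (2 * \<alpha>) a) * n2 (wt s b) * n2 (wt 0 d))" by (simp only:) (elim exE conjE)
  let ?B = "C * (2 * sqrt K) * (2 * sqrt K) * n2 (wt 0 d)"
  have B: "0 \<le> ?B" using C K by auto
  have le: "kap_form (w \<tau>) (w \<tau>) d \<le> ennreal ?B"
    if \<tau>: "0 \<le> \<tau>" for \<tau>
  proof (rule order_trans[OF T[rule_format, OF wt_bound(1)[OF \<tau>] Ls[OF \<tau>] d0]])
    show "ennreal (C * n2 (wt (2 * \<alpha>) (w \<tau>)) * n2 (wt s (w \<tau>)) * n2 (wt 0 d)) \<le> ennreal ?B"
      using C K al s1 by (intro ennreal_leI mult_mono wt_bound \<tau>) auto
  qed (use al s1 in auto)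
  show ?thesis
    by (intro exI[of _ ?B] conjI B allI impI NL_pair_bound[OF mw mw _ le B]) auto
qed

text \<open>Translates the pointwise expression of the weak formulation into frequency. Each product
  becomes a convolution by \<open>product_fourier\<close>, separately integrable by
  \<open>convolution_integrable\<close>; only the sum of the two convolutions is
  \<open>NL\<close>.\<close>

lemma sqg_pairing:
  assumes \<tau>: "0 \<le> \<tau>" and f: "is_FT f (w \<tau>)" and \<phi>: "testc \<phi>"
  shows "(LINT x|lborel. (Dpow (2 * \<alpha>) f x + sqg_u1 f x * pderiv2 1 f x + sqg_u2 f x * pderiv2 2 f x) * \<phi> x)
    = complex_of_real (1 / (2*pi)\<^sup>2) * (LINT \<xi>|lborel. (complex_of_real (lamb \<alpha> \<xi>) * w \<tau> \<xi> + NL (w \<tau>) (w \<tau>) \<xi>) * fourier \<phi> (- \<xi>))"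
proof -
  define c where "c = complex_of_real (1 / (2*pi)\<^sup>2)"
  define d where "d \<xi> = fourier \<phi> (- \<xi>)" for \<xi>
  define a where "a = w \<tau>"
  define m1 where "m1 \<xi> = - \<i> * complex_of_real (\<xi> $ 2 / norm \<xi>)" for \<xi> :: pt
  define m2 where "m2 \<xi> = \<i> * complex_of_real (\<xi> $ 1 / norm \<xi>)" for \<xi> :: pt
  define p where "p j \<xi> = \<i> * complex_of_real (\<xi> $ j)" for j and \<xi> :: pt
  have [measurable]: "a \<in> borel_measurable borel" unfolding a_def by (rule mw)
  have [measurable]: "m1 \<in> borel_measurable borel" "m2 \<in> borel_measurable borel" "p j \<in> borel_measurable borel" for j
    unfolding m1_def[abs_def] m2_def[abs_def] p_def[abs_def] by measurable
  have La: "L2c a" "L2c (wt s a)" "L2c (wt (2 * \<alpha>) a)" "L2c (wt 1 a)"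
    unfolding a_def using Lw[OF \<tau>] Ls[OF \<tau>] wt_bound(1)[OF \<tau>] al s1 by auto
  have fa: "is_FT f a" using f unfolding a_def .
  have Ld: "L2c d" unfolding d_def by (rule L2c_uminus_arg) (rule plancherel_testc(1)[OF \<phi>])
  have mle: "cmod (m1 \<xi>) \<le> 1" "cmod (m2 \<xi>) \<le> 1" "cmod (p j \<xi>) \<le> norm \<xi>" for \<xi> j
    unfolding m1_def m2_def p_def norm_mult norm_minus_cancel norm_ii norm_of_real mult_1_left using component_ratio_le component_le_norm_cart by blast+
  have Lm: "L2c (\<lambda>\<xi>. m \<xi> * a \<xi>)" if [measurable]: "m \<in> borel_measurable borel" and "\<And>\<xi>. cmod (m \<xi>) \<le> 1" for m
  proof (rule L2c_mono(1)[OF La(1) _ AE_I2])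
    show "cmod (m \<xi> * a \<xi>) \<le> 1 * cmod (a \<xi>)" for \<xi> unfolding norm_mult by (rule mult_right_mono[OF that(2)]) simp
  qed auto
  have Lp: "L2c (\<lambda>\<xi>. p j \<xi> * a \<xi>)" for j
  proof (rule L2c_mono(1)[OF La(4) _ AE_I2])
    show "cmod (p j \<xi> * a \<xi>) \<le> 1 * cmod (wt 1 a \<xi>)" for \<xi> unfolding norm_mult cmod_wt using mult_right_mono[OF mle(3)[of j \<xi>], of "cmod (a \<xi>)"] by simp
  qed auto
  have F0: "is_FT (Dpow (2 * \<alpha>) f) (wt (2 * \<alpha>) a)" by (rule Dpow_is_FT[OF fa La(3)])
  have F1: "is_FT (sqg_u1 f) (\<lambda>\<xi>. m1 \<xi> * a \<xi>)" unfolding sqg_u1_def m1_def[symmetric] by (rule fmult_is_FT[OF fa _ Lm]) (use mle in auto)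
  have F2: "is_FT (sqg_u2 f) (\<lambda>\<xi>. m2 \<xi> * a \<xi>)" unfolding sqg_u2_def m2_def[symmetric] by (rule fmult_is_FT[OF fa _ Lm]) (use mle in auto)
  have P: "is_FT (pderiv2 j f) (\<lambda>\<xi>. p j \<xi> * a \<xi>)" for j unfolding pderiv2_def p_def[symmetric] by (rule fmult_is_FT[OF fa _ Lp]) auto
  have I: "integrable lborel2 (\<lambda>(\<xi>, \<eta>). (m (\<xi> - \<eta>) * a (\<xi> - \<eta>)) * (p j \<eta> * a \<eta>) * d \<xi>)"
    if [measurable]: "m \<in> borel_measurable borel" and m: "\<And>\<xi>. cmod (m \<xi>) \<le> 1" "m 0 = 0" for m j
  proof (rule convolution_integrable[OF al La(3) La(2)[unfolded s] Ld])
    show "cmod (m z * a z) \<le> cmod (a z)" for z unfolding norm_mult using mult_right_mono[OF m(1)[of z], of "cmod (a z)"] by simp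
    show "cmod (p j \<eta> * a \<eta>) \<le> norm \<eta> * cmod (a \<eta>)" for \<eta> unfolding norm_mult by (rule mult_right_mono[OF mle(3)]) simp
  qed (use m in auto)
  have m0: "m1 0 = 0" "m2 0 = 0" by (auto simp: m1_def m2_def)
  have I1: "integrable lborel2 (\<lambda>(\<xi>, \<eta>). (m1 (\<xi> - \<eta>) * a (\<xi> - \<eta>)) * (p 1 \<eta> * a \<eta>) * d \<xi>)" by (rule I[of m1, OF _ mle(1) m0(1)]) simp
  have I2: "integrable lborel2 (\<lambda>(\<xi>, \<eta>). (m2 (\<xi> - \<eta>) * a (\<xi> - \<eta>)) * (p 2 \<eta> * a \<eta>) * d \<xi>)" by (rule I[of m2, OF _ mle(2) m0(2)]) simp
  let ?A1 = "\<lambda>\<xi>. LINT \<eta>|lborel. (m1 (\<xi> - \<eta>) * a (\<xi> - \<eta>)) * (p 1 \<eta> * a \<eta>)"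
  let ?A2 = "\<lambda>\<xi>. LINT \<eta>|lborel. (m2 (\<xi> - \<eta>) * a (\<xi> - \<eta>)) * (p 2 \<eta> * a \<eta>)"
  have i1: "integrable lborel (\<lambda>\<xi>. ?A1 \<xi> * d \<xi>)" using lborel_pair.integrable_fst[OF I1] by simp
  have i2: "integrable lborel (\<lambda>\<xi>. ?A2 \<xi> * d \<xi>)" using lborel_pair.integrable_fst[OF I2] by simp
  have NLe: "NL a a \<xi> = c * (?A1 \<xi> + ?A2 \<xi>)" for \<xi>
  proof -
    have "?A1 \<xi> + ?A2 \<xi> = (LINT \<eta>|lborel. (m1 (\<xi> - \<eta>) * a (\<xi> - \<eta>)) * (p 1 \<eta> * a \<eta>) + (m2 (\<xi> - \<eta>) * a (\<xi> - \<eta>)) * (p 2 \<eta> * a \<eta>))"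
      by (rule Bochner_Integration.integral_add[symmetric]; rule L2c_mult_integrable[OF _ Lp])
         (rule L2c_reflect_arg(1)[where a="\<lambda>\<xi>. m1 \<xi> * a \<xi>"], rule Lm, use mle in simp_all, rule L2c_reflect_arg(1)[where a="\<lambda>\<xi>. m2 \<xi> * a \<xi>"], rule Lm, use mle in simp_all)
    also have "\<dots> = (LINT \<eta>|lborel. complex_of_real (kap \<xi> \<eta>) * a (\<xi> - \<eta>) * a \<eta>)"
    proof (rule Bochner_Integration.integral_cong[OF refl])
      fix \<eta>
      \<comment> \<open>The product of the two imaginary units makes the combined symbol real and
        gives the sign of \<open>kap\<close>.\<close>
      have "m1 (\<xi> - \<eta>) * p 1 \<eta> + m2 (\<xi> - \<eta>) * p 2 \<eta> = complex_of_real (((\<xi> - \<eta>) $ 2 * \<eta> $ 1 - (\<xi> - \<eta>) $ 1 * \<eta> $ 2) / norm (\<xi> - \<eta>))"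
        unfolding m1_def m2_def p_def by (simp add: complex_eq_iff diff_divide_distrib left_diff_distrib)
      also have "((\<xi> - \<eta>) $ 2 * \<eta> $ 1 - (\<xi> - \<eta>) $ 1 * \<eta> $ 2) / norm (\<xi> - \<eta>) = kap \<xi> \<eta>" unfolding kap_def by (simp add: algebra_simps)
      finally have e: "m1 (\<xi> - \<eta>) * p 1 \<eta> + m2 (\<xi> - \<eta>) * p 2 \<eta> = complex_of_real (kap \<xi> \<eta>)" .
      show "(m1 (\<xi> - \<eta>) * a (\<xi> - \<eta>)) * (p 1 \<eta> * a \<eta>) + (m2 (\<xi> - \<eta>) * a (\<xi> - \<eta>)) * (p 2 \<eta> * a \<eta>) = complex_of_real (kap \<xi> \<eta>) * a (\<xi> - \<eta>) * a \<eta>"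
        unfolding e[symmetric] by (simp add: algebra_simps)
    qed
    finally show ?thesis unfolding NL_def c_def by simp
  qed
  have iN: "integrable lborel (\<lambda>\<xi>. NL a a \<xi> * d \<xi>)"
    unfolding NLe using integrable_mult_right[OF Bochner_Integration.integrable_add[OF i1 i2], of c] by (simp add: algebra_simps)
  have iw: "integrable lborel (\<lambda>\<xi>. wt (2 * \<alpha>) a \<xi> * d \<xi>)" by (rule L2c_mult_integrable[OF La(3) Ld])
  note X = is_FT_L2c(1)
  have "(LINT x|lborel. (Dpow (2 * \<alpha>) f x + sqg_u1 f x * pderiv2 1 f x + sqg_u2 f x * pderiv2 2 f x) * \<phi> x)
    = (LINT x|lborel. (Dpow (2 * \<alpha>) f x * \<phi> x + sqg_u1 f x * pderiv2 1 f x * \<phi> x) + sqg_u2 f x * pderiv2 2 f x * \<phi> x)"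
    by (simp only: distrib_right)
  also have "\<dots> = (LINT x|lborel. Dpow (2 * \<alpha>) f x * \<phi> x) + (LINT x|lborel. sqg_u1 f x * pderiv2 1 f x * \<phi> x) + (LINT x|lborel. sqg_u2 f x * pderiv2 2 f x * \<phi> x)"
    using L2c_mult_integrable[OF X[OF F0] testc_L2c[OF \<phi>]] L2c_mult_testc_integrable[OF X[OF F1] X[OF P[of 1]] \<phi>] L2c_mult_testc_integrable[OF X[OF F2] X[OF P[of 2]] \<phi>]
    by simp
  also have "\<dots> = c * (LINT \<xi>|lborel. wt (2 * \<alpha>) a \<xi> * d \<xi>) + c * (c * (LINT \<xi>|lborel. ?A1 \<xi> * d \<xi>)) + c * (c * (LINT \<xi>|lborel. ?A2 \<xi> * d \<xi>))"
    unfolding parseval_mult[OF F0 testc_L2c[OF \<phi>] testc_integrable[OF \<phi>], folded c_def d_def]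
      product_fourier[OF F1 P[of 1] \<phi>, folded c_def d_def, OF I1] product_fourier[OF F2 P[of 2] \<phi>, folded c_def d_def, OF I2] ..
  also have "\<dots> = c * ((LINT \<xi>|lborel. wt (2 * \<alpha>) a \<xi> * d \<xi>) + c * ((LINT \<xi>|lborel. ?A1 \<xi> * d \<xi>) + (LINT \<xi>|lborel. ?A2 \<xi> * d \<xi>)))"
    by (simp only: distrib_left add.assoc)
  also have "c * ((LINT \<xi>|lborel. ?A1 \<xi> * d \<xi>) + (LINT \<xi>|lborel. ?A2 \<xi> * d \<xi>)) = (LINT \<xi>|lborel. NL a a \<xi> * d \<xi>)"
  proof -
    have "(LINT \<xi>|lborel. NL a a \<xi> * d \<xi>) = (LINT \<xi>|lborel. c * (?A1 \<xi> * d \<xi> + ?A2 \<xi> * d \<xi>))" unfolding NLe by (simp only: distrib_right mult.assoc)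
    also have "\<dots> = c * (LINT \<xi>|lborel. ?A1 \<xi> * d \<xi> + ?A2 \<xi> * d \<xi>)" by (rule integral_mult_right_zero)
    also have "(LINT \<xi>|lborel. ?A1 \<xi> * d \<xi> + ?A2 \<xi> * d \<xi>) = (LINT \<xi>|lborel. ?A1 \<xi> * d \<xi>) + (LINT \<xi>|lborel. ?A2 \<xi> * d \<xi>)" by (rule Bochner_Integration.integral_add[OF i1 i2])
    finally show ?thesis ..
  qed
  also have "(LINT \<xi>|lborel. wt (2 * \<alpha>) a \<xi> * d \<xi>) + (LINT \<xi>|lborel. NL a a \<xi> * d \<xi>) = (LINT \<xi>|lborel. wt (2 * \<alpha>) a \<xi> * d \<xi> + NL a a \<xi> * d \<xi>)"
    by (rule Bochner_Integration.integral_add[OF iw iN, symmetric])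
  finally show ?thesis unfolding c_def d_def a_def wt_def lamb_def distrib_right .
qed

text \<open>The equation is integrated in time at each frequency, paired with the reflected
  transform of the test function, and brought back by Parseval. Uniform bounds on the pairing allow
  time and frequency integrals to be exchanged.\<close>

lemma weak_solution:
  assumes t: "0 \<le> t" and h: "\<And>\<tau>. 0 \<le> \<tau> \<Longrightarrow> is_FT (h \<tau>) (w \<tau>)" and h0: "is_FT h0 w0" and \<phi>: "testc \<phi>"
    and F: "\<And>\<tau>. F \<tau> = (LINT x|lborel. (Dpow (2 * \<alpha>) (h \<tau>) x + sqg_u1 (h \<tau>) x * pderiv2 1 (h \<tau>) x + sqg_u2 (h \<tau>) x * pderiv2 2 (h \<tau>) x) * \<phi> x)"
  shows "set_integrable lborel {0..t} F" "(LINT x|lborel. h t x * \<phi> x) - (LINT x|lborel. h0 x * \<phi> x) + (LINT \<tau>:{0..t}|lborel. F \<tau>) = 0"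
proof -
  define c where "c = complex_of_real (1 / (2*pi)\<^sup>2)"
  define d where "d \<xi> = fourier \<phi> (- \<xi>)" for \<xi>
  define q where "q \<tau> \<xi> = complex_of_real (lamb \<alpha> \<xi>) * w \<tau> \<xi> + NL (w \<tau>) (w \<tau>) \<xi>" for \<tau> \<xi>
  define G where "G \<tau> = (LINT \<xi>|lborel. q \<tau> \<xi> * d \<xi>)" for \<tau>
  have Ld: "L2c d" unfolding d_def by (rule L2c_uminus_arg) (rule plancherel_testc(1)[OF \<phi>])
  have [measurable]: "d \<in> borel_measurable borel" using L2c_measurable[OF Ld] by simp
  have FG: "F \<tau> = c * G \<tau>" if \<tau>: "0 \<le> \<tau>" for \<tau>
    unfolding F sqg_pairing[OF \<tau> h[OF \<tau>] \<phi>] c_def G_def q_def d_def ..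
  obtain B where B: "0 \<le> B" and NB: "\<And>\<tau>. 0 \<le> \<tau> \<Longrightarrow> integrable lborel (\<lambda>\<xi>. cmod (NL (w \<tau>) (w \<tau>) \<xi>) * cmod (d \<xi>)) \<and> (LINT \<xi>|lborel. cmod (NL (w \<tau>) (w \<tau>) \<xi>) * cmod (d \<xi>)) \<le> B"
    using NL_test_bound[OF Ld] by blast
  have sl: "(\<integral>\<^sup>+\<xi>. ennreal (cmod (q \<tau> \<xi> * d \<xi>)) \<partial>lborel) \<le> ennreal (2 * sqrt K * n2 d) + ennreal B" if \<tau>: "0 \<le> \<tau>" for \<tau>
  proof -
    note [measurable] = jmeas_slice[OF jw] jmeas_slice[OF NL_jmeas]
    have L: "L2c (wt (2 * \<alpha>) (w \<tau>))" "n2 (wt (2 * \<alpha>) (w \<tau>)) \<le> 2 * sqrt K" using wt_bound[OF \<tau>, of "2 * \<alpha>"] al s1 by auto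
    have "(\<integral>\<^sup>+\<xi>. ennreal (cmod (q \<tau> \<xi> * d \<xi>)) \<partial>lborel) \<le> (\<integral>\<^sup>+\<xi>. ennreal (cmod (wt (2 * \<alpha>) (w \<tau>) \<xi>) * cmod (d \<xi>)) + ennreal (cmod (NL (w \<tau>) (w \<tau>) \<xi>) * cmod (d \<xi>)) \<partial>lborel)"
    proof (rule nn_integral_mono)
      fix \<xi>
      have "cmod (q \<tau> \<xi> * d \<xi>) \<le> (cmod (wt (2 * \<alpha>) (w \<tau>) \<xi>) + cmod (NL (w \<tau>) (w \<tau>) \<xi>)) * cmod (d \<xi>)"
        unfolding q_def norm_mult wt_def lamb_def by (rule mult_right_mono[OF order_trans[OF norm_triangle_ineq]]) (auto simp: norm_mult)
      then have "cmod (q \<tau> \<xi> * d \<xi>) \<le> cmod (wt (2 * \<alpha>) (w \<tau>) \<xi>) * cmod (d \<xi>) + cmod (NL (w \<tau>) (w \<tau>) \<xi>) * cmod (d \<xi>)" by (simp only: distrib_right)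
      then have "ennreal (cmod (q \<tau> \<xi> * d \<xi>)) \<le> ennreal (cmod (wt (2 * \<alpha>) (w \<tau>) \<xi>) * cmod (d \<xi>) + cmod (NL (w \<tau>) (w \<tau>) \<xi>) * cmod (d \<xi>))" by (rule ennreal_leI)
      then show "ennreal (cmod (q \<tau> \<xi> * d \<xi>)) \<le> ennreal (cmod (wt (2 * \<alpha>) (w \<tau>) \<xi>) * cmod (d \<xi>)) + ennreal (cmod (NL (w \<tau>) (w \<tau>) \<xi>) * cmod (d \<xi>))"
        by (subst (asm) ennreal_plus) auto
    qed
    also have "\<dots> = (\<integral>\<^sup>+\<xi>. ennreal (cmod (wt (2 * \<alpha>) (w \<tau>) \<xi>) * cmod (d \<xi>)) \<partial>lborel) + (\<integral>\<^sup>+\<xi>. ennreal (cmod (NL (w \<tau>) (w \<tau>) \<xi>) * cmod (d \<xi>)) \<partial>lborel)"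
      by (rule nn_integral_add) auto
    also have "\<dots> \<le> ennreal (2 * sqrt K * n2 d) + ennreal B"
    proof (rule add_mono)
      show "(\<integral>\<^sup>+\<xi>. ennreal (cmod (wt (2 * \<alpha>) (w \<tau>) \<xi>) * cmod (d \<xi>)) \<partial>lborel) \<le> ennreal (2 * sqrt K * n2 d)"
        by (rule order_trans[OF L2_CS_nn[OF L(1) Ld]]) (intro ennreal_leI mult_right_mono L, simp)
      show "(\<integral>\<^sup>+\<xi>. ennreal (cmod (NL (w \<tau>) (w \<tau>) \<xi>) * cmod (d \<xi>)) \<partial>lborel) \<le> ennreal B"
        using NB[OF \<tau>] by (subst nn_integral_eq_integral) (auto intro: ennreal_leI)
    qed
    finally show ?thesis .
  qed
  have IQ: "integrable lborel2 (\<lambda>(\<tau>, \<xi>). indicator {0..t} \<tau> *\<^sub>R (q \<tau> \<xi> * d \<xi>))"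
  proof (rule integrableI_bounded)
    note [measurable (raw)] = measurable_pair_apply[OF jw] measurable_pair_apply[OF NL_jmeas]
    show M: "(\<lambda>(\<tau>, \<xi>). indicator {0..t} \<tau> *\<^sub>R (q \<tau> \<xi> * d \<xi>)) \<in> borel_measurable lborel2"
      unfolding q_def by measurable
    have "(\<integral>\<^sup>+p. ennreal (norm (case p of (\<tau>, \<xi>) \<Rightarrow> indicator {0..t} \<tau> *\<^sub>R (q \<tau> \<xi> * d \<xi>))) \<partial>lborel2)
       = (\<integral>\<^sup>+\<tau>. \<integral>\<^sup>+\<xi>. ennreal (norm (indicator {0..t} \<tau> *\<^sub>R (q \<tau> \<xi> * d \<xi>))) \<partial>lborel \<partial>lborel)"
      by (subst lborel.nn_integral_fst[symmetric]) (use M in auto)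
    also have "\<dots> \<le> (\<integral>\<^sup>+\<tau>. indicator {0..t} \<tau> * (ennreal (2 * sqrt K * n2 d) + ennreal B) \<partial>lborel)"
    proof (rule nn_integral_mono)
      fix \<tau> :: real
      show "(\<integral>\<^sup>+\<xi>. ennreal (norm (indicator {0..t} \<tau> *\<^sub>R (q \<tau> \<xi> * d \<xi>))) \<partial>lborel) \<le> indicator {0..t} \<tau> * (ennreal (2 * sqrt K * n2 d) + ennreal B)"
        using sl[of \<tau>] by (cases "\<tau> \<in> {0..t}") auto
    qed
    also have "\<dots> < \<infinity>" by (subst nn_integral_multc) (use t in \<open>auto simp: ennreal_mult_less_top\<close>)
    finally show "(\<integral>\<^sup>+p. ennreal (norm (case p of (\<tau>, \<xi>) \<Rightarrow> indicator {0..t} \<tau> *\<^sub>R (q \<tau> \<xi> * d \<xi>))) \<partial>lborel2) < \<infinity>" .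
  qed
  have iG: "set_integrable lborel {0..t} G" using lborel_pair.integrable_fst[OF IQ] unfolding set_integrable_def G_def by simp
  have "set_integrable lborel {0..t} F \<longleftrightarrow> set_integrable lborel {0..t} (\<lambda>\<tau>. c * G \<tau>)"
    by (rule set_integrable_cong) (use FG in auto)
  then show "set_integrable lborel {0..t} F" using set_integrable_mult_right[OF iG] by simp
  \<comment> \<open>The integrand q is minus the time derivative of w, and it is continuous in time
    at each frequency.\<close>
  have ftc: "(LINT \<tau>|lborel. indicator {0..t} \<tau> *\<^sub>R q \<tau> \<xi>) = w0 \<xi> - w t \<xi>" for \<xi>
  proof -
    have "(LINT \<tau>|lborel. indicator {0..t} \<tau> *\<^sub>R q \<tau> \<xi>) = - w t \<xi> - (- w 0 \<xi>)"
    proof (rule integral_FTC_Icc[OF t])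
      show "continuous_on {0..t} (\<lambda>\<tau>. q \<tau> \<xi>)" unfolding q_def
        by (intro continuous_intros continuous_on_subset[OF w_continuous] continuous_on_subset[OF NL_continuous[OF cw]]) auto
      fix x assume x: "0 \<le> x" "x \<le> t"
      have "((\<lambda>\<tau>. - w \<tau> \<xi>) has_vector_derivative - (- complex_of_real (lamb \<alpha> \<xi>) * w x \<xi> - NL (w x) (w x) \<xi>)) (at x within {0..t})"
        by (intro has_vector_derivative_minus has_vector_derivative_within_subset[OF ode[OF x(1)]]) auto
      then show "((\<lambda>\<tau>. - w \<tau> \<xi>) has_vector_derivative q x \<xi>) (at x within {0..t})" unfolding q_def by (simp add: add.commute)
    qed
    moreover have "w 0 \<xi> = w0 \<xi>" unfolding ew[OF order_refl] by (rule duh_0) (rule NL_continuous[OF cw])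
    ultimately show ?thesis by simp
  qed
  have "(LINT \<tau>:{0..t}|lborel. G \<tau>) = (LINT \<tau>|lborel. LINT \<xi>|lborel. indicator {0..t} \<tau> *\<^sub>R (q \<tau> \<xi> * d \<xi>))"
    unfolding set_lebesgue_integral_def G_def by simp
  also have "\<dots> = (LINT \<xi>|lborel. LINT \<tau>|lborel. indicator {0..t} \<tau> *\<^sub>R (q \<tau> \<xi> * d \<xi>))"
    by (rule lborel_pair.Fubini_integral[OF IQ, symmetric])
  also have "\<dots> = (LINT \<xi>|lborel. w0 \<xi> * d \<xi> - w t \<xi> * d \<xi>)"
  proof (rule Bochner_Integration.integral_cong[OF refl])
    fix \<xi>
    have "(LINT \<tau>|lborel. indicator {0..t} \<tau> *\<^sub>R (q \<tau> \<xi> * d \<xi>)) = (LINT \<tau>|lborel. (indicator {0..t} \<tau> *\<^sub>R q \<tau> \<xi>) * d \<xi>)" by simp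
    also have "\<dots> = (w0 \<xi> - w t \<xi>) * d \<xi>" unfolding ftc[symmetric] by (rule integral_mult_left_zero)
    finally show "(LINT \<tau>|lborel. indicator {0..t} \<tau> *\<^sub>R (q \<tau> \<xi> * d \<xi>)) = w0 \<xi> * d \<xi> - w t \<xi> * d \<xi>" by (simp only: left_diff_distrib)
  qed
  also have "\<dots> = (LINT \<xi>|lborel. w0 \<xi> * d \<xi>) - (LINT \<xi>|lborel. w t \<xi> * d \<xi>)"
    by (rule Bochner_Integration.integral_diff; rule L2c_mult_integrable[OF _ Ld]) (use is_FT_L2c(2)[OF h0] Lw[OF t] in simp_all)
  finally have IG: "(LINT \<tau>:{0..t}|lborel. G \<tau>) = (LINT \<xi>|lborel. w0 \<xi> * d \<xi>) - (LINT \<xi>|lborel. w t \<xi> * d \<xi>)" .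
  have "(LINT \<tau>:{0..t}|lborel. F \<tau>) = (LINT \<tau>:{0..t}|lborel. c * G \<tau>)"
    by (rule set_lebesgue_integral_cong) (use FG in auto)
  also have "\<dots> = c * (LINT \<tau>:{0..t}|lborel. G \<tau>)" by (rule set_integral_mult_right)
  also have "\<dots> = c * (LINT \<xi>|lborel. w0 \<xi> * d \<xi>) - c * (LINT \<xi>|lborel. w t \<xi> * d \<xi>)" unfolding IG by (rule right_diff_distrib)
  also have "\<dots> = (LINT x|lborel. h0 x * \<phi> x) - (LINT x|lborel. h t x * \<phi> x)"
    unfolding parseval_mult[OF h0 testc_L2c[OF \<phi>] testc_integrable[OF \<phi>]] parseval_mult[OF h[OF t] testc_L2c[OF \<phi>] testc_integrable[OF \<phi>]] c_def d_def ..
  finally show "(LINT x|lborel. h t x * \<phi> x) - (LINT x|lborel. h0 x * \<phi> x) + (LINT \<tau>:{0..t}|lborel. F \<tau>) = 0" by simp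
qed

end

text \<open>f and its conjugate have the same transform, so they agree almost everywhere and the
  real part of f is an admissible representative.\<close>

lemma real_inverse_FT:
  assumes g: "L2c g" and h: "\<And>\<xi>. g (- \<xi>) = cnj (g \<xi>)"
  shows "\<exists>f :: pt \<Rightarrow> real. is_FT (cR f) g"
proof -
  obtain f where f: "is_FT f g" using is_FT_inverse_exists[OF g] by blast
  have "is_FT (\<lambda>x. cnj (f x)) g" using is_FT_cnj[OF f] by (simp add: h)
  from is_FT_inj[OF f this AE_I2[OF refl]] have AE: "AE x in lborel. f x = complex_of_real (Re (f x))"
  proof eventually_elim
    case (elim x)
    then have "f x \<in> \<real>" by (simp add: complex_is_Real_iff complex_eq_iff)
    then show ?case by (simp add: complex_is_Real_iff complex_eq_iff)
  qed
  note [measurable] = L2c_measurable[OF is_FT_L2c(1)[OF f]] L2c_measurable[OF g]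
  have "is_FT (cR (\<lambda>x. Re (f x))) g" by (rule is_FT_cong_AE[OF f _ _ AE]) auto
  then show ?thesis by (rule exI[of _ "\<lambda>x. Re (f x)"])
qed

text \<open>The transform of a real function is Hermitian almost everywhere only; averaging it with
  its reflected conjugate makes the symmetry hold at every point, as the construction of the
  solution requires.\<close>

lemma hermitian_FT:
  assumes f: "is_FT (cR f) g"
  shows "\<exists>g'. is_FT (cR f) g' \<and> (\<forall>\<xi>. g' (- \<xi>) = cnj (g' \<xi>)) \<and> (AE \<xi> in lborel. g \<xi> = g' \<xi>)"
proof -
  define g' where "g' \<xi> = (g \<xi> + cnj (g (- \<xi>))) / 2" for \<xi>
  have "is_FT (cR f) (\<lambda>\<xi>. cnj (g (- \<xi>)))" using is_FT_cnj[OF f] by simp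
  from is_FT_unique[OF f this] have AE: "AE \<xi> in lborel. g \<xi> = g' \<xi>"
    unfolding g'_def by eventually_elim simp
  have [measurable]: "g \<in> borel_measurable borel" using L2c_measurable[OF is_FT_L2c(2)[OF f]] by simp
  have "g' \<in> borel_measurable lborel" unfolding g'_def by measurable
  with L2c_measurable[OF is_FT_L2c(1)[OF f]] AE have "is_FT (cR f) g'" by (intro is_FT_cong_AE[OF f]) auto
  moreover have "g' (- \<xi>) = cnj (g' \<xi>)" for \<xi> unfolding g'_def by (simp add: add.commute)
  ultimately show ?thesis using AE by blast
qed

lemma wt_wt: "wt r (wt q f) = wt (r + q) f"
  by (rule ext) (simp add: wt_def powr_add)

theorem theorem1p3:
  fixes \<alpha> :: real
  assumes "0 < \<alpha>" and "\<alpha> < 1/2"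
  shows "\<exists>\<epsilon>0>0. \<forall>\<theta>0 :: pt \<Rightarrow> real.
           in_H (2 - 2*\<alpha>) (cR \<theta>0) \<and> sob_norm (2 - 2*\<alpha>) (cR \<theta>0) < \<epsilon>0 \<longrightarrow>
           (\<exists>\<theta> :: real \<Rightarrow> pt \<Rightarrow> real.
              sqg_solution \<alpha> \<theta>0 \<theta> \<and>
              cont_H (2 - 2*\<alpha>) \<theta> \<and>
              L2_Hdot (2 - \<alpha>) \<theta> \<and>
              (\<forall>t\<ge>0. set_integrable lborel {0..t}
                        (\<lambda>\<tau>. sob_norm_sq (2 - 2*\<alpha>) (Dpow \<alpha> (cR (\<theta> \<tau>)))) \<and>
                      sob_norm_sq (2 - 2*\<alpha>) (cR (\<theta> t))
                      + (LINT \<tau>:{0..t}|lborel. sob_norm_sq (2 - 2*\<alpha>) (Dpow \<alpha> (cR (\<theta> \<tau>))))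
                      \<le> sob_norm_sq (2 - 2*\<alpha>) (cR \<theta>0)))"
proof -
  define s where "s = 2 - 2 * \<alpha>"
  have s0: "0 \<le> s" using assms by (simp add: s_def)
  let ?c = "1 / (2*pi)\<^sup>2"
  obtain C where C: "1 \<le> C" and sol: "\<forall>w0. L2c w0 \<longrightarrow> L2c (wt s w0) \<longrightarrow> (\<forall>\<xi>. w0 (- \<xi>) = cnj (w0 \<xi>)) \<longrightarrow> C * n2 (wt s w0) < 1 \<longrightarrow>
    (\<exists>w. jmeas w \<and> l2cont w \<and> (\<forall>t\<ge>0. \<forall>\<xi>. w t (- \<xi>) = cnj (w t \<xi>)) \<and>
      (\<forall>t\<ge>0. \<forall>\<xi>. w t \<xi> = duh (lamb \<alpha>) w0 (\<lambda>\<tau>. NL (w \<tau>) (w \<tau>)) t \<xi>) \<and>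
      (\<forall>t\<ge>0. (\<integral>\<^sup>+p. enfun s \<alpha> w t p \<partial>lborel2) \<le> ennreal ((n2 w0)\<^sup>2 + (n2 (wt s w0))\<^sup>2)))"
    using fourier_solution[OF s_def assms] by (elim exE conjE)
  \<comment> \<open>The threshold 1 / (2 pi C): with the unnormalised transform the weighted norm of
    w0 is at most 2 pi times the Sobolev norm of the data.\<close>
  have main: "\<exists>\<theta> :: real \<Rightarrow> pt \<Rightarrow> real. sqg_solution \<alpha> \<theta>0 \<theta> \<and> cont_H s \<theta> \<and> L2_Hdot (2 - \<alpha>) \<theta> \<and>
      (\<forall>t\<ge>0. set_integrable lborel {0..t} (\<lambda>\<tau>. sob_norm_sq s (Dpow \<alpha> (cR (\<theta> \<tau>)))) \<and>
         sob_norm_sq s (cR (\<theta> t)) + (LINT \<tau>:{0..t}|lborel. sob_norm_sq s (Dpow \<alpha> (cR (\<theta> \<tau>)))) \<le> sob_norm_sq s (cR \<theta>0))"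
    if H: "in_H s (cR \<theta>0)" and small: "sob_norm s (cR \<theta>0) < 1 / (2 * pi * C)" for \<theta>0
  proof -
    obtain w0 where f0: "is_FT (cR \<theta>0) w0" and herm: "\<forall>\<xi>. w0 (- \<xi>) = cnj (w0 \<xi>)" and AE0: "AE \<xi> in lborel. FTL2 (cR \<theta>0) \<xi> = w0 \<xi>"
      using hermitian_FT[OF in_H_D(1)[OF H s0]] by blast
    have L0: "L2c w0" by (rule is_FT_L2c(2)[OF f0])
    have [measurable]: "w0 \<in> borel_measurable borel" using L2c_measurable[OF L0] by simp
    have Ls0: "L2c (wt s w0)"
    proof (rule L2c_cong_AE[OF in_H_D(2)[OF H s0]])
      show "AE \<xi> in lborel. wt s (FTL2 (cR \<theta>0)) \<xi> = wt s w0 \<xi>" using AE0 by eventually_elim (simp add: wt_def)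
    qed simp
    \<comment> \<open>The energy of the data in frequency variables, (2 pi)^2 times the squared
      Sobolev norm.\<close>
    define K where "K = (n2 w0)\<^sup>2 + (n2 (wt s w0))\<^sup>2"
    have N0: "sob_norm_sq s (cR \<theta>0) = ?c * K" unfolding sob_norm_sq_FT[OF f0] K_def ..
    have sm: "C * n2 (wt s w0) < 1"
    proof -
      have "n2 (wt s w0) \<le> sqrt K" unfolding K_def by (rule real_le_rsqrt) simp
      also have "sqrt K = 2 * pi * sob_norm s (cR \<theta>0)" unfolding sob_norm_def N0 real_sqrt_mult real_sqrt_divide real_sqrt_abs real_sqrt_one by simp
      also have "\<dots> < 2 * pi * (1 / (2 * pi * C))" by (intro mult_strict_left_mono small) simp
      also have "\<dots> = 1 / C" by simp
      finally show ?thesis using C by (simp add: pos_less_divide_eq mult.commute)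
    qed
    obtain w where w: "jmeas w" "l2cont w" "\<forall>t\<ge>0. \<forall>\<xi>. w t (- \<xi>) = cnj (w t \<xi>)"
      "\<forall>t\<ge>0. \<forall>\<xi>. w t \<xi> = duh (lamb \<alpha>) w0 (\<lambda>\<tau>. NL (w \<tau>) (w \<tau>)) t \<xi>"
      "\<forall>t\<ge>0. (\<integral>\<^sup>+p. enfun s \<alpha> w t p \<partial>lborel2) \<le> ennreal K"
      using sol[rule_format, OF L0 Ls0 herm[rule_format] sm] unfolding K_def by (elim exE conjE)
    interpret fourier_sqg s \<alpha> K w0 w
      by (rule fourier_sqg.intro[OF s_def assms _ w(1,2) w(3,4,5)[rule_format]]) (simp_all add: K_def)
    have "\<exists>f :: pt \<Rightarrow> real. is_FT (cR f) (w t)" if "0 \<le> t" for t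
      by (rule real_inverse_FT[OF Lw[OF that] hw[OF that]])
    \<comment> \<open>A real representative is chosen at each time independently; all quantities in
      the conclusion are computed from its transform w t.\<close>
    then obtain \<theta> :: "real \<Rightarrow> pt \<Rightarrow> real" where FT: "\<And>t. 0 \<le> t \<Longrightarrow> is_FT (cR (\<theta> t)) (w t)" by metis
    have "sqg_solution \<alpha> \<theta>0 \<theta>"
      unfolding sqg_solution_def Let_def
      by (intro allI impI conjI weak_solution[OF _ FT f0 _ refl]) auto
    moreover have "cont_H s \<theta>" unfolding cont_H_def
    proof (intro conjI allI impI)
      fix t :: real assume t: "0 \<le> t"
      show "in_H s (cR (\<theta> t))" by (rule in_H_FT[OF FT[OF t] Ls[OF t] s0])
      have "((\<lambda>\<tau>. sqrt (?c * ((n2 (\<lambda>\<xi>. w \<tau> \<xi> - w t \<xi>))\<^sup>2 + (n2 (\<lambda>\<xi>. wt s (w \<tau>) \<xi> - wt s (w t) \<xi>))\<^sup>2))) \<longlongrightarrow> sqrt (?c * (0\<^sup>2 + 0\<^sup>2))) (at t within {0..})"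
        using cw t unfolding l2cont_def by (intro tendsto_intros Hs_continuous t) auto
      moreover have "\<forall>\<^sub>F \<tau> in at t within {0..}. sqrt (?c * ((n2 (\<lambda>\<xi>. w \<tau> \<xi> - w t \<xi>))\<^sup>2 + (n2 (\<lambda>\<xi>. wt s (w \<tau>) \<xi> - wt s (w t) \<xi>))\<^sup>2)) = sob_norm s (\<lambda>x. cR (\<theta> \<tau>) x - cR (\<theta> t) x)"
        unfolding eventually_at_filter sob_norm_def
      proof (intro always_eventually allI impI)
        fix \<tau> :: real assume "\<tau> \<in> {0..}"
        then have \<tau>: "0 \<le> \<tau>" by simp
        show "sqrt (?c * ((n2 (\<lambda>\<xi>. w \<tau> \<xi> - w t \<xi>))\<^sup>2 + (n2 (\<lambda>\<xi>. wt s (w \<tau>) \<xi> - wt s (w t) \<xi>))\<^sup>2)) = sqrt (sob_norm_sq s (\<lambda>x. cR (\<theta> \<tau>) x - cR (\<theta> t) x))"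
          unfolding sob_norm_sq_FT[OF is_FT_diff[OF FT[OF \<tau>] FT[OF t]]] wt_diff ..
      qed
      ultimately have "((\<lambda>\<tau>. sob_norm s (\<lambda>x. cR (\<theta> \<tau>) x - cR (\<theta> t) x)) \<longlongrightarrow> sqrt (?c * (0\<^sup>2 + 0\<^sup>2))) (at t within {0..})"
        by (rule Lim_transform_eventually)
      then show "((\<lambda>\<tau>. sob_norm s (\<lambda>x. cR (\<theta> \<tau>) x - cR (\<theta> t) x)) \<longlongrightarrow> 0) (at t within {0..})" by simp
    qed
    moreover have "L2_Hdot (2 - \<alpha>) \<theta>"
    proof -
      \<comment> \<open>The space in the conclusion is that of the dissipation, s +
        \<alpha>.\<close>
      have e: "2 - \<alpha> = s + \<alpha>" by (simp add: s_def)
      have "AE \<tau> in lborel. 0 \<le> \<tau> \<longrightarrow> in_Hdot (s + \<alpha>) (cR (\<theta> \<tau>))"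
        using AE_L2c by eventually_elim (blast intro: in_Hdot_FT FT)
      moreover have "set_integrable lborel {0..} (\<lambda>\<tau>. hdot_norm_sq (s + \<alpha>) (cR (\<theta> \<tau>))) \<longleftrightarrow> set_integrable lborel {0..} (\<lambda>\<tau>. ?c * (n2 (wt (s + \<alpha>) (w \<tau>)))\<^sup>2)"
        by (rule set_integrable_cong) (auto simp: hdot_norm_sq_FT[OF FT])
      moreover have "set_integrable lborel {0..} (\<lambda>\<tau>. ?c * (n2 (wt (s + \<alpha>) (w \<tau>)))\<^sup>2)"
        by (rule set_integrable_mult_right) (rule dissipation_integrable_at_top)
      ultimately show ?thesis unfolding L2_Hdot_def e by blast
    qed
    moreover have "set_integrable lborel {0..t} (\<lambda>\<tau>. sob_norm_sq s (Dpow \<alpha> (cR (\<theta> \<tau>)))) \<and>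
         sob_norm_sq s (cR (\<theta> t)) + (LINT \<tau>:{0..t}|lborel. sob_norm_sq s (Dpow \<alpha> (cR (\<theta> \<tau>)))) \<le> sob_norm_sq s (cR \<theta>0)" if t: "0 \<le> t" for t
    proof -
      let ?d = "\<lambda>\<tau>. (n2 (wt \<alpha> (w \<tau>)))\<^sup>2 + (n2 (wt (s + \<alpha>) (w \<tau>)))\<^sup>2"
      have e: "sob_norm_sq s (Dpow \<alpha> (cR (\<theta> \<tau>))) = ?c * ?d \<tau>" if \<tau>: "\<tau> \<in> {0..t}" for \<tau>
      proof -
        have \<tau>0: "0 \<le> \<tau>" using \<tau> by simp
        have "L2c (wt \<alpha> (w \<tau>))" using al s1 by (intro wt_bound(1)[OF \<tau>0]) auto
        from sob_norm_sq_FT[OF Dpow_is_FT[OF FT[OF \<tau>0] this]] show ?thesis unfolding wt_wt .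
      qed
      have "set_integrable lborel {0..t} (\<lambda>\<tau>. sob_norm_sq s (Dpow \<alpha> (cR (\<theta> \<tau>)))) \<longleftrightarrow> set_integrable lborel {0..t} (\<lambda>\<tau>. ?c * ?d \<tau>)"
        by (rule set_integrable_cong) (use e in auto)
      moreover have "set_integrable lborel {0..t} (\<lambda>\<tau>. ?c * ?d \<tau>)" by (rule set_integrable_mult_right) (rule energy_integrable(1)[OF t])
      moreover have "(LINT \<tau>:{0..t}|lborel. sob_norm_sq s (Dpow \<alpha> (cR (\<theta> \<tau>)))) = (LINT \<tau>:{0..t}|lborel. ?c * ?d \<tau>)"
        by (rule set_lebesgue_integral_cong) (use e in auto)
      moreover have "(LINT \<tau>:{0..t}|lborel. ?c * ?d \<tau>) = ?c * (LINT \<tau>:{0..t}|lborel. ?d \<tau>)" by (rule set_integral_mult_right)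
      moreover have "?c * ((n2 (w t))\<^sup>2 + (n2 (wt s (w t)))\<^sup>2) + ?c * (LINT \<tau>:{0..t}|lborel. ?d \<tau>) \<le> ?c * K"
        unfolding distrib_left[symmetric] by (rule mult_left_mono[OF energy_integrable(2)[OF t]]) simp
      ultimately show ?thesis unfolding sob_norm_sq_FT[OF FT[OF t]] N0 by simp
    qed
    ultimately show ?thesis by blast
  qed
  have "0 < 1 / (2 * pi * C)" using C by simp
  then show ?thesis unfolding s_def[symmetric]
    by (intro exI[of _ "1 / (2 * pi * C)"] conjI allI impI main) simp_all
qed

end
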